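(* There is a deterministic algorithm that, given a connected simple graph with $n$ vertices, $m$ edges and minimum degree $\delta\ge\lg^6 n$, in near-linear time $\widetilde O(m)$ either (1) certifies that there are no non-trivial min-cuts, or (2) finds a cut with conductance $o(1/\log m)$.
   Context: Graphs are finite, undirected, unweighted; a simple graph has no loops or parallel edges. $\lg=\log_2$. A cut is given by one side $U\subset V$, with $U$ and $V\setminus U$ nonempty; $\partial U$ is the set of edges between $U$ and $V\setminus U$, and $|\partial U|$ is the size of the cut. A min-cut is a cut of minimum size; a cut is non-trivial if both sides have at least two vertices. The volume is $\mathrm{vol}(U)=\sum_{v\in U}d(v)$, and the conductance of the cut is $$\Phi(U)=\frac{|\partial U|}{\min\{\mathrm{vol}(U),\mathrm{vol}(V\setminus U)\}}.$$ "Certifies" means that the algorithm ends in this outcome only if the asserted property is true. $f=\widetilde O(g)$ means that there are constants $n_0,c$ such that $f\le g\cdot(\log_2 n)^{c}$ whenever $n\ge n_0$. The $o(\cdot)$ is uniform over all such graphs as $n\to\infty$. *)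

theory Defs
  imports Complex_Main "HOL-Library.Landau_Symbols" "HOL-Library.Log_Nat"
begin

section \<open>Simple graphs, cuts and conductance\<close>

text \<open>An undirected edge is the two-element set of its endpoints.\<close>

definition simple_graph :: "'v set \<Rightarrow> 'v set set \<Rightarrow> bool" where
  "simple_graph V E \<longleftrightarrow> finite V \<and> (\<forall>e\<in>E. e \<subseteq> V \<and> card e = 2)"

definition connected_graph :: "'v set \<Rightarrow> 'v set set \<Rightarrow> bool" where
  "connected_graph V E \<longleftrightarrow> V \<noteq> {} \<and> (\<forall>u\<in>V. \<forall>v\<in>V. (u, v) \<in> {(x, y). {x, y} \<in> E}\<^sup>*)"

definition degree :: "'v set set \<Rightarrow> 'v \<Rightarrow> nat" where
  "degree E v = card {e \<in> E. v \<in> e}"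

definition min_degree :: "'v set \<Rightarrow> 'v set set \<Rightarrow> nat" where
  "min_degree V E = Min (degree E ` V)"

definition is_cut :: "'v set \<Rightarrow> 'v set \<Rightarrow> bool" where
  "is_cut V U \<longleftrightarrow> U \<subseteq> V \<and> U \<noteq> {} \<and> V - U \<noteq> {}"

definition edge_boundary :: "'v set \<Rightarrow> 'v set set \<Rightarrow> 'v set \<Rightarrow> 'v set set" where
  "edge_boundary V E U = {e \<in> E. e \<inter> U \<noteq> {} \<and> e \<inter> (V - U) \<noteq> {}}"

definition min_cut :: "'v set \<Rightarrow> 'v set set \<Rightarrow> 'v set \<Rightarrow> bool" where
  "min_cut V E U \<longleftrightarrow> is_cut V U \<and>
     (\<forall>W. is_cut V W \<longrightarrow> card (edge_boundary V E U) \<le> card (edge_boundary V E W))"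

definition nontrivial_cut :: "'v set \<Rightarrow> 'v set \<Rightarrow> bool" where
  "nontrivial_cut V U \<longleftrightarrow> is_cut V U \<and> 2 \<le> card U \<and> 2 \<le> card (V - U)"

definition volume :: "'v set set \<Rightarrow> 'v set \<Rightarrow> nat" where
  "volume E U = (\<Sum>v\<in>U. degree E v)"

definition conductance :: "'v set \<Rightarrow> 'v set set \<Rightarrow> 'v set \<Rightarrow> real" where
  "conductance V E U =
     real (card (edge_boundary V E U)) / real (min (volume E U) (volume E (V - U)))"


section \<open>Graphs as inputs of an algorithm\<close>

text \<open>
  A graph is handed to an algorithm as its number of vertices \<open>n\<close> and a list of its edges. The
  vertices are \<open>0, ..., n - 1\<close>. Each edge is listed exactly once, in an arbitrary position and
  with its endpoints in an arbitrary order.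
\<close>

type_synonym graph_input = "nat \<times> (nat \<times> nat) list"

definition verts :: "graph_input \<Rightarrow> nat set" where
  "verts G = {..<fst G}"

definition edges :: "graph_input \<Rightarrow> nat set set" where
  "edges G = set (map (\<lambda>(u, v). {u, v}) (snd G))"

definition encodes_simple_graph :: "graph_input \<Rightarrow> bool" where
  "encodes_simple_graph G \<longleftrightarrow>
     simple_graph (verts G) (edges G) \<and> distinct (map (\<lambda>(u, v). {u, v}) (snd G))"

definition num_verts :: "graph_input \<Rightarrow> nat" where
  "num_verts G = card (verts G)"

definition num_edges :: "graph_input \<Rightarrow> nat" where
  "num_edges G = card (edges G)"


section \<open>Deterministic random-access machine\<close>

text \<open>
  The machine model is a random-access machine with logarithmic costs, programmed in a structured
  language. The memory consists of numbered arrays \<open>s a\<close> of natural numbers, with indirect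
  addressing inside each array. The array names in a program are constants, so a program uses only
  a fixed finite number of arrays, and interleaving them gives a machine with a single memory.

  Every operation, and every access to the memory, is charged the binary lengths of the numbers
  involved. Hence nothing is gained by computing with huge numbers, and up to factors that are
  polylogarithmic in the input size and the running time, the running time is that of a
  unit-cost machine whose words have \<open>O(log n)\<close> bits.
\<close>

type_synonym store = "nat \<Rightarrow> nat \<Rightarrow> nat"

datatype aexp =
    Const nat
  | Read nat aexp
  | Add aexp aexp
  | Sub aexp aexp
  | Mul aexp aexp
  | Div aexp aexp

fun aval :: "aexp \<Rightarrow> store \<Rightarrow> nat" where
  "aval (Const k) s = k"
| "aval (Read a e) s = s a (aval e s)"
| "aval (Add e f) s = aval e s + aval f s"
| "aval (Sub e f) s = aval e s - aval f s"
| "aval (Mul e f) s = aval e s * aval f s"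
| "aval (Div e f) s = aval e s div aval f s"

text \<open>
  \<open>floorlog 2 k\<close> is the number of binary digits of \<open>k\<close> (and \<open>0\<close> for \<open>k = 0\<close>). An operation is
  charged for its result; its operands, and the address in a memory access, are charged in the
  costs of the subexpressions that produce them.
\<close>

fun acost :: "aexp \<Rightarrow> store \<Rightarrow> nat" where
  "acost (Const k) s = 1 + floorlog 2 k"
| "acost (Read a e) s = acost e s + 1 + floorlog 2 (aval (Read a e) s)"
| "acost (Add e f) s = acost e s + acost f s + 1 + floorlog 2 (aval (Add e f) s)"
| "acost (Sub e f) s = acost e s + acost f s + 1 + floorlog 2 (aval (Sub e f) s)"
| "acost (Mul e f) s = acost e s + acost f s + 1 + floorlog 2 (aval (Mul e f) s)"
| "acost (Div e f) s = acost e s + acost f s + 1 + floorlog 2 (aval (Div e f) s)"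

datatype com =
    Skip
  | Assign nat aexp aexp
  | Seq com com
  | If aexp com com
  | While aexp com

text \<open>
  \<open>exec c s t s'\<close>: started in \<open>s\<close>, the program \<open>c\<close> halts in \<open>s'\<close> after time \<open>t\<close>.
  \<open>Assign a i e\<close> stores \<open>e\<close> in cell \<open>i\<close> of array \<open>a\<close>; a condition holds if its value is nonzero.
  Comparisons come from truncated subtraction: \<open>x < y\<close> iff \<open>y - x\<close> is nonzero.
\<close>

inductive exec :: "com \<Rightarrow> store \<Rightarrow> nat \<Rightarrow> store \<Rightarrow> bool" where
  Skip: "exec Skip s 1 s"
| Assign: "exec (Assign a i e) s (1 + acost i s + acost e s)
             (s(a := (s a)(aval i s := aval e s)))"
| Seq: "\<lbrakk>exec c1 s1 t1 s2; exec c2 s2 t2 s3\<rbrakk> \<Longrightarrow> exec (Seq c1 c2) s1 (t1 + t2) s3"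
| IfTrue: "\<lbrakk>aval b s \<noteq> 0; exec c1 s t s'\<rbrakk> \<Longrightarrow> exec (If b c1 c2) s (1 + acost b s + t) s'"
| IfFalse: "\<lbrakk>aval b s = 0; exec c2 s t s'\<rbrakk> \<Longrightarrow> exec (If b c1 c2) s (1 + acost b s + t) s'"
| WhileFalse: "aval b s = 0 \<Longrightarrow> exec (While b c) s (1 + acost b s) s"
| WhileTrue: "\<lbrakk>aval b s1 \<noteq> 0; exec c s1 t1 s2; exec (While b c) s2 t2 s3\<rbrakk>
             \<Longrightarrow> exec (While b c) s1 (1 + acost b s1 + t1 + t2) s3"

inductive_cases exec_SkipE: "exec Skip s t s'"
inductive_cases exec_AssignE: "exec (Assign a i e) s t s'"
inductive_cases exec_SeqE: "exec (Seq c1 c2) s t s'"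
inductive_cases exec_IfE: "exec (If b c1 c2) s t s'"
inductive_cases exec_WhileE: "exec (While b c) s t s'"

lemma exec_deterministic:
  "\<lbrakk>exec c s t s'; exec c s u s''\<rbrakk> \<Longrightarrow> u = t \<and> s'' = s'"
proof (induction arbitrary: u s'' rule: exec.induct)
  case (WhileTrue b s1 c t1 s2 t2 s3)
  note IH = WhileTrue.IH
  show ?case
    using WhileTrue.prems
  proof (cases rule: exec.cases)
    case WhileFalse
    then show ?thesis using WhileTrue.hyps(1) by simp
  next
    case (WhileTrue u1 s2' u2)
    then show ?thesis using IH by blast
  qed
next
  case (Seq c1 s1 t1 s2 c2 t2 s3)
  from Seq.prems obtain u1 s2' u2
    where "exec c1 s1 u1 s2'" "exec c2 s2' u2 s''" "u = u1 + u2"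
    by (rule exec_SeqE)
  then show ?case using Seq.IH by blast
next
  case (IfTrue b s c1 t s' c2)
  from IfTrue.prems IfTrue.hyps(1) obtain t'
    where "exec c1 s t' s''" "u = 1 + acost b s + t'"
    by (auto elim: exec_IfE)
  then show ?case using IfTrue.IH by blast
next
  case (IfFalse b s c2 t s' c1)
  from IfFalse.prems IfFalse.hyps(1) obtain t'
    where "exec c2 s t' s''" "u = 1 + acost b s + t'"
    by (auto elim: exec_IfE)
  then show ?case using IfFalse.IH by blast
next
  case (WhileFalse b s c)
  from WhileFalse.prems WhileFalse.hyps show ?case
    by (auto elim: exec_WhileE)
next
  case (Skip s)
  then show ?case by (rule exec_SkipE) simp
next
  case (Assign a i e s)
  then show ?case by (rule exec_AssignE) simp
qed


section \<open>Input, output and running time\<close>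

definition array_of :: "nat list \<Rightarrow> nat \<Rightarrow> nat" where
  "array_of xs i = (if i < length xs then xs ! i else 0)"

text \<open>
  Array 0 holds \<open>n\<close> and \<open>m\<close>, and arrays 1 and 2 hold the two endpoints of the listed edges. All
  other cells are zero.
\<close>

definition initial_store :: "graph_input \<Rightarrow> store" where
  "initial_store G = (\<lambda>_ _. 0)
     (0 := array_of [fst G, length (snd G)],
      1 := array_of (map fst (snd G)),
      2 := array_of (map snd (snd G)))"

datatype outcome = No_nontrivial_min_cut | Cut_found (found_cut: "nat set")

text \<open>
  The first cell of array 3 says which of the two outcomes is reported. In the second one, array 4
  holds the characteristic vector of one side of the cut.
\<close>

definition outcome_of :: "graph_input \<Rightarrow> store \<Rightarrow> outcome" where
  "outcome_of G s =
     (if s 3 0 = 0 then No_nontrivial_min_cut else Cut_found {v \<in> verts G. s 4 v \<noteq> 0})"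

definition computes :: "com \<Rightarrow> graph_input \<Rightarrow> nat \<Rightarrow> outcome \<Rightarrow> bool" where
  "computes P G t r \<longleftrightarrow> (\<exists>s. exec P (initial_store G) t s \<and> outcome_of G s = r)"

text \<open>\<open>f\<close> is soft-O of \<open>g\<close> on the inputs \<open>I\<close>; the hidden factor is a power of \<open>log 2 n\<close>.\<close>

definition soft_bigo ::
  "graph_input set \<Rightarrow> (graph_input \<Rightarrow> real) \<Rightarrow> (graph_input \<Rightarrow> real) \<Rightarrow> bool" where
  "soft_bigo I f g \<longleftrightarrow>
     (\<exists>(n0::nat) (c::nat). \<forall>G\<in>I. n0 \<le> num_verts G \<longrightarrow>
        f G \<le> g G * log 2 (real (num_verts G)) ^ c)"

text \<open>
  The filter on the inputs in \<open>I\<close> for \<open>n\<close> tending to infinity: a property holds eventually iff for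
  some \<open>N\<close> it holds for all inputs in \<open>I\<close> with \<open>n \<ge> N\<close>. Landau symbols with respect to
  it are uniform over all inputs in \<open>I\<close>.
\<close>

definition order_to_infinity :: "graph_input set \<Rightarrow> graph_input filter" where
  "order_to_infinity I = inf (filtercomap num_verts at_top) (principal I)"

lemma eventually_order_to_infinity:
  "eventually Q (order_to_infinity I) \<longleftrightarrow> (\<exists>N. \<forall>G\<in>I. N \<le> num_verts G \<longrightarrow> Q G)"
proof
  assume "eventually Q (order_to_infinity I)"
  then show "\<exists>N. \<forall>G\<in>I. N \<le> num_verts G \<longrightarrow> Q G"
    unfolding order_to_infinity_def eventually_inf_principal eventually_filtercomap
      eventually_at_top_linorder
    by fast
next
  assume "\<exists>N. \<forall>G\<in>I. N \<le> num_verts G \<longrightarrow> Q G"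
  then obtain N where "\<forall>G. N \<le> num_verts G \<longrightarrow> G \<in> I \<longrightarrow> Q G"
    by auto
  moreover have "eventually (\<lambda>n. N \<le> n) at_top"
    by (rule eventually_ge_at_top)
  ultimately show "eventually Q (order_to_infinity I)"
    unfolding order_to_infinity_def eventually_inf_principal eventually_filtercomap
    by (intro exI[of _ "\<lambda>n. N \<le> n"] conjI)
qed

end

theory Submission imports Defs "HOL-Analysis.Convex" "HOL-Library.Disjoint_Sets" begin

text \<open>
  A lazy diffusion \<open>f' u = f u + (\<Sum>v\<in>nb u. f v - f u) / (2 * D u)\<close> is simulated, where \<open>D u\<close> is a
  power of two between the degree of \<open>u\<close> and its double, so that exact integer arithmetic suffices. If at some
  time the squared positive or negative part of the deviation from a weighted median has total
  variation below its weight divided by \<open>l\<^sup>2\<close> (\<open>l\<close> is the bit length of \<open>n\<close>), then one of its threshold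
  cuts has conductance at most \<open>1 / l\<^sup>2\<close>, and bisection of the range of thresholds finds it. Otherwise
  Cheeger's argument makes the variance decay by a constant factor within \<open>O(l\<^sup>4)\<close> steps, and \<open>80 * l\<^sup>5\<close>
  steps spread the mass uniformly.

  The initial masses are chosen such that no nontrivial min-cut survives this. Let \<open>T\<close> be the side
  of smaller volume of such a cut; its boundary has at most \<open>\<delta>\<close> edges and its volume is at least
  \<open>\<delta>\<^sup>2\<close>. For a suitable power of two \<open>M\<close>, the uniform distribution puts a mass between \<open>M / 4\<close> and
  \<open>3 * M / 4\<close> on \<open>T\<close>. The initial mass is placed on neighbourhoods of seed vertices, a multiple of
  \<open>M\<close> for each seed, with a density that exceeds \<open>O(M / \<delta>\<^sup>2 + 1)\<close> nowhere. Hence \<open>T\<close> starts with a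
  multiple of \<open>M\<close> up to what the seeds send across the boundary, and little mass crosses the boundary
  later. The seeds of different phases are disjoint, so in one of the 128 phases of the scale \<open>M\<close> few seeds
  send mass across the boundary, and the final mass of \<open>T\<close> is close to a multiple of \<open>M\<close>: a contradiction.
\<close>

section \<open>A logic for the cost of structured programs\<close>

text \<open>Two requirements on the number \<open>\<tau>\<close> of steps pull against each other.
  Cheeger's inequality at conductance \<open>1 / l\<^sup>2\<close> needs about \<open>l ^ 4\<close>
  steps for each constant factor and \<open>l\<close> such factors, hence
  \<open>\<tau> = 80 * l ^ 5\<close>. On the other hand, \<open>\<tau>\<close> steps at density
  \<open>O(M / \<delta>\<^sup>2 + 1)\<close> may carry
  \<open>O(\<tau> * (M / \<delta> + \<delta>))\<close> across the at most \<open>\<delta>\<close>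
  boundary edges of \<open>T\<close>. This is small against \<open>M\<close> only if
  \<open>\<delta>\<close> is a large multiple of \<open>\<tau>\<close>, because \<open>M\<close> is
  known to be at least of order \<open>\<delta>\<^sup>2\<close> and no more. That is where a minimum
  degree of order \<open>lg ^ 6 n\<close> enters; five of the six factors pay for the steps and the
  sixth absorbs constants. The target \<open>1 / l\<^sup>2\<close> is \<open>o(1 / log m)\<close>
  because \<open>log m\<close> is at most twice \<open>log n\<close>. The side \<open>T\<close> is
  unknown, so all powers of two are tried for \<open>M\<close>. Exact integers spare any analysis of
  rounding errors; their length grows linearly with the number of steps and so stays
  polylogarithmic.\<close>

fun asize :: "aexp \<Rightarrow> nat" where
  "asize (Const k) = 1"
| "asize (Read a e) = 1 + asize e"
| "asize (Add e f) = 1 + asize e + asize f"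
| "asize (Sub e f) = 1 + asize e + asize f"
| "asize (Mul e f) = 1 + asize e + asize f"
| "asize (Div e f) = 1 + asize e + asize f"

text \<open>Every constant below this bound fits into a cell, as \<open>10 ^ 6 < 2 ^ 20\<close> and
  \<open>cells_below\<close> demands \<open>20 \<le> w\<close>. The threshold \<open>n0\<close> of
  the final program is exempt; the test against it is costed by hand.\<close>

fun small_consts :: "aexp \<Rightarrow> bool" where
  "small_consts (Const k) \<longleftrightarrow> k < 1000000"
| "small_consts (Read a e) \<longleftrightarrow> small_consts e"
| "small_consts (Add e f) \<longleftrightarrow> small_consts e \<and> small_consts f"
| "small_consts (Sub e f) \<longleftrightarrow> small_consts e \<and> small_consts f"
| "small_consts (Mul e f) \<longleftrightarrow> small_consts e \<and> small_consts f"
| "small_consts (Div e f) \<longleftrightarrow> small_consts e \<and> small_consts f"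

definition cells_below :: "nat \<Rightarrow> store \<Rightarrow> bool" where
  "cells_below w s \<longleftrightarrow> 20 \<le> w \<and> (\<forall>a i. s a i < 2 ^ w)"

lemma cells_belowD: "cells_below w s \<Longrightarrow> s a i < 2 ^ w"
  by (simp add: cells_below_def)

lemma floorlog_le_of_less: "x < 2 ^ p \<Longrightarrow> floorlog 2 x \<le> p"
  by (rule floorlog_leI) auto

text \<open>Only stored values obey the bound \<open>2 ^ w\<close>; intermediate results may be
  longer. Multiplication adds exponents, and the extra unit in \<open>asize\<close> pays for the
  carry of an addition.\<close>

lemma aval_below:
  assumes "cells_below w s" "small_consts e"
  shows "aval e s < 2 ^ (w * asize e)"
  using assms(2)
proof (induction e)
  case (Const k)
  have "(2::nat) ^ 20 \<le> 2 ^ w"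
    using assms(1) by (intro power_increasing) (auto simp: cells_below_def)
  then show ?case using Const by simp
next
  case (Read a e)
  have "s a (aval e s) < 2 ^ w" by (rule cells_belowD[OF assms(1)])
  also have "(2::nat) ^ w \<le> 2 ^ (w * asize (Read a e))"
    by (intro power_increasing) auto
  finally show ?case by simp
next
  case (Add e f)
  have w: "1 \<le> w" using assms(1) by (simp add: cells_below_def)
  let ?p = "w * asize e" and ?q = "w * asize f"
  have "aval e s + aval f s < 2 ^ ?p + 2 ^ ?q" using Add by simp
  also have "\<dots> \<le> 2 ^ (?p + ?q) + 2 ^ (?p + ?q)"
    by (intro add_mono power_increasing) auto
  also have "\<dots> = (2::nat) ^ Suc (?p + ?q)" by simp
  also have "\<dots> \<le> 2 ^ (w * asize (Add e f))"
    using w by (intro power_increasing) (auto simp: algebra_simps)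
  finally show ?case by simp
next
  case (Sub e f)
  have "aval e s - aval f s \<le> aval e s" by simp
  also have "\<dots> < 2 ^ (w * asize e)" using Sub by simp
  also have "\<dots> \<le> (2::nat) ^ (w * asize (Sub e f))"
    by (intro power_increasing) (auto simp: algebra_simps)
  finally show ?case by simp
next
  case (Mul e f)
  have "aval e s * aval f s < 2 ^ (w * asize e) * 2 ^ (w * asize f)"
    using Mul by (intro mult_strict_mono) auto
  also have "\<dots> = 2 ^ (w * asize e + w * asize f)" by (simp add: power_add)
  also have "\<dots> \<le> (2::nat) ^ (w * asize (Mul e f))"
    by (intro power_increasing) (auto simp: algebra_simps)
  finally show ?case by simp
next
  case (Div e f)
  have "aval e s div aval f s \<le> aval e s" by simp
  also have "\<dots> < 2 ^ (w * asize e)" using Div by simp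
  also have "\<dots> \<le> (2::nat) ^ (w * asize (Div e f))"
    by (intro power_increasing) (auto simp: algebra_simps)
  finally show ?case by simp
qed

text \<open>Quadratic in the size: each of the \<open>asize e\<close> nodes is charged the length of
  its result, at most \<open>w * asize e\<close> bits, and the factor 2 covers the unit
  charges.\<close>

definition ecost :: "aexp \<Rightarrow> nat" where
  "ecost e = 2 * (asize e * asize e)"

lemma binary_cost_le:
  fixes w p q :: nat
  assumes "1 \<le> w" "c1 \<le> w * (2 * (p * p))" "c2 \<le> w * (2 * (q * q))" "f \<le> w * (1 + p + q)"
  shows "c1 + c2 + 1 + f \<le> w * (2 * ((1 + p + q) * (1 + p + q)))"
proof -
  have "c1 + c2 + 1 + f \<le> w * (2 * (p * p)) + w * (2 * (q * q)) + w + w * (1 + p + q)"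
    using assms by linarith
  also have "\<dots> = w * (2 * (p * p) + 2 * (q * q) + 2 + p + q)" by (simp add: algebra_simps)
  also have "\<dots> \<le> w * (2 * ((1 + p + q) * (1 + p + q)))"
    by (intro mult_le_mono2) (simp add: algebra_simps)
  finally show ?thesis .
qed

lemma acost_le:
  assumes b: "cells_below w s" and "small_consts e"
  shows "acost e s \<le> ecost e * w"
proof -
  have w: "1 \<le> w" using b by (simp add: cells_below_def)
  have fl: "floorlog 2 (aval e s) \<le> w * asize e" if "small_consts e" for e
    by (rule floorlog_le_of_less[OF aval_below[OF b that]])
  have "acost e s \<le> w * (2 * (asize e * asize e))"
    using assms(2)
  proof (induction e)
    case (Const k)
    then show ?case using fl[of "Const k"] w by simp
  next
    case (Read a e)
    have "0 + acost e s + 1 + floorlog 2 (aval (Read a e) s)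
          \<le> w * (2 * ((1 + 0 + asize e) * (1 + 0 + asize e)))"
      by (rule binary_cost_le) (use w Read fl[of "Read a e"] in auto)
    then show ?case by simp
  next
    case (Add e f)
    then show ?case using binary_cost_le[OF w _ _ fl[of "Add e f", unfolded asize.simps], of "acost e s" "acost f s"]
      by simp
  next
    case (Sub e f)
    then show ?case using binary_cost_le[OF w _ _ fl[of "Sub e f", unfolded asize.simps], of "acost e s" "acost f s"]
      by simp
  next
    case (Mul e f)
    then show ?case using binary_cost_le[OF w _ _ fl[of "Mul e f", unfolded asize.simps], of "acost e s" "acost f s"]
      by simp
  next
    case (Div e f)
    then show ?case using binary_cost_le[OF w _ _ fl[of "Div e f", unfolded asize.simps], of "acost e s" "acost f s"]
      by simp
  qed
  then show ?thesis by (simp add: ecost_def mult.commute)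
qed

section \<open>Total correctness with step counts and frames\<close>

fun writes :: "com \<Rightarrow> nat set" where
  "writes Skip = {}"
| "writes (Assign a i e) = {a}"
| "writes (Seq c d) = writes c \<union> writes d"
| "writes (If b c d) = writes c \<union> writes d"
| "writes (While b c) = writes c"

lemma exec_frame: "exec c s t s' \<Longrightarrow> a \<notin> writes c \<Longrightarrow> s' a = s a"
  by (induction rule: exec.induct) auto

text \<open>
  \<open>k\<close> counts steps, each of which costs at most \<open>w\<close> bit operations as long as all cells
  stay below \<open>2 ^ w\<close>.
\<close>

definition wp :: "nat \<Rightarrow> com \<Rightarrow> (nat \<Rightarrow> store \<Rightarrow> bool) \<Rightarrow> store \<Rightarrow> bool" where
  "wp w c Q s \<longleftrightarrow> (cells_below w s \<longrightarrow>
     (\<exists>t k s'. exec c s t s' \<and> t \<le> k * w \<and> cells_below w s' \<and> Q k s'))"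

text \<open>Besides weakening the postcondition, this supplies the frame: arrays that the program
  never writes are unchanged. Specifications of subprograms can therefore be silent about
  them.\<close>

lemma wp_conseq:
  assumes "wp w c Q s"
    and "\<And>k s'. Q k s' \<Longrightarrow> cells_below w s' \<Longrightarrow> (\<And>a. a \<notin> writes c \<Longrightarrow> s' a = s a) \<Longrightarrow> R k s'"
  shows "wp w c R s"
  using assms exec_frame unfolding wp_def by meson

text \<open>As \<open>wp\<close> holds vacuously in stores with oversized cells, the size bound is
  available as a hypothesis.\<close>

lemma wp_below: "(cells_below w s \<Longrightarrow> wp w c Q s) \<Longrightarrow> wp w c Q s"
  by (auto simp: wp_def)

lemma wp_Skip: "Q 1 s \<Longrightarrow> wp w Skip Q s"
  unfolding wp_def
  by (intro impI exI[of _ 1] exI[of _ s]) (use exec.Skip[of s] in \<open>auto simp: cells_below_def\<close>)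

text \<open>The new value must be shown to fit into a cell; an index is under no such bound, because
  addresses are charged but not stored.\<close>

lemma wp_Assign:
  assumes "small_consts i \<and> small_consts e"
    and "cells_below w s \<Longrightarrow> aval e s < 2 ^ w"
    and "Q (1 + ecost i + ecost e) (s(a := (s a)(aval i s := aval e s)))"
  shows "wp w (Assign a i e) Q s"
  unfolding wp_def
proof (intro impI exI conjI)
  assume b: "cells_below w s"
  show "exec (Assign a i e) s (1 + acost i s + acost e s) (s(a := (s a)(aval i s := aval e s)))"
    by (rule exec.Assign)
  have "1 \<le> w" using b by (simp add: cells_below_def)
  then show "1 + acost i s + acost e s \<le> (1 + ecost i + ecost e) * w"
    using acost_le[OF b, of i] acost_le[OF b, of e] assms(1) by (simp add: algebra_simps)
  show "cells_below w (s(a := (s a)(aval i s := aval e s)))"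
    using b assms(2)[OF b] by (auto simp: cells_below_def)
  show "Q (1 + ecost i + ecost e) (s(a := (s a)(aval i s := aval e s)))" by (rule assms(3))
qed

lemma wp_Seq:
  assumes "wp w c (\<lambda>k s'. wp w d (\<lambda>l. Q (k + l)) s') s"
  shows "wp w (Seq c d) Q s"
  unfolding wp_def
proof
  assume "cells_below w s"
  then obtain t k s' where 1: "exec c s t s'" "t \<le> k * w" "cells_below w s'"
      "wp w d (\<lambda>l. Q (k + l)) s'"
    using assms unfolding wp_def by blast
  from 1(4) 1(3) obtain u l s'' where 2: "exec d s' u s''" "u \<le> l * w" "cells_below w s''"
      "Q (k + l) s''"
    unfolding wp_def by blast
  show "\<exists>t k s'. exec (Seq c d) s t s' \<and> t \<le> k * w \<and> cells_below w s' \<and> Q k s'"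
    using exec.Seq[OF 1(1) 2(1)] 1(2) 2(2-4) by (metis add_mono distrib_right)
qed

lemma wp_If:
  assumes "small_consts b"
    and "aval b s \<noteq> 0 \<Longrightarrow> wp w c (\<lambda>k. Q (1 + ecost b + k)) s"
    and "aval b s = 0 \<Longrightarrow> wp w d (\<lambda>k. Q (1 + ecost b + k)) s"
  shows "wp w (If b c d) Q s"
  unfolding wp_def
proof
  assume w: "cells_below w s"
  then have w1: "1 \<le> w" by (simp add: cells_below_def)
  note cb = acost_le[OF w assms(1)]
  have le: "1 + acost b s + t \<le> (1 + ecost b + k) * w" if "t \<le> k * w" for t k
    using cb w1 that by (simp add: algebra_simps)
  show "\<exists>t k s'. exec (If b c d) s t s' \<and> t \<le> k * w \<and> cells_below w s' \<and> Q k s'"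
  proof (cases "aval b s = 0")
    case True
    then obtain t k s' where "exec d s t s'" "t \<le> k * w" "cells_below w s'" "Q (1 + ecost b + k) s'"
      using assms(3) w unfolding wp_def by blast
    then show ?thesis using exec.IfFalse[OF True] le by blast
  next
    case False
    then obtain t k s' where "exec c s t s'" "t \<le> k * w" "cells_below w s'" "Q (1 + ecost b + k) s'"
      using assms(2) w unfolding wp_def by blast
    then show ?thesis using exec.IfTrue[OF False] le by blast
  qed
qed

abbreviation Var :: "nat \<Rightarrow> aexp" where "Var x \<equiv> Read x (Const 0)"
abbreviation Set :: "nat \<Rightarrow> aexp \<Rightarrow> com" where "Set x e \<equiv> Assign x (Const 0) e"

text \<open>By truncated subtraction the test succeeds exactly while the counter is below the bound.
  The bound is evaluated again in each round, which is why \<open>wp_For\<close> asks that its value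
  stay fixed.\<close>

definition For :: "nat \<Rightarrow> aexp \<Rightarrow> com \<Rightarrow> com" where
  "For x N c = Seq (Set x (Const 0))
     (While (Sub N (Var x)) (Seq c (Set x (Add (Var x) (Const 1)))))"

lemma writes_For [simp]: "writes (For x N c) = insert x (writes c)"
  by (auto simp: For_def)

definition fcost :: "aexp \<Rightarrow> nat" where
  "fcost N = 100 + ecost (Sub N (Var 0))"

lemma ecost_Var: "ecost (Sub N (Var x)) = ecost (Sub N (Var 0))"
  by (simp add: ecost_def)

text \<open>The cost \<open>b i\<close> may vary with the round, so that a loop over all vertices
  that scans adjacency lists is charged the sum of the degrees and not \<open>n\<close> times the
  largest one. The invariant for the next round is required after the increment, which the loop and
  not the body performs.\<close>

lemma wp_For:
  assumes N: "small_consts N"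
    and init: "Inv 0 (s(x := (s x)(0 := 0)))"
    and bound: "\<And>i s'. Inv i s' \<Longrightarrow> i \<le> B \<Longrightarrow> s' x 0 = i \<Longrightarrow>
        (\<And>a. a \<noteq> x \<Longrightarrow> a \<notin> writes c \<Longrightarrow> s' a = s a) \<Longrightarrow> aval N s' = B"
    and B: "cells_below w s \<Longrightarrow> B < 2 ^ w"
    and step: "\<And>i s'. i < B \<Longrightarrow> s' x 0 = i \<Longrightarrow> Inv i s' \<Longrightarrow>
        (\<And>a. a \<noteq> x \<Longrightarrow> a \<notin> writes c \<Longrightarrow> s' a = s a) \<Longrightarrow>
        wp w c (\<lambda>k s''. k \<le> b i \<and> s'' x 0 = i \<and> Inv (Suc i) (s''(x := (s'' x)(0 := Suc i)))) s'"
    and post: "\<And>k s'. Inv B s' \<Longrightarrow> s' x 0 = B \<Longrightarrow>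
        (\<And>a. a \<noteq> x \<Longrightarrow> a \<notin> writes c \<Longrightarrow> s' a = s a) \<Longrightarrow>
        k \<le> (\<Sum>i<B. b i) + (B + 1) * fcost N \<Longrightarrow> Q k s'"
  shows "wp w (For x N c) Q s"
  unfolding wp_def
proof
  assume w: "cells_below w s"
  then have w1: "1 \<le> w" by (simp add: cells_below_def)
  let ?body = "Seq c (Set x (Add (Var x) (Const 1)))"
  let ?frame = "\<lambda>s'. \<forall>a. a \<noteq> x \<longrightarrow> a \<notin> writes c \<longrightarrow> s' a = s a"
  \<comment> \<open>Induction on the number of remaining rounds; the summand
    \<open>1 + ecost (Sub N (Var x))\<close> pays for the last, failing test.\<close>
  have loop: "\<exists>t s''. exec (While (Sub N (Var x)) ?body) s' t s'' \<and>
      t \<le> ((\<Sum>i=i..<B. b i) + (B - i) * fcost N + 1 + ecost (Sub N (Var x))) * w \<and>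
      cells_below w s'' \<and> Inv B s'' \<and> s'' x 0 = B \<and> ?frame s''"
    if "i \<le> B" "s' x 0 = i" "Inv i s'" "cells_below w s'" "?frame s'" for i s'
    using that
  proof (induction "B - i" arbitrary: i s')
    case 0
    then have i: "i = B" by simp
    have v: "aval N s' = B" using bound[of i s'] 0 by blast
    have "acost (Sub N (Var x)) s' \<le> ecost (Sub N (Var x)) * w"
      by (rule acost_le) (use 0 N in auto)
    then have "1 + acost (Sub N (Var x)) s' \<le>
        ((\<Sum>i=i..<B. b i) + (B - i) * fcost N + 1 + ecost (Sub N (Var x))) * w"
      using w1 i by (simp add: algebra_simps)
    moreover have "exec (While (Sub N (Var x)) ?body) s' (1 + acost (Sub N (Var x)) s') s'"
      by (rule exec.WhileFalse) (use v 0 i in simp)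
    ultimately show ?case using 0 i by blast
  next
    case (Suc j)
    then have i: "i < B" by simp
    have v: "aval N s' = B" using bound[of i s'] Suc.prems i by auto
    have "wp w c (\<lambda>k s''. k \<le> b i \<and> s'' x 0 = i \<and> Inv (Suc i) (s''(x := (s'' x)(0 := Suc i)))) s'"
      using step[of i s'] Suc.prems i by blast
    then obtain t1 k1 s1 where 1: "exec c s' t1 s1" "t1 \<le> k1 * w" "cells_below w s1"
       "k1 \<le> b i" "s1 x 0 = i" "Inv (Suc i) (s1(x := (s1 x)(0 := Suc i)))"
      using Suc.prems unfolding wp_def by blast
    let ?s2 = "s1(x := (s1 x)(0 := Suc i))"
    let ?inc = "Add (Var x) (Const 1)"
    have "exec (Set x ?inc) s1 (1 + acost (Const 0) s1 + acost ?inc s1)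
        (s1(x := (s1 x)(aval (Const 0) s1 := aval ?inc s1)))"
      by (rule exec.Assign)
    then have 2: "exec (Set x ?inc) s1 (1 + acost (Const 0) s1 + acost ?inc s1) ?s2"
      using 1(5) by simp
    have lt: "Suc i < 2 ^ w" using B[OF w] i by simp
    have 3: "cells_below w ?s2" using 1(3) lt by (auto simp: cells_below_def)
    have fr1: "s1 a = s' a" if "a \<notin> writes c" for a using exec_frame[OF 1(1) that] .
    have 4: "?frame ?s2" using fr1 Suc.prems by auto
    obtain t3 s3 where 5: "exec (While (Sub N (Var x)) ?body) ?s2 t3 s3"
      "t3 \<le> ((\<Sum>i=Suc i..<B. b i) + (B - Suc i) * fcost N + 1 + ecost (Sub N (Var x))) * w"
      "cells_below w s3" "Inv B s3" "s3 x 0 = B" "?frame s3"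
    proof -
      have "j = B - Suc i" "Suc i \<le> B" "?s2 x 0 = Suc i" using Suc.hyps(2) i by auto
      from Suc.hyps(1)[OF this 1(6) 3 4] show thesis using that by blast
    qed
    have c1: "acost (Sub N (Var x)) s' \<le> ecost (Sub N (Var x)) * w"
      by (rule acost_le) (use Suc.prems N in auto)
    have c2: "acost (Const 0) s1 \<le> ecost (Const 0) * w" "acost ?inc s1 \<le> ecost ?inc * w"
      by (rule acost_le[OF 1(3)]; simp)+
    have "exec (While (Sub N (Var x)) ?body) s'
        (1 + acost (Sub N (Var x)) s' + (t1 + (1 + acost (Const 0) s1 + acost ?inc s1)) + t3) s3"
      by (rule exec.WhileTrue[OF _ exec.Seq[OF 1(1) 2] 5(1)]) (use v Suc.prems i in simp)
    moreover have "1 + acost (Sub N (Var x)) s' + (t1 + (1 + acost (Const 0) s1 + acost ?inc s1)) + t3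
       \<le> ((\<Sum>i=i..<B. b i) + (B - i) * fcost N + 1 + ecost (Sub N (Var x))) * w"
    proof -
      have "t1 \<le> b i * w" using 1(2,4) by (meson le_trans mult_le_mono1)
      then have "1 + acost (Sub N (Var x)) s' + (t1 + (1 + acost (Const 0) s1 + acost ?inc s1)) + t3
        \<le> w + ecost (Sub N (Var x)) * w + b i * w + w + ecost (Const 0) * w + ecost ?inc * w +
          ((\<Sum>i=Suc i..<B. b i) + (B - Suc i) * fcost N + 1 + ecost (Sub N (Var x))) * w"
        using w1 c1 c2 5(2) by linarith
      also have "\<dots> = (2 + ecost (Sub N (Var x)) + ecost (Const 0) + ecost ?inc + b i +
          (\<Sum>i=Suc i..<B. b i) + (B - Suc i) * fcost N + 1 + ecost (Sub N (Var x))) * w"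
        by (simp add: algebra_simps)
      also have "\<dots> \<le> ((\<Sum>i=i..<B. b i) + (B - i) * fcost N + 1 + ecost (Sub N (Var x))) * w"
      proof (rule mult_le_mono1)
        have e: "2 + ecost (Sub N (Var x)) + ecost (Const 0) + ecost ?inc \<le> fcost N"
          by (simp add: fcost_def ecost_def)
        have "(B - i) * fcost N = fcost N + (B - Suc i) * fcost N"
          using i by (metis Suc_diff_Suc mult_Suc)
        moreover have "(\<Sum>i=i..<B. b i) = b i + (\<Sum>i=Suc i..<B. b i)"
          using i by (simp add: sum.atLeast_Suc_lessThan)
        ultimately show "2 + ecost (Sub N (Var x)) + ecost (Const 0) + ecost ?inc + b i +
          (\<Sum>i=Suc i..<B. b i) + (B - Suc i) * fcost N + 1 + ecost (Sub N (Var x))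
          \<le> (\<Sum>i=i..<B. b i) + (B - i) * fcost N + 1 + ecost (Sub N (Var x))"
          using e by linarith
      qed
      finally show ?thesis .
    qed
    ultimately show ?case using 5 by blast
  qed
  let ?s0 = "s(x := (s x)(0 := 0))"
  have "exec (Set x (Const 0)) s (1 + acost (Const 0) s + acost (Const 0) s)
     (s(x := (s x)(aval (Const 0) s := aval (Const 0) s)))"
    by (rule exec.Assign)
  then have 1: "exec (Set x (Const 0)) s 3 ?s0" by (simp add: floorlog_def numeral_3_eq_3)
  have 2: "cells_below w ?s0" using w by (auto simp: cells_below_def)
  obtain t s'' where 3: "exec (While (Sub N (Var x)) ?body) ?s0 t s''"
    "t \<le> ((\<Sum>i=0..<B. b i) + (B - 0) * fcost N + 1 + ecost (Sub N (Var x))) * w"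
    "cells_below w s''" "Inv B s''" "s'' x 0 = B" "?frame s''"
    using loop[of 0 ?s0] init 2 by auto
  have "exec (For x N c) s (3 + t) s''"
    unfolding For_def by (rule exec.Seq[OF 1 3(1)])
  moreover have "3 + t \<le> ((\<Sum>i<B. b i) + (B + 1) * fcost N) * w"
  proof -
    have "3 + t \<le> 3 * w + ((\<Sum>i=0..<B. b i) + (B - 0) * fcost N + 1 + ecost (Sub N (Var x))) * w"
      using 3(2) w1 by linarith
    also have "\<dots> = (3 + (\<Sum>i<B. b i) + B * fcost N + 1 + ecost (Sub N (Var x))) * w"
      by (simp add: algebra_simps atLeast0LessThan)
    also have "\<dots> \<le> ((\<Sum>i<B. b i) + (B + 1) * fcost N) * w"
      by (rule mult_le_mono1) (simp add: fcost_def ecost_Var[of N x])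
    finally show ?thesis .
  qed
  ultimately show "\<exists>t k s'. exec (For x N c) s t s' \<and> t \<le> k * w \<and> cells_below w s' \<and> Q k s'"
    using 3(3-6) post[OF 3(4,5)] by blast
qed

section \<open>Lazy diffusion\<close>

text \<open>Functions on the vertices are densities with respect to \<open>D\<close>. The excess of
  \<open>D u\<close> over the degree acts like self-loops, so rounding degrees up to powers of two
  still leaves a reversible walk with stationary measure \<open>D\<close>.\<close>

locale diffusion =
  fixes n :: nat and nb :: "nat \<Rightarrow> nat set" and D :: "nat \<Rightarrow> nat"
  assumes nb_less: "u < n \<Longrightarrow> nb u \<subseteq> {..<n}"
    and nb_sym: "u < n \<Longrightarrow> v < n \<Longrightarrow> v \<in> nb u \<longleftrightarrow> u \<in> nb v"
    and card_nb_le: "u < n \<Longrightarrow> card (nb u) \<le> D u"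
    and D_pos: "u < n \<Longrightarrow> 0 < D u"
begin

lemma finite_nb: "u < n \<Longrightarrow> finite (nb u)"
  using nb_less finite_subset by blast

text \<open>Sums run over arcs, so each edge occurs once from either end; symmetry of
  \<open>nb\<close> exchanges the ends.\<close>

lemma arc_sum_swap:
  assumes "S \<subseteq> {..<n}" "T \<subseteq> {..<n}"
  shows "(\<Sum>u\<in>S. \<Sum>v\<in>nb u \<inter> T. h u v) = (\<Sum>v\<in>T. \<Sum>u\<in>nb v \<inter> S. (h u v :: 'a :: comm_monoid_add))"
proof -
  have fin: "finite S" "finite T" using assms finite_subset by blast+
  have "(\<Sum>u\<in>S. \<Sum>v\<in>nb u \<inter> T. h u v) = (\<Sum>u\<in>S. \<Sum>v\<in>{v. v \<in> T \<and> v \<in> nb u}. h u v)"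
    by (intro sum.cong) auto
  also have "\<dots> = (\<Sum>v\<in>T. \<Sum>u\<in>{u. u \<in> S \<and> v \<in> nb u}. h u v)"
    by (rule sum.swap_restrict[OF fin])
  also have "\<dots> = (\<Sum>v\<in>T. \<Sum>u\<in>nb v \<inter> S. h u v)"
  proof (rule sum.cong)
    fix v assume v: "v \<in> T"
    have "{u. u \<in> S \<and> v \<in> nb u} = nb v \<inter> S"
      using nb_sym[of _ v] assms v by auto
    then show "(\<Sum>u\<in>{u. u \<in> S \<and> v \<in> nb u}. h u v) = (\<Sum>u\<in>nb v \<inter> S. h u v)" by simp
  qed simp
  finally show ?thesis .
qed

lemma nb_Int_all: "u < n \<Longrightarrow> nb u \<inter> {..<n} = nb u"
  using nb_less by blast

lemma arc_sum_sym:
  "(\<Sum>u<n. \<Sum>v\<in>nb u. h u v) = (\<Sum>u<n. \<Sum>v\<in>nb u. (h v u :: 'a :: comm_monoid_add))"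
proof -
  have "(\<Sum>u<n. \<Sum>v\<in>nb u. g u v) = (\<Sum>u<n. \<Sum>v\<in>nb u \<inter> {..<n}. g u v)" for g :: "nat \<Rightarrow> nat \<Rightarrow> 'a"
    by (rule sum.cong) (auto simp: nb_Int_all)
  from this[of h] this[of "\<lambda>u v. h v u"] show ?thesis
    using arc_sum_swap[of "{..<n}" "{..<n}" h] by simp
qed

section \<open>Transport of mass\<close>

definition step :: "(nat \<Rightarrow> real) \<Rightarrow> nat \<Rightarrow> real" where
  "step f u = f u + (\<Sum>v\<in>nb u. f v - f u) / (2 * real (D u))"

definition mass_on :: "nat set \<Rightarrow> (nat \<Rightarrow> real) \<Rightarrow> real" where
  "mass_on T f = (\<Sum>u\<in>T. real (D u) * f u)"

definition vol :: "nat set \<Rightarrow> nat" where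
  "vol T = (\<Sum>u\<in>T. D u)"

definition crossing :: "nat set \<Rightarrow> nat" where
  "crossing T = (\<Sum>u\<in>T. card (nb u - T))"

definition energy :: "(nat \<Rightarrow> real) \<Rightarrow> real" where
  "energy f = (\<Sum>u<n. \<Sum>v\<in>nb u. (f u - f v)\<^sup>2)"

text \<open>What flows along an arc inside \<open>T\<close> is cancelled by its reverse, so only
  arcs that leave \<open>T\<close> contribute, each with half the difference of the
  densities.\<close>

lemma mass_on_step:
  assumes "T \<subseteq> {..<n}"
  shows "mass_on T (step f) = mass_on T f + (\<Sum>u\<in>T. \<Sum>v\<in>nb u - T. f v - f u) / 2"
proof -
  have fin: "finite T" using assms finite_subset by blast
  have "mass_on T (step f) = (\<Sum>u\<in>T. real (D u) * f u + (\<Sum>v\<in>nb u. f v - f u) / 2)"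
    unfolding mass_on_def
  proof (rule sum.cong)
    fix u assume "u \<in> T"
    then have "0 < D u" using D_pos assms by blast
    then show "real (D u) * step f u = real (D u) * f u + (\<Sum>v\<in>nb u. f v - f u) / 2"
      by (simp add: step_def field_simps)
  qed simp
  also have "\<dots> = mass_on T f + (\<Sum>u\<in>T. \<Sum>v\<in>nb u. f v - f u) / 2"
    by (simp add: mass_on_def sum.distrib sum_divide_distrib)
  also have "(\<Sum>u\<in>T. \<Sum>v\<in>nb u. f v - f u) =
     (\<Sum>u\<in>T. (\<Sum>v\<in>nb u \<inter> T. f v - f u) + (\<Sum>v\<in>nb u - T. f v - f u))"
  proof (rule sum.cong)
    fix u assume "u \<in> T"
    then have "finite (nb u)" using assms finite_nb by blast
    then show "(\<Sum>v\<in>nb u. f v - f u) = (\<Sum>v\<in>nb u \<inter> T. f v - f u) + (\<Sum>v\<in>nb u - T. f v - f u)"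
      by (simp add: sum.Int_Diff)
  qed simp
  also have "\<dots> = (\<Sum>u\<in>T. \<Sum>v\<in>nb u \<inter> T. f v - f u) + (\<Sum>u\<in>T. \<Sum>v\<in>nb u - T. f v - f u)"
    by (rule sum.distrib)
  also have "(\<Sum>u\<in>T. \<Sum>v\<in>nb u \<inter> T. f v - f u) = 0"
  proof -
    have "(\<Sum>u\<in>T. \<Sum>v\<in>nb u \<inter> T. f v - f u) = (\<Sum>u\<in>T. \<Sum>v\<in>nb u \<inter> T. f u - f v)"
      using arc_sum_swap[OF assms assms, of "\<lambda>u v. f v - f u"] by simp
    also have "\<dots> = - (\<Sum>u\<in>T. \<Sum>v\<in>nb u \<inter> T. f v - f u)"
      by (simp only: sum_negf[symmetric] minus_diff_eq)
    finally show ?thesis by simp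
  qed
  finally show ?thesis by simp
qed

lemma mass_on_step_all: "mass_on {..<n} (step f) = mass_on {..<n} f"
proof -
  have "(\<Sum>u<n. \<Sum>v\<in>nb u - {..<n}. f v - f u) = (\<Sum>u<n. 0)"
    by (rule sum.cong) (use nb_less in \<open>auto intro!: sum.neutral\<close>)
  then show ?thesis by (simp add: mass_on_step)
qed

text \<open>A maximum principle: the new value is a convex combination of old ones, since the weight
  \<open>1 - card (nb u) / (2 * D u)\<close> of the vertex itself is nonnegative.\<close>

lemma step_bounds:
  assumes u: "u < n" and f: "\<And>v. v < n \<Longrightarrow> 0 \<le> f v \<and> f v \<le> C"
  shows "0 \<le> step f u \<and> step f u \<le> C"
proof -
  let ?d = "real (card (nb u))" and ?D = "real (D u)"
  have D: "0 < ?D" "?d \<le> ?D" using D_pos card_nb_le u by auto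
  have fu: "0 \<le> f u" "f u \<le> C" using f u by auto
  have fb: "0 \<le> f v \<and> f v \<le> C" if "v \<in> nb u" for v
    using f nb_less[OF u] that by blast
  have s: "0 \<le> (\<Sum>v\<in>nb u. f v)" "(\<Sum>v\<in>nb u. f v) \<le> ?d * C"
    using fb by (auto intro!: sum_nonneg sum_bounded_above)
  have eq: "step f u * (2 * ?D) = f u * (2 * ?D - ?d) + (\<Sum>v\<in>nb u. f v)"
    using D by (simp add: step_def sum_subtractf field_simps)
  have "0 \<le> f u * (2 * ?D - ?d)" using fu D by simp
  moreover have "f u * (2 * ?D - ?d) \<le> C * (2 * ?D - ?d)"
    using fu D by (intro mult_right_mono) auto
  ultimately have "0 \<le> step f u * (2 * ?D)" "step f u * (2 * ?D) \<le> C * (2 * ?D)"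
    using s eq by (auto simp: algebra_simps)
  then show ?thesis using D by (simp add: zero_le_mult_iff)
qed

lemma step_iter_bounds:
  assumes "\<And>v. v < n \<Longrightarrow> 0 \<le> f v \<and> f v \<le> C" and "v < n"
  shows "0 \<le> (step ^^ t) f v \<and> (step ^^ t) f v \<le> C"
  using assms(2)
proof (induction t arbitrary: v)
  case 0
  then show ?case using assms(1) by simp
next
  case (Suc t)
  have "0 \<le> step ((step ^^ t) f) v \<and> step ((step ^^ t) f) v \<le> C"
    by (rule step_bounds[OF Suc.prems Suc.IH])
  then show ?case by simp
qed

lemma mass_on_iter_all: "mass_on {..<n} ((step ^^ t) f) = mass_on {..<n} f"
  by (induction t) (simp_all add: mass_on_step_all)

text \<open>Each arc across the boundary carries at most half of the largest density, in whichever
  direction.\<close>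

lemma mass_on_step_change:
  assumes T: "T \<subseteq> {..<n}" and f: "\<And>v. v < n \<Longrightarrow> 0 \<le> f v \<and> f v \<le> C"
  shows "\<bar>mass_on T (step f) - mass_on T f\<bar> \<le> real (crossing T) * C / 2"
proof -
  have "\<bar>\<Sum>u\<in>T. \<Sum>v\<in>nb u - T. f v - f u\<bar> \<le> (\<Sum>u\<in>T. \<bar>\<Sum>v\<in>nb u - T. f v - f u\<bar>)"
    by (rule sum_abs)
  also have "\<dots> \<le> (\<Sum>u\<in>T. \<Sum>v\<in>nb u - T. \<bar>f v - f u\<bar>)"
    by (intro sum_mono sum_abs)
  also have "\<dots> \<le> (\<Sum>u\<in>T. \<Sum>v\<in>nb u - T. C)"
  proof (intro sum_mono)
    fix u v assume "u \<in> T" "v \<in> nb u - T"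
    then have "u < n" "v < n" using T nb_less by blast+
    then show "\<bar>f v - f u\<bar> \<le> C" using f[of u] f[of v] by auto
  qed
  also have "\<dots> = real (crossing T) * C" by (simp add: crossing_def sum_distrib_right)
  finally show ?thesis by (simp add: mass_on_step[OF T])
qed

lemma mass_on_iter_change:
  assumes T: "T \<subseteq> {..<n}" and f: "\<And>v. v < n \<Longrightarrow> 0 \<le> f v \<and> f v \<le> C"
  shows "\<bar>mass_on T ((step ^^ t) f) - mass_on T f\<bar> \<le> real t * (real (crossing T) * C / 2)"
proof (induction t)
  case (Suc t)
  have "\<bar>mass_on T (step ((step ^^ t) f)) - mass_on T ((step ^^ t) f)\<bar> \<le> real (crossing T) * C / 2"
    by (rule mass_on_step_change[OF T]) (use step_iter_bounds f in blast)
  moreover have "real (Suc t) * (real (crossing T) * C / 2) =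
      real t * (real (crossing T) * C / 2) + real (crossing T) * C / 2"
    by (simp add: algebra_simps)
  ultimately have "\<bar>mass_on T (step ((step ^^ t) f)) - mass_on T f\<bar> \<le> real (Suc t) * (real (crossing T) * C / 2)"
    using Suc by linarith
  then show ?case by (simp only: funpow.simps o_apply)
qed simp

section \<open>Dissipation of energy and decay of the variance\<close>

lemma energy_nonneg: "0 \<le> energy f"
  unfolding energy_def by (intro sum_nonneg) auto

text \<open>Expanding the square, the cross term costs half the energy after averaging over the two
  directions of each edge. Cauchy-Schwarz with degree at most \<open>D u\<close> lets the quadratic
  term return no more than a quarter; the factor 2 of laziness is what makes it less than the
  loss.\<close>

lemma square_norm_step:
  "mass_on {..<n} (\<lambda>u. (step f u)\<^sup>2) \<le> mass_on {..<n} (\<lambda>u. (f u)\<^sup>2) - energy f / 4"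
proof -
  let ?S = "\<lambda>u. \<Sum>v\<in>nb u. f v - f u"
  have pt: "real (D u) * (step f u)\<^sup>2 \<le>
      real (D u) * (f u)\<^sup>2 + f u * ?S u + (\<Sum>v\<in>nb u. (f u - f v)\<^sup>2) / 4" if u: "u < n" for u
  proof -
    have D: "0 < real (D u)" "real (card (nb u)) \<le> real (D u)" using D_pos card_nb_le u by auto
    have "(?S u)\<^sup>2 \<le> (\<Sum>v\<in>nb u. (f v - f u)\<^sup>2) * card (nb u)"
      by (rule sum_squared_le_sum_of_squares)
    also have "\<dots> \<le> (\<Sum>v\<in>nb u. (f v - f u)\<^sup>2) * real (D u)"
      using D by (intro mult_left_mono) (auto intro: sum_nonneg)
    finally have "(?S u)\<^sup>2 / (4 * real (D u)) \<le> (\<Sum>v\<in>nb u. (f v - f u)\<^sup>2) / 4"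
      using D by (simp add: field_simps)
    moreover have "x * (a + S / (2 * x))\<^sup>2 = x * a\<^sup>2 + a * S + S\<^sup>2 / (4 * x)" if "0 < x" for x a S :: real
      using that by (simp add: field_simps power2_eq_square)
    then have "real (D u) * (step f u)\<^sup>2 = real (D u) * (f u)\<^sup>2 + f u * ?S u + (?S u)\<^sup>2 / (4 * real (D u))"
      using D(1) unfolding step_def by blast
    ultimately show ?thesis by (simp add: power2_commute[of "f u"])
  qed
  have "(\<Sum>u<n. f u * ?S u) = (\<Sum>u<n. \<Sum>v\<in>nb u. f u * f v - f u * f u)"
    by (simp add: sum_distrib_left algebra_simps)
  moreover have "(\<Sum>u<n. \<Sum>v\<in>nb u. f u * f v - f u * f u) = (\<Sum>u<n. \<Sum>v\<in>nb u. f u * f v - f v * f v)"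
    using arc_sum_sym[of "\<lambda>u v. f u * f v - f u * f u"] by (simp add: mult.commute)
  ultimately have "2 * (\<Sum>u<n. f u * ?S u) =
      (\<Sum>u<n. \<Sum>v\<in>nb u. f u * f v - f u * f u) + (\<Sum>u<n. \<Sum>v\<in>nb u. f u * f v - f v * f v)"
    by simp
  also have "\<dots> = (\<Sum>u<n. \<Sum>v\<in>nb u. - ((f u - f v)\<^sup>2))"
    unfolding sum.distrib[symmetric]
    by (intro sum.cong refl) (simp add: power2_eq_square algebra_simps)
  also have "\<dots> = - energy f" by (simp add: energy_def sum_negf)
  finally have cross: "(\<Sum>u<n. f u * ?S u) = - energy f / 2" by simp
  have "mass_on {..<n} (\<lambda>u. (step f u)\<^sup>2) \<le>
      (\<Sum>u<n. real (D u) * (f u)\<^sup>2 + f u * ?S u + (\<Sum>v\<in>nb u. (f u - f v)\<^sup>2) / 4)"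
    unfolding mass_on_def by (intro sum_mono pt) simp
  also have "\<dots> = mass_on {..<n} (\<lambda>u. (f u)\<^sup>2) - energy f / 2 + energy f / 4"
    by (simp add: mass_on_def sum.distrib cross energy_def sum_divide_distrib[symmetric])
  finally show ?thesis by simp
qed

definition mean :: "(nat \<Rightarrow> real) \<Rightarrow> real" where
  "mean f = mass_on {..<n} f / real (vol {..<n})"

definition variance :: "(nat \<Rightarrow> real) \<Rightarrow> real" where
  "variance f = mass_on {..<n} (\<lambda>u. (f u - mean f)\<^sup>2)"

lemma mean_step: "mean (step f) = mean f"
  by (simp add: mean_def mass_on_step_all)

lemma mean_iter: "mean ((step ^^ t) f) = mean f"
  by (simp add: mean_def mass_on_iter_all)

lemma step_shift: "step (\<lambda>u. f u - c) u = step f u - c"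
  by (simp add: step_def)

lemma energy_shift: "energy (\<lambda>u. f u - c) = energy f"
  by (simp add: energy_def)

lemma variance_step: "variance (step f) \<le> variance f - energy f / 4"
proof -
  have "variance (step f) = mass_on {..<n} (\<lambda>u. (step (\<lambda>u. f u - mean f) u)\<^sup>2)"
    by (simp add: variance_def step_shift mean_step)
  also have "\<dots> \<le> variance f - energy f / 4"
    using square_norm_step[of "\<lambda>u. f u - mean f"] by (simp add: variance_def energy_shift)
  finally show ?thesis .
qed

lemma vol_all_pos: "0 < n \<Longrightarrow> 0 < vol {..<n}"
  unfolding vol_def using D_pos by (intro sum_pos) auto

text \<open>The mean minimizes the weighted square deviation. The centre \<open>c\<close> will be a
  median in the decay estimate and \<open>0\<close> for the initial variance.\<close>

lemma variance_le_centered: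
  assumes "0 < n"
  shows "variance f \<le> mass_on {..<n} (\<lambda>u. (f u - c)\<^sup>2)"
proof -
  let ?V = "real (vol {..<n})" and ?m = "mean f"
  have V: "0 < ?V" using vol_all_pos[OF assms] by simp
  have m: "mass_on {..<n} f = ?m * ?V" using V by (simp add: mean_def)
  have "mass_on {..<n} (\<lambda>u. (f u - c)\<^sup>2) =
     (\<Sum>u<n. real (D u) * (f u - ?m)\<^sup>2 + 2 * (?m - c) * (real (D u) * f u)
        + (c\<^sup>2 - ?m\<^sup>2) * real (D u))"
    unfolding mass_on_def by (rule sum.cong) (simp_all add: power2_eq_square algebra_simps)
  also have "\<dots> = variance f + 2 * (?m - c) * mass_on {..<n} f + (c\<^sup>2 - ?m\<^sup>2) * ?V"
    by (simp add: sum.distrib variance_def mass_on_def vol_def sum_distrib_left)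
  also have "\<dots> = variance f + ?V * (?m - c)\<^sup>2"
    by (simp add: m power2_eq_square algebra_simps)
  finally show ?thesis using V by simp
qed

text \<open>Cauchy-Schwarz with the weight \<open>D u\<close> split into two square roots.\<close>

lemma mass_on_near_mean:
  assumes T: "T \<subseteq> {..<n}"
  shows "\<bar>mass_on T f - mean f * real (vol T)\<bar> \<le> sqrt (real (vol T) * variance f)"
proof -
  let ?g = "\<lambda>u. f u - mean f"
  have fin: "finite T" using T finite_subset by blast
  have "(\<Sum>u\<in>T. sqrt (D u) * (sqrt (D u) * ?g u))\<^sup>2
     \<le> (\<Sum>u\<in>T. (sqrt (D u))\<^sup>2) * (\<Sum>u\<in>T. (sqrt (D u) * ?g u)\<^sup>2)"
    by (rule Cauchy_Schwarz_ineq_sum)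
  also have "(\<Sum>u\<in>T. sqrt (D u) * (sqrt (D u) * ?g u)) = (\<Sum>u\<in>T. real (D u) * f u - mean f * real (D u))"
    by (rule sum.cong) (simp_all add: mult.assoc[symmetric] right_diff_distrib)
  also have "\<dots> = mass_on T f - mean f * real (vol T)"
    by (simp add: mass_on_def vol_def sum_subtractf sum_distrib_left)
  also have "(\<Sum>u\<in>T. (sqrt (D u))\<^sup>2) = real (vol T)" by (simp add: vol_def)
  also have "(\<Sum>u\<in>T. (sqrt (D u) * ?g u)\<^sup>2) \<le> variance f"
    unfolding variance_def mass_on_def
    by (simp add: power_mult_distrib, intro sum_mono2) (use T in auto)
  finally have "(mass_on T f - mean f * real (vol T))\<^sup>2 \<le> real (vol T) * variance f"
    by (metis mult_left_mono of_nat_0_le_iff)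
  then show ?thesis by (simp add: real_le_rsqrt)
qed

text \<open>The hypothesis says that no threshold cut of \<open>g\<^sup>2\<close> is sparse on average.\<close>

lemma cheeger_energy:
  assumes L: "0 \<le> L"
    and thr: "mass_on {..<n} (\<lambda>u. (g u)\<^sup>2) \<le> L * (\<Sum>u<n. \<Sum>v\<in>nb u. \<bar>(g u)\<^sup>2 - (g v)\<^sup>2\<bar>)"
  shows "mass_on {..<n} (\<lambda>u. (g u)\<^sup>2) \<le> 4 * L\<^sup>2 * energy g"
proof -
  let ?A = "Sigma {..<n} nb" and ?Q = "mass_on {..<n} (\<lambda>u. (g u)\<^sup>2)"
  have fin: "\<forall>u\<in>{..<n}. finite (nb u)" using finite_nb by blast
  have Sig: "(\<Sum>u<n. \<Sum>v\<in>nb u. h u v) = (\<Sum>(u, v)\<in>?A. h u v)" for h :: "nat \<Rightarrow> nat \<Rightarrow> real"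
    by (rule sum.Sigma[OF _ fin]) simp
  let ?P = "\<Sum>u<n. \<Sum>v\<in>nb u. \<bar>(g u)\<^sup>2 - (g v)\<^sup>2\<bar>"
  have Q0: "0 \<le> ?Q" unfolding mass_on_def by (intro sum_nonneg) auto
  \<comment> \<open>Factoring a difference of squares lets Cauchy-Schwarz separate the energy from a
    sum that is at most four times the squared norm \<open>?Q\<close>.\<close>
  have "?P = (\<Sum>(u, v)\<in>?A. \<bar>g u - g v\<bar> * \<bar>g u + g v\<bar>)"
    unfolding Sig by (simp add: power2_eq_square square_diff_square_factored abs_mult mult.commute)
  then have "?P\<^sup>2 = (\<Sum>x\<in>?A. (case x of (u, v) \<Rightarrow> \<bar>g u - g v\<bar>) * (case x of (u, v) \<Rightarrow> \<bar>g u + g v\<bar>))\<^sup>2"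
    by (simp add: case_prod_unfold)
  also have "\<dots> \<le> (\<Sum>x\<in>?A. (case x of (u, v) \<Rightarrow> \<bar>g u - g v\<bar>)\<^sup>2) * (\<Sum>x\<in>?A. (case x of (u, v) \<Rightarrow> \<bar>g u + g v\<bar>)\<^sup>2)"
    by (rule Cauchy_Schwarz_ineq_sum)
  also have "(\<Sum>x\<in>?A. (case x of (u, v) \<Rightarrow> \<bar>g u - g v\<bar>)\<^sup>2) = energy g"
    unfolding energy_def Sig by (simp add: case_prod_unfold)
  also have "(\<Sum>x\<in>?A. (case x of (u, v) \<Rightarrow> \<bar>g u + g v\<bar>)\<^sup>2) = (\<Sum>u<n. \<Sum>v\<in>nb u. (g u + g v)\<^sup>2)"
    unfolding Sig by (simp add: case_prod_unfold)
  also have "\<dots> \<le> (\<Sum>u<n. \<Sum>v\<in>nb u. 2 * (g u)\<^sup>2 + 2 * (g v)\<^sup>2)"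
  proof (intro sum_mono)
    fix u v show "(g u + g v)\<^sup>2 \<le> 2 * (g u)\<^sup>2 + 2 * (g v)\<^sup>2"
      using zero_le_power2[of "g u - g v"] by (simp add: power2_eq_square algebra_simps)
  qed
  also have "\<dots> = (\<Sum>u<n. \<Sum>v\<in>nb u. 2 * (g u)\<^sup>2) + (\<Sum>u<n. \<Sum>v\<in>nb u. 2 * (g v)\<^sup>2)"
    by (simp add: sum.distrib)
  also have "(\<Sum>u<n. \<Sum>v\<in>nb u. 2 * (g v)\<^sup>2) = (\<Sum>u<n. \<Sum>v\<in>nb u. 2 * (g u)\<^sup>2)"
    by (rule arc_sum_sym)
  also have "(\<Sum>u<n. \<Sum>v\<in>nb u. 2 * (g u)\<^sup>2) \<le> 2 * ?Q"
    unfolding mass_on_def sum_distrib_left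
    by (intro sum_mono) (use card_nb_le in \<open>auto intro!: mult_right_mono\<close>)
  finally have "?P\<^sup>2 \<le> energy g * (2 * ?Q + 2 * ?Q)"
    by (simp add: mult_left_mono energy_nonneg)
  then have PQ: "?P\<^sup>2 \<le> 4 * energy g * ?Q" by (simp add: algebra_simps)
  have "?Q * ?Q \<le> (L * ?P)\<^sup>2" using power_mono[OF thr Q0, of 2] by (simp add: power2_eq_square)
  also have "\<dots> \<le> L\<^sup>2 * (4 * energy g * ?Q)"
    using PQ by (simp add: power_mult_distrib mult_left_mono)
  finally have "?Q * ?Q \<le> (4 * L\<^sup>2 * energy g) * ?Q" by (simp add: algebra_simps)
  then show ?thesis
    using Q0 energy_nonneg[of g] by (cases "?Q = 0") (simp, auto dest: mult_right_le_imp_le)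
qed

definition above :: "real \<Rightarrow> (nat \<Rightarrow> real) \<Rightarrow> nat \<Rightarrow> real" where
  "above c f u = max (f u - c) 0"

definition below :: "real \<Rightarrow> (nat \<Rightarrow> real) \<Rightarrow> nat \<Rightarrow> real" where
  "below c f u = max (c - f u) 0"

text \<open>Splitting \<open>f - c\<close> into its two parts keeps the squared norm and does not
  increase the energy, so Cheeger's inequality for both parts applies to \<open>f\<close> as a
  whole. Cutting at \<open>c\<close> keeps every threshold set on one side of the centre; for a
  median such a set has at most half of the volume.\<close>

lemma variance_decay:
  assumes n: "0 < n" and L: "0 < L"
    and up: "mass_on {..<n} (\<lambda>u. (above c f u)\<^sup>2)
               \<le> L * (\<Sum>u<n. \<Sum>v\<in>nb u. \<bar>(above c f u)\<^sup>2 - (above c f v)\<^sup>2\<bar>)"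
    and dn: "mass_on {..<n} (\<lambda>u. (below c f u)\<^sup>2)
               \<le> L * (\<Sum>u<n. \<Sum>v\<in>nb u. \<bar>(below c f u)\<^sup>2 - (below c f v)\<^sup>2\<bar>)"
  shows "variance (step f) \<le> (1 - 1 / (16 * L\<^sup>2)) * variance f"
proof -
  have "energy (above c f) + energy (below c f) \<le> energy f"
    unfolding energy_def sum.distrib[symmetric]
  proof (intro sum_mono)
    fix u v
    show "(above c f u - above c f v)\<^sup>2 + (below c f u - below c f v)\<^sup>2 \<le> (f u - f v)\<^sup>2"
    proof -
      \<comment> \<open>Since the parts have disjoint supports, expanding leaves only the mixed
        terms \<open>a * b' + a' * b\<close>, which are nonnegative.\<close>
      have "(a - b)\<^sup>2 + (a' - b')\<^sup>2 \<le> ((a - a') - (b - b'))\<^sup>2"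
        if "0 \<le> a" "0 \<le> a'" "0 \<le> b" "0 \<le> b'" "a * a' = 0" "b * b' = 0" for a b a' b' :: real
      proof -
        have "((a - a') - (b - b'))\<^sup>2 = (a - b)\<^sup>2 + (a' - b')\<^sup>2 + 2 * (a * b' + a' * b) - 2 * (a * a') - 2 * (b * b')"
          by (simp add: power2_eq_square algebra_simps)
        moreover have "0 \<le> a * b' + a' * b" using that by simp
        ultimately show ?thesis using that by simp
      qed
      note sq = this
      have d: "f u - f v = (above c f u - below c f u) - (above c f v - below c f v)"
        by (simp add: above_def below_def max_def)
      have pos: "0 \<le> above c f u" "0 \<le> below c f u" "above c f u * below c f u = 0" for u
        by (auto simp: above_def below_def max_def)
      show ?thesis unfolding d by (rule sq) (simp_all only: pos)
    qed
  qed
  moreover have "mass_on {..<n} (\<lambda>u. (f u - c)\<^sup>2) =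
     mass_on {..<n} (\<lambda>u. (above c f u)\<^sup>2) + mass_on {..<n} (\<lambda>u. (below c f u)\<^sup>2)"
    unfolding mass_on_def sum.distrib[symmetric]
    by (rule sum.cong) (auto simp: above_def below_def max_def power2_commute)
  moreover have "mass_on {..<n} (\<lambda>u. (above c f u)\<^sup>2) \<le> 4 * L\<^sup>2 * energy (above c f)"
    "mass_on {..<n} (\<lambda>u. (below c f u)\<^sup>2) \<le> 4 * L\<^sup>2 * energy (below c f)"
    using cheeger_energy L up dn by simp_all
  ultimately have "mass_on {..<n} (\<lambda>u. (f u - c)\<^sup>2) \<le> 4 * L\<^sup>2 * (energy (above c f) + energy (below c f))"
    by (simp add: algebra_simps)
  also have "\<dots> \<le> 4 * L\<^sup>2 * energy f"
    using \<open>_ \<le> energy f\<close> by (intro mult_left_mono) auto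
  finally have "variance f \<le> 4 * L\<^sup>2 * energy f"
    using variance_le_centered[OF n, of f c] by linarith
  then have "variance f / (16 * L\<^sup>2) \<le> energy f / 4"
    using L by (simp add: field_simps)
  then show ?thesis using variance_step[of f] by (simp add: algebra_simps)
qed

text \<open>Two estimates meet at time \<open>t\<close>: little mass has crossed the boundary of
  \<open>T\<close> until then, and the distribution is nearly uniform by then. As the mean is
  invariant, the result concerns the initial mass of \<open>T\<close>.\<close>

lemma mixed_mass:
  assumes T: "T \<subseteq> {..<n}" and f: "\<And>v. v < n \<Longrightarrow> 0 \<le> f v \<and> f v \<le> C"
    and var: "variance ((step ^^ t) f) \<le> \<epsilon>"
  shows "\<bar>mass_on T f - mean f * real (vol T)\<bar> \<le> real t * (real (crossing T) * C / 2) + sqrt (real (vol T) * \<epsilon>)"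
proof -
  have "sqrt (real (vol T) * variance ((step ^^ t) f)) \<le> sqrt (real (vol T) * \<epsilon>)"
    using var by (intro real_sqrt_le_mono mult_left_mono) auto
  moreover have "\<bar>mass_on T ((step ^^ t) f) - mass_on T f\<bar> \<le> real t * (real (crossing T) * C / 2)"
    by (rule mass_on_iter_change[OF T f])
  ultimately show ?thesis
    using mass_on_near_mean[OF T, of "(step ^^ t) f"]
    unfolding mean_iter by linarith
qed

end

section \<open>Threshold cuts by bisection\<close>

text \<open>The part of \<open>x\<close> that lies in the window from \<open>a\<close> to
  \<open>a + w\<close>. A window of width 1 gives the indicator of \<open>a < x\<close>, so
  bisecting windows is a search among the threshold cuts.\<close>

definition clamp :: "nat \<Rightarrow> nat \<Rightarrow> nat \<Rightarrow> nat" where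
  "clamp a w x = min (x - a) w"

definition gap :: "nat \<Rightarrow> nat \<Rightarrow> nat" where
  "gap x y = (x - y) + (y - x)"

lemma clamp_double: "clamp a (2 * w) x = clamp a w x + clamp (a + w) w x"
  unfolding clamp_def min_def by auto

lemma clamp_mono: "x \<le> y \<Longrightarrow> clamp a w x \<le> clamp a w y"
  by (auto simp: clamp_def)

text \<open>Clamping is monotone, so the differences in both halves have the same sign and add up
  without cancellation.\<close>

lemma gap_clamp_double:
  "gap (clamp a (2 * w) x) (clamp a (2 * w) y) =
     gap (clamp a w x) (clamp a w y) + gap (clamp (a + w) w x) (clamp (a + w) w y)"
proof (cases "x \<le> y")
  case True
  then show ?thesis
    using clamp_mono[OF True, of a w] clamp_mono[OF True, of "a + w" w]
    by (simp add: gap_def clamp_double)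
next
  case False
  then have "y \<le> x" by simp
  from clamp_mono[OF this, of a w] clamp_mono[OF this, of "a + w" w] show ?thesis
    by (simp add: gap_def clamp_double)
qed

lemma real_gap: "real (gap x y) = \<bar>real x - real y\<bar>"
  by (simp add: gap_def)

context diffusion
begin

definition total_variation :: "(nat \<Rightarrow> nat) \<Rightarrow> nat" where
  "total_variation G = (\<Sum>u<n. \<Sum>v\<in>nb u. gap (G u) (G v))"

definition weight :: "(nat \<Rightarrow> nat) \<Rightarrow> nat" where
  "weight G = (\<Sum>u<n. D u * G u)"

text \<open>The total variation sums boundary sizes and the weight sums volumes over the thresholds
  in the window; the inequality thus speaks of an average of threshold cuts.\<close>

definition sparse_window :: "nat \<Rightarrow> nat \<Rightarrow> nat \<Rightarrow> (nat \<Rightarrow> nat) \<Rightarrow> bool" where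
  "sparse_window L a w G \<longleftrightarrow>
     L * total_variation (\<lambda>u. clamp a w (G u)) < weight (\<lambda>u. clamp a w (G u))"

text \<open>Weight and total variation are additive over the halves of a window, so the strict
  inequality must survive in one of them.\<close>

lemma sparse_window_halve:
  assumes "sparse_window L a (2 * w) G" "\<not> sparse_window L a w G"
  shows "sparse_window L (a + w) w G"
proof -
  have "total_variation (\<lambda>u. clamp a (2 * w) (G u)) =
     total_variation (\<lambda>u. clamp a w (G u)) + total_variation (\<lambda>u. clamp (a + w) w (G u))"
    by (simp add: total_variation_def gap_clamp_double sum.distrib)
  moreover have "weight (\<lambda>u. clamp a (2 * w) (G u)) =
     weight (\<lambda>u. clamp a w (G u)) + weight (\<lambda>u. clamp (a + w) w (G u))"
    by (simp add: weight_def clamp_double sum.distrib distrib_left)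
  ultimately show ?thesis using assms by (simp add: sparse_window_def algebra_simps)
qed

lemma crossing_complement:
  assumes T: "T \<subseteq> {..<n}"
  shows "(\<Sum>u\<in>{..<n} - T. card (nb u \<inter> T)) = crossing T"
proof -
  have "(\<Sum>u\<in>{..<n} - T. card (nb u \<inter> T)) = (\<Sum>u\<in>{..<n} - T. \<Sum>v\<in>nb u \<inter> T. 1)"
    by simp
  also have "\<dots> = (\<Sum>v\<in>T. \<Sum>u\<in>nb v \<inter> ({..<n} - T). 1)"
    by (rule arc_sum_swap) (use T in auto)
  also have "\<dots> = (\<Sum>v\<in>T. card (nb v - T))"
  proof (rule sum.cong)
    fix v assume "v \<in> T"
    then have "nb v \<inter> ({..<n} - T) = nb v - T" using nb_less[of v] T by auto
    then show "(\<Sum>u\<in>nb v \<inter> ({..<n} - T). 1) = card (nb v - T)" by simp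
  qed simp
  finally show ?thesis by (simp add: crossing_def)
qed

text \<open>Every edge between \<open>T\<close> and its complement is seen from both ends.\<close>

lemma sum_separated:
  assumes T: "T \<subseteq> {..<n}"
  shows "(\<Sum>u<n. card {v \<in> nb u. (v \<in> T) \<noteq> (u \<in> T)}) = 2 * crossing T"
proof -
  have "(\<Sum>u<n. card {v \<in> nb u. (v \<in> T) \<noteq> (u \<in> T)}) =
     (\<Sum>u\<in>{..<n} - T. card {v \<in> nb u. (v \<in> T) \<noteq> (u \<in> T)}) +
     (\<Sum>u\<in>T. card {v \<in> nb u. (v \<in> T) \<noteq> (u \<in> T)})"
    by (rule sum.subset_diff) (use T in auto)
  also have "(\<Sum>u\<in>T. card {v \<in> nb u. (v \<in> T) \<noteq> (u \<in> T)}) = crossing T"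
    unfolding crossing_def by (intro sum.cong refl arg_cong[where f = card]) auto
  also have "(\<Sum>u\<in>{..<n} - T. card {v \<in> nb u. (v \<in> T) \<noteq> (u \<in> T)}) =
      (\<Sum>u\<in>{..<n} - T. card (nb u \<inter> T))"
    by (intro sum.cong refl arg_cong[where f = card]) auto
  finally show ?thesis by (simp add: crossing_complement[OF T])
qed

text \<open>The factor 2 is the double count of boundary edges by the total variation. It later pays
  for \<open>D u\<close> being up to twice the degree.\<close>

lemma sparse_window_unit:
  assumes "sparse_window L a 1 G" and S: "S = {u. u < n \<and> a < G u}"
  shows "L * (2 * crossing S) < vol S"
proof -
  have ST: "S \<subseteq> {..<n}" using S by auto
  have cl: "clamp a 1 (G u) = (if u \<in> S then 1 else 0)" if "u < n" for u
    using that by (auto simp: clamp_def S)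
  have "total_variation (\<lambda>u. clamp a 1 (G u)) =
      (\<Sum>u<n. card {v \<in> nb u. (v \<in> S) \<noteq> (u \<in> S)})"
    unfolding total_variation_def
  proof (rule sum.cong)
    fix u assume "u \<in> {..<n}"
    then have u: "u < n" by simp
    have "(\<Sum>v\<in>nb u. gap (clamp a 1 (G u)) (clamp a 1 (G v))) =
       (\<Sum>v\<in>nb u. if (v \<in> S) \<noteq> (u \<in> S) then 1 else 0)"
    proof (rule sum.cong)
      fix v assume "v \<in> nb u"
      then have "v < n" using nb_less[OF u] by auto
      then show "gap (clamp a 1 (G u)) (clamp a 1 (G v)) = (if (v \<in> S) \<noteq> (u \<in> S) then 1 else 0)"
        unfolding cl[OF u] cl[OF \<open>v < n\<close>] by (simp add: gap_def)
    qed simp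
    also have "\<dots> = (\<Sum>v\<in>{v \<in> nb u. (v \<in> S) \<noteq> (u \<in> S)}. 1)"
      by (rule sum.inter_filter[OF finite_nb[OF u], symmetric])
    finally show "(\<Sum>v\<in>nb u. gap (clamp a 1 (G u)) (clamp a 1 (G v))) =
        card {v \<in> nb u. (v \<in> S) \<noteq> (u \<in> S)}" by simp
  qed simp
  moreover have "weight (\<lambda>u. clamp a 1 (G u)) = vol S"
  proof -
    have "weight (\<lambda>u. clamp a 1 (G u)) = (\<Sum>u<n. if u \<in> S then D u else 0)"
      unfolding weight_def by (rule sum.cong) (auto simp: cl[unfolded One_nat_def])
    also have "\<dots> = (\<Sum>u\<in>{..<n} \<inter> S. D u)" by (simp add: sum.inter_restrict)
    finally show ?thesis using ST by (simp add: vol_def Int_absorb1)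
  qed
  ultimately show ?thesis using assms(1) sum_separated[OF ST] by (simp add: sparse_window_def)
qed

text \<open>As \<open>W\<close> bounds the values, the windows of width \<open>W\<close> at \<open>0\<close> clamp nothing.\<close>

lemma integer_variance_decay:
  assumes n: "0 < n" and L: "0 < L" and N: "0 < N"
    and F: "\<And>u. u < n \<Longrightarrow> real (F u) = N * f u"
    and W: "\<And>u. u < n \<Longrightarrow> (F u - c)\<^sup>2 \<le> W \<and> (c - F u)\<^sup>2 \<le> W"
    and up: "\<not> sparse_window L 0 W (\<lambda>u. (F u - c)\<^sup>2)"
    and dn: "\<not> sparse_window L 0 W (\<lambda>u. (c - F u)\<^sup>2)"
  shows "variance (step f) \<le> (1 - 1 / (16 * (real L)\<^sup>2)) * variance f"
proof -
  \<comment> \<open>Both sides are homogeneous of degree two in the densities, so the scaling factor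
    of the integers cancels.\<close>
  have main: "mass_on {..<n} (\<lambda>u. (g u)\<^sup>2) \<le> real L * (\<Sum>u<n. \<Sum>v\<in>nb u. \<bar>(g u)\<^sup>2 - (g v)\<^sup>2\<bar>)"
    if g: "\<And>u. u < n \<Longrightarrow> real (G u) = N\<^sup>2 * (g u)\<^sup>2" and GW: "\<And>u. u < n \<Longrightarrow> G u \<le> W"
      and ns: "\<not> sparse_window L 0 W G" for G g
  proof -
    have cl: "clamp 0 W (G u) = G u" if "u < n" for u using GW[OF that] by (simp add: clamp_def)
    have "weight (\<lambda>u. clamp 0 W (G u)) = weight G"
      by (simp add: weight_def cl)
    moreover have "total_variation (\<lambda>u. clamp 0 W (G u)) = total_variation G"
      unfolding total_variation_def
    proof (intro sum.cong refl)
      fix u v assume "u \<in> {..<n}" "v \<in> nb u"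
      then have "u < n" "v < n" using nb_less[of u] by auto
      then show "gap (clamp 0 W (G u)) (clamp 0 W (G v)) = gap (G u) (G v)" by (simp add: cl)
    qed
    ultimately have "weight G \<le> L * total_variation G" using ns by (simp add: sparse_window_def)
    then have le: "real (weight G) \<le> real L * real (total_variation G)"
      by (metis of_nat_le_iff of_nat_mult)
    have w: "real (weight G) = N\<^sup>2 * mass_on {..<n} (\<lambda>u. (g u)\<^sup>2)"
      by (simp add: weight_def mass_on_def g sum_distrib_left algebra_simps)
    have "real (total_variation G) = (\<Sum>u<n. \<Sum>v\<in>nb u. N\<^sup>2 * \<bar>(g u)\<^sup>2 - (g v)\<^sup>2\<bar>)"
      unfolding total_variation_def of_nat_sum
    proof (intro sum.cong refl)
      fix u v assume "u \<in> {..<n}" "v \<in> nb u"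
      then have "u < n" "v < n" using nb_less[of u] by auto
      then show "real (gap (G u) (G v)) = N\<^sup>2 * \<bar>(g u)\<^sup>2 - (g v)\<^sup>2\<bar>"
        by (simp add: real_gap g right_diff_distrib[symmetric] abs_mult)
    qed
    then have "real (total_variation G) = N\<^sup>2 * (\<Sum>u<n. \<Sum>v\<in>nb u. \<bar>(g u)\<^sup>2 - (g v)\<^sup>2\<bar>)"
      by (simp add: sum_distrib_left)
    with le w have "N\<^sup>2 * mass_on {..<n} (\<lambda>u. (g u)\<^sup>2) \<le>
        N\<^sup>2 * (real L * (\<Sum>u<n. \<Sum>v\<in>nb u. \<bar>(g u)\<^sup>2 - (g v)\<^sup>2\<bar>))"
      by (simp add: algebra_simps)
    then show ?thesis using N by simp
  qed
  let ?c = "real c / N"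
  have "real (F u - c) = N * above ?c f u" "real (c - F u) = N * below ?c f u" if "u < n" for u
  proof -
    have e: "N * (f u - ?c) = real (F u) - real c" using F[OF that] N by (simp add: right_diff_distrib)
    have "real (F u - c) = N * above ?c f u \<and> real (c - F u) = N * below ?c f u"
    proof (cases "c \<le> F u")
      case True
      then have "0 \<le> N * (f u - ?c)" using e by simp
      then have "?c \<le> f u" using N by (simp add: zero_le_mult_iff)
      then show ?thesis
        using True e by (simp_all add: above_def below_def)
    next
      case False
      then have "N * (f u - ?c) < 0" using e by simp
      then have "f u < ?c" using N by (simp add: mult_less_0_iff)
      moreover have "N * (?c - f u) = real c - real (F u)" using e by (simp add: right_diff_distrib)
      ultimately show ?thesis
        using False by (simp_all add: above_def below_def)
    qed
    then show "real (F u - c) = N * above ?c f u" "real (c - F u) = N * below ?c f u"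
      by simp_all
  qed
  then have "real ((F u - c)\<^sup>2) = N\<^sup>2 * (above ?c f u)\<^sup>2" "real ((c - F u)\<^sup>2) = N\<^sup>2 * (below ?c f u)\<^sup>2"
    if "u < n" for u
    using that by (simp_all add: power_mult_distrib)
  then show ?thesis
    using main[OF _ _ up] main[OF _ _ dn] W variance_decay[OF n, of "real L" ?c f] L by simp
qed

section \<open>Seeds\<close>

text \<open>Double counting of arcs into \<open>F\<close>: a vertex outside \<open>U\<close> has at
  least half of its arcs there, and each \<open>u \<in> F\<close> receives at most
  \<open>D u\<close> of them. This is what forces the greedy choice to reach its target: blocked
  vertices cannot make up the whole graph while the total load is small.\<close>

lemma volume_exhausted:
  assumes full: "\<And>v. v < n \<Longrightarrow> v \<notin> U \<Longrightarrow> card (nb v) \<le> 2 * card {u \<in> nb v. u \<in> F}"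
    and U: "U \<subseteq> {..<n}" and F: "\<And>u. u < n \<Longrightarrow> u \<in> F \<Longrightarrow> 2 * D u \<le> ld u"
  shows "(\<Sum>v<n. card (nb v)) \<le> vol U + (\<Sum>u<n. ld u)"
proof -
  have "(\<Sum>v<n. card (nb v)) = (\<Sum>v\<in>{..<n} - U. card (nb v)) + (\<Sum>v\<in>U. card (nb v))"
    by (rule sum.subset_diff) (use U in auto)
  also have "(\<Sum>v\<in>U. card (nb v)) \<le> vol U"
    unfolding vol_def by (rule sum_mono) (use U card_nb_le in auto)
  also have "(\<Sum>v\<in>{..<n} - U. card (nb v)) \<le> (\<Sum>u<n. ld u)"
  proof -
    have "(\<Sum>v\<in>{..<n} - U. card (nb v)) \<le> (\<Sum>v\<in>{..<n} - U. 2 * card {u \<in> nb v. u \<in> F})"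
      by (rule sum_mono) (use full in auto)
    also have "\<dots> \<le> (\<Sum>v<n. 2 * card {u \<in> nb v. u \<in> F})"
      by (rule sum_mono2) auto
    also have "\<dots> = 2 * (\<Sum>v<n. \<Sum>u\<in>nb v \<inter> (F \<inter> {..<n}). 1)"
      unfolding sum_distrib_left[symmetric]
      by (intro arg_cong2[where f = "(*)"] sum.cong refl) (use nb_less in \<open>auto intro!: arg_cong[where f = card]\<close>)
    also have "(\<Sum>v<n. \<Sum>u\<in>nb v \<inter> (F \<inter> {..<n}). 1) = (\<Sum>u\<in>F \<inter> {..<n}. \<Sum>v\<in>nb u \<inter> {..<n}. 1)"
      by (rule arc_sum_swap) auto
    also have "2 * \<dots> \<le> (\<Sum>u\<in>F \<inter> {..<n}. ld u)"
      unfolding sum_distrib_left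
    proof (rule sum_mono)
      fix u assume "u \<in> F \<inter> {..<n}"
      then have u: "u < n" "u \<in> F" by auto
      have "2 * (\<Sum>v\<in>nb u \<inter> {..<n}. 1) = 2 * card (nb u)" using nb_Int_all[OF u(1)] by simp
      also have "\<dots> \<le> 2 * D u" using card_nb_le[OF u(1)] by simp
      also have "\<dots> \<le> ld u" using F u by blast
      finally show "(\<Sum>v\<in>nb u \<inter> {..<n}. 2 * 1) \<le> ld u" by simp
    qed
    also have "\<dots> \<le> (\<Sum>u<n. ld u)" by (rule sum_mono2) auto
    finally show ?thesis .
  qed
  finally show ?thesis by simp
qed

text \<open>A seed \<open>v\<close> hands the same amount \<open>inc v\<close> to each receiver in
  \<open>R v\<close>, and the total is a whole number of units \<open>M\<close>. The increment is to
  be the same in all phases of a scale, which allows one leak estimate for all of them.\<close>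

definition seeding :: "nat \<Rightarrow> nat set \<Rightarrow> (nat \<Rightarrow> nat set) \<Rightarrow> (nat \<Rightarrow> nat) \<Rightarrow> (nat \<Rightarrow> nat) \<Rightarrow> bool" where
  "seeding M A R inc ld \<longleftrightarrow> A \<subseteq> {..<n} \<and>
     (\<forall>v\<in>A. R v \<subseteq> nb v \<and> M dvd inc v * card (R v)) \<and>
     (\<forall>u<n. ld u = (\<Sum>v\<in>A. if u \<in> R v then inc v else 0))"

text \<open>All neighbours of a seed across the boundary are counted, not only those in
  \<open>R v\<close>, so that the bound is in terms of boundary edges whatever receivers were
  chosen.\<close>

definition leak :: "nat set \<Rightarrow> nat set \<Rightarrow> (nat \<Rightarrow> nat) \<Rightarrow> nat" where
  "leak T A inc = (\<Sum>v\<in>A. inc v * card {u \<in> nb v. (u \<in> T) \<noteq> (v \<in> T)})"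

text \<open>The multiple is the total spread by the seeds inside \<open>T\<close>; each seed
  disturbs it by no more than what it sends to the other side.\<close>

lemma seeding_mass_near_multiple:
  assumes s: "seeding M A R inc ld" and T: "T \<subseteq> {..<n}"
  shows "\<exists>k. \<bar>real (\<Sum>u\<in>T. ld u) - real (k * M)\<bar> \<le> real (leak T A inc)"
proof -
  have A: "A \<subseteq> {..<n}" and R: "\<And>v. v \<in> A \<Longrightarrow> R v \<subseteq> nb v"
    and M: "\<And>v. v \<in> A \<Longrightarrow> M dvd inc v * card (R v)"
    and ld: "\<And>u. u < n \<Longrightarrow> ld u = (\<Sum>v\<in>A. if u \<in> R v then inc v else 0)"
    using s by (auto simp: seeding_def)
  have fA: "finite A" and fT: "finite T" using A T finite_subset by blast+
  have finR: "finite (R v)" "finite (nb v)" if "v \<in> A" for v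
    using R[OF that] finite_nb A that finite_subset by blast+
  have "(\<Sum>u\<in>T. ld u) = (\<Sum>u\<in>T. \<Sum>v\<in>A. if u \<in> R v then inc v else 0)"
    by (rule sum.cong) (use T ld in auto)
  also have "\<dots> = (\<Sum>v\<in>A. \<Sum>u\<in>T. if u \<in> R v then inc v else 0)" by (rule sum.swap)
  also have "\<dots> = (\<Sum>v\<in>A. inc v * card (R v \<inter> T))"
  proof (rule sum.cong)
    fix v assume "v \<in> A"
    have "(\<Sum>u\<in>T. if u \<in> R v then inc v else 0) = (\<Sum>u\<in>T \<inter> R v. inc v)"
      using sum.inter_restrict[OF fT, of "\<lambda>_. inc v" "R v"] by simp
    then show "(\<Sum>u\<in>T. if u \<in> R v then inc v else 0) = inc v * card (R v \<inter> T)"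
      by (simp add: Int_commute mult.commute)
  qed simp
  finally have 1: "(\<Sum>u\<in>T. ld u) = (\<Sum>v\<in>A. inc v * card (R v \<inter> T))" .
  have "M dvd (\<Sum>v\<in>A \<inter> T. inc v * card (R v))" using M by (intro dvd_sum) auto
  then obtain k where k: "(\<Sum>v\<in>A \<inter> T. inc v * card (R v)) = k * M" by (auto simp: dvd_def mult.commute)
  have "(\<Sum>v\<in>A \<inter> T. inc v * card (R v)) = (\<Sum>v\<in>A. if v \<in> T then inc v * card (R v) else 0)"
    using fA by (simp add: sum.inter_restrict)
  then have "real (\<Sum>u\<in>T. ld u) - real (k * M) =
     (\<Sum>v\<in>A. real (inc v * card (R v \<inter> T)) - real (if v \<in> T then inc v * card (R v) else 0))"
    unfolding 1 k[symmetric] by (simp add: sum_subtractf)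
  then have "\<bar>real (\<Sum>u\<in>T. ld u) - real (k * M)\<bar> \<le>
     (\<Sum>v\<in>A. \<bar>real (inc v * card (R v \<inter> T)) - real (if v \<in> T then inc v * card (R v) else 0)\<bar>)"
    by (simp only: sum_abs)
  also have "\<dots> \<le> (\<Sum>v\<in>A. real (inc v * card {u \<in> nb v. (u \<in> T) \<noteq> (v \<in> T)}))"
  proof (rule sum_mono)
    fix v assume v: "v \<in> A"
    let ?C = "{u \<in> nb v. (u \<in> T) \<noteq> (v \<in> T)}"
    have fC: "finite ?C" using finR[OF v] by simp
    show "\<bar>real (inc v * card (R v \<inter> T)) - real (if v \<in> T then inc v * card (R v) else 0)\<bar>
       \<le> real (inc v * card ?C)"
    proof (cases "v \<in> T")
      case True
      have "card (R v) = card (R v \<inter> T) + card (R v - T)"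
        using finR[OF v] by (metis card_Int_Diff)
      have "card (R v - T) \<le> card ?C"
        by (rule card_mono[OF fC]) (use R[OF v] True in auto)
      then have "inc v * card (R v - T) \<le> inc v * card ?C" by simp
      then have "real (inc v * card (R v - T)) \<le> real (inc v * card ?C)" by (simp only: of_nat_le_iff)
      moreover have "real (inc v * card (R v)) = real (inc v * card (R v \<inter> T)) + real (inc v * card (R v - T))"
        using \<open>card (R v) = _\<close> by (simp add: distrib_left)
      ultimately show ?thesis using True by simp
    next
      case False
      have "card (R v \<inter> T) \<le> card ?C"
        by (rule card_mono[OF fC]) (use R[OF v] False in auto)
      then show ?thesis using False by (simp del: of_nat_mult)
    qed
  qed
  finally show ?thesis unfolding leak_def by (auto intro!: exI[of _ k])
qed

text \<open>Disjoint seed sets let a boundary edge be charged at most twice over all phases, once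
  from each end.\<close>

lemma sum_leak_le:
  fixes q :: nat
  assumes disj: "disjoint_family_on A {..<q}" and A: "\<And>i. i < q \<Longrightarrow> A i \<subseteq> {..<n}"
    and inc: "\<And>v. v < n \<Longrightarrow> inc v \<le> b" and T: "T \<subseteq> {..<n}"
  shows "(\<Sum>i<q. leak T (A i) inc) \<le> b * (2 * crossing T)"
proof -
  let ?c = "\<lambda>v. card {u \<in> nb v. (u \<in> T) \<noteq> (v \<in> T)}"
  have "(\<Sum>i<q. leak T (A i) inc) = (\<Sum>v\<in>(\<Union>i<q. A i). inc v * ?c v)"
    unfolding leak_def
  proof (rule sum.UNION_disjoint[symmetric])
    show "\<forall>i\<in>{..<q}. finite (A i)" using finite_subset[OF A] by auto
    show "\<forall>i\<in>{..<q}. \<forall>j\<in>{..<q}. i \<noteq> j \<longrightarrow> A i \<inter> A j = {}"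
      using disj by (auto simp: disjoint_family_on_def)
  qed simp
  also have "\<dots> \<le> (\<Sum>v<n. inc v * ?c v)" by (rule sum_mono2) (use A in auto)
  also have "\<dots> \<le> (\<Sum>v<n. b * ?c v)" by (rule sum_mono) (use inc in auto)
  also have "\<dots> = b * (2 * crossing T)"
    by (simp only: sum_distrib_left[symmetric] sum_separated[OF T])
  finally show ?thesis .
qed

text \<open>The equilibrium mass of \<open>T\<close> is at distance at least
  \<open>8 * M / 32\<close> from all multiples of \<open>M\<close>. Flow across the boundary
  accounts for \<open>M / 32\<close> and imperfect mixing for \<open>2 * M / 32\<close>, so every
  phase leaks at least \<open>5 * M / 32\<close>. Over 128 phases this is \<open>20 * M\<close>,
  whereas disjointness allows only \<open>8 * M + 8 * \<delta>\<close>, and \<open>\<delta>\<close>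
  is far below \<open>M\<close>.\<close>

lemma scale_refutes_cut:
  fixes A :: "nat \<Rightarrow> nat set" and ld :: "nat \<Rightarrow> nat \<Rightarrow> nat"
  assumes seed: "\<And>i. i < 128 \<Longrightarrow> seeding M (A i) (R i) inc (ld i)"
    and disj: "disjoint_family_on A {..<128}"
    and inc: "\<And>v. v < n \<Longrightarrow> inc v \<le> 4 * (M div D v) + 4"
    and cap: "\<And>i u. i < 128 \<Longrightarrow> u < n \<Longrightarrow> ld i u * \<Delta>\<^sup>2 \<le> 6 * (M + \<Delta>\<^sup>2) * D u"
    and tot: "\<And>i. i < 128 \<Longrightarrow> X \<le> (\<Sum>u<n. ld i u) \<and> 2 * (\<Sum>u<n. ld i u) \<le> 3 * X"
    and var: "\<And>i. i < 128 \<Longrightarrow> variance ((step ^^ \<tau>) (\<lambda>u. real (ld i u) / real (D u))) \<le> 1 / 10 ^ 6"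
    and \<Delta>: "\<delta> \<le> \<Delta>" and D\<delta>: "\<And>u. u < n \<Longrightarrow> \<delta> \<le> D u"
    and T: "T \<subseteq> {..<n}" "crossing T \<le> \<delta>" "\<delta>\<^sup>2 \<le> vol T"
    and M: "2 * vol T * X \<le> M * vol {..<n}" "M * vol {..<n} < 4 * vol T * X"
    and V: "vol {..<n} < 4096 * X"
    and big: "200000 * \<tau> \<le> \<delta>" "20000 \<le> \<delta>"
  shows False
proof -
  let ?V = "vol {..<n}" and ?t = "vol T"
  have X0: "0 < X" using V by (cases X) auto
  have \<delta>0: "0 < \<delta>" using big by simp
  have t0: "0 < ?t" using T(3) \<delta>0 by (metis gr0I le_zero_eq not_less0 power_not_zero)
  have V0: "0 < ?V" using M t0 X0 by (cases ?V) auto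
  have M0: "0 < M" using M t0 X0 by (cases M) auto
  have "2 * ?t * X \<le> M * (4096 * X)" using M(1) V by (meson le_trans less_imp_le mult_le_mono2)
  then have tM: "?t \<le> 2048 * M" using X0 by simp
  then have \<delta>M: "\<delta>\<^sup>2 \<le> 2048 * M" using T(3) by simp
  define C where "C = 6 * (real M / (real \<delta>)\<^sup>2 + 1)"
  \<comment> \<open>From \<open>200000 * \<tau> \<le> \<delta>\<close> and
    \<open>\<delta>\<^sup>2 \<le> 2048 * M\<close> comes the factor
    \<open>(3 + 3 * 2048) / 200000\<close>, just below \<open>1 / 32\<close>.\<close>
  have flow: "real \<tau> * (real (crossing T) * C / 2) \<le> real M / 32"
  proof -
    have "real (crossing T) * C / 2 \<le> real \<delta> * C / 2"
      using T(2) by (intro divide_right_mono mult_right_mono) (auto simp: C_def)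
    also have "\<dots> = 3 * (real M / real \<delta>) + 3 * real \<delta>"
      using \<delta>0 by (simp add: C_def field_simps power2_eq_square)
    finally have "real \<tau> * (real (crossing T) * C / 2) \<le> real \<tau> * (3 * (real M / real \<delta>) + 3 * real \<delta>)"
      by (intro mult_left_mono) auto
    also have "\<dots> \<le> (real \<delta> / 200000) * (3 * (real M / real \<delta>) + 3 * real \<delta>)"
      using big(1) by (intro mult_right_mono) auto
    also have "\<dots> = (3 * real M + 3 * real (\<delta>\<^sup>2)) / 200000"
      using \<delta>0 by (simp add: field_simps power2_eq_square)
    also have "\<dots> \<le> (3 * real M + 3 * real (2048 * M)) / 200000"
      using \<delta>M by (intro divide_right_mono add_left_mono mult_left_mono) (auto simp only: of_nat_le_iff)
    also have "\<dots> \<le> real M / 32" by simp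
    finally show ?thesis .
  qed
  \<comment> \<open>The radicand is linear in \<open>M\<close>, and \<open>M \<ge> 1\<close> lets a
    square dominate it.\<close>
  have mix: "sqrt (real ?t * (1 / 10 ^ 6)) \<le> real M / 16"
  proof (rule real_le_lsqrt)
    have "real M * 1 \<le> real M * real M" using M0 by (intro mult_left_mono) auto
    then have "real (2048 * M) * (1 / 10 ^ 6) \<le> (real M / 16)\<^sup>2"
      by (simp add: power2_eq_square)
    moreover have "real ?t * (1 / 10 ^ 6) \<le> real (2048 * M) * (1 / 10 ^ 6)"
      using tM by simp
    ultimately show "real ?t * (1 / 10 ^ 6) \<le> (real M / 16)\<^sup>2" by linarith
  qed auto
  have leak: "5 * M \<le> 32 * leak T (A i) inc" if i: "i < 128" for i
  proof -
    let ?f = "\<lambda>u. real (ld i u) / real (D u)"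
    let ?Z = "\<Sum>u<n. ld i u"
    have mass: "mass_on S ?f = real (\<Sum>u\<in>S. ld i u)" if "S \<subseteq> {..<n}" for S
      unfolding mass_on_def of_nat_sum
    proof (rule sum.cong)
      fix u assume "u \<in> S"
      then have "0 < D u" using that D_pos by blast
      then show "real (D u) * (real (ld i u) / real (D u)) = real (ld i u)" by simp
    qed simp
    have fC: "0 \<le> ?f u \<and> ?f u \<le> C" if u: "u < n" for u
    proof -
      have \<Delta>0: "0 < \<Delta>" using \<Delta> \<delta>0 by simp
      have "real (ld i u * \<Delta>\<^sup>2) \<le> real (6 * (M + \<Delta>\<^sup>2) * D u)"
        using cap[OF i u] by (simp only: of_nat_le_iff)
      then have "?f u \<le> 6 * (real M + (real \<Delta>)\<^sup>2) / (real \<Delta>)\<^sup>2"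
        using D_pos[OF u] \<Delta>0 by (simp add: field_simps)
      also have "\<dots> = 6 * (real M / (real \<Delta>)\<^sup>2 + 1)"
        using \<Delta>0 by (simp add: field_simps)
      also have "\<dots> \<le> C"
        unfolding C_def using \<Delta> \<delta>0
        by (intro mult_left_mono add_right_mono divide_left_mono power_mono) auto
      finally show ?thesis by simp
    qed
    let ?y = "mean ?f * real ?t"
    \<comment> \<open>The total load lies between \<open>X\<close> and \<open>3 * X / 2\<close>;
      with the two inequalities for \<open>M\<close> this puts \<open>?y\<close> between
      \<open>M / 4\<close> and \<open>3 * M / 4\<close>, away from \<open>0\<close> and from every
      \<open>k * M\<close> with \<open>k \<ge> 1\<close>.\<close>
    have y: "?y = real (?Z * ?t) / real ?V"
      by (simp add: mean_def mass)
    have "real (M * ?V) \<le> real (4 * (?Z * ?t))"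
      unfolding of_nat_le_iff
    proof -
      have "X * ?t \<le> ?Z * ?t" using tot[OF i] by (intro mult_le_mono1) auto
      moreover have "4 * ?t * X = 4 * (X * ?t)" by simp
      ultimately show "M * ?V \<le> 4 * (?Z * ?t)" using M(2) by linarith
    qed
    then have y1: "real M / 4 \<le> ?y" using V0 unfolding y by (simp add: field_simps)
    have "real (4 * (?Z * ?t)) \<le> real (3 * (M * ?V))"
      unfolding of_nat_le_iff
    proof -
      have "2 * ?Z * ?t \<le> 3 * X * ?t" using tot[OF i] by (intro mult_le_mono1) auto
      moreover have "3 * X * ?t = 3 * (X * ?t)" "2 * ?t * X = 2 * (X * ?t)" "2 * ?Z * ?t = 2 * (?Z * ?t)"
        by simp_all
      ultimately show "4 * (?Z * ?t) \<le> 3 * (M * ?V)" using M(1) by linarith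
    qed
    then have y2: "?y \<le> 3 * real M / 4" using V0 unfolding y by (simp add: field_simps)
    have "\<bar>mass_on T ?f - ?y\<bar> \<le> real \<tau> * (real (crossing T) * C / 2) + sqrt (real ?t * (1 / 10 ^ 6))"
      by (rule mixed_mass[OF T(1) fC var[OF i]])
    then have near: "\<bar>real (\<Sum>u\<in>T. ld i u) - ?y\<bar> \<le> 3 * real M / 32"
      using flow mix mass[OF T(1)] by linarith
    obtain k where k: "\<bar>real (\<Sum>u\<in>T. ld i u) - real (k * M)\<bar> \<le> real (leak T (A i) inc)"
      using seeding_mass_near_multiple[OF seed[OF i] T(1)] by blast
    have "real M / 4 \<le> \<bar>?y - real (k * M)\<bar>"
    proof (cases "k = 0")
      case True
      then show ?thesis using y1 by simp
    next
      case False
      then have "M * 1 \<le> M * k" by (intro mult_le_mono2) auto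
      then have "real M \<le> real (k * M)" by (simp only: of_nat_le_iff mult.commute[of k] mult_1_right)
      then show ?thesis using y2 by linarith
    qed
    then have "5 * real M \<le> 32 * real (leak T (A i) inc)"
      using near k by linarith
    then show ?thesis by linarith
  qed
  have "(\<Sum>i<128::nat. 5 * M) \<le> (\<Sum>i<128. 32 * leak T (A i) inc)"
    by (rule sum_mono) (use leak in auto)
  then have "20 * M \<le> (\<Sum>i<128. leak T (A i) inc)"
    by (simp add: sum_distrib_left[symmetric])
  also have "\<dots> \<le> (4 * (M div \<delta>) + 4) * (2 * crossing T)"
  proof (rule sum_leak_le[OF disj _ _ T(1)])
    show "A i \<subseteq> {..<n}" if "i < 128" for i using seed[OF that] by (simp add: seeding_def)
    show "inc v \<le> 4 * (M div \<delta>) + 4" if "v < n" for v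
      using inc[OF that] div_le_mono2[OF \<delta>0 D\<delta>[OF that], of M] by linarith
  qed
  also have "\<dots> \<le> (4 * (M div \<delta>) + 4) * (2 * \<delta>)" using T(2) by simp
  also have "\<dots> = 8 * (M div \<delta> * \<delta>) + 8 * \<delta>" by (simp add: algebra_simps)
  also have "\<dots> \<le> 8 * M + 8 * \<delta>" by simp
  finally have "12 * M \<le> 8 * \<delta>" by simp
  \<comment> \<open>Together with \<open>\<delta>\<^sup>2 \<le> 2048 * M\<close> this puts
    \<open>\<delta>\<close> below \<open>M / 9\<close>, against
    \<open>12 * M \<le> 8 * \<delta>\<close>.\<close>
  moreover have "20000 * \<delta> \<le> \<delta>\<^sup>2"
    unfolding power2_eq_square using big(2) by (intro mult_le_mono1)
  ultimately show False using \<delta>M M0 by linarith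
qed

text \<open>Centred at \<open>0\<close>; one factor of each square is bounded by the total load. A
  polynomial bound is enough, because the decay is exponential.\<close>

lemma initial_variance:
  assumes n: "0 < n"
  shows "variance (\<lambda>u. real (ld u) / real (D u)) \<le> (real (\<Sum>u<n. ld u))\<^sup>2"
proof -
  let ?Z = "\<Sum>u<n. ld u"
  have "variance (\<lambda>u. real (ld u) / real (D u)) \<le> mass_on {..<n} (\<lambda>u. (real (ld u) / real (D u) - 0)\<^sup>2)"
    by (rule variance_le_centered[OF n])
  also have "\<dots> \<le> (\<Sum>u<n. real (ld u) * real ?Z)"
    unfolding mass_on_def
  proof (rule sum_mono)
    fix u assume "u \<in> {..<n}"
    then have u: "u < n" by simp
    have D: "1 \<le> real (D u)" using D_pos[OF u] by simp
    have "real (D u) * (real (ld u) / real (D u) - 0)\<^sup>2 = real (ld u) * real (ld u) / real (D u)"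
      using D by (simp add: power2_eq_square)
    also have "\<dots> \<le> real (ld u) * real (ld u)"
      using D by (simp add: divide_le_eq mult_le_cancel_left1)
    also have "\<dots> \<le> real (ld u) * real ?Z"
      using member_le_sum[of u "{..<n}" ld] u by (intro mult_left_mono) (auto simp del: of_nat_sum)
    finally show "real (D u) * (real (ld u) / real (D u) - 0)\<^sup>2 \<le> real (ld u) * real ?Z" .
  qed
  also have "\<dots> = (real ?Z)\<^sup>2" by (simp add: sum_distrib_right[symmetric] power2_eq_square)
  finally show ?thesis .
qed

end

text \<open>A block of \<open>16 * l ^ 4\<close> steps multiplies the variance by at most
  \<open>1 / e < 1 / 2\<close>. After \<open>5 * l\<close> blocks, \<open>2 ^ (- 5 * l)\<close>
  meets the initial \<open>2 ^ (4 * l)\<close> and leaves \<open>2 ^ (- l)\<close>, at most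
  \<open>2 ^ (- 20)\<close>. This is the origin of \<open>80 * l ^ 5\<close>.\<close>

lemma iterated_decay_small:
  fixes l :: nat
  assumes l: "20 \<le> l" and N: "N \<le> 2 ^ l" and v: "v \<le> (N\<^sup>2)\<^sup>2" "0 \<le> N"
  shows "(1 - 1 / (16 * (real (l\<^sup>2))\<^sup>2)) ^ (80 * l ^ 5) * v \<le> 1 / (10 ^ 6 :: real)"
proof -
  define K where "K = 16 * l ^ 4"
  have K: "1 \<le> K" using l by (simp add: K_def)
  have Keq: "16 * (real (l\<^sup>2))\<^sup>2 = real K" by (simp add: K_def power_mult[symmetric])
  have p: "0 \<le> 1 - 1 / real K" using K by simp
  have "(1 - 1 / real K) ^ K \<le> exp (- (1 / real K)) ^ K"
    by (rule power_mono[OF _ p]) (use exp_ge_add_one_self[of "- (1 / real K)"] in simp)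
  also have "\<dots> = exp (-1)" using K by (simp add: exp_of_nat_mult[symmetric])
  also have "\<dots> \<le> 1 / 2" using exp_ge_add_one_self[of 1] by (simp add: exp_minus field_simps)
  finally have half: "(1 - 1 / real K) ^ K \<le> 1 / 2" .
  have e: "80 * l ^ 5 = K * (5 * l)" using power_add[of l 4 1] by (simp add: K_def)
  have "(1 - 1 / real K) ^ (80 * l ^ 5) = ((1 - 1 / real K) ^ K) ^ (5 * l)"
    unfolding e by (rule power_mult)
  also have "\<dots> \<le> (1 / 2) ^ (5 * l)" by (rule power_mono[OF half]) (use p in simp)
  finally have 1: "(1 - 1 / real K) ^ (80 * l ^ 5) \<le> (1 / 2) ^ (5 * l)" .
  have "(N\<^sup>2)\<^sup>2 = N ^ 4" by (simp add: power_mult[symmetric])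
  also have "\<dots> \<le> (2 ^ l) ^ 4" using N v by (intro power_mono) auto
  also have "\<dots> = 2 ^ (4 * l)" by (simp add: power_mult[symmetric] mult.commute)
  finally have 2: "v \<le> 2 ^ (4 * l)" using v by linarith
  have "(1 - 1 / real K) ^ (80 * l ^ 5) * v \<le> (1 - 1 / real K) ^ (80 * l ^ 5) * 2 ^ (4 * l)"
    using 2 p by (intro mult_left_mono) auto
  also have "\<dots> \<le> (1 / 2) ^ (5 * l) * 2 ^ (4 * l)"
    using 1 by (intro mult_right_mono) auto
  also have "\<dots> = (1 / 2) ^ l"
  proof -
    have "(1 / 2 :: real) ^ (5 * l) = (1 / 2) ^ l * (1 / 2) ^ (4 * l)"
      by (simp add: power_add[symmetric])
    then show ?thesis by (simp add: power_one_over)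
  qed
  also have "\<dots> \<le> (1 / 2) ^ 20" by (rule power_decreasing) (use l in auto)
  also have "\<dots> \<le> 1 / 10 ^ 6" by (simp add: power_one_over)
  finally show ?thesis unfolding Keq .
qed

text \<open>The least admissible exponent works: its predecessor fails the lower inequality, and
  doubling turns this failure into the upper one. The hypothesis \<open>y\<close> is the case of
  exponent 0.\<close>

lemma dyadic_scale:
  fixes y x V :: nat
  assumes x: "2 * y \<le> 2 ^ k * V" and y: "V < 2 * (2 * y)"
  shows "\<exists>j\<le>k. 2 * y \<le> 2 ^ j * V \<and> 2 ^ j * V < 4 * y"
proof -
  define j where "j = (LEAST j. 2 * y \<le> 2 ^ j * V)"
  have 1: "2 * y \<le> 2 ^ j * V" unfolding j_def by (rule LeastI[of _ k]) (rule x)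
  have 2: "j \<le> k" unfolding j_def by (rule Least_le) (rule x)
  have "2 ^ j * V < 4 * y"
  proof (cases j)
    case 0
    then show ?thesis using y by simp
  next
    case (Suc i)
    then have "i < (LEAST j. 2 * y \<le> 2 ^ j * V)" by (simp add: j_def)
    then have "\<not> 2 * y \<le> 2 ^ i * V" by (rule not_less_Least)
    moreover have "2 ^ j * V = 2 * (2 ^ i * V)" using Suc by simp
    ultimately show ?thesis by linarith
  qed
  with 1 2 show ?thesis by blast
qed

section \<open>From input graphs to diffusions\<close>

definition nbrs :: "graph_input \<Rightarrow> nat \<Rightarrow> nat set" where
  "nbrs G u = {v. {u, v} \<in> edges G}"

lemma nbrs_sym: "v \<in> nbrs G u \<longleftrightarrow> u \<in> nbrs G v"
  by (simp add: nbrs_def insert_commute)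

context
  fixes G :: graph_input
  assumes G: "encodes_simple_graph G"
begin

lemma edge_pair: "e \<in> edges G \<Longrightarrow> e \<subseteq> verts G \<and> card e = 2"
  using G by (simp add: encodes_simple_graph_def simple_graph_def)

lemma nbrs_less: "nbrs G u \<subseteq> {..<fst G}"
  using edge_pair by (force simp: nbrs_def verts_def)

lemma nbrs_irrefl: "u \<notin> nbrs G u"
  using edge_pair[of "{u}"] by (auto simp: nbrs_def)

lemma edge_other:
  assumes "e \<in> edges G" "u \<in> e"
  obtains v where "e = {u, v}" "v \<noteq> u"
proof -
  from edge_pair[OF assms(1)] obtain a b where "e = {a, b}" "a \<noteq> b" by (auto simp: card_2_iff)
  with assms(2) that show ?thesis by (cases "u = a") (auto simp: insert_commute)
qed

lemma degree_nbrs: "degree (edges G) u = card (nbrs G u)"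
proof -
  have "bij_betw (\<lambda>v. {u, v}) (nbrs G u) {e \<in> edges G. u \<in> e}"
    unfolding bij_betw_def
  proof
    show "inj_on (\<lambda>v. {u, v}) (nbrs G u)" by (auto simp: inj_on_def doubleton_eq_iff)
    show "(\<lambda>v. {u, v}) ` nbrs G u = {e \<in> edges G. u \<in> e}"
      by (auto simp: nbrs_def elim: edge_other)
  qed
  then show ?thesis by (simp add: degree_def bij_betw_same_card)
qed

text \<open>An edge of the boundary has exactly one end in \<open>U\<close>, hence corresponds to
  exactly one arc that leaves \<open>U\<close>.\<close>

lemma boundary_arcs:
  assumes "U \<subseteq> verts G"
  shows "card (edge_boundary (verts G) (edges G) U) = (\<Sum>u\<in>U. card (nbrs G u - U))"
proof -
  let ?A = "Sigma U (\<lambda>u. nbrs G u - U)"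
  have fin: "finite U" using assms finite_subset by (auto simp: verts_def)
  have "bij_betw (\<lambda>(u, v). {u, v}) ?A (edge_boundary (verts G) (edges G) U)"
    unfolding bij_betw_def
  proof
    show "inj_on (\<lambda>(u, v). {u, v}) ?A" by (auto simp: inj_on_def doubleton_eq_iff)
    show "(\<lambda>(u, v). {u, v}) ` ?A = edge_boundary (verts G) (edges G) U"
    proof
      show "(\<lambda>(u, v). {u, v}) ` ?A \<subseteq> edge_boundary (verts G) (edges G) U"
        using nbrs_less by (auto simp: edge_boundary_def nbrs_def verts_def)
      show "edge_boundary (verts G) (edges G) U \<subseteq> (\<lambda>(u, v). {u, v}) ` ?A"
      proof
        fix e assume "e \<in> edge_boundary (verts G) (edges G) U"
        then have e: "e \<in> edges G" "e \<inter> U \<noteq> {}" "e \<inter> (verts G - U) \<noteq> {}"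
          by (auto simp: edge_boundary_def)
        from e(2) obtain u where u: "u \<in> e" "u \<in> U" by auto
        from edge_other[OF e(1) u(1)] obtain v where v: "e = {u, v}" "v \<noteq> u" .
        with e u have "(u, v) \<in> ?A" by (auto simp: nbrs_def)
        then show "e \<in> (\<lambda>(u, v). {u, v}) ` ?A" using v(1) by (metis (mono_tags, lifting) case_prod_conv imageI)
      qed
    qed
  qed
  then have "card (edge_boundary (verts G) (edges G) U) = card ?A"
    by (simp add: bij_betw_same_card)
  also have "\<dots> = (\<Sum>u\<in>U. card (nbrs G u - U))"
    using fin finite_subset[OF nbrs_less] by (intro card_SigmaI) auto
  finally show ?thesis .
qed

lemma boundary_complement:
  assumes "U \<subseteq> verts G"
  shows "edge_boundary (verts G) (edges G) (verts G - U) = edge_boundary (verts G) (edges G) U"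
  using assms by (auto simp: edge_boundary_def double_diff)

lemma num_edges_length: "num_edges G = length (snd G)"
  using G unfolding num_edges_def edges_def encodes_simple_graph_def
  by (metis distinct_card length_map)

text \<open>Isolating a vertex of minimum degree bounds the min-cut by \<open>\<delta>\<close>. A
  vertex of a simple graph has at most \<open>card S - 1\<close> neighbours in \<open>S\<close>, so
  a side with fewer than \<open>\<delta>\<close> vertices would send out more than
  \<open>\<delta>\<close> edges. Hence there are at least \<open>\<delta>\<close> vertices, each of
  degree at least \<open>\<delta>\<close>.\<close>

lemma nontrivial_min_cut_volume:
  assumes U: "min_cut (verts G) (edges G) U" "nontrivial_cut (verts G) U"
    and \<delta>: "\<delta> = min_degree (verts G) (edges G)" "0 < \<delta>"
    and S: "S = U \<or> S = verts G - U"
  shows "(\<Sum>u\<in>S. card (nbrs G u - S)) \<le> \<delta>" "\<delta>\<^sup>2 \<le> (\<Sum>u\<in>S. card (nbrs G u))"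
proof -
  have cut: "is_cut (verts G) U" "2 \<le> card U" "2 \<le> card (verts G - U)" and UV: "U \<subseteq> verts G"
    using U(2) by (auto simp: nontrivial_cut_def is_cut_def)
  have finV: "finite (verts G)" by (simp add: verts_def)
  have SV: "S \<subseteq> verts G" and cS: "2 \<le> card S" using S cut UV by auto
  have finS: "finite S" using SV finV finite_subset by blast
  have bS: "card (edge_boundary (verts G) (edges G) S) = card (edge_boundary (verts G) (edges G) U)"
    using S boundary_complement[OF UV] by auto
  have V0: "verts G \<noteq> {}" using cut by (auto simp: is_cut_def)
  have "\<delta> \<in> degree (edges G) ` verts G"
    unfolding \<delta> min_degree_def by (rule Min_in) (use finV V0 in auto)
  then obtain x where x: "x \<in> verts G" "card (nbrs G x) = \<delta>" by (auto simp: degree_nbrs)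
  have dmin: "\<delta> \<le> card (nbrs G u)" if "u \<in> verts G" for u
    unfolding \<delta> min_degree_def degree_nbrs[symmetric] by (rule Min_le) (use finV that in auto)
  have "is_cut (verts G) {x}"
  proof -
    have "verts G \<noteq> {x}" using card_mono[OF finV UV] cut(2) by auto
    then show ?thesis using x by (auto simp: is_cut_def)
  qed
  then have "card (edge_boundary (verts G) (edges G) U) \<le> card (edge_boundary (verts G) (edges G) {x})"
    using U(1) by (simp add: min_cut_def)
  also have "\<dots> = \<delta>" using boundary_arcs[of "{x}"] x nbrs_irrefl by (simp add: Diff_triv)
  finally have b: "(\<Sum>u\<in>S. card (nbrs G u - S)) \<le> \<delta>"
    using bS boundary_arcs[OF SV] by simp
  show "(\<Sum>u\<in>S. card (nbrs G u - S)) \<le> \<delta>" by (rule b)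
  have "card S * \<delta> \<le> (\<Sum>u\<in>S. card (nbrs G u))"
    using sum_mono[of S "\<lambda>_. \<delta>" "\<lambda>u. card (nbrs G u)"] dmin SV by auto
  also have "\<dots> \<le> (\<Sum>u\<in>S. (card S - 1) + card (nbrs G u - S))"
  proof (rule sum_mono)
    fix u assume u: "u \<in> S"
    have f: "finite (nbrs G u)" using nbrs_less finite_subset by blast
    have "card (nbrs G u) = card (nbrs G u \<inter> S) + card (nbrs G u - S)"
      by (metis card_Int_Diff f)
    moreover have "card (nbrs G u \<inter> S) \<le> card (S - {u})"
      by (rule card_mono) (use finS nbrs_irrefl[of u] in auto)
    ultimately show "card (nbrs G u) \<le> (card S - 1) + card (nbrs G u - S)"
      using u finS by simp
  qed
  also have "\<dots> = card S * (card S - 1) + (\<Sum>u\<in>S. card (nbrs G u - S))" by (simp add: sum.distrib)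
  finally have "card S * \<delta> \<le> card S * (card S - 1) + \<delta>" using b by simp
  \<comment> \<open>Cancelling \<open>card S - 1\<close> afterwards is possible because a nontrivial
    side has two vertices.\<close>
  then have "(card S - 1) * \<delta> \<le> (card S - 1) * card S"
    using cS by (cases "card S") (auto simp: algebra_simps)
  then have "\<delta> \<le> card S" using cS by simp
  then have "\<delta> * \<delta> \<le> card S * \<delta>" by simp
  also note \<open>card S * \<delta> \<le> (\<Sum>u\<in>S. card (nbrs G u))\<close>
  finally show "\<delta>\<^sup>2 \<le> (\<Sum>u\<in>S. card (nbrs G u))" by (simp add: power2_eq_square)
qed

end

section \<open>Loops for sums, tables and powers of two\<close>

definition SumTo :: "nat \<Rightarrow> nat \<Rightarrow> aexp \<Rightarrow> aexp \<Rightarrow> com" where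
  "SumTo acc x N e = Seq (Set acc (Const 0)) (For x N (Set acc (Add (Var acc) e)))"

definition MapTo :: "nat \<Rightarrow> nat \<Rightarrow> aexp \<Rightarrow> aexp \<Rightarrow> com" where
  "MapTo out x N e = For x N (Assign out (Var x) e)"

text \<open>
  Computes the least power of two \<open>y = 2 ^ k\<close> with \<open>e < c * y\<close>, where \<open>k\<close> is capped by \<open>N\<close>; for
  \<open>c = 0\<close> this is \<open>2 ^ N\<close>.
\<close>

definition DoubleTo :: "nat \<Rightarrow> nat \<Rightarrow> nat \<Rightarrow> aexp \<Rightarrow> aexp \<Rightarrow> aexp \<Rightarrow> com" where
  "DoubleTo y k x N c e = Seq (Set y (Const 1)) (Seq (Set k (Const 0))
     (For x N (If (Sub (Add e (Const 1)) (Mul c (Var y)))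
       (Seq (Set y (Mul (Const 2) (Var y))) (Set k (Add (Var k) (Const 1)))) Skip)))"

lemma writes_SumTo [simp]: "writes (SumTo acc x N e) = {acc, x}"
  by (auto simp: SumTo_def)

lemma writes_MapTo [simp]: "writes (MapTo out x N e) = {out, x}"
  by (auto simp: MapTo_def)

lemma writes_DoubleTo [simp]: "writes (DoubleTo y k x N c e) = {y, k, x}"
  by (auto simp: DoubleTo_def)

lemma wp_For_uniform:
  assumes "small_consts N"
    and "Inv 0 (s(x := (s x)(0 := 0)))"
    and "\<And>i s'. Inv i s' \<Longrightarrow> i \<le> B \<Longrightarrow> s' x 0 = i \<Longrightarrow>
        (\<And>a. a \<noteq> x \<Longrightarrow> a \<notin> writes c \<Longrightarrow> s' a = s a) \<Longrightarrow> aval N s' = B"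
    and "cells_below w s \<Longrightarrow> B < 2 ^ w"
    and "\<And>i s'. i < B \<Longrightarrow> s' x 0 = i \<Longrightarrow> Inv i s' \<Longrightarrow>
        (\<And>a. a \<noteq> x \<Longrightarrow> a \<notin> writes c \<Longrightarrow> s' a = s a) \<Longrightarrow>
        wp w c (\<lambda>k s''. k \<le> b \<and> s'' x 0 = i \<and> Inv (Suc i) (s''(x := (s'' x)(0 := Suc i)))) s'"
    and post: "\<And>k s'. Inv B s' \<Longrightarrow> s' x 0 = B \<Longrightarrow>
        (\<And>a. a \<noteq> x \<Longrightarrow> a \<notin> writes c \<Longrightarrow> s' a = s a) \<Longrightarrow>
        k \<le> (B + 1) * (b + fcost N) \<Longrightarrow> Q k s'"
  shows "wp w (For x N c) Q s"
  by (rule wp_For[of N Inv s x B c w "\<lambda>_. b" Q]; (rule assms(1-5) | rule post); simp add: algebra_simps)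

definition sumcost :: "aexp \<Rightarrow> aexp \<Rightarrow> nat" where
  "sumcost N e = fcost N + 10 + ecost (Add (Var 0) e)"

lemma wp_SumTo:
  assumes sc: "small_consts N" "small_consts e" and ne: "acc \<noteq> x"
    and N: "\<And>s'. (\<And>a. a \<noteq> acc \<Longrightarrow> a \<noteq> x \<Longrightarrow> s' a = s a) \<Longrightarrow> aval N s' = B"
    and e: "\<And>i s'. i < B \<Longrightarrow> s' x 0 = i \<Longrightarrow> (\<And>a. a \<noteq> acc \<Longrightarrow> a \<noteq> x \<Longrightarrow> s' a = s a) \<Longrightarrow>
              aval e s' = g i"
    and B: "cells_below w s \<Longrightarrow> B < 2 ^ w" and sum: "cells_below w s \<Longrightarrow> (\<Sum>i<B. g i) < 2 ^ w"
    and post: "\<And>k s'. s' acc 0 = (\<Sum>i<B. g i) \<Longrightarrow> (\<And>a. a \<noteq> acc \<Longrightarrow> a \<noteq> x \<Longrightarrow> s' a = s a) \<Longrightarrow>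
              k \<le> (B + 1) * sumcost N e \<Longrightarrow> Q k s'"
  shows "wp w (SumTo acc x N e) Q s"
proof (rule wp_below)
  assume w: "cells_below w s"
  show ?thesis
    unfolding SumTo_def
  proof (rule wp_Seq, rule wp_Assign, simp, simp)
    let ?s = "s(acc := (s acc)(aval (Const 0) s := aval (Const 0) s))"
    show "wp w (For x N (Set acc (Add (Var acc) e))) (\<lambda>l. Q (1 + ecost (Const 0) + ecost (Const 0) + l)) ?s"
    proof (rule wp_For_uniform[where Inv = "\<lambda>i s'. s' acc 0 = (\<Sum>j<i. g j)" and B = B
          and b = "3 + ecost (Add (Var acc) e)"])
      show "small_consts N" by (rule sc)
      show "(?s(x := (?s x)(0 := 0))) acc 0 = (\<Sum>j<0. g j)" using ne by simp
      show "B < 2 ^ w" by (rule B[OF w])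
    next
      fix i s' assume "\<And>a. a \<noteq> x \<Longrightarrow> a \<notin> writes (Set acc (Add (Var acc) e)) \<Longrightarrow> s' a = ?s a"
      then have "\<And>a. a \<noteq> acc \<Longrightarrow> a \<noteq> x \<Longrightarrow> s' a = s a" by auto
      then show "aval N s' = B" by (rule N)
    next
      fix i s' assume i: "i < B" "s' x 0 = i" "s' acc 0 = (\<Sum>j<i. g j)"
        and fr: "\<And>a. a \<noteq> x \<Longrightarrow> a \<notin> writes (Set acc (Add (Var acc) e)) \<Longrightarrow> s' a = ?s a"
      then have fr': "\<And>a. a \<noteq> acc \<Longrightarrow> a \<noteq> x \<Longrightarrow> s' a = s a" by auto
      have v: "aval e s' = g i" by (rule e[OF i(1,2) fr'])
      have "(\<Sum>j<Suc i. g j) \<le> (\<Sum>j<B. g j)" using i(1) by (intro sum_mono2) auto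
      also have "\<dots> < 2 ^ w" by (rule sum[OF w])
      finally have "(\<Sum>j<i. g j) + g i < 2 ^ w" by simp
      then show "wp w (Set acc (Add (Var acc) e)) (\<lambda>k s''. k \<le> 3 + ecost (Add (Var acc) e) \<and> s'' x 0 = i \<and>
         (s''(x := (s'' x)(0 := Suc i))) acc 0 = (\<Sum>j<Suc i. g j)) s'"
        by (intro wp_Assign) (use sc i v ne in \<open>simp_all add: ecost_def\<close>)
    next
      fix k s' assume *: "s' acc 0 = (\<Sum>j<B. g j)" "k \<le> (B + 1) * (3 + ecost (Add (Var acc) e) + fcost N)"
        and fr: "\<And>a. a \<noteq> x \<Longrightarrow> a \<notin> writes (Set acc (Add (Var acc) e)) \<Longrightarrow> s' a = ?s a"
      have "1 + ecost (Const 0) + ecost (Const 0) + k \<le> 5 + (B + 1) * (3 + ecost (Add (Var acc) e) + fcost N)"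
        using *(2) by (simp add: ecost_def)
      also have "\<dots> \<le> (B + 1) * (3 + ecost (Add (Var acc) e) + fcost N + 5)"
        by (simp add: distrib_left)
      also have "\<dots> \<le> (B + 1) * sumcost N e"
        by (intro mult_le_mono2) (simp add: sumcost_def ecost_def)
      finally show "Q (1 + ecost (Const 0) + ecost (Const 0) + k) s'"
        using fr * by (intro post) auto
    qed
  qed
qed

definition mapcost :: "aexp \<Rightarrow> aexp \<Rightarrow> nat" where
  "mapcost N e = fcost N + 20 + ecost e"

text \<open>Cells of \<open>out\<close> from the current index on still hold their old contents, so
  \<open>e\<close> may read the cell that is about to be overwritten. The diffusion step updates the
  densities in place this way.\<close>

lemma wp_MapTo:
  assumes sc: "small_consts N" "small_consts e" and ne: "out \<noteq> x"
    and N: "\<And>s'. (\<And>a. a \<noteq> out \<Longrightarrow> a \<noteq> x \<Longrightarrow> s' a = s a) \<Longrightarrow> aval N s' = B"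
    and e: "\<And>i s'. i < B \<Longrightarrow> s' x 0 = i \<Longrightarrow> (\<And>u. i \<le> u \<Longrightarrow> s' out u = s out u) \<Longrightarrow>
              (\<And>a. a \<noteq> out \<Longrightarrow> a \<noteq> x \<Longrightarrow> s' a = s a) \<Longrightarrow> aval e s' = g i"
    and B: "cells_below w s \<Longrightarrow> B < 2 ^ w" and gb: "\<And>i. cells_below w s \<Longrightarrow> i < B \<Longrightarrow> g i < 2 ^ w"
    and post: "\<And>k s'. (\<And>u. u < B \<Longrightarrow> s' out u = g u) \<Longrightarrow>
              (\<And>a. a \<noteq> out \<Longrightarrow> a \<noteq> x \<Longrightarrow> s' a = s a) \<Longrightarrow> k \<le> (B + 1) * mapcost N e \<Longrightarrow> Q k s'"
  shows "wp w (MapTo out x N e) Q s"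
proof (rule wp_below)
  assume w: "cells_below w s"
  show ?thesis
    unfolding MapTo_def
  proof (rule wp_For_uniform[where Inv = "\<lambda>i s'. s' out = (\<lambda>u. if u < i then g u else s out u)" and B = B
          and b = "9 + ecost e"])
    show "small_consts N" by (rule sc)
    show "(s(x := (s x)(0 := 0))) out = (\<lambda>u. if u < 0 then g u else s out u)" using ne by simp
    show "B < 2 ^ w" by (rule B[OF w])
  next
    fix i s' assume "\<And>a. a \<noteq> x \<Longrightarrow> a \<notin> writes (Assign out (Var x) e) \<Longrightarrow> s' a = s a"
    then have "\<And>a. a \<noteq> out \<Longrightarrow> a \<noteq> x \<Longrightarrow> s' a = s a" by auto
    then show "aval N s' = B" by (rule N)
  next
    fix i s' assume i: "i < B" "s' x 0 = i" "s' out = (\<lambda>u. if u < i then g u else s out u)"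
      and fr: "\<And>a. a \<noteq> x \<Longrightarrow> a \<notin> writes (Assign out (Var x) e) \<Longrightarrow> s' a = s a"
    have v: "aval e s' = g i" by (rule e[where i = i and s' = s']) (use i fr in auto)
    show "wp w (Assign out (Var x) e) (\<lambda>k s''. k \<le> 9 + ecost e \<and> s'' x 0 = i \<and>
       (s''(x := (s'' x)(0 := Suc i))) out = (\<lambda>u. if u < Suc i then g u else s out u)) s'"
      by (intro wp_Assign) (use sc i v ne gb[OF w] in \<open>auto simp: ecost_def\<close>)
  next
    fix k s' assume *: "s' out = (\<lambda>u. if u < B then g u else s out u)" "k \<le> (B + 1) * (9 + ecost e + fcost N)"
      and fr: "\<And>a. a \<noteq> x \<Longrightarrow> a \<notin> writes (Assign out (Var x) e) \<Longrightarrow> s' a = s a"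
    have "k \<le> (B + 1) * (9 + ecost e + fcost N)"
      using *(2) by simp
    also have "\<dots> \<le> (B + 1) * mapcost N e" by (intro mult_le_mono2) (simp add: mapcost_def)
    finally show "Q k s'"
      using fr * by (intro post) auto
  qed
qed

definition doublecost :: "aexp \<Rightarrow> aexp \<Rightarrow> aexp \<Rightarrow> nat" where
  "doublecost N c e = fcost N + 200 + ecost (Sub (Add e (Const 1)) (Mul c (Var 0)))"

text \<open>The last doubling happened because \<open>C * 2 ^ (j - 1) \<le> E\<close>; this yields
  the upper bound on \<open>2 ^ j\<close>. For \<open>C = 0\<close> nothing but the cap stops the
  doubling, so overflow is excluded by \<open>B < w\<close> instead.\<close>

lemma wp_DoubleTo:
  assumes sc: "small_consts N" "small_consts c" "small_consts e"
    and ne: "y \<noteq> x" "k \<noteq> x" "y \<noteq> k"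
    and ev: "\<And>s'. (\<And>a. a \<noteq> y \<Longrightarrow> a \<noteq> k \<Longrightarrow> a \<noteq> x \<Longrightarrow> s' a = s a) \<Longrightarrow>
          aval N s' = B \<and> aval c s' = C \<and> aval e s' = E"
    and bnd: "cells_below w s \<Longrightarrow> B < 2 ^ w" "cells_below w s \<Longrightarrow> C = 0 \<Longrightarrow> B < w"
       "cells_below w s \<Longrightarrow> 2 * E < 2 ^ w"
    and post: "\<And>t s' j. s' y 0 = 2 ^ j \<Longrightarrow> s' k 0 = j \<Longrightarrow> j \<le> B \<Longrightarrow> j = 0 \<or> C * 2 ^ j \<le> 2 * E \<Longrightarrow>
        j = B \<or> E < C * 2 ^ j \<Longrightarrow>
        (\<And>a. a \<noteq> y \<Longrightarrow> a \<noteq> k \<Longrightarrow> a \<noteq> x \<Longrightarrow> s' a = s a) \<Longrightarrow> t \<le> (B + 1) * doublecost N c e \<Longrightarrow> Q t s'"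
  shows "wp w (DoubleTo y k x N c e) Q s"
proof (rule wp_below)
  assume w: "cells_below w s"
  have w20: "20 \<le> w" using w by (simp add: cells_below_def)
  let ?b = "Seq (Set y (Mul (Const 2) (Var y))) (Set k (Add (Var k) (Const 1)))"
  let ?g = "Sub (Add e (Const 1)) (Mul c (Var y))"
  let ?s = "s(y := (s y)(0 := 1), k := (s k)(0 := 0))"
  define R where "R t s' \<longleftrightarrow> t \<le> (B + 1) * doublecost N c e \<and>
     (\<exists>j\<le>B. s' y 0 = 2 ^ j \<and> s' k 0 = j \<and> (j = 0 \<or> C * 2 ^ j \<le> 2 * E) \<and> (j = B \<or> E < C * 2 ^ j)) \<and>
     (\<forall>a. a \<noteq> y \<longrightarrow> a \<noteq> k \<longrightarrow> a \<noteq> x \<longrightarrow> s' a = s a)" for t and s' :: store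
  have For: "wp w (For x N (If ?g ?b Skip)) (\<lambda>l. R (10 + l)) ?s"
  proof (rule wp_For_uniform[where Inv = "\<lambda>i s'. \<exists>j\<le>i. s' y 0 = 2 ^ j \<and> s' k 0 = j \<and>
       (j = 0 \<or> C * 2 ^ j \<le> 2 * E) \<and> (j = i \<or> E < C * 2 ^ j)" and B = B
       and b = "100 + ecost ?g"])
    show "small_consts N" by (rule sc)
    show "B < 2 ^ w" by (rule bnd[OF w])
    show "\<exists>j\<le>0. (?s(x := (?s x)(0 := 0))) y 0 = 2 ^ j \<and> (?s(x := (?s x)(0 := 0))) k 0 = j \<and>
       (j = 0 \<or> C * 2 ^ j \<le> 2 * E) \<and> (j = 0 \<or> E < C * 2 ^ j)"
      using ne by simp
  next
    fix i s' assume "\<And>a. a \<noteq> x \<Longrightarrow> a \<notin> writes (If ?g ?b Skip) \<Longrightarrow> s' a = ?s a"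
    then have "\<And>a. a \<noteq> y \<Longrightarrow> a \<noteq> k \<Longrightarrow> a \<noteq> x \<Longrightarrow> s' a = s a" by auto
    then show "aval N s' = B" using ev by blast
  next
    fix i s' assume i: "i < B" "s' x 0 = i"
      and inv: "\<exists>j\<le>i. s' y 0 = 2 ^ j \<and> s' k 0 = j \<and>
       (j = 0 \<or> C * 2 ^ j \<le> 2 * E) \<and> (j = i \<or> E < C * 2 ^ j)"
      and fr: "\<And>a. a \<noteq> x \<Longrightarrow> a \<notin> writes (If ?g ?b Skip) \<Longrightarrow> s' a = ?s a"
    then obtain j where j: "j \<le> i" "s' y 0 = 2 ^ j" "s' k 0 = j"
       "j = 0 \<or> C * 2 ^ j \<le> 2 * E" "j = i \<or> E < C * 2 ^ j" by blast
    have "\<And>a. a \<noteq> y \<Longrightarrow> a \<noteq> k \<Longrightarrow> a \<noteq> x \<Longrightarrow> s' a = s a" using fr by auto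
    then have v: "aval c s' = C" "aval e s' = E" using ev by blast+
    have lt: "2 * 2 ^ j < (2::nat) ^ w" if "C * 2 ^ j \<le> E"
    proof (cases "C = 0")
      case True
      have "Suc j < w" using bnd(2)[OF w True] i j(1) by simp
      then have "(2::nat) ^ Suc j < 2 ^ w" by (intro power_strict_increasing) auto
      then show ?thesis by simp
    next
      case False
      then have "1 * 2 ^ j \<le> C * 2 ^ j" by (intro mult_le_mono1) simp
      then show ?thesis using bnd(3)[OF w] that by linarith
    qed
    have lt2: "Suc j < 2 ^ w" using bnd(1)[OF w] i(1) j(1) by simp
    show "wp w (If ?g ?b Skip) (\<lambda>t s''. t \<le> 100 + ecost ?g \<and> s'' x 0 = i \<and>
       (\<exists>j\<le>Suc i. (s''(x := (s'' x)(0 := Suc i))) y 0 = 2 ^ j \<and> (s''(x := (s'' x)(0 := Suc i))) k 0 = j \<and>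
       (j = 0 \<or> C * 2 ^ j \<le> 2 * E) \<and> (j = Suc i \<or> E < C * 2 ^ j))) s'"
    proof (rule wp_If)
      assume "aval ?g s' \<noteq> 0"
      then have le: "C * 2 ^ j \<le> E" using v j by simp
      then have ji: "j = i" using j(5) by auto
      show "wp w ?b (\<lambda>t s''. 1 + ecost ?g + t \<le> 100 + ecost ?g \<and> s'' x 0 = i \<and>
       (\<exists>j\<le>Suc i. (s''(x := (s'' x)(0 := Suc i))) y 0 = 2 ^ j \<and> (s''(x := (s'' x)(0 := Suc i))) k 0 = j \<and>
       (j = 0 \<or> C * 2 ^ j \<le> 2 * E) \<and> (j = Suc i \<or> E < C * 2 ^ j))) s'"
        by (intro wp_Seq wp_Assign)
           (use lt[OF le] lt2 le ji ne j i in \<open>auto simp: ecost_def intro!: exI[of _ "Suc j"]\<close>)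
    next
      assume "aval ?g s' = 0"
      then have "E < C * 2 ^ j" using v j by simp
      then show "wp w Skip (\<lambda>t s''. 1 + ecost ?g + t \<le> 100 + ecost ?g \<and> s'' x 0 = i \<and>
       (\<exists>j\<le>Suc i. (s''(x := (s'' x)(0 := Suc i))) y 0 = 2 ^ j \<and> (s''(x := (s'' x)(0 := Suc i))) k 0 = j \<and>
       (j = 0 \<or> C * 2 ^ j \<le> 2 * E) \<and> (j = Suc i \<or> E < C * 2 ^ j))) s'"
        by (intro wp_Skip) (use ne j i in \<open>auto intro!: exI[of _ j]\<close>)
    qed (use sc in simp)
  next
    fix t s' assume inv: "\<exists>j\<le>B. s' y 0 = 2 ^ j \<and> s' k 0 = j \<and>
       (j = 0 \<or> C * 2 ^ j \<le> 2 * E) \<and> (j = B \<or> E < C * 2 ^ j)"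
      and t: "t \<le> (B + 1) * (100 + ecost ?g + fcost N)"
      and fr: "\<And>a. a \<noteq> x \<Longrightarrow> a \<notin> writes (If ?g ?b Skip) \<Longrightarrow> s' a = ?s a"
    have fr': "\<And>a. a \<noteq> y \<Longrightarrow> a \<noteq> k \<Longrightarrow> a \<noteq> x \<Longrightarrow> s' a = s a" using fr by auto
    have "10 + t \<le> 10 + (B + 1) * (100 + ecost ?g + fcost N)" using t by simp
    also have "\<dots> \<le> (B + 1) * (100 + ecost ?g + fcost N + 10)" by (simp add: distrib_left)
    also have "\<dots> \<le> (B + 1) * doublecost N c e"
      by (intro mult_le_mono2) (simp add: doublecost_def ecost_def)
    finally show "R (10 + t) s'" using inv fr' unfolding R_def by blast
  qed
  have two: "(1::nat) < 2 ^ w" using w20 by (intro one_less_power) auto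
  have "wp w (DoubleTo y k x N c e) R s"
    unfolding DoubleTo_def
  proof (intro wp_Seq wp_Assign)
    have eq: "s(y := (s y)(aval (Const 0) s := aval (Const 1) s),
         k := ((s(y := (s y)(aval (Const 0) s := aval (Const 1) s))) k)
           (aval (Const 0) (s(y := (s y)(aval (Const 0) s := aval (Const 1) s))) :=
            aval (Const 0) (s(y := (s y)(aval (Const 0) s := aval (Const 1) s))))) = ?s"
      using ne by simp
    have "1 + ecost (Const 0) + ecost (Const 1) + (1 + ecost (Const 0) + ecost (Const 0) + l) = 10 + l" for l
      by (simp add: ecost_def)
    then show "wp w (For x N (If ?g ?b Skip))
      (\<lambda>l. R (1 + ecost (Const 0) + ecost (Const 1) + (1 + ecost (Const 0) + ecost (Const 0) + l)))
      (s(y := (s y)(aval (Const 0) s := aval (Const 1) s),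
         k := ((s(y := (s y)(aval (Const 0) s := aval (Const 1) s))) k)
           (aval (Const 0) (s(y := (s y)(aval (Const 0) s := aval (Const 1) s))) :=
            aval (Const 0) (s(y := (s y)(aval (Const 0) s := aval (Const 1) s))))))"
      using For unfolding eq by presburger
  qed (use two in simp_all)
  then show ?thesis by (rule wp_conseq) (auto simp: R_def intro: post)
qed

declare One_nat_def [simp del]

lemma small_below: "cells_below w s \<Longrightarrow> c \<le> 1000000 \<Longrightarrow> (c::nat) < 2 ^ w"
proof -
  assume "cells_below w s" "c \<le> 1000000"
  then have "(2::nat) ^ 20 \<le> 2 ^ w" by (intro power_increasing) (auto simp: cells_below_def)
  then show ?thesis using \<open>c \<le> 1000000\<close> by simp
qed

section \<open>Memory layout and adjacency arrays\<close>

text \<open>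
  Arrays beyond the input and the output: 5 degrees; 6 neighbours, the \<open>j\<close>-th neighbour of \<open>u\<close> being
  in cell \<open>u + n * j\<close>; 7 the measure \<open>D\<close>; 8 load; 9 used seeds; 10 scaled density; 11 sums over
  neighbourhoods; 12 squared deviation from the median; 13 its clamped values. Scalars in cell 0:
  20 \<open>l\<close>, 21 \<open>2 ^ l\<close>, 22 \<open>X = 2 ^ kX\<close>, 23 \<open>kX\<close>, 24 \<open>\<Delta>\<close>, 25 \<open>2 ^ B\<close>, 26 total volume,
  27 the scale \<open>M\<close>, 28 placed mass, 29 nonfull neighbours, 30 median, 31 window width, 32 window start,
  33 total variation, 34 weight, 36 scaling factor per step, 37 number of steps, 38 \<open>B\<close>; 35, 40 and 41
  are auxiliary, and 50 to 57 are loop counters.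
\<close>

abbreviation nV :: aexp where "nV \<equiv> Var 0"
abbreviation mV :: aexp where "mV \<equiv> Read 0 (Const 1)"

text \<open>A functional model of the adjacency arrays: processing an edge appends to the lists of
  both of its ends.\<close>

definition adj_list :: "(nat \<times> nat) list \<Rightarrow> nat \<Rightarrow> nat list" where
  "adj_list es u = concat (map (\<lambda>(a, b). if a = u then [b] else if b = u then [a] else []) es)"

lemma adj_list_Nil [simp]: "adj_list [] u = []"
  and adj_list_Cons: "adj_list ((a, b) # es) u = (if a = u then [b] else if b = u then [a] else []) @ adj_list es u"
  and adj_list_snoc: "adj_list (es @ [(a, b)]) u = adj_list es u @ (if a = u then [b] else if b = u then [a] else [])"
  by (simp_all add: adj_list_def)

lemma set_adj_list: "v \<in> set (adj_list es u) \<longleftrightarrow> {u, v} \<in> set (map (\<lambda>(a, b). {a, b}) es)"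
proof (induction es)
  case (Cons e es)
  obtain a b where e: "e = (a, b)" by fastforce
  define S where "S = set (map (\<lambda>(a, b). {a, b}) es)"
  have "set (map (\<lambda>(a, b). {a, b}) (e # es)) = insert {a, b} S" by (simp add: e S_def)
  then show ?case using Cons.IH unfolding S_def[symmetric] e
    by (auto simp: adj_list_Cons doubleton_eq_iff)
qed simp

lemma distinct_adj_list:
  "distinct (map (\<lambda>(a, b). {a, b}) es) \<Longrightarrow> distinct (adj_list es u)"
proof (induction es)
  case (Cons e es)
  obtain a b where e: "e = (a, b)" by fastforce
  have "{a, b} \<notin> set (map (\<lambda>(a, b). {a, b}) es)" "distinct (map (\<lambda>(a, b). {a, b}) es)"
    using Cons.prems by (simp_all add: e)
  then have "b \<notin> set (adj_list es a)" "a \<notin> set (adj_list es b)" "distinct (adj_list es u)"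
    using Cons.IH unfolding set_adj_list by (simp_all only: insert_commute) simp_all
  then show ?case by (auto simp: e adj_list_Cons)
qed simp

lemma length_adj_list: "length (adj_list es u) \<le> length es"
  by (induction es) (auto simp: adj_list_Cons)

text \<open>The address determines the vertex as its residue modulo \<open>n\<close>, so lists of
  unknown lengths share one array without collisions and without precomputed offsets.\<close>

lemma pair_address:
  fixes u v n j k :: nat
  assumes "u < n" "v < n"
  shows "u + n * j = v + n * k \<longleftrightarrow> u = v \<and> j = k"
proof
  assume eq: "u + n * j = v + n * k"
  have "(u + n * j) mod n = (v + n * k) mod n" using eq by simp
  then have "u = v" using assms by simp
  then show "u = v \<and> j = k" using eq assms by simp
qed simp

text \<open>Only a bijection is recorded, no order; that is enough to rewrite sums over list
  positions as sums over neighbours.\<close>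

definition adj_ready :: "graph_input \<Rightarrow> store \<Rightarrow> bool" where
  "adj_ready G s \<longleftrightarrow> (\<forall>u<fst G. s 5 u = card (nbrs G u) \<and>
     bij_betw (\<lambda>j. s 6 (u + fst G * j)) {..<card (nbrs G u)} (nbrs G u))"

definition adj_body :: com where
  "adj_body =
     Seq (Assign 6 (Add (Read 1 (Var 57)) (Mul nV (Read 5 (Read 1 (Var 57))))) (Read 2 (Var 57)))
     (Seq (Assign 5 (Read 1 (Var 57)) (Add (Read 5 (Read 1 (Var 57))) (Const 1)))
     (Seq (Assign 6 (Add (Read 2 (Var 57)) (Mul nV (Read 5 (Read 2 (Var 57))))) (Read 1 (Var 57)))
       (Assign 5 (Read 2 (Var 57)) (Add (Read 5 (Read 2 (Var 57))) (Const 1)))))"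

lemma writes_adj_body [simp]: "writes adj_body = {5, 6}"
  by (auto simp: adj_body_def)

definition setup_adj :: com where
  "setup_adj = For 57 mV adj_body"

lemma writes_setup_adj [simp]: "writes setup_adj = {57, 5, 6}"
  by (simp add: setup_adj_def)

lemma nth_edge:
  assumes G: "encodes_simple_graph G" and i: "i < length (snd G)" and e: "snd G ! i = (a, b)"
  shows "a < fst G" "b < fst G" "a \<noteq> b"
proof -
  have "(a, b) \<in> set (snd G)" using i e by (metis nth_mem)
  then have "{a, b} \<in> edges G" by (force simp: edges_def)
  then have "{a, b} \<subseteq> verts G" "card {a, b} = 2" using edge_pair[OF G] by blast+
  then show "a < fst G" "b < fst G" "a \<noteq> b" by (auto simp: verts_def card_2_iff')
qed

lemma adj_ready_of_list:
  assumes G: "encodes_simple_graph G"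
    and s: "\<forall>u<fst G. s 5 u = length (adj_list (snd G) u) \<and>
     (\<forall>j<length (adj_list (snd G) u). s 6 (u + fst G * j) = adj_list (snd G) u ! j)"
  shows "adj_ready G s"
  unfolding adj_ready_def
proof (intro allI impI)
  fix u assume u: "u < fst G"
  have "distinct (map (\<lambda>(u, v). {u, v}) (snd G))" using G by (simp add: encodes_simple_graph_def)
  then have d: "distinct (adj_list (snd G) u)" by (rule distinct_adj_list)
  have set: "set (adj_list (snd G) u) = nbrs G u"
    unfolding nbrs_def edges_def using set_adj_list[of _ "snd G" u] by blast
  then have len: "length (adj_list (snd G) u) = card (nbrs G u)" using distinct_card[OF d] by simp
  have "bij_betw (\<lambda>j. adj_list (snd G) u ! j) {..<card (nbrs G u)} (nbrs G u)"
    using bij_betw_nth[OF d] set len by auto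
  moreover have "s 6 (u + fst G * j) = adj_list (snd G) u ! j" if "j \<in> {..<card (nbrs G u)}" for j
    using s u len that by simp
  ultimately show "s 5 u = card (nbrs G u) \<and>
     bij_betw (\<lambda>j. s 6 (u + fst G * j)) {..<card (nbrs G u)} (nbrs G u)"
    using s u len bij_betw_cong[of "{..<card (nbrs G u)}" "\<lambda>j. s 6 (u + fst G * j)"] by auto
qed

lemma wp_setup_adj:
  assumes G: "encodes_simple_graph G"
    and s: "s = initial_store G"
    and w: "length (snd G) < 2 ^ w" "fst G < 2 ^ w"
  shows "wp w setup_adj (\<lambda>k s'. k \<le> (length (snd G) + 1) * 2000 \<and> adj_ready G s') s"
proof -
  let ?n = "fst G" and ?es = "snd G" and ?m = "length (snd G)"
  \<comment> \<open>The arrays agree with \<open>adj_list\<close> of the edges read so far; the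
    current degree is the position of the next free cell.\<close>
  let ?Inv = "\<lambda>i s'. \<forall>u<?n. s' 5 u = length (adj_list (take i ?es) u) \<and>
     (\<forall>j<length (adj_list (take i ?es) u). s' 6 (u + ?n * j) = adj_list (take i ?es) u ! j)"
  show ?thesis
    unfolding setup_adj_def
  proof (rule wp_For_uniform[where Inv = ?Inv and B = ?m and b = 1000])
    show "?Inv 0 (s(57 := (s 57)(0 := 0)))" by (simp add: s initial_store_def)
  next
    fix i s' assume fr: "\<And>a. a \<noteq> 57 \<Longrightarrow> a \<notin> writes adj_body \<Longrightarrow> s' a = s a"
    then have "s' 0 = s 0" by simp
    then show "aval mV s' = ?m" by (simp add: s initial_store_def array_of_def)
  next
    fix i s' assume i: "i < ?m" "s' 57 0 = i" and inv: "?Inv i s'"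
      and fr: "\<And>a. a \<noteq> 57 \<Longrightarrow> a \<notin> writes adj_body \<Longrightarrow> s' a = s a"
    obtain a b where e: "?es ! i = (a, b)" by fastforce
    note ab = nth_edge[OF G i(1) e]
    have fr': "s' 0 = s 0" "s' 1 = s 1" "s' 2 = s 2" using fr by simp_all
    have rd: "s' 0 0 = ?n" "s' 1 i = a" "s' 2 i = b"
      using i e by (simp_all add: fr' s initial_store_def array_of_def)
    have take: "take (Suc i) ?es = take i ?es @ [(a, b)]"
      using i e by (simp add: take_Suc_conv_app_nth)
    let ?da = "length (adj_list (take i ?es) a)" and ?db = "length (adj_list (take i ?es) b)"
    have d: "s' 5 a = ?da" "s' 5 b = ?db" using inv ab by auto
    have "length (adj_list (take i ?es) u) \<le> i" for u
      using length_adj_list[of "take i ?es" u] i by simp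
    from this[of a] this[of b] have lt: "?da + 1 < 2 ^ w" "?db + 1 < 2 ^ w" using i(1) w by linarith+
    let ?s2 = "s'(6 := (s' 6)(a + ?n * ?da := b, b + ?n * ?db := a), 5 := (s' 5)(a := ?da + 1, b := ?db + 1))"
    have upd: "?Inv (Suc i) (?s2(57 := (?s2 57)(0 := Suc i)))"
    proof (intro allI impI)
      fix u assume u: "u < ?n"
      have old: "s' 5 u = length (adj_list (take i ?es) u)"
        "\<And>j. j < length (adj_list (take i ?es) u) \<Longrightarrow> s' 6 (u + ?n * j) = adj_list (take i ?es) u ! j"
        using inv u by blast+
      have addr: "u + ?n * j = a + ?n * k \<longleftrightarrow> u = a \<and> j = k" "u + ?n * j = b + ?n * k \<longleftrightarrow> u = b \<and> j = k" for j k
        using pair_address u ab by blast+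
      note addr' = pair_address[OF ab(2) ab(1)] pair_address[OF ab(1) ab(2)]
      show "(?s2(57 := (?s2 57)(0 := Suc i))) 5 u = length (adj_list (take (Suc i) ?es) u) \<and>
        (\<forall>j<length (adj_list (take (Suc i) ?es) u).
          (?s2(57 := (?s2 57)(0 := Suc i))) 6 (u + ?n * j) = adj_list (take (Suc i) ?es) u ! j)"
        using old ab by (auto simp: take adj_list_snoc addr addr' nth_append less_Suc_eq)
    qed
    have "wp w adj_body (\<lambda>k s''. k \<le> 1000 \<and> s'' = ?s2) s'"
      unfolding adj_body_def
      by (intro wp_Seq wp_Assign)
        (use ab lt w in \<open>simp_all add: rd i(2) d ecost_def fun_upd_twist\<close>)
    then show "wp w adj_body
      (\<lambda>k s''. k \<le> 1000 \<and> s'' 57 0 = i \<and> ?Inv (Suc i) (s''(57 := (s'' 57)(0 := Suc i)))) s'"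
      by (rule wp_conseq) (use upd i(2) in simp)
  qed (use w in \<open>simp_all add: fcost_def ecost_def adj_ready_of_list[OF G]\<close>)
qed

lemma sum_length_adj_list:
  assumes "\<And>a b. (a, b) \<in> set es \<Longrightarrow> a < n \<and> b < n \<and> a \<noteq> b"
  shows "(\<Sum>u<n. length (adj_list es u)) = 2 * length es"
  using assms
proof (induction es)
  case (Cons e es)
  obtain a b where e: "e = (a, b)" by fastforce
  have ab: "a < n" "b < n" "a \<noteq> b" using Cons.prems[of a b] e by auto
  have "(\<Sum>u<n. length (adj_list (e # es) u)) =
     (\<Sum>u<n. (if u = a then 1 else 0) + (if u = b then 1 else 0) + length (adj_list es u))"
    by (rule sum.cong) (use ab in \<open>auto simp: e adj_list_Cons\<close>)
  also have "\<dots> = 2 + (\<Sum>u<n. length (adj_list es u))"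
    using ab by (simp add: sum.distrib)
  also have "(\<Sum>u<n. length (adj_list es u)) = 2 * length es"
    by (rule Cons.IH) (use Cons.prems in auto)
  finally show ?case by simp
qed simp

lemma handshake:
  assumes G: "encodes_simple_graph G"
  shows "(\<Sum>u<fst G. card (nbrs G u)) = 2 * length (snd G)"
proof -
  have d: "distinct (map (\<lambda>(u, v). {u, v}) (snd G))" using G by (simp add: encodes_simple_graph_def)
  have "card (nbrs G u) = length (adj_list (snd G) u)" for u
  proof -
    have "set (adj_list (snd G) u) = nbrs G u"
      unfolding nbrs_def edges_def using set_adj_list[of _ "snd G" u] by blast
    then show ?thesis using distinct_card[OF distinct_adj_list[OF d]] by metis
  qed
  moreover have "(\<Sum>u<fst G. length (adj_list (snd G) u)) = 2 * length (snd G)"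
  proof (rule sum_length_adj_list)
    fix a b assume "(a, b) \<in> set (snd G)"
    then obtain i where "i < length (snd G)" "snd G ! i = (a, b)" by (auto simp: in_set_conv_nth)
    then show "a < fst G \<and> b < fst G \<and> a \<noteq> b" using nth_edge[OF G] by blast
  qed
  ultimately show ?thesis by simp
qed

section \<open>Parameters of the diffusion\<close>

abbreviation tgt :: aexp where "tgt \<equiv> Read 6 (Add (Var 55) (Mul nV (Var 56)))"

definition Gather :: "aexp \<Rightarrow> com" where
  "Gather e = For 55 nV (Seq (SumTo 35 56 (Read 5 (Var 55)) e) (Assign 11 (Var 55) (Var 35)))"

lemma writes_Gather [simp]: "writes (Gather e) = {55, 35, 56, 11}"
  by (auto simp: Gather_def)

definition gathercost :: "aexp \<Rightarrow> nat" where
  "gathercost e = 3 * sumcost (Read 5 (Var 55)) e + 500"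

definition bits :: "graph_input \<Rightarrow> nat" where
  "bits G = floorlog 2 (fst G)"

definition num_steps :: "nat \<Rightarrow> nat" where
  "num_steps l = 80 * l ^ 5"

text \<open>
  Each step multiplies the integer densities by at most \<open>2 ^ (l + 2)\<close>; \<open>2 ^ window_bits l\<close> still
  bounds the squares of the last ones.
\<close>

definition window_bits :: "nat \<Rightarrow> nat" where
  "window_bits l = 2 * ((l + 2) * (num_steps l + 3))"

text \<open>\<open>window_bits l\<close> bits for squared densities and thresholds,
  \<open>8 * l\<close> for factors up to \<open>n ^ 8\<close> from sums over vertices and arcs, and
  slack that also guarantees \<open>20 \<le> w\<close>.\<close>

definition width :: "nat \<Rightarrow> nat" where
  "width l = window_bits l + 8 * l + 40"

text \<open>The bound \<open>200000 * num_steps l \<le> \<delta>\<close> is the form in which the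
  degree hypothesis of the theorem is used; it follows from \<open>lg ^ 6 n\<close> once
  \<open>n\<close> is large.\<close>

locale base_graph =
  fixes G :: graph_input and \<delta> n m l w :: nat
  assumes G: "encodes_simple_graph G"
    and n_def: "n = fst G" and m_def: "m = length (snd G)"
    and l_def: "l = bits G" and w_def: "w = width l"
    and \<delta>_def: "\<delta> = min_degree (verts G) (edges G)"
    and n_pos: "0 < n"
    and l_ge: "20 \<le> l" and \<delta>_ge: "200000 * num_steps l \<le> \<delta>"
begin

section \<open>Sizes of the graph against the word length\<close>

lemma n_bits: "n < 2 ^ l" "2 ^ l \<le> 2 * n"
proof -
  have b: "2 ^ (floorlog 2 n - 1) \<le> n \<and> n < 2 ^ floorlog 2 n"
    by (rule floorlog_bounds) (use n_pos in auto)
  then show "n < 2 ^ l" by (simp add: l_def bits_def n_def)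
  have "l = floorlog 2 n" by (simp add: l_def bits_def n_def)
  moreover have "l = Suc (l - 1)" using l_ge by simp
  ultimately have "(2::nat) ^ l = 2 * 2 ^ (floorlog 2 n - 1)" by (metis power_Suc)
  then show "2 ^ l \<le> 2 * n" using b by simp
qed

lemma \<delta>_le: "u < n \<Longrightarrow> \<delta> \<le> card (nbrs G u)"
  unfolding \<delta>_def min_degree_def degree_nbrs[OF G, symmetric]
  by (rule Min_le) (auto simp: verts_def n_def)

lemma \<delta>_big: "20000 \<le> \<delta>"
proof -
  have "1 \<le> l ^ 5" using l_ge by simp
  then have "20000 \<le> 200000 * num_steps l" unfolding num_steps_def by linarith
  then show ?thesis using \<delta>_ge by linarith
qed

lemma card_nbrs_less: "u < n \<Longrightarrow> card (nbrs G u) < n"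
proof -
  assume u: "u < n"
  have "card (nbrs G u) \<le> card ({..<n} - {u})"
    by (rule card_mono) (use nbrs_less[OF G, of u] nbrs_irrefl[OF G, of u] in \<open>auto simp: n_def\<close>)
  then show ?thesis using u by simp
qed

lemma sum_degrees: "(\<Sum>u<n. card (nbrs G u)) = 2 * m"
  using handshake[OF G] by (simp add: n_def m_def)

lemma m_less: "2 * m \<le> n * n"
proof -
  have "(\<Sum>u<n. card (nbrs G u)) \<le> (\<Sum>u<n. n)"
    by (rule sum_mono) (use card_nbrs_less in \<open>auto intro: less_imp_le\<close>)
  then show ?thesis by (simp add: sum_degrees)
qed

lemma m_ge: "10000 * n \<le> m"
proof -
  have "(\<Sum>u<n. 20000) \<le> (\<Sum>u<n. card (nbrs G u))"
    by (rule sum_mono) (use \<delta>_le \<delta>_big in \<open>fastforce intro: le_trans\<close>)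
  then show ?thesis by (simp add: sum_degrees)
qed

abbreviation "B \<equiv> window_bits l"

lemma pow_w: "2 ^ w = 2 ^ B * (2::nat) ^ (8 * l) * 2 ^ 40"
  by (simp add: w_def width_def power_add)

lemma below_w: "a \<le> 2 ^ B \<Longrightarrow> b \<le> 2 ^ (8 * l) \<Longrightarrow> a * b < (2::nat) ^ w"
proof -
  assume "a \<le> 2 ^ B" "b \<le> 2 ^ (8 * l)"
  then have "a * b \<le> 2 ^ B * (2::nat) ^ (8 * l)" by (rule mult_le_mono)
  also have "\<dots> < 2 ^ w" by (simp add: pow_w)
  finally show ?thesis .
qed

lemma n_pow_le: "n ^ 8 \<le> 2 ^ (8 * l)"
proof -
  have "n ^ 8 \<le> (2 ^ l) ^ 8" using n_bits by (intro power_mono) auto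
  then show ?thesis by (simp add: power_mult[symmetric] mult.commute)
qed

lemma n_ge: "20000 < n"
  using card_nbrs_less[of 0] \<delta>_le[of 0] \<delta>_big n_pos by linarith

lemma below_w_poly: "a \<le> n ^ 8 \<Longrightarrow> a < 2 ^ w"
  using below_w[of 1 a] n_pow_le by simp

lemma n_le_pow: "n \<le> n ^ 8" "2 * n \<le> n ^ 8" "n * n \<le> n ^ 8" "2 * (n * n) \<le> n ^ 8" "n * n * n \<le> n ^ 8"
proof -
  have p: "n ^ i \<le> n ^ 8" if "i \<le> 8" for i using that n_pos by (intro power_increasing) auto
  have 2: "2 * n \<le> n ^ 2" using n_ge by (simp add: power2_eq_square)
  have 3: "2 * n ^ 2 \<le> n ^ 3" using n_ge by (simp add: power3_eq_cube power2_eq_square)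
  show "n \<le> n ^ 8" using p[of 1] by simp
  show "2 * n \<le> n ^ 8" using 2 p[of 2] by simp
  show "n * n \<le> n ^ 8" using p[of 2] by (simp add: power2_eq_square)
  show "2 * (n * n) \<le> n ^ 8" using 3 p[of 3] by (simp add: power2_eq_square)
  show "n * n * n \<le> n ^ 8" using p[of 3] by (simp add: power3_eq_cube)
qed

lemma n_below: "n < 2 ^ w" and m_below: "m < 2 ^ w" and card_below: "u < n \<Longrightarrow> card (nbrs G u) < 2 ^ w"
proof -
  show n: "n < 2 ^ w" by (rule below_w_poly[OF n_le_pow(1)])
  show "m < 2 ^ w" using m_less n_le_pow(3) by (intro below_w_poly) linarith
  show "u < n \<Longrightarrow> card (nbrs G u) < 2 ^ w" using n card_nbrs_less[of u] by simp
qed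

end

text \<open>\<open>X\<close> is the target mass of a phase, between \<open>m / 1024\<close> and
  \<open>m / 512\<close>. It is this small so that 128 disjoint seed sets leave most of the graph
  untouched, and yet at least \<open>9 * n\<close>, so that an overshoot of \<open>2 * n\<close>
  does little harm. \<open>\<Delta>\<close> will be the smallest \<open>D u\<close>.\<close>

locale big_graph = base_graph +
  fixes D :: "nat \<Rightarrow> nat" and X kX \<Delta> :: nat
  assumes D_pow: "u < n \<Longrightarrow> \<exists>k. D u = 2 ^ k"
    and D_ge: "u < n \<Longrightarrow> card (nbrs G u) \<le> D u"
    and D_le: "u < n \<Longrightarrow> D u \<le> 2 * card (nbrs G u)"
    and X_pow: "X = 2 ^ kX" and X_le: "1024 * X \<le> 2 * m" and X_gt: "m < 1024 * X"
    and \<Delta>_le: "u < n \<Longrightarrow> \<Delta> \<le> D u" and \<Delta>_ge: "\<delta> \<le> \<Delta>"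
begin

sublocale diffusion n "nbrs G" D
proof
  fix u v
  show "u < n \<Longrightarrow> nbrs G u \<subseteq> {..<n}" using nbrs_less[OF G] by (simp add: n_def)
  show "v \<in> nbrs G u \<longleftrightarrow> u \<in> nbrs G v" by (rule nbrs_sym)
  show "u < n \<Longrightarrow> card (nbrs G u) \<le> D u" by (rule D_ge)
  show "u < n \<Longrightarrow> 0 < D u" using D_ge[of u] \<delta>_le[of u] \<delta>_big by simp
qed

lemma D_less: "u < n \<Longrightarrow> D u < 2 * n"
  using D_le[of u] card_nbrs_less[of u] by simp

lemma vol_bounds: "2 * m \<le> vol {..<n}" "vol {..<n} \<le> 4 * m"
proof -
  show "2 * m \<le> vol {..<n}"
    unfolding vol_def sum_degrees[symmetric] by (rule sum_mono) (use D_ge in auto)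
  have "vol {..<n} \<le> (\<Sum>u<n. 2 * card (nbrs G u))"
    unfolding vol_def by (rule sum_mono) (use D_le in auto)
  then show "vol {..<n} \<le> 4 * m" by (simp add: sum_distrib_left[symmetric] sum_degrees)
qed

lemma X_ge: "9 * n \<le> X"
  using X_gt m_ge by linarith

definition env :: "store \<Rightarrow> bool" where
  "env s \<longleftrightarrow> s 0 0 = n \<and> s 0 1 = m \<and> adj_ready G s \<and> (\<forall>u<n. s 7 u = D u) \<and>
     s 20 0 = l \<and> s 22 0 = X \<and> s 23 0 = kX \<and> s 24 0 = \<Delta> \<and> s 25 0 = 2 ^ B \<and> s 26 0 = vol {..<n} \<and>
     s 36 0 = 2 ^ (l + 2) \<and> s 37 0 = num_steps l \<and> s 38 0 = B"

text \<open>None of the programs that run after the preparation writes to these arrays, so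
  \<open>env_cong\<close> transports \<open>env\<close> from state to state.\<close>

definition env_arrays :: "nat set" where
  "env_arrays = {0, 5, 6, 7, 20, 22, 23, 24, 25, 26, 36, 37, 38}"

lemma env_cong:
  assumes "env s" and "\<And>a. a \<in> env_arrays \<Longrightarrow> s' a = s a"
  shows "env s'"
  using assms unfolding env_def env_arrays_def adj_ready_def by simp

lemma envD:
  assumes "env s"
  shows "s 0 0 = n" "s 0 1 = m" "u < n \<Longrightarrow> s 5 u = card (nbrs G u)" "u < n \<Longrightarrow> s 7 u = D u"
    "s 20 0 = l" "s 22 0 = X" "s 23 0 = kX" "s 24 0 = \<Delta>" "s 25 0 = 2 ^ B" "s 26 0 = vol {..<n}"
    "s 36 0 = 2 ^ (l + 2)" "s 37 0 = num_steps l" "s 38 0 = B"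
    "u < n \<Longrightarrow> bij_betw (\<lambda>j. s 6 (u + n * j)) {..<card (nbrs G u)} (nbrs G u)"
  using assms by (auto simp: env_def adj_ready_def n_def[symmetric])

lemma env_target:
  assumes "env s" "u < n" "j < card (nbrs G u)"
  shows "s 6 (u + n * j) \<in> nbrs G u" "s 6 (u + n * j) < n"
  using envD(14)[OF assms(1,2)] assms nb_less[OF assms(2)] unfolding bij_betw_def by blast+

lemma env_sum_targets:
  assumes "env s" "u < n"
  shows "(\<Sum>j<card (nbrs G u). h (s 6 (u + n * j))) = (\<Sum>v\<in>nbrs G u. h v)"
  by (rule sum.reindex_bij_betw[OF envD(14)[OF assms]])

text \<open>The inner loops have the degrees as lengths, which sum to \<open>2 * m\<close>; with
  \<open>n \<le> m\<close> the whole sweep is linear in \<open>m\<close>.\<close>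

lemma wp_Gather:
  assumes s: "env s" and sc: "small_consts e"
    and e: "\<And>u j s'. u < n \<Longrightarrow> j < card (nbrs G u) \<Longrightarrow> s' 55 0 = u \<Longrightarrow> s' 56 0 = j \<Longrightarrow>
        s' 6 (u + n * j) = s 6 (u + n * j) \<Longrightarrow> s' 0 0 = n \<Longrightarrow>
        (\<And>a. a \<notin> {55, 35, 56, 11} \<Longrightarrow> s' a = s a) \<Longrightarrow> aval e s' = \<phi> u (s 6 (u + n * j))"
    and \<phi>: "\<And>u. u < n \<Longrightarrow> (\<Sum>v\<in>nbrs G u. \<phi> u v) < 2 ^ w"
    and post: "\<And>k s'. (\<And>u. u < n \<Longrightarrow> s' 11 u = (\<Sum>v\<in>nbrs G u. \<phi> u v)) \<Longrightarrow>
       (\<And>a. a \<notin> {55, 35, 56, 11} \<Longrightarrow> s' a = s a) \<Longrightarrow> k \<le> (m + 1) * gathercost e \<Longrightarrow> Q k s'"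
  shows "wp w (Gather e) Q s"
  unfolding Gather_def
proof (rule wp_For[where Inv = "\<lambda>i s'. \<forall>u<i. s' 11 u = (\<Sum>v\<in>nbrs G u. \<phi> u v)" and B = n
      and b = "\<lambda>u. (card (nbrs G u) + 1) * sumcost (Read 5 (Var 55)) e + 50"])
  fix i s' assume "\<And>a. a \<noteq> 55 \<Longrightarrow> a \<notin> writes (Seq (SumTo 35 56 (Read 5 (Var 55)) e) (Assign 11 (Var 55) (Var 35))) \<Longrightarrow> s' a = s a"
  then have "s' 0 = s 0" by simp
  then show "aval nV s' = n" using s by (simp add: envD)
next
  fix i s' assume i: "i < n" "s' 55 0 = i" and inv: "\<forall>u<i. s' 11 u = (\<Sum>v\<in>nbrs G u. \<phi> u v)"
    and fr: "\<And>a. a \<noteq> 55 \<Longrightarrow> a \<notin> writes (Seq (SumTo 35 56 (Read 5 (Var 55)) e) (Assign 11 (Var 55) (Var 35))) \<Longrightarrow> s' a = s a"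
  have fr': "s' a = s a" if "a \<notin> {55, 35, 56, 11}" for a using fr[of a] that by auto
  show "wp w (Seq (SumTo 35 56 (Read 5 (Var 55)) e) (Assign 11 (Var 55) (Var 35)))
     (\<lambda>k s''. k \<le> (card (nbrs G i) + 1) * sumcost (Read 5 (Var 55)) e + 50 \<and> s'' 55 0 = i \<and>
       (\<forall>u<Suc i. (s''(55 := (s'' 55)(0 := Suc i))) 11 u = (\<Sum>v\<in>nbrs G u. \<phi> u v))) s'"
  proof (rule wp_Seq, rule wp_SumTo[where B = "card (nbrs G i)" and g = "\<lambda>j. \<phi> i (s 6 (i + n * j))"])
    fix s'' assume "\<And>a. a \<noteq> 35 \<Longrightarrow> a \<noteq> 56 \<Longrightarrow> s'' a = s' a"
    then have "s'' 55 = s' 55" "s'' 5 = s' 5" by auto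
    then show "aval (Read 5 (Var 55)) s'' = card (nbrs G i)" using i fr'[of 5] s by (simp add: envD)
  next
    fix j s'' assume j: "j < card (nbrs G i)" "s'' 56 0 = j" and f: "\<And>a. a \<noteq> 35 \<Longrightarrow> a \<noteq> 56 \<Longrightarrow> s'' a = s' a"
    show "aval e s'' = \<phi> i (s 6 (i + n * j))"
      by (rule e) (use i j f fr' s in \<open>auto simp: envD\<close>)
  next
    show "card (nbrs G i) < 2 ^ w" by (rule card_below[OF i(1)])
    show "(\<Sum>j<card (nbrs G i). \<phi> i (s 6 (i + n * j))) < 2 ^ w"
      using \<phi>[OF i(1)] env_sum_targets[OF s i(1), of "\<phi> i"] by simp
  next
    fix k s'' assume "s'' 35 0 = (\<Sum>j<card (nbrs G i). \<phi> i (s 6 (i + n * j)))"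
      and f: "\<And>a. a \<noteq> 35 \<Longrightarrow> a \<noteq> 56 \<Longrightarrow> s'' a = s' a"
      and k: "k \<le> (card (nbrs G i) + 1) * sumcost (Read 5 (Var 55)) e"
    then have v: "s'' 35 0 = (\<Sum>v\<in>nbrs G i. \<phi> i v)" using env_sum_targets[OF s i(1), of "\<phi> i"] by simp
    show "wp w (Assign 11 (Var 55) (Var 35)) (\<lambda>la s''. k + la \<le> (card (nbrs G i) + 1) * sumcost (Read 5 (Var 55)) e + 50 \<and> s'' 55 0 = i \<and>
       (\<forall>u<Suc i. (s''(55 := (s'' 55)(0 := Suc i))) 11 u = (\<Sum>v\<in>nbrs G u. \<phi> u v))) s''"
      by (rule wp_Assign)
         (use v i f[of 55] f[of 11] \<phi>[OF i(1)] inv k in \<open>auto simp: ecost_def less_Suc_eq\<close>)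
  qed (use sc in simp_all)
next
  fix k s' assume inv: "\<forall>u<n. s' 11 u = (\<Sum>v\<in>nbrs G u. \<phi> u v)"
    and fr: "\<And>a. a \<noteq> 55 \<Longrightarrow> a \<notin> writes (Seq (SumTo 35 56 (Read 5 (Var 55)) e) (Assign 11 (Var 55) (Var 35))) \<Longrightarrow> s' a = s a"
    and k: "k \<le> (\<Sum>i<n. (card (nbrs G i) + 1) * sumcost (Read 5 (Var 55)) e + 50) + (n + 1) * fcost nV"
  let ?c = "sumcost (Read 5 (Var 55)) e"
  have "(\<Sum>i<n. (card (nbrs G i) + 1) * ?c + 50) = (\<Sum>i<n. card (nbrs G i)) * ?c + n * ?c + n * 50"
    by (simp add: sum.distrib sum_distrib_right algebra_simps)
  then have "k \<le> 2 * m * ?c + n * ?c + n * 50 + (n + 1) * 200"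
    using k by (simp add: sum_degrees fcost_def ecost_def)
  also have "\<dots> \<le> (m + 1) * gathercost e"
  proof -
    have "n * ?c \<le> m * ?c" "n \<le> m" using m_ge by (auto intro: mult_le_mono1)
    then have "2 * m * ?c + n * ?c + n * 50 + (n + 1) * 200 \<le> 2 * m * ?c + m * ?c + m * 50 + (m + 1) * 200"
      by (intro add_mono mult_le_mono) simp_all
    also have "\<dots> \<le> (m + 1) * gathercost e"
      by (simp add: gathercost_def algebra_simps)
    finally show ?thesis .
  qed
  finally show "Q k s'" using inv fr by (intro post) auto
qed (use s sc n_below in simp_all)

end

section \<open>Search for a sparse threshold cut\<close>

text \<open>Minimum by truncated subtraction: \<open>y - (y - v)\<close> is the smaller of
  \<open>y\<close> and \<open>v\<close>.\<close>

definition clampE :: aexp where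
  "clampE = Sub (Sub (Read 12 (Var 55)) (Var 32)) (Sub (Sub (Read 12 (Var 55)) (Var 32)) (Var 31))"

definition gapE :: aexp where
  "gapE = Add (Sub (Read 13 (Var 55)) (Read 13 tgt)) (Sub (Read 13 tgt) (Read 13 (Var 55)))"

definition window :: com where
  "window = Seq (MapTo 13 55 nV clampE) (Seq (Gather gapE)
     (Seq (SumTo 33 55 nV (Read 11 (Var 55))) (SumTo 34 55 nV (Mul (Read 7 (Var 55)) (Read 13 (Var 55))))))"

definition sparseE :: aexp where
  "sparseE = Sub (Var 34) (Mul (Mul (Var 20) (Var 20)) (Var 33))"

definition halve :: com where
  "halve = Seq (Set 31 (Div (Var 31) (Const 2))) (Seq window (If sparseE Skip (Set 32 (Add (Var 32) (Var 31)))))"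

text \<open>After \<open>B\<close> halvings of the initial width \<open>2 ^ B\<close> the window has
  width 1, and the vertices above its start form the cut.\<close>

definition find_cut :: com where
  "find_cut = Seq (For 54 (Var 38) halve)
     (Seq (MapTo 4 55 nV (Sub (Read 12 (Var 55)) (Var 32))) (Set 3 (Const 1)))"

definition try_cut :: com where
  "try_cut = Seq (Set 32 (Const 0)) (Seq (Set 31 (Var 25)) (Seq window (If sparseE find_cut Skip)))"

lemma writes_window [simp]: "writes window = {55, 13, 35, 56, 11, 33, 34}"
  by (auto simp: window_def)

lemma writes_halve [simp]: "writes halve = {31, 32, 55, 13, 35, 56, 11, 33, 34}"
  by (auto simp: halve_def)

lemma writes_find_cut [simp]: "writes find_cut = {3, 4, 54, 31, 32, 55, 13, 35, 56, 11, 33, 34}"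
  by (auto simp: find_cut_def)

lemma writes_try_cut [simp]: "writes try_cut = {3, 4, 54, 31, 32, 55, 13, 35, 56, 11, 33, 34}"
  by (auto simp: try_cut_def)

context big_graph
begin

lemma clampE_val: "clamp a v x = (x - a) - ((x - a) - v)"
  by (simp add: clamp_def min_def)

lemma gap_le: "gap x y \<le> max x y"
  by (simp add: gap_def max_def)

lemma wp_window:
  assumes s: "env s" and W: "s 31 0 \<le> 2 ^ B"
  shows "wp w window (\<lambda>k s'. k \<le> (m + 1) * 20000 \<and>
    s' 33 0 = total_variation (\<lambda>u. clamp (s 32 0) (s 31 0) (s 12 u)) \<and>
    s' 34 0 = weight (\<lambda>u. clamp (s 32 0) (s 31 0) (s 12 u))) s"
proof -
  let ?H = "\<lambda>u. clamp (s 32 0) (s 31 0) (s 12 u)"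
  have H: "?H u \<le> 2 ^ B" for u using W by (simp add: clamp_def)
  have gapH: "gap (?H u) (?H v) \<le> 2 ^ B" for u v
    using gap_le[of "?H u" "?H v"] H[of u] H[of v] by simp
  have row: "(\<Sum>v\<in>nbrs G u. gap (?H u) (?H v)) \<le> 2 ^ B * n" if "u < n" for u
  proof -
    have "(\<Sum>v\<in>nbrs G u. gap (?H u) (?H v)) \<le> card (nbrs G u) * 2 ^ B"
      using sum_bounded_above[of "nbrs G u" "\<lambda>v. gap (?H u) (?H v)"] gapH by auto
    also have "\<dots> \<le> n * 2 ^ B" using card_nbrs_less[OF that] by (intro mult_le_mono1) simp
    finally show ?thesis by (simp add: mult.commute)
  qed
  have nn: "n \<le> 2 ^ (8 * l)" "n * n \<le> 2 ^ (8 * l)" "2 * (n * n) \<le> 2 ^ (8 * l)"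
    using n_le_pow n_pow_le by (meson le_trans)+
  have tot: "(\<Sum>u<n. \<Sum>v\<in>nbrs G u. gap (?H u) (?H v)) < 2 ^ w"
  proof -
    have "(\<Sum>u<n. \<Sum>v\<in>nbrs G u. gap (?H u) (?H v)) \<le> (\<Sum>u<n. 2 ^ B * n)"
      by (rule sum_mono) (use row in auto)
    also have "\<dots> = 2 ^ B * (n * n)" by simp
    also have "\<dots> < 2 ^ w" by (rule below_w) (use nn in auto)
    finally show ?thesis .
  qed
  have wt: "(\<Sum>u<n. D u * ?H u) < 2 ^ w"
  proof -
    have "(\<Sum>u<n. D u * ?H u) \<le> (\<Sum>u<n. (2 * n) * 2 ^ B)"
      by (rule sum_mono, rule mult_le_mono) (use H D_less in \<open>auto intro: less_imp_le\<close>)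
    also have "\<dots> = 2 ^ B * (2 * (n * n))" by simp
    also have "\<dots> < 2 ^ w" by (rule below_w) (use nn in auto)
    finally show ?thesis .
  qed
  have nm: "n \<le> m" using m_ge by linarith
  show ?thesis
    unfolding window_def
  proof (rule wp_Seq, rule wp_MapTo[where B = n and g = ?H])
    fix i s' assume "s' 55 0 = i" "\<And>a. a \<noteq> 13 \<Longrightarrow> a \<noteq> 55 \<Longrightarrow> s' a = s a"
    then show "aval clampE s' = ?H i" by (simp add: clampE_def clampE_val)
  next
    fix i show "?H i < 2 ^ w" using below_w[OF H, of 1 i] by simp
  next
    fix k1 s1 assume 1: "\<And>u. u < n \<Longrightarrow> s1 13 u = ?H u" "\<And>a. a \<noteq> 13 \<Longrightarrow> a \<noteq> 55 \<Longrightarrow> s1 a = s a"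
      and k1: "k1 \<le> (n + 1) * mapcost nV clampE"
    have s1: "env s1" by (rule env_cong[OF s]) (use 1(2) in \<open>auto simp: env_arrays_def\<close>)
    show "wp w (Seq (Gather gapE) (Seq (SumTo 33 55 nV (Read 11 (Var 55))) (SumTo 34 55 nV (Mul (Read 7 (Var 55)) (Read 13 (Var 55))))))
       (\<lambda>l s'. k1 + l \<le> (m + 1) * 20000 \<and> s' 33 0 = total_variation ?H \<and> s' 34 0 = weight ?H) s1"
    proof (rule wp_Seq, rule wp_Gather[OF s1, where \<phi> = "\<lambda>u v. gap (?H u) (?H v)"])
      fix u j s' assume u: "u < n" "j < card (nbrs G u)" "s' 55 0 = u" "s' 56 0 = j"
        "s' 6 (u + n * j) = s1 6 (u + n * j)" "s' 0 0 = n"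
        and f: "\<And>a. a \<notin> {55, 35, 56, 11} \<Longrightarrow> s' a = s1 a"
      have "s1 6 (u + n * j) < n" by (rule env_target[OF s1 u(1,2)])
      then show "aval gapE s' = gap (?H u) (?H (s1 6 (u + n * j)))"
        using u f[of 13] 1(1) by (simp add: gapE_def gap_def)
    next
      fix u assume "u < n"
      have "(\<Sum>v\<in>nbrs G u. gap (?H u) (?H v)) \<le> 2 ^ B * n" by (rule row) fact
      also have "\<dots> < 2 ^ w" by (rule below_w) (use nn in auto)
      finally show "(\<Sum>v\<in>nbrs G u. gap (?H u) (?H v)) < 2 ^ w" .
    next
      fix k2 s2 assume 2: "\<And>u. u < n \<Longrightarrow> s2 11 u = (\<Sum>v\<in>nbrs G u. gap (?H u) (?H v))"
        "\<And>a. a \<notin> {55, 35, 56, 11} \<Longrightarrow> s2 a = s1 a" and k2: "k2 \<le> (m + 1) * gathercost gapE"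
      have s2: "env s2" by (rule env_cong[OF s1]) (use 2(2) in \<open>auto simp: env_arrays_def\<close>)
      show "wp w (Seq (SumTo 33 55 nV (Read 11 (Var 55))) (SumTo 34 55 nV (Mul (Read 7 (Var 55)) (Read 13 (Var 55)))))
         (\<lambda>l s'. k1 + (k2 + l) \<le> (m + 1) * 20000 \<and> s' 33 0 = total_variation ?H \<and> s' 34 0 = weight ?H) s2"
      proof (rule wp_Seq, rule wp_SumTo[where B = n and g = "\<lambda>u. \<Sum>v\<in>nbrs G u. gap (?H u) (?H v)"])
        fix k3 s3 assume 3: "s3 33 0 = (\<Sum>u<n. \<Sum>v\<in>nbrs G u. gap (?H u) (?H v))"
          "\<And>a. a \<noteq> 33 \<Longrightarrow> a \<noteq> 55 \<Longrightarrow> s3 a = s2 a" and k3: "k3 \<le> (n + 1) * sumcost nV (Read 11 (Var 55))"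
        show "wp w (SumTo 34 55 nV (Mul (Read 7 (Var 55)) (Read 13 (Var 55))))
          (\<lambda>l s'. k1 + (k2 + (k3 + l)) \<le> (m + 1) * 20000 \<and> s' 33 0 = total_variation ?H \<and> s' 34 0 = weight ?H) s3"
        proof (rule wp_SumTo[where B = n and g = "\<lambda>u. D u * ?H u"])
          fix k4 s4 assume 4: "s4 34 0 = (\<Sum>u<n. D u * ?H u)" "\<And>a. a \<noteq> 34 \<Longrightarrow> a \<noteq> 55 \<Longrightarrow> s4 a = s3 a"
            and k4: "k4 \<le> (n + 1) * sumcost nV (Mul (Read 7 (Var 55)) (Read 13 (Var 55)))"
          have "k1 + (k2 + (k3 + k4)) \<le> (m + 1) * 20000"
            using k1 k2 k3 k4 nm by (simp add: mapcost_def sumcost_def gathercost_def fcost_def ecost_def clampE_def gapE_def)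
          then show "k1 + (k2 + (k3 + k4)) \<le> (m + 1) * 20000 \<and> s4 33 0 = total_variation ?H \<and> s4 34 0 = weight ?H"
            using 3(1) 4 by (simp add: total_variation_def weight_def)
        qed (use s 2 3 1 wt n_below in \<open>auto simp: envD\<close>)
      qed (use s 2 1 tot n_below in \<open>auto simp: envD\<close>)
    qed (simp add: gapE_def)
  qed (use s n_below in \<open>auto simp: envD clampE_def\<close>)
qed

lemma sparseE_iff:
  assumes "s 20 0 = l" "s 33 0 = total_variation (\<lambda>u. clamp a v (Gf u))" "s 34 0 = weight (\<lambda>u. clamp a v (Gf u))"
  shows "aval sparseE s \<noteq> 0 \<longleftrightarrow> sparse_window (l\<^sup>2) a v Gf"
  using assms by (simp add: sparseE_def sparse_window_def power2_eq_square not_le)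

definition sparse_set :: "nat set \<Rightarrow> bool" where
  "sparse_set S \<longleftrightarrow> S \<subseteq> {..<n} \<and> l\<^sup>2 * (2 * crossing S) < vol S"

text \<open>The last conjunct, that only vertices of positive deviation are chosen, keeps the cut on
  one side of the median and thereby bounds its volume.\<close>

lemma wp_find_cut:
  assumes s: "env s" and a: "s 32 0 = 0" "s 31 0 = 2 ^ B"
    and sp: "sparse_window (l\<^sup>2) 0 (2 ^ B) (s 12)" and Gb: "\<And>u. u < n \<Longrightarrow> s 12 u \<le> 2 ^ B"
  shows "wp w find_cut (\<lambda>k s'. k \<le> (B + 1) * ((m + 1) * 30000) \<and> s' 3 0 = 1 \<and>
     sparse_set {v. v < n \<and> s' 4 v \<noteq> 0} \<and> (\<forall>v<n. s' 4 v \<noteq> 0 \<longrightarrow> 0 < s 12 v)) s"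
proof -
  have nm: "n \<le> m" using m_ge by linarith
  have Bw: "B < 2 ^ w"
  proof -
    have "B < w" using l_ge by (simp add: w_def width_def)
    also have "w < 2 ^ w" by (rule less_exp)
    finally show ?thesis .
  qed
  have p_w: "x < 2 ^ w" if "x \<le> 2 ^ B" for x :: nat using below_w[OF that, of 1] by simp
  \<comment> \<open>The current window is always sparse; its end stays at most \<open>2 ^ B\<close>,
    so that its start fits into a cell.\<close>
  let ?Inv = "\<lambda>i s'. s' 31 0 = 2 ^ (B - i) \<and> sparse_window (l\<^sup>2) (s' 32 0) (2 ^ (B - i)) (s 12) \<and>
     s' 32 0 + 2 ^ (B - i) \<le> 2 ^ B"
  show ?thesis
    unfolding find_cut_def
  proof (rule wp_Seq, rule wp_For_uniform[where Inv = ?Inv and B = B and b = "(m + 1) * 20000 + 500"])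
    fix i s' assume "\<And>a. a \<noteq> 54 \<Longrightarrow> a \<notin> writes halve \<Longrightarrow> s' a = s a"
    then have "s' 38 = s 38" by simp
    then show "aval (Var 38) s' = B" using s by (simp add: envD)
  next
    fix i s' assume i: "i < B" "s' 54 0 = i" and inv: "?Inv i s'"
      and fr: "\<And>a. a \<noteq> 54 \<Longrightarrow> a \<notin> writes halve \<Longrightarrow> s' a = s a"
    let ?h = "2 ^ (B - Suc i) :: nat"
    have hh: "2 ^ (B - i) = 2 * ?h"
      using i(1) by (metis Suc_diff_Suc power_Suc)
    have hB: "?h \<le> 2 ^ B" by (intro power_increasing) auto
    let ?s1 = "s'(31 := (s' 31)(0 := ?h))"
    have s1: "env ?s1" by (rule env_cong[OF s]) (use fr in \<open>auto simp: env_arrays_def\<close>)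
    have eq12: "s' 12 = s 12" using fr by simp
    have "wp w window (\<lambda>k s''. k \<le> (m + 1) * 20000 \<and>
       s'' 33 0 = total_variation (\<lambda>u. clamp (?s1 32 0) (?s1 31 0) (?s1 12 u)) \<and>
       s'' 34 0 = weight (\<lambda>u. clamp (?s1 32 0) (?s1 31 0) (?s1 12 u))) ?s1"
      by (rule wp_window[OF s1]) (use hB in simp)
    then have "wp w (Seq window (If sparseE Skip (Set 32 (Add (Var 32) (Var 31)))))
       (\<lambda>k s''. k \<le> (m + 1) * 20000 + 400 \<and> s'' 54 0 = i \<and> ?Inv (Suc i) (s''(54 := (s'' 54)(0 := Suc i)))) ?s1"
    proof (intro wp_Seq, elim wp_conseq)
      fix k1 s2
      assume "k1 \<le> (m + 1) * 20000 \<and>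
         s2 33 0 = total_variation (\<lambda>u. clamp (?s1 32 0) (?s1 31 0) (?s1 12 u)) \<and>
         s2 34 0 = weight (\<lambda>u. clamp (?s1 32 0) (?s1 31 0) (?s1 12 u))"
        and f2: "\<And>a. a \<notin> writes window \<Longrightarrow> s2 a = ?s1 a"
      then have k1: "k1 \<le> (m + 1) * 20000"
        and v: "s2 33 0 = total_variation (\<lambda>u. clamp (s' 32 0) ?h (s 12 u))"
          "s2 34 0 = weight (\<lambda>u. clamp (s' 32 0) ?h (s 12 u))" by (simp_all add: eq12)
      have s2: "env s2" by (rule env_cong[OF s1]) (use f2 in \<open>auto simp: env_arrays_def\<close>)
      have c: "s2 32 = s' 32" "s2 31 0 = ?h" "s2 54 0 = i" using f2 i by simp_all
      have iff: "aval sparseE s2 \<noteq> 0 \<longleftrightarrow> sparse_window (l\<^sup>2) (s' 32 0) ?h (s 12)"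
        by (rule sparseE_iff) (use envD(5)[OF s2] v in simp_all)
      show "wp w (If sparseE Skip (Set 32 (Add (Var 32) (Var 31))))
        (\<lambda>l s''. k1 + l \<le> (m + 1) * 20000 + 400 \<and> s'' 54 0 = i \<and> ?Inv (Suc i) (s''(54 := (s'' 54)(0 := Suc i)))) s2"
      proof (rule wp_If)
        assume "aval sparseE s2 \<noteq> 0"
        then have "sparse_window (l\<^sup>2) (s' 32 0) ?h (s 12)" using iff by blast
        then show "wp w Skip (\<lambda>k s''. k1 + (1 + ecost sparseE + k) \<le> (m + 1) * 20000 + 400 \<and> s'' 54 0 = i \<and>
           ?Inv (Suc i) (s''(54 := (s'' 54)(0 := Suc i)))) s2"
          by (intro wp_Skip) (use c k1 inv hh in \<open>simp add: ecost_def sparseE_def\<close>)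
      next
        assume "aval sparseE s2 = 0"
        then have "\<not> sparse_window (l\<^sup>2) (s' 32 0) ?h (s 12)" using iff by blast
        then have "sparse_window (l\<^sup>2) (s' 32 0 + ?h) ?h (s 12)"
          using sparse_window_halve inv hh by metis
        moreover have "s' 32 0 + ?h \<le> 2 ^ B" using inv hh by linarith
        ultimately show "wp w (Set 32 (Add (Var 32) (Var 31))) (\<lambda>k s''. k1 + (1 + ecost sparseE + k) \<le> (m + 1) * 20000 + 400 \<and> s'' 54 0 = i \<and>
           ?Inv (Suc i) (s''(54 := (s'' 54)(0 := Suc i)))) s2"
          by (intro wp_Assign) (use c k1 inv hh p_w in \<open>simp_all add: ecost_def sparseE_def\<close>)
      qed (simp add: sparseE_def)
    qed
    then show "wp w halve (\<lambda>k s''. k \<le> (m + 1) * 20000 + 500 \<and> s'' 54 0 = i \<and>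
        ?Inv (Suc i) (s''(54 := (s'' 54)(0 := Suc i)))) s'"
    proof -
      assume rest: "wp w (Seq window (If sparseE Skip (Set 32 (Add (Var 32) (Var 31)))))
       (\<lambda>k s''. k \<le> (m + 1) * 20000 + 400 \<and> s'' 54 0 = i \<and> ?Inv (Suc i) (s''(54 := (s'' 54)(0 := Suc i)))) ?s1"
      have eq: "s'(31 := (s' 31)(aval (Const 0) s' := aval (Div (Var 31) (Const 2)) s')) = ?s1"
        using inv hh by simp
      show ?thesis
        unfolding halve_def
      proof (rule wp_Seq, rule wp_Assign)
        show "aval (Div (Var 31) (Const 2)) s' < 2 ^ w" using inv hh p_w[OF hB] by simp
        show "wp w (Seq window (If sparseE Skip (Set 32 (Add (Var 32) (Var 31)))))
          (\<lambda>la s''. 1 + ecost (Const 0) + ecost (Div (Var 31) (Const 2)) + la \<le> (m + 1) * 20000 + 500 \<and>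
             s'' 54 0 = i \<and> ?Inv (Suc i) (s''(54 := (s'' 54)(0 := Suc i))))
          (s'(31 := (s' 31)(aval (Const 0) s' := aval (Div (Var 31) (Const 2)) s')))"
          unfolding eq by (rule wp_conseq[OF rest]) (simp add: ecost_def)
      qed simp
    qed
  next
    fix k1 s1 assume inv: "?Inv B s1" and fr: "\<And>a. a \<noteq> 54 \<Longrightarrow> a \<notin> writes halve \<Longrightarrow> s1 a = s a"
      and k1: "k1 \<le> (B + 1) * ((m + 1) * 20000 + 500 + fcost (Var 38))"
    have s1: "env s1" by (rule env_cong[OF s]) (use fr in \<open>auto simp: env_arrays_def\<close>)
    let ?a = "s1 32 0"
    have eq12: "s1 12 = s 12" using fr by simp
    have sp1: "sparse_window (l\<^sup>2) ?a 1 (s 12)" using inv by simp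
    show "wp w (Seq (MapTo 4 55 nV (Sub (Read 12 (Var 55)) (Var 32))) (Set 3 (Const 1)))
       (\<lambda>la s'. k1 + la \<le> (B + 1) * ((m + 1) * 30000) \<and> s' 3 0 = 1 \<and>
          sparse_set {v. v < n \<and> s' 4 v \<noteq> 0} \<and> (\<forall>v<n. s' 4 v \<noteq> 0 \<longrightarrow> 0 < s 12 v)) s1"
    proof (rule wp_Seq, rule wp_MapTo[where B = n and g = "\<lambda>v. s 12 v - ?a"])
      fix i assume "i < n"
      then show "s 12 i - ?a < 2 ^ w" using Gb[of i] by (intro p_w) simp
    next
      fix k2 and s2 :: store assume v: "\<And>u. u < n \<Longrightarrow> s2 4 u = s 12 u - ?a"
        and k2: "k2 \<le> (n + 1) * mapcost nV (Sub (Read 12 (Var 55)) (Var 32))"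
      have "{v. v < n \<and> s2 4 v \<noteq> 0} = {v. v < n \<and> ?a < s 12 v}" using v by auto
      then have "sparse_set {v. v < n \<and> s2 4 v \<noteq> 0}"
        using sparse_window_unit[OF sp1] unfolding sparse_set_def by auto
      moreover have "k1 + (k2 + 5) \<le> (B + 1) * ((m + 1) * 30000)"
      proof -
        have "k2 + 5 \<le> (m + 1) * 1000"
          using k2 nm by (simp add: mapcost_def fcost_def ecost_def)
        also have "\<dots> \<le> (B + 1) * ((m + 1) * 1000)" by simp
        finally have "k1 + (k2 + 5) \<le> (B + 1) * ((m + 1) * 20000 + 500 + fcost (Var 38) + (m + 1) * 1000)"
          using k1 by (simp add: distrib_left)
        also have "\<dots> \<le> (B + 1) * ((m + 1) * 30000)"
          by (intro mult_le_mono2) (simp add: fcost_def ecost_def)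
        finally show ?thesis .
      qed
      ultimately show "wp w (Set 3 (Const 1)) (\<lambda>la s'. k1 + (k2 + la) \<le> (B + 1) * ((m + 1) * 30000) \<and> s' 3 0 = 1 \<and>
          sparse_set {v. v < n \<and> s' 4 v \<noteq> 0} \<and> (\<forall>v<n. s' 4 v \<noteq> 0 \<longrightarrow> 0 < s 12 v)) s2"
        by (intro wp_Assign) (use v small_below in \<open>auto simp: ecost_def\<close>)
    qed (use s1 eq12 n_below in \<open>auto simp: envD\<close>)
  qed (use a sp Bw in simp_all)
qed

text \<open>The full window clamps nothing because \<open>2 ^ B\<close> bounds all values, so
  failure of the first test is one of the two hypotheses of
  \<open>integer_variance_decay\<close>.\<close>

lemma wp_try_cut:
  assumes s: "env s" and Gb: "\<And>u. u < n \<Longrightarrow> s 12 u \<le> 2 ^ B"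
  shows "wp w try_cut (\<lambda>k s'. k \<le> (B + 2) * ((m + 1) * 30000) \<and>
     (s' 3 0 = 1 \<and> sparse_set {v. v < n \<and> s' 4 v \<noteq> 0} \<and> (\<forall>v<n. s' 4 v \<noteq> 0 \<longrightarrow> 0 < s 12 v) \<or>
      s' 3 0 = s 3 0 \<and> \<not> sparse_window (l\<^sup>2) 0 (2 ^ B) (s 12))) s"
proof -
  let ?Q = "\<lambda>s'. s' 3 0 = 1 \<and> sparse_set {v. v < n \<and> s' 4 v \<noteq> 0} \<and> (\<forall>v<n. s' 4 v \<noteq> 0 \<longrightarrow> 0 < s 12 v) \<or>
      s' 3 0 = s 3 0 \<and> \<not> sparse_window (l\<^sup>2) 0 (2 ^ B) (s 12)"
  let ?s2 = "s(32 := (s 32)(0 := 0), 31 := (s 31)(0 := 2 ^ B))"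
  have s2: "env ?s2" by (rule env_cong[OF s]) (auto simp: env_arrays_def)
  have Bw: "(2::nat) ^ B < 2 ^ w" using below_w[of "2 ^ B" 1] by simp
  have rest: "wp w (Seq window (If sparseE find_cut Skip)) (\<lambda>k s'. k + 100 \<le> (B + 2) * ((m + 1) * 30000) \<and> ?Q s') ?s2"
  proof (rule wp_Seq, rule wp_conseq[OF wp_window[OF s2]])
    fix k1 s3
    assume "k1 \<le> (m + 1) * 20000 \<and>
         s3 33 0 = total_variation (\<lambda>u. clamp (?s2 32 0) (?s2 31 0) (?s2 12 u)) \<and>
         s3 34 0 = weight (\<lambda>u. clamp (?s2 32 0) (?s2 31 0) (?s2 12 u))"
      and f3: "\<And>a. a \<notin> writes window \<Longrightarrow> s3 a = ?s2 a"
    then have k1: "k1 \<le> (m + 1) * 20000"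
        and v: "s3 33 0 = total_variation (\<lambda>u. clamp 0 (2 ^ B) (s 12 u))"
          "s3 34 0 = weight (\<lambda>u. clamp 0 (2 ^ B) (s 12 u))" by simp_all
    have s3: "env s3" by (rule env_cong[OF s2]) (use f3 in \<open>auto simp: env_arrays_def\<close>)
    have c: "s3 32 0 = 0" "s3 31 0 = 2 ^ B" "s3 12 = s 12" "s3 3 = s 3" using f3 by simp_all
    have iff: "aval sparseE s3 \<noteq> 0 \<longleftrightarrow> sparse_window (l\<^sup>2) 0 (2 ^ B) (s 12)"
      by (rule sparseE_iff) (use envD(5)[OF s3] v in simp_all)
    have ec: "1 + ecost sparseE \<le> 1000" by (simp add: sparseE_def ecost_def)
    show "wp w (If sparseE find_cut Skip) (\<lambda>la s'. k1 + la + 100 \<le> (B + 2) * ((m + 1) * 30000) \<and> ?Q s') s3"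
    proof (rule wp_If)
      assume "aval sparseE s3 \<noteq> 0"
      then have "sparse_window (l\<^sup>2) 0 (2 ^ B) (s3 12)" using iff c by simp
      from wp_find_cut[OF s3 c(1,2) this] Gb c(3)
      have "wp w find_cut (\<lambda>k s'. k \<le> (B + 1) * ((m + 1) * 30000) \<and> s' 3 0 = 1 \<and>
         sparse_set {v. v < n \<and> s' 4 v \<noteq> 0} \<and> (\<forall>v<n. s' 4 v \<noteq> 0 \<longrightarrow> 0 < s 12 v)) s3" by simp
      then show "wp w find_cut (\<lambda>k s'. k1 + (1 + ecost sparseE + k) + 100 \<le> (B + 2) * ((m + 1) * 30000) \<and> ?Q s') s3"
      proof (rule wp_conseq)
        fix k and s' :: store assume *: "k \<le> (B + 1) * ((m + 1) * 30000) \<and> s' 3 0 = 1 \<and>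
         sparse_set {v. v < n \<and> s' 4 v \<noteq> 0} \<and> (\<forall>v<n. s' 4 v \<noteq> 0 \<longrightarrow> 0 < s 12 v)"
        have "(B + 2) * ((m + 1) * 30000) = (B + 1) * ((m + 1) * 30000) + (m + 1) * 30000"
          by (simp add: algebra_simps)
        moreover have "1100 \<le> (m + 1) * 10000" by simp
        moreover have "k \<le> (B + 1) * ((m + 1) * 30000)" using * by blast
        ultimately have "k1 + (1 + ecost sparseE + k) + 100 \<le> (B + 2) * ((m + 1) * 30000)"
          using k1 ec by linarith
        then show "k1 + (1 + ecost sparseE + k) + 100 \<le> (B + 2) * ((m + 1) * 30000) \<and> ?Q s'"
          using * by blast
      qed
    next
      assume "aval sparseE s3 = 0"
      then have "\<not> sparse_window (l\<^sup>2) 0 (2 ^ B) (s 12)" using iff by simp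
      moreover have "k1 + (1 + ecost sparseE + 1) + 100 \<le> (B + 2) * ((m + 1) * 30000)"
      proof -
        have "k1 + (1 + ecost sparseE + 1) + 100 \<le> (m + 1) * 30000" using k1 ec by simp
        also have "\<dots> \<le> (B + 2) * ((m + 1) * 30000)" by simp
        finally show ?thesis .
      qed
      ultimately show "wp w Skip (\<lambda>k s'. k1 + (1 + ecost sparseE + k) + 100 \<le> (B + 2) * ((m + 1) * 30000) \<and> ?Q s') s3"
        by (intro wp_Skip) (use c in simp)
    qed (simp add: sparseE_def)
  qed simp
  show ?thesis
    unfolding try_cut_def
  proof (rule wp_Seq, rule wp_Assign, simp, simp, rule wp_Seq, rule wp_Assign, simp)
    let ?s1 = "s(32 := (s 32)(aval (Const 0) s := aval (Const 0) s))"
    show "aval (Var 25) ?s1 < 2 ^ w" using s Bw by (simp add: envD)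
    have eq: "?s1(31 := (?s1 31)(aval (Const 0) ?s1 := aval (Var 25) ?s1)) = ?s2"
      using s by (simp add: envD)
    show "wp w (Seq window (If sparseE find_cut Skip)) (\<lambda>la s'.
        1 + ecost (Const 0) + ecost (Const 0) + (1 + ecost (Const 0) + ecost (Var 25) + la) \<le> (B + 2) * ((m + 1) * 30000) \<and> ?Q s')
        (?s1(31 := (?s1 31)(aval (Const 0) ?s1 := aval (Var 25) ?s1)))"
      unfolding eq by (rule wp_conseq[OF rest]) (auto simp: ecost_def)
  qed
qed

end

section \<open>Diffusion steps\<close>

text \<open>The indicator of density at least \<open>Var 30 + Var 31\<close>; the pattern
  \<open>1 - (1 - x)\<close> reduces a positive number to 1.\<close>

definition geE :: aexp where
  "geE = Sub (Const 1) (Sub (Const 1) (Sub (Add (Read 10 (Var 55)) (Const 1)) (Add (Var 30) (Var 31))))"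

definition med_body :: com where
  "med_body = Seq (Set 31 (Div (Var 31) (Const 2)))
     (Seq (SumTo 35 55 nV (Mul (Read 7 (Var 55)) geE))
       (If (Sub (Mul (Const 2) (Var 35)) (Var 26)) (Set 30 (Add (Var 30) (Var 31))) Skip))"

text \<open>The median is found bit by bit among its possible values, by comparing volumes; no
  sorting takes place.\<close>

definition median :: com where
  "median = Seq (Set 30 (Const 0)) (Seq (Set 31 (Var 25)) (For 54 (Var 38) med_body))"

definition rateE :: aexp where
  "rateE = Div (Var 36) (Mul (Const 2) (Read 7 (Var 55)))"

definition advance :: com where
  "advance = Seq (Gather (Read 10 tgt))
     (MapTo 10 55 nV (Add (Mul (Read 10 (Var 55)) (Sub (Var 36) (Mul rateE (Read 5 (Var 55))))) (Mul rateE (Read 11 (Var 55)))))"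

text \<open>The loop counter 53 is 0 or 1 and selects the positive or the negative part, which
  truncated subtraction isolates.\<close>

definition deviationE :: aexp where
  "deviationE = Add (Mul (Var 53) (Mul (Sub (Var 30) (Read 10 (Var 55))) (Sub (Var 30) (Read 10 (Var 55)))))
     (Mul (Sub (Const 1) (Var 53)) (Mul (Sub (Read 10 (Var 55)) (Var 30)) (Sub (Read 10 (Var 55)) (Var 30))))"

definition side_body :: com where
  "side_body = If (Var 3) Skip (Seq (MapTo 12 55 nV deviationE) try_cut)"

definition walk_step :: com where
  "walk_step = Seq median (Seq (For 53 (Const 2) side_body) advance)"

text \<open>The initial densities carry one factor \<open>2 ^ (l + 2)\<close> so that the division
  by \<open>D u\<close> is exact; after \<open>t\<close> steps the scale is its power with exponent
  \<open>t + 1\<close>.\<close>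

definition walk :: com where
  "walk = Seq (MapTo 10 55 nV (Mul (Read 8 (Var 55)) (Div (Var 36) (Read 7 (Var 55)))))
     (For 52 (Var 37) (If (Var 3) Skip walk_step))"

lemma writes_med_body [simp]: "writes med_body = {30, 31, 35, 55}"
  by (auto simp: med_body_def)

lemma writes_median [simp]: "writes median = {30, 31, 35, 54, 55}"
  by (auto simp: median_def)

lemma writes_advance [simp]: "writes advance = {10, 11, 35, 55, 56}"
  by (auto simp: advance_def)

lemma writes_side_body [simp]: "writes side_body = {12, 3, 4, 54, 31, 32, 55, 13, 35, 56, 11, 33, 34}"
  by (auto simp: side_body_def)

lemma writes_walk_step [simp]: "writes walk_step = {10, 30, 53, 12, 3, 4, 54, 31, 32, 55, 13, 35, 56, 11, 33, 34}"
  by (auto simp: walk_step_def)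

lemma writes_walk [simp]: "writes walk = {52, 10, 30, 53, 12, 3, 4, 54, 31, 32, 55, 13, 35, 56, 11, 33, 34}"
  by (auto simp: walk_def)

context big_graph
begin

section \<open>Weighted median of the densities\<close>

lemma B_below: "B < 2 ^ w"
proof -
  have "B < w" using l_ge by (simp add: w_def width_def)
  also have "w < 2 ^ w" by (rule less_exp)
  finally show ?thesis .
qed

lemma pow_B_below: "x \<le> 2 ^ B \<Longrightarrow> (x::nat) < 2 ^ w"
  using below_w[of x 1] by simp

lemma sum_indicator_vol: "(\<Sum>u<n. D u * (if P u then 1 else 0)) = vol {u. u < n \<and> P u}"
proof -
  have "(\<Sum>u<n. D u * (if P u then 1 else 0)) = (\<Sum>u<n. if P u then D u else 0)"
    by (rule sum.cong) auto
  also have "\<dots> = (\<Sum>u\<in>{u \<in> {..<n}. P u}. D u)" by (rule sum.inter_filter[symmetric]) simp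
  also have "{u \<in> {..<n}. P u} = {u. u < n \<and> P u}" by auto
  finally show ?thesis by (simp add: vol_def)
qed

lemma vol_mono: "S \<subseteq> T \<Longrightarrow> T \<subseteq> {..<n} \<Longrightarrow> vol S \<le> vol T"
  unfolding vol_def by (rule sum_mono2) (auto intro: finite_subset)

lemma vol_le_all: "S \<subseteq> {..<n} \<Longrightarrow> vol S \<le> vol {..<n}"
  by (rule vol_mono) auto

lemma vol_below: "2 * vol {..<n} < 2 ^ w"
proof -
  have "2 * vol {..<n} \<le> 4 * (n * n)" using vol_bounds(2) m_less by linarith
  also have "\<dots> \<le> n * (n * n)" using n_ge by (intro mult_le_mono1) simp
  also have "\<dots> < 2 ^ w" using n_le_pow(5) by (intro below_w_poly) simp
  finally show ?thesis .
qed

lemma vol_complement: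
  "vol {u. u < n \<and> \<not> P u} + vol {u. u < n \<and> P u} = vol {..<n}"
proof -
  have "{..<n} = {u. u < n \<and> \<not> P u} \<union> {u. u < n \<and> P u}" by auto
  then have "vol {..<n} = sum D ({u. u < n \<and> \<not> P u} \<union> {u. u < n \<and> P u})" by (simp add: vol_def)
  also have "\<dots> = sum D {u. u < n \<and> \<not> P u} + sum D {u. u < n \<and> P u}"
    by (rule sum.union_disjoint) auto
  finally show ?thesis by (simp add: vol_def)
qed

lemma wp_median:
  assumes s: "env s" and F: "\<And>u. u < n \<Longrightarrow> s 10 u \<le> Mx" and Mx: "Mx < 2 ^ B"
  shows "wp w median (\<lambda>k s'. k \<le> (B + 2) * ((m + 1) * 2000) \<and> s' 30 0 \<le> Mx \<and>
     2 * vol {u. u < n \<and> s' 30 0 < s 10 u} \<le> vol {..<n} \<and>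
     2 * vol {u. u < n \<and> s 10 u < s' 30 0} \<le> vol {..<n}) s"
proof -
  have nm: "n \<le> m" using m_ge by linarith
  let ?V = "vol {..<n}" and ?c = "\<lambda>s'. s' 30 0"
  let ?ge = "\<lambda>x. vol {u. u < n \<and> x \<le> s 10 u}"
  \<comment> \<open>More than half of the volume lies at or above the candidate, unless it is 0, and
    at most half at or above the candidate plus the step. Once the step is 1, these are the two
    median inequalities.\<close>
  let ?Inv = "\<lambda>i s'. s' 31 0 = 2 ^ (B - i) \<and> (?c s' = 0 \<or> ?V < 2 * ?ge (?c s')) \<and>
     2 * ?ge (?c s' + 2 ^ (B - i)) \<le> ?V \<and> ?c s' + 2 ^ (B - i) \<le> 2 ^ B"
  let ?s2 = "s(30 := (s 30)(0 := 0), 31 := (s 31)(0 := 2 ^ B))"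
  have body: "wp w med_body (\<lambda>k s''. k \<le> (n + 1) * sumcost nV (Mul (Read 7 (Var 55)) geE) + 500 \<and> s'' 54 0 = i \<and>
       ?Inv (Suc i) (s''(54 := (s'' 54)(0 := Suc i)))) s'"
    if i: "i < B" "s' 54 0 = i" and inv: "?Inv i s'"
      and fr: "\<And>a. a \<noteq> 54 \<Longrightarrow> a \<notin> writes med_body \<Longrightarrow> s' a = s a" for i s'
  proof -
    let ?h = "2 ^ (B - Suc i) :: nat"
    have hh: "2 ^ (B - i) = 2 * ?h"
      using i(1) by (metis Suc_diff_Suc power_Suc)
    have hB: "?h \<le> 2 ^ B" by (intro power_increasing) auto
    let ?s1 = "s'(31 := (s' 31)(0 := ?h))"
    have eq: "s'(31 := (s' 31)(aval (Const 0) s' := aval (Div (Var 31) (Const 2)) s')) = ?s1"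
      using inv hh by simp
    have rest: "wp w (Seq (SumTo 35 55 nV (Mul (Read 7 (Var 55)) geE))
       (If (Sub (Mul (Const 2) (Var 35)) (Var 26)) (Set 30 (Add (Var 30) (Var 31))) Skip))
      (\<lambda>k s''. k \<le> (n + 1) * sumcost nV (Mul (Read 7 (Var 55)) geE) + 400 \<and> s'' 54 0 = i \<and>
       ?Inv (Suc i) (s''(54 := (s'' 54)(0 := Suc i)))) ?s1"
    proof (rule wp_Seq, rule wp_SumTo[where B = n and
          g = "\<lambda>u. D u * (if ?c s' + ?h \<le> s 10 u then 1 else 0)"])
      fix j s2 assume "j < n" "s2 55 0 = j" "\<And>a. a \<noteq> 35 \<Longrightarrow> a \<noteq> 55 \<Longrightarrow> s2 a = ?s1 a"
      then show "aval (Mul (Read 7 (Var 55)) geE) s2 = D j * (if ?c s' + ?h \<le> s 10 j then 1 else 0)"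
        using fr s by (simp add: geE_def envD)
    next
      have "?ge (?c s' + ?h) \<le> ?V" by (rule vol_le_all) auto
      then show "(\<Sum>u<n. D u * (if ?c s' + ?h \<le> s 10 u then 1 else 0)) < 2 ^ w"
        using vol_below by (simp add: sum_indicator_vol)
    next
      fix k2 s2 assume v: "s2 35 0 = (\<Sum>u<n. D u * (if ?c s' + ?h \<le> s 10 u then 1 else 0))"
        and f2: "\<And>a. a \<noteq> 35 \<Longrightarrow> a \<noteq> 55 \<Longrightarrow> s2 a = ?s1 a"
        and k2: "k2 \<le> (n + 1) * sumcost nV (Mul (Read 7 (Var 55)) geE)"
      have v': "s2 35 0 = ?ge (?c s' + ?h)" using v by (simp only: sum_indicator_vol)
      have c: "s2 30 = s' 30" "s2 31 0 = ?h" "s2 54 0 = i" "s2 26 0 = ?V"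
        using f2 fr i s by (simp_all add: envD)
      show "wp w (If (Sub (Mul (Const 2) (Var 35)) (Var 26)) (Set 30 (Add (Var 30) (Var 31))) Skip)
        (\<lambda>la s''. k2 + la \<le> (n + 1) * sumcost nV (Mul (Read 7 (Var 55)) geE) + 400 \<and> s'' 54 0 = i \<and>
         ?Inv (Suc i) (s''(54 := (s'' 54)(0 := Suc i)))) s2"
      proof (rule wp_If)
        assume "aval (Sub (Mul (Const 2) (Var 35)) (Var 26)) s2 \<noteq> 0"
        then have gt: "?V < 2 * ?ge (?c s' + ?h)" using v' c by simp
        have le: "?c s' + ?h \<le> 2 ^ B" "?c s' + ?h + ?h \<le> 2 ^ B"
          "2 * ?ge (?c s' + ?h + ?h) \<le> ?V" using inv hh by (simp_all add: add.assoc mult_2)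
        show "wp w (Set 30 (Add (Var 30) (Var 31)))
          (\<lambda>k s''. k2 + (1 + ecost (Sub (Mul (Const 2) (Var 35)) (Var 26)) + k) \<le> (n + 1) * sumcost nV (Mul (Read 7 (Var 55)) geE) + 400 \<and>
           s'' 54 0 = i \<and> ?Inv (Suc i) (s''(54 := (s'' 54)(0 := Suc i)))) s2"
          by (intro wp_Assign) (use c k2 gt le pow_B_below[OF le(1)] in \<open>simp_all add: ecost_def\<close>)
      next
        assume "aval (Sub (Mul (Const 2) (Var 35)) (Var 26)) s2 = 0"
        then have le: "2 * ?ge (?c s' + ?h) \<le> ?V" using v' c by simp
        show "wp w Skip
          (\<lambda>k s''. k2 + (1 + ecost (Sub (Mul (Const 2) (Var 35)) (Var 26)) + k) \<le> (n + 1) * sumcost nV (Mul (Read 7 (Var 55)) geE) + 400 \<and>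
           s'' 54 0 = i \<and> ?Inv (Suc i) (s''(54 := (s'' 54)(0 := Suc i)))) s2"
          by (intro wp_Skip) (use c k2 le inv hh in \<open>simp add: ecost_def\<close>)
      qed simp
    qed (use s fr n_below in \<open>auto simp: envD geE_def\<close>)
    show ?thesis
      unfolding med_body_def
    proof (rule wp_Seq, rule wp_Assign)
      show "aval (Div (Var 31) (Const 2)) s' < 2 ^ w" using inv hh pow_B_below[OF hB] by simp
      show "wp w (Seq (SumTo 35 55 nV (Mul (Read 7 (Var 55)) geE))
       (If (Sub (Mul (Const 2) (Var 35)) (Var 26)) (Set 30 (Add (Var 30) (Var 31))) Skip))
        (\<lambda>la s''. 1 + ecost (Const 0) + ecost (Div (Var 31) (Const 2)) + la \<le>
            (n + 1) * sumcost nV (Mul (Read 7 (Var 55)) geE) + 500 \<and>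
           s'' 54 0 = i \<and> ?Inv (Suc i) (s''(54 := (s'' 54)(0 := Suc i))))
        (s'(31 := (s' 31)(aval (Const 0) s' := aval (Div (Var 31) (Const 2)) s')))"
        unfolding eq by (rule wp_conseq[OF rest]) (simp add: ecost_def)
    qed simp
  qed
  have loop: "wp w (For 54 (Var 38) med_body) (\<lambda>k s'. k + 100 \<le> (B + 2) * ((m + 1) * 2000) \<and> s' 30 0 \<le> Mx \<and>
     2 * vol {u. u < n \<and> s' 30 0 < s 10 u} \<le> ?V \<and> 2 * vol {u. u < n \<and> s 10 u < s' 30 0} \<le> ?V) ?s2"
  proof (rule wp_For_uniform[where Inv = ?Inv and B = B and b = "(n + 1) * sumcost nV (Mul (Read 7 (Var 55)) geE) + 500"])
    have "{u. u < n \<and> 2 ^ B \<le> s 10 u} = {}" using F Mx by fastforce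
    then have "?ge (2 ^ B) = 0" by (simp only: vol_def sum.empty)
    then show "?Inv 0 (?s2(54 := (?s2 54)(0 := 0)))" by simp
  next
    fix i s' assume "\<And>a. a \<noteq> 54 \<Longrightarrow> a \<notin> writes med_body \<Longrightarrow> s' a = ?s2 a"
    then have "s' 38 = s 38" by simp
    then show "aval (Var 38) s' = B" using s by (simp add: envD)
  next
    show "B < 2 ^ w" by (rule B_below)
  next
    fix i s' assume i: "i < B" "s' 54 0 = i" and inv: "?Inv i s'"
      and fr: "\<And>a. a \<noteq> 54 \<Longrightarrow> a \<notin> writes med_body \<Longrightarrow> s' a = ?s2 a"
    show "wp w med_body (\<lambda>k s''. k \<le> (n + 1) * sumcost nV (Mul (Read 7 (Var 55)) geE) + 500 \<and> s'' 54 0 = i \<and>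
       ?Inv (Suc i) (s''(54 := (s'' 54)(0 := Suc i)))) s'"
    proof (rule body[of i s'])
      fix a assume "a \<noteq> 54" "a \<notin> writes med_body"
      then show "s' a = s a" using fr[of a] by auto
    qed (use i inv in blast)+
  next
    fix k and s' :: store assume inv: "?Inv B s'"
      and k: "k \<le> (B + 1) * ((n + 1) * sumcost nV (Mul (Read 7 (Var 55)) geE) + 500 + fcost (Var 38))"
    let ?x = "s' 30 0"
    have "(?x + 1 \<le> y) = (?x < y)" for y by linarith
    then have 1: "2 * vol {u. u < n \<and> ?x < s 10 u} \<le> ?V" using inv by simp
    have 2: "2 * vol {u. u < n \<and> s 10 u < ?x} \<le> ?V"
    proof (cases "?x = 0")
      case False
      then have "?V < 2 * ?ge ?x" using inv by auto
      then show ?thesis using vol_complement[of "\<lambda>u. ?x \<le> s 10 u"] by (simp add: not_le)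
    qed (simp add: vol_def)
    have 3: "?x \<le> Mx"
    proof (rule ccontr)
      assume "\<not> ?x \<le> Mx"
      then have "{u. u < n \<and> ?x \<le> s 10 u} = {}" using F by fastforce
      then have "?ge ?x = 0" by (simp only: vol_def sum.empty)
      then show False using inv \<open>\<not> ?x \<le> Mx\<close> by auto
    qed
    have "(n + 1) * sumcost nV (Mul (Read 7 (Var 55)) geE) + 500 + fcost (Var 38) \<le> (m + 1) * 1900"
      using nm by (simp add: sumcost_def fcost_def ecost_def geE_def)
    then have "(B + 1) * ((n + 1) * sumcost nV (Mul (Read 7 (Var 55)) geE) + 500 + fcost (Var 38)) \<le> (B + 1) * ((m + 1) * 1900)"
      by (rule mult_le_mono2)
    also have "\<dots> + 100 \<le> (B + 2) * ((m + 1) * 2000)" by (simp add: algebra_simps)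
    finally show "k + 100 \<le> (B + 2) * ((m + 1) * 2000) \<and> ?x \<le> Mx \<and>
     2 * vol {u. u < n \<and> ?x < s 10 u} \<le> ?V \<and> 2 * vol {u. u < n \<and> s 10 u < ?x} \<le> ?V"
      using 1 2 3 k by simp
  qed simp
  show ?thesis
    unfolding median_def
  proof (rule wp_Seq, rule wp_Assign, simp, simp, rule wp_Seq, rule wp_Assign, simp)
    let ?s1 = "s(30 := (s 30)(aval (Const 0) s := aval (Const 0) s))"
    show "aval (Var 25) ?s1 < 2 ^ w" using s pow_B_below by (simp add: envD)
    have eq: "?s1(31 := (?s1 31)(aval (Const 0) ?s1 := aval (Var 25) ?s1)) = ?s2"
      using s by (simp add: envD)
    show "wp w (For 54 (Var 38) med_body) (\<lambda>la s'.
        1 + ecost (Const 0) + ecost (Const 0) + (1 + ecost (Const 0) + ecost (Var 25) + la) \<le> (B + 2) * ((m + 1) * 2000) \<and> s' 30 0 \<le> Mx \<and>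
     2 * vol {u. u < n \<and> s' 30 0 < s 10 u} \<le> ?V \<and> 2 * vol {u. u < n \<and> s 10 u < s' 30 0} \<le> ?V)
        (?s1(31 := (?s1 31)(aval (Const 0) ?s1 := aval (Var 25) ?s1)))"
      unfolding eq by (rule wp_conseq[OF loop]) (auto simp: ecost_def)
  qed
qed

section \<open>The diffusion in exact integers\<close>

lemma two_D_dvd: "u < n \<Longrightarrow> 2 * D u dvd 2 ^ (l + 2)"
proof -
  assume u: "u < n"
  obtain k where k: "D u = 2 ^ k" using D_pow[OF u] by blast
  have "(2::nat) ^ (l + 1) = 2 * 2 ^ l" by (simp add: power_add)
  then have "(2::nat) ^ k < 2 ^ (l + 1)" using D_less[OF u] n_bits k by linarith
  then have "Suc k \<le> l + 2" by (simp add: power_less_imp_less_exp)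
  then have "(2::nat) ^ Suc k dvd 2 ^ (l + 2)" by (rule le_imp_power_dvd)
  then show ?thesis by (simp add: k)
qed

text \<open>
  A step of the diffusion scaled by \<open>2 ^ (l + 2)\<close>, which every \<open>2 * D u\<close> divides.
\<close>

definition next_F :: "(nat \<Rightarrow> nat) \<Rightarrow> nat \<Rightarrow> nat" where
  "next_F F u = F u * (2 ^ (l + 2) - 2 ^ (l + 2) div (2 * D u) * card (nbrs G u)) +
     2 ^ (l + 2) div (2 * D u) * (\<Sum>v\<in>nbrs G u. F v)"

text \<open>Ensures that the subtraction in \<open>next_F\<close> does not truncate.\<close>

lemma rate_degree_le: "u < n \<Longrightarrow> 2 ^ (l + 2) div (2 * D u) * card (nbrs G u) \<le> 2 ^ (l + 2)"
proof -
  assume u: "u < n"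
  have "2 ^ (l + 2) div (2 * D u) * card (nbrs G u) \<le> 2 ^ (l + 2) div (2 * D u) * (2 * D u)"
    using D_ge[OF u] by (intro mult_le_mono2) simp
  also have "\<dots> = 2 ^ (l + 2)" using two_D_dvd[OF u] by simp
  finally show ?thesis .
qed

text \<open>The weights of a vertex and of its neighbours add up to \<open>2 ^ (l + 2)\<close>: the
  integer form of the maximum principle.\<close>

lemma next_F_le:
  assumes u: "u < n" and F: "\<And>v. v < n \<Longrightarrow> F v \<le> Mx"
  shows "next_F F u \<le> 2 ^ (l + 2) * Mx"
proof -
  let ?q = "2 ^ (l + 2) div (2 * D u)" and ?d = "card (nbrs G u)"
  have "(\<Sum>v\<in>nbrs G u. F v) \<le> ?d * Mx"
    using sum_bounded_above[of "nbrs G u" F Mx] F nb_less[OF u] by auto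
  then have "next_F F u \<le> Mx * (2 ^ (l + 2) - ?q * ?d) + ?q * (?d * Mx)"
    unfolding next_F_def using F[OF u] by (intro add_mono mult_le_mono) auto
  also have "\<dots> = Mx * (2 ^ (l + 2) - ?q * ?d + ?q * ?d)" by (simp add: algebra_simps)
  also have "\<dots> = 2 ^ (l + 2) * Mx" using rate_degree_le[OF u] by simp
  finally show ?thesis .
qed

lemma next_F_real:
  assumes u: "u < n" and F: "\<And>v. v < n \<Longrightarrow> real (F v) = K * f v"
  shows "real (next_F F u) = K * 2 ^ (l + 2) * step f u"
proof -
  let ?q = "2 ^ (l + 2) div (2 * D u)" and ?d = "card (nbrs G u)"
  have D: "0 < real (D u)" using D_pos[OF u] by simp
  have q: "real ?q = 2 ^ (l + 2) / (2 * real (D u))"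
    using two_D_dvd[OF u] by (simp add: real_of_nat_div)
  have "(\<Sum>v\<in>nbrs G u. real (F v)) = (\<Sum>v\<in>nbrs G u. K * f v)"
    using F nb_less[OF u] by (intro sum.cong) auto
  then have S: "real (\<Sum>v\<in>nbrs G u. F v) = K * (\<Sum>v\<in>nbrs G u. f v)"
    by (simp add: sum_distrib_left)
  have "real (next_F F u) = K * f u * (2 ^ (l + 2) - real ?q * real ?d) + real ?q * (K * (\<Sum>v\<in>nbrs G u. f v))"
    unfolding next_F_def of_nat_add of_nat_mult S of_nat_diff[OF rate_degree_le[OF u]] F[OF u] by simp
  also have "\<dots> = K * 2 ^ (l + 2) * (f u + ((\<Sum>v\<in>nbrs G u. f v) - real ?d * f u) / (2 * real (D u)))"
    unfolding q using D by (simp add: field_simps)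
  also have "(\<Sum>v\<in>nbrs G u. f v) - real ?d * f u = (\<Sum>v\<in>nbrs G u. f v - f u)"
    by (simp add: sum_subtractf)
  finally show ?thesis by (simp add: step_def)
qed

lemma wp_advance:
  assumes s: "env s" and F: "\<And>u. u < n \<Longrightarrow> s 10 u \<le> Mx" and Mx: "Mx \<le> 2 ^ B"
  shows "wp w advance (\<lambda>k s'. k \<le> (m + 1) * 10000 \<and> (\<forall>u<n. s' 10 u = next_F (s 10) u)) s"
  unfolding advance_def
proof (rule wp_Seq, rule wp_Gather[OF s, where \<phi> = "\<lambda>u v. s 10 v"])
  have nn: "n \<le> 2 ^ (8 * l)" using n_le_pow n_pow_le by (meson le_trans)
  have nm: "n \<le> m" using m_ge by linarith
  fix u assume u: "u < n"
  have "(\<Sum>v\<in>nbrs G u. s 10 v) \<le> card (nbrs G u) * Mx"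
    using sum_bounded_above[of "nbrs G u" "s 10" Mx] F nb_less[OF u] by auto
  also have "\<dots> \<le> n * Mx" using card_nbrs_less[OF u] by (intro mult_le_mono1) simp
  also have "\<dots> < 2 ^ w" using below_w[OF Mx nn] by (simp add: mult.commute)
  finally show "(\<Sum>v\<in>nbrs G u. s 10 v) < 2 ^ w" .
next
  fix u j s' assume u: "u < n" "j < card (nbrs G u)" "s' 55 0 = u" "s' 56 0 = j"
        "s' 6 (u + n * j) = s 6 (u + n * j)" "s' 0 0 = n"
        and f: "\<And>a. a \<notin> {55, 35, 56, 11} \<Longrightarrow> s' a = s a"
  then show "aval (Read 10 tgt) s' = s 10 (s 6 (u + n * j))" by simp
next
  fix k1 s1 assume 1: "\<And>u. u < n \<Longrightarrow> s1 11 u = (\<Sum>v\<in>nbrs G u. s 10 v)"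
    and f1: "\<And>a. a \<notin> {55, 35, 56, 11} \<Longrightarrow> s1 a = s a"
    and k1: "k1 \<le> (m + 1) * gathercost (Read 10 tgt)"
  let ?e = "Add (Mul (Read 10 (Var 55)) (Sub (Var 36) (Mul rateE (Read 5 (Var 55))))) (Mul rateE (Read 11 (Var 55)))"
  have nm: "n \<le> m" using m_ge by linarith
  show "wp w (MapTo 10 55 nV ?e)
     (\<lambda>la s'. k1 + la \<le> (m + 1) * 10000 \<and> (\<forall>u<n. s' 10 u = next_F (s 10) u)) s1"
  proof (rule wp_MapTo[where B = n and g = "next_F (s 10)"])
    fix i s' assume "i < n" "s' 55 0 = i" "\<And>u. i \<le> u \<Longrightarrow> s' 10 u = s1 10 u"
      "\<And>a. a \<noteq> 10 \<Longrightarrow> a \<noteq> 55 \<Longrightarrow> s' a = s1 a"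
    then show "aval ?e s' = next_F (s 10) i"
      using s f1 1 by (simp add: rateE_def next_F_def envD)
  next
    fix i assume i: "i < n"
    have "next_F (s 10) i \<le> 2 ^ (l + 2) * Mx" by (rule next_F_le[OF i F])
    also have "\<dots> < 2 ^ w"
    proof -
      have "(2::nat) ^ (l + 2) \<le> 2 ^ (8 * l)" by (intro power_increasing) (use l_ge in auto)
      from below_w[OF Mx this] show ?thesis by (simp add: mult.commute)
    qed
    finally show "next_F (s 10) i < 2 ^ w" .
  next
    fix k2 s2 assume "\<And>u. u < n \<Longrightarrow> s2 10 u = next_F (s 10) u" "k2 \<le> (n + 1) * mapcost nV ?e"
    then show "k1 + k2 \<le> (m + 1) * 10000 \<and> (\<forall>u<n. s2 10 u = next_F (s 10) u)"
      using k1 nm by (simp add: mapcost_def gathercost_def sumcost_def fcost_def ecost_def rateE_def)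
  qed (use s f1 n_below in \<open>auto simp: envD rateE_def\<close>)
qed simp

text \<open>The second clause makes \<open>S\<close> the side of smaller \<open>D\<close>-volume and
  leaves a nonempty complement.\<close>

definition good_cut :: "nat set \<Rightarrow> bool" where
  "good_cut S \<longleftrightarrow> sparse_set S \<and> 2 * vol S \<le> vol {..<n}"

definition found :: "store \<Rightarrow> bool" where
  "found s \<longleftrightarrow> s 3 0 = 1 \<and> good_cut {v. v < n \<and> s 4 v \<noteq> 0}"

definition deviation :: "nat \<Rightarrow> nat \<Rightarrow> (nat \<Rightarrow> nat) \<Rightarrow> nat \<Rightarrow> nat" where
  "deviation sg c F u = (if sg = 0 then (F u - c)\<^sup>2 else (c - F u)\<^sup>2)"

text \<open>Once a cut is recorded, the flag disables further searches, so \<open>found\<close> is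
  stable. A new cut lies strictly on one side of the median and hence has at most half of the
  volume.\<close>

lemma wp_side_body:
  assumes s: "env s" and sg: "s 53 0 = sg" "sg < 2"
    and F: "\<And>u. u < n \<Longrightarrow> s 10 u \<le> Mx" and c: "s 30 0 \<le> Mx" and Mx: "Mx\<^sup>2 \<le> 2 ^ B"
    and med: "2 * vol {u. u < n \<and> s 30 0 < s 10 u} \<le> vol {..<n}"
      "2 * vol {u. u < n \<and> s 10 u < s 30 0} \<le> vol {..<n}"
    and st: "found s \<or> s 3 0 = 0"
  shows "wp w side_body (\<lambda>k s'. k \<le> (B + 3) * ((m + 1) * 30000) \<and>
     (found s' \<or> s 3 0 = 0 \<and> s' 3 0 = 0 \<and> \<not> sparse_window (l\<^sup>2) 0 (2 ^ B) (deviation sg (s 30 0) (s 10)))) s"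
  unfolding side_body_def
proof (rule wp_If)
  assume "aval (Var 3) s \<noteq> 0"
  then have f: "found s" using st by simp
  have "1 + ecost (Var 3) + 1 \<le> (B + 3) * ((m + 1) * 30000)" by (simp add: ecost_def algebra_simps)
  then show "wp w Skip (\<lambda>k s'. 1 + ecost (Var 3) + k \<le> (B + 3) * ((m + 1) * 30000) \<and>
     (found s' \<or> s 3 0 = 0 \<and> s' 3 0 = 0 \<and> \<not> sparse_window (l\<^sup>2) 0 (2 ^ B) (deviation sg (s 30 0) (s 10)))) s"
    by (intro wp_Skip) (use f in simp)
next
  assume "aval (Var 3) s = 0"
  then have z: "s 3 0 = 0" by simp
  have nm: "n \<le> m" using m_ge by linarith
  let ?G = "deviation sg (s 30 0) (s 10)"
  have GB: "?G u \<le> 2 ^ B" if "u < n" for u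
  proof -
    have "(s 10 u - s 30 0)\<^sup>2 \<le> Mx\<^sup>2" "(s 30 0 - s 10 u)\<^sup>2 \<le> Mx\<^sup>2"
      using F[OF that] c by (intro power_mono; simp)+
    from le_trans[OF this(1) Mx] le_trans[OF this(2) Mx] show ?thesis by (simp add: deviation_def)
  qed
  show "wp w (Seq (MapTo 12 55 nV deviationE) try_cut) (\<lambda>k s'. 1 + ecost (Var 3) + k \<le> (B + 3) * ((m + 1) * 30000) \<and>
     (found s' \<or> s 3 0 = 0 \<and> s' 3 0 = 0 \<and> \<not> sparse_window (l\<^sup>2) 0 (2 ^ B) ?G)) s"
  proof (rule wp_Seq, rule wp_MapTo[where B = n and g = ?G])
    fix i s' assume "s' 55 0 = i" "\<And>a. a \<noteq> 12 \<Longrightarrow> a \<noteq> 55 \<Longrightarrow> s' a = s a"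
    then show "aval deviationE s' = ?G i"
      using sg by (cases "sg = 0") (auto simp: deviationE_def deviation_def power2_eq_square less_2_cases_iff)
  next
    fix i assume "i < n"
    then show "?G i < 2 ^ w" by (rule pow_B_below[OF GB])
  next
    fix k1 s1 assume G: "\<And>u. u < n \<Longrightarrow> s1 12 u = ?G u" and f1: "\<And>a. a \<noteq> 12 \<Longrightarrow> a \<noteq> 55 \<Longrightarrow> s1 a = s a"
      and k1: "k1 \<le> (n + 1) * mapcost nV deviationE"
    have s1: "env s1" by (rule env_cong[OF s]) (use f1 in \<open>auto simp: env_arrays_def\<close>)
    have k1': "k1 + 20 \<le> (m + 1) * 20000"
      using k1 nm by (simp add: mapcost_def fcost_def ecost_def deviationE_def)
    have sp: "sparse_window (l\<^sup>2) 0 (2 ^ B) (s1 12) = sparse_window (l\<^sup>2) 0 (2 ^ B) ?G"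
    proof -
      have "total_variation (\<lambda>u. clamp 0 (2 ^ B) (s1 12 u)) = total_variation (\<lambda>u. clamp 0 (2 ^ B) (?G u))"
        unfolding total_variation_def
      proof (intro sum.cong refl)
        fix u v assume "u \<in> {..<n}" "v \<in> nbrs G u"
        then have "u < n" "v < n" using nb_less[of u] by auto
        then show "gap (clamp 0 (2 ^ B) (s1 12 u)) (clamp 0 (2 ^ B) (s1 12 v)) = gap (clamp 0 (2 ^ B) (?G u)) (clamp 0 (2 ^ B) (?G v))"
          by (simp add: G)
      qed
      moreover have "weight (\<lambda>u. clamp 0 (2 ^ B) (s1 12 u)) = weight (\<lambda>u. clamp 0 (2 ^ B) (?G u))"
        by (simp add: weight_def G)
      ultimately show ?thesis by (simp add: sparse_window_def)
    qed
    show "wp w try_cut (\<lambda>la s'. 1 + ecost (Var 3) + (k1 + la) \<le> (B + 3) * ((m + 1) * 30000) \<and>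
     (found s' \<or> s 3 0 = 0 \<and> s' 3 0 = 0 \<and> \<not> sparse_window (l\<^sup>2) 0 (2 ^ B) ?G)) s1"
    proof (rule wp_conseq[OF wp_try_cut[OF s1]])
      fix u assume "u < n" then show "s1 12 u \<le> 2 ^ B" using G GB by simp
    next
      fix k and s' :: store
      assume *: "k \<le> (B + 2) * ((m + 1) * 30000) \<and>
        (s' 3 0 = 1 \<and> sparse_set {v. v < n \<and> s' 4 v \<noteq> 0} \<and> (\<forall>v<n. s' 4 v \<noteq> 0 \<longrightarrow> 0 < s1 12 v) \<or>
         s' 3 0 = s1 3 0 \<and> \<not> sparse_window (l\<^sup>2) 0 (2 ^ B) (s1 12))"
      have "1 + ecost (Var 3) + (k1 + k) \<le> (B + 3) * ((m + 1) * 30000)"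
      proof -
        have "(B + 3) * ((m + 1) * 30000) = (B + 2) * ((m + 1) * 30000) + (m + 1) * 30000" by (simp add: algebra_simps)
        moreover have "1 + ecost (Var 3) \<le> 20" by (simp add: ecost_def)
        moreover have "k \<le> (B + 2) * ((m + 1) * 30000)" using * by blast
        moreover have "(m + 1) * 20000 \<le> (m + 1) * 30000" by simp
        ultimately show ?thesis using k1' by linarith
      qed
      moreover have "found s'" if S: "s' 3 0 = 1" "sparse_set {v. v < n \<and> s' 4 v \<noteq> 0}"
          "\<forall>v<n. s' 4 v \<noteq> 0 \<longrightarrow> 0 < s1 12 v"
      proof -
        let ?S = "{v. v < n \<and> s' 4 v \<noteq> 0}"
        have "2 * vol ?S \<le> vol {..<n}"
        proof (cases "sg = 0")
          case True
          have "?S \<subseteq> {u. u < n \<and> s 30 0 < s 10 u}"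
            using S(3) G True by (auto simp: deviation_def)
          then have "vol ?S \<le> vol {u. u < n \<and> s 30 0 < s 10 u}" by (rule vol_mono) auto
          then show ?thesis using med by linarith
        next
          case False
          have "?S \<subseteq> {u. u < n \<and> s 10 u < s 30 0}"
            using S(3) G False by (auto simp: deviation_def)
          then have "vol ?S \<le> vol {u. u < n \<and> s 10 u < s 30 0}" by (rule vol_mono) auto
          then show ?thesis using med by linarith
        qed
        then show ?thesis using S by (simp add: found_def good_cut_def)
      qed
      ultimately show "1 + ecost (Var 3) + (k1 + k) \<le> (B + 3) * ((m + 1) * 30000) \<and>
        (found s' \<or> s 3 0 = 0 \<and> s' 3 0 = 0 \<and> \<not> sparse_window (l\<^sup>2) 0 (2 ^ B) ?G)"
        using * sp z f1[of 3] by auto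
    qed
  qed (use s n_below in \<open>auto simp: envD deviationE_def\<close>)
qed simp

definition decay :: real where
  "decay = 1 - 1 / (16 * (real (l\<^sup>2))\<^sup>2)"

text \<open>The densities are advanced even after a cut has been found in the same step; this is
  harmless because \<open>advance\<close> leaves arrays 3 and 4 alone.\<close>

lemma wp_walk_step:
  assumes s: "env s" and F: "\<And>u. u < n \<Longrightarrow> s 10 u \<le> Mx" and Mx: "Mx\<^sup>2 \<le> 2 ^ B" "Mx < 2 ^ B"
    and fl: "s 3 0 = 0" and K: "0 < K" "\<And>u. u < n \<Longrightarrow> real (s 10 u) = K * f u"
  shows "wp w walk_step (\<lambda>k s'. k \<le> (B + 3) * ((m + 1) * 100000) \<and>
     (found s' \<or> s' 3 0 = 0 \<and> (\<forall>u<n. s' 10 u = next_F (s 10) u) \<and> variance (step f) \<le> decay * variance f)) s"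
  unfolding walk_step_def
proof (rule wp_Seq, rule wp_conseq[OF wp_median[OF s F Mx(2)]], assumption)
  fix k1 s1
  assume 1: "k1 \<le> (B + 2) * ((m + 1) * 2000) \<and> s1 30 0 \<le> Mx \<and>
     2 * vol {u. u < n \<and> s1 30 0 < s 10 u} \<le> vol {..<n} \<and>
     2 * vol {u. u < n \<and> s 10 u < s1 30 0} \<le> vol {..<n}"
    and f1: "\<And>a. a \<notin> writes median \<Longrightarrow> s1 a = s a"
  have s1: "env s1" by (rule env_cong[OF s]) (use f1 in \<open>auto simp: env_arrays_def\<close>)
  have eq: "s1 10 = s 10" "s1 3 = s 3" using f1 by simp_all
  have cm: "s1 30 0 \<le> Mx" using 1 by blast
  let ?ns = "\<lambda>sg. \<not> sparse_window (l\<^sup>2) 0 (2 ^ B) (deviation sg (s1 30 0) (s 10))"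
  show "wp w (Seq (For 53 (Const 2) side_body) advance) (\<lambda>la s'. k1 + la \<le> (B + 3) * ((m + 1) * 100000) \<and>
     (found s' \<or> s' 3 0 = 0 \<and> (\<forall>u<n. s' 10 u = next_F (s 10) u) \<and> variance (step f) \<le> decay * variance f)) s1"
  proof (rule wp_Seq, rule wp_For_uniform[where B = 2 and b = "(B + 3) * ((m + 1) * 30000)"
        and Inv = "\<lambda>i s'. found s' \<or> s' 3 0 = 0 \<and> (\<forall>sg<i. ?ns sg)"])
    show "found (s1(53 := (s1 53)(0 := 0))) \<or> (s1(53 := (s1 53)(0 := 0))) 3 0 = 0 \<and> (\<forall>sg<0. ?ns sg)"
      using fl eq by simp
  next
    fix i s' assume i: "i < 2" "s' 53 0 = i" and inv: "found s' \<or> s' 3 0 = 0 \<and> (\<forall>sg<i. ?ns sg)"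
      and fr: "\<And>a. a \<noteq> 53 \<Longrightarrow> a \<notin> writes side_body \<Longrightarrow> s' a = s1 a"
    have s': "env s'" by (rule env_cong[OF s1]) (use fr in \<open>auto simp: env_arrays_def\<close>)
    have e: "s' 10 = s 10" "s' 30 = s1 30" using fr eq by simp_all
    have "wp w side_body (\<lambda>k s''. k \<le> (B + 3) * ((m + 1) * 30000) \<and>
     (found s'' \<or> s' 3 0 = 0 \<and> s'' 3 0 = 0 \<and> \<not> sparse_window (l\<^sup>2) 0 (2 ^ B) (deviation i (s' 30 0) (s' 10)))) s'"
      by (rule wp_side_body[OF s' i(2,1) _ _ Mx(1)]) (use F 1 e inv in auto)
    then show "wp w side_body (\<lambda>k s''. k \<le> (B + 3) * ((m + 1) * 30000) \<and> s'' 53 0 = i \<and>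
       (found (s''(53 := (s'' 53)(0 := Suc i))) \<or> (s''(53 := (s'' 53)(0 := Suc i))) 3 0 = 0 \<and> (\<forall>sg<Suc i. ?ns sg))) s'"
    proof (rule wp_conseq)
      fix k and s'' :: store
      assume *: "k \<le> (B + 3) * ((m + 1) * 30000) \<and>
        (found s'' \<or> s' 3 0 = 0 \<and> s'' 3 0 = 0 \<and> \<not> sparse_window (l\<^sup>2) 0 (2 ^ B) (deviation i (s' 30 0) (s' 10)))"
        and fr2: "\<And>a. a \<notin> writes side_body \<Longrightarrow> s'' a = s' a"
      have "found (s''(53 := (s'' 53)(0 := Suc i))) = found s''" by (simp add: found_def)
      moreover have "s'' 53 0 = i" using fr2 i by simp
      moreover have "found s' \<Longrightarrow> s' 3 0 \<noteq> 0" by (simp add: found_def)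
      ultimately show "k \<le> (B + 3) * ((m + 1) * 30000) \<and> s'' 53 0 = i \<and>
       (found (s''(53 := (s'' 53)(0 := Suc i))) \<or> (s''(53 := (s'' 53)(0 := Suc i))) 3 0 = 0 \<and> (\<forall>sg<Suc i. ?ns sg))"
        using * inv e by (auto simp: less_Suc_eq)
    qed
  next
    fix k2 s2 assume inv: "found s2 \<or> s2 3 0 = 0 \<and> (\<forall>sg<2. ?ns sg)"
      and fr: "\<And>a. a \<noteq> 53 \<Longrightarrow> a \<notin> writes side_body \<Longrightarrow> s2 a = s1 a"
      and k2: "k2 \<le> (2 + 1) * ((B + 3) * ((m + 1) * 30000) + fcost (Const 2))"
    have s2: "env s2" by (rule env_cong[OF s1]) (use fr in \<open>auto simp: env_arrays_def\<close>)
    have e2: "s2 10 = s 10" using fr eq by simp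
    show "wp w advance (\<lambda>la s'. k1 + (k2 + la) \<le> (B + 3) * ((m + 1) * 100000) \<and>
     (found s' \<or> s' 3 0 = 0 \<and> (\<forall>u<n. s' 10 u = next_F (s 10) u) \<and> variance (step f) \<le> decay * variance f)) s2"
    proof (rule wp_conseq[OF wp_advance[OF s2]])
      show "s2 10 u \<le> Mx" if "u < n" for u using F[OF that] e2 by simp
      show "Mx \<le> 2 ^ B" using Mx by simp
    next
      fix k3 and s3 :: store
      assume 3: "k3 \<le> (m + 1) * 10000 \<and> (\<forall>u<n. s3 10 u = next_F (s2 10) u)"
        and fr3: "\<And>a. a \<notin> writes advance \<Longrightarrow> s3 a = s2 a"
      have e3: "s3 3 = s2 3" "s3 4 = s2 4" using fr3 by simp_all
      then have "found s3 = found s2" by (simp add: found_def)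
      moreover have "k1 + (k2 + k3) \<le> (B + 3) * ((m + 1) * 100000)"
      proof -
        let ?y = "(B + 3) * (m + 1)"
        have "k1 \<le> 2000 * ?y" using 1 by (simp add: algebra_simps)
        moreover have "k2 \<le> 90000 * ?y + 1000" using k2 by (simp add: fcost_def ecost_def algebra_simps)
        moreover have "3 * (m + 1) \<le> ?y" by (rule mult_le_mono1) simp
        moreover have "k3 \<le> (m + 1) * 10000" using 3 by simp
        moreover have "k1 + (k2 + k3) \<le> 100000 * y"
          if "k1 \<le> 2000 * y" "k2 \<le> 90000 * y + 1000" "3 * z \<le> y" "k3 \<le> z * 10000" "1 \<le> z" for y z
          using that by linarith
        ultimately have "k1 + (k2 + k3) \<le> 100000 * ?y" by simp
        then show ?thesis by (simp only: mult.assoc mult.commute mult.left_commute)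
      qed
      \<comment> \<open>With both searches unsuccessful, the decay estimate applies with
        \<open>L = l\<^sup>2\<close>, which gives the factor \<open>decay\<close>.\<close>
      moreover have "variance (step f) \<le> decay * variance f" if "\<forall>sg<2. ?ns sg"
        unfolding decay_def
      proof (rule integer_variance_decay[OF n_pos _ K(1) K(2)])
        show "0 < l\<^sup>2" using l_ge by simp
        show "\<not> sparse_window (l\<^sup>2) 0 (2 ^ B) (\<lambda>u. (s 10 u - s1 30 0)\<^sup>2)"
          using that[rule_format, of 0] by (simp add: deviation_def[abs_def])
        show "\<not> sparse_window (l\<^sup>2) 0 (2 ^ B) (\<lambda>u. (s1 30 0 - s 10 u)\<^sup>2)"
          using that[rule_format, of 1] by (simp add: deviation_def[abs_def])
        fix u assume u: "u < n"
        have "(s 10 u - s1 30 0)\<^sup>2 \<le> Mx\<^sup>2" "(s1 30 0 - s 10 u)\<^sup>2 \<le> Mx\<^sup>2"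
          using F[OF u] cm by (intro power_mono; arith)+
        from le_trans[OF this(1) Mx(1)] le_trans[OF this(2) Mx(1)]
        show "(s 10 u - s1 30 0)\<^sup>2 \<le> 2 ^ B \<and> (s1 30 0 - s 10 u)\<^sup>2 \<le> 2 ^ B" ..
      qed
      ultimately show "k1 + (k2 + k3) \<le> (B + 3) * ((m + 1) * 100000) \<and>
         (found s3 \<or> s3 3 0 = 0 \<and> (\<forall>u<n. s3 10 u = next_F (s 10) u) \<and> variance (step f) \<le> decay * variance f)"
        using inv 3 e2 e3 by auto
    qed
  qed (use small_below in \<open>auto\<close>)
qed

text \<open>The initial load is at most \<open>2 ^ (2 * l)\<close>, and each of the
  \<open>t + 1\<close> scalings contributes \<open>l + 2\<close> bits.\<close>

definition density_bound :: "nat \<Rightarrow> nat" where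
  "density_bound t = 2 ^ ((l + 2) * (t + 1) + 2 * l)"

lemma density_bound_small:
  assumes "t \<le> num_steps l"
  shows "(density_bound t)\<^sup>2 \<le> 2 ^ B" "density_bound t < 2 ^ B"
proof -
  have "(l + 2) * (t + 1) \<le> (l + 2) * (num_steps l + 1)"
    by (rule mult_le_mono2) (use assms in simp)
  moreover have "2 * l \<le> (l + 2) * 2" by simp
  ultimately have "(l + 2) * (t + 1) + 2 * l \<le> (l + 2) * (num_steps l + 1) + (l + 2) * 2"
    by (rule add_mono)
  also have "\<dots> = (l + 2) * (num_steps l + 3)" by (simp add: algebra_simps)
  finally have "((l + 2) * (t + 1) + 2 * l) * 2 \<le> (l + 2) * (num_steps l + 3) * 2"
    by (rule mult_le_mono1)
  then have e: "((l + 2) * (t + 1) + 2 * l) * 2 \<le> B"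
    by (simp only: window_bits_def mult.commute[of 2 "(l + 2) * (num_steps l + 3)"])
  have "(density_bound t)\<^sup>2 = 2 ^ (((l + 2) * (t + 1) + 2 * l) * 2)"
    unfolding density_bound_def by (simp only: power_mult)
  also have "\<dots> \<le> 2 ^ B" by (rule power_increasing[OF e]) simp
  finally show "(density_bound t)\<^sup>2 \<le> 2 ^ B" .
  have pos: "0 < (l + 2) * (t + 1) + 2 * l" by simp
  have "a < b" if "0 < a" "a * 2 \<le> b" for a b :: nat using that by linarith
  from this[OF pos e] have "(l + 2) * (t + 1) + 2 * l < B" .
  then show "density_bound t < 2 ^ B" unfolding density_bound_def by (rule power_strict_increasing) simp
qed

lemma density_bound_step: "2 ^ (l + 2) * density_bound t = density_bound (Suc t)"
  unfolding density_bound_def power_add[symmetric] by (rule arg_cong[where f = "(^) 2"]) simp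

lemma wp_walk:
  assumes s: "env s" and fl: "s 3 0 = 0" and ld: "\<And>u. u < n \<Longrightarrow> s 8 u = ld u"
    and Z: "\<And>u. u < n \<Longrightarrow> ld u \<le> 2 ^ (2 * l)"
  defines "f \<equiv> \<lambda>u. real (ld u) / real (D u)"
  shows "wp w walk (\<lambda>k s'. k \<le> (num_steps l + 2) * ((B + 3) * ((m + 1) * 110000)) \<and>
     (found s' \<or> s' 3 0 = 0 \<and> variance ((step ^^ num_steps l) f) \<le> decay ^ num_steps l * variance f)) s"
proof -
  let ?N = "2 ^ (l + 2) :: nat" and ?\<tau> = "num_steps l"
  have nm: "n \<le> m" using m_ge by linarith
  have dec: "0 \<le> decay"
  proof -
    have "1 \<le> 16 * (real (l\<^sup>2))\<^sup>2"
    proof -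
      have "1 \<le> (l\<^sup>2)\<^sup>2" using l_ge by simp
      then have "real 1 \<le> real ((l\<^sup>2)\<^sup>2)" by (simp only: of_nat_le_iff)
      then show ?thesis by simp
    qed
    then have "1 / (16 * (real (l\<^sup>2))\<^sup>2) \<le> 1" by (subst divide_le_eq_1_pos) linarith+
    then show ?thesis unfolding decay_def by linarith
  qed
  have DN: "D u dvd ?N" if "u < n" for u using two_D_dvd[OF that] by (rule dvd_mult_right)
  have init_le: "ld u * (?N div D u) \<le> density_bound 0" if "u < n" for u
  proof -
    have "ld u * (?N div D u) \<le> 2 ^ (2 * l) * ?N" using Z[OF that] by (intro mult_le_mono) auto
    also have "\<dots> = density_bound 0" by (simp add: density_bound_def power_add[symmetric] add.commute)
    finally show ?thesis .
  qed
  have init_real: "real (ld u * (?N div D u)) = real ?N * f u" if "u < n" for u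
    using DN[OF that] D_pos[OF that] by (simp add: f_def real_of_nat_div)
  \<comment> \<open>The link between machine and analysis: the stored integers are the exact
    iterates of \<open>step\<close>, scaled by \<open>?N ^ (t + 1)\<close>.\<close>
  define S where "S t s' \<longleftrightarrow> s' 3 0 = 0 \<and>
     (\<forall>u<n. s' 10 u \<le> density_bound t \<and> real (s' 10 u) = (real ?N) ^ (t + 1) * (step ^^ t) f u) \<and>
     variance ((step ^^ t) f) \<le> decay ^ t * variance f" for t and s' :: store
  have S_I: "S t s'" if "s' 3 0 = 0" "\<And>u. u < n \<Longrightarrow> s' 10 u \<le> density_bound t"
    "\<And>u. u < n \<Longrightarrow> real (s' 10 u) = (real ?N) ^ (t + 1) * (step ^^ t) f u"
    "variance ((step ^^ t) f) \<le> decay ^ t * variance f" for t and s' :: store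
    unfolding S_def using that by (intro conjI allI impI)
  have S_D: "s' 3 0 = 0 \<and> variance ((step ^^ t) f) \<le> decay ^ t * variance f" if "S t s'" for t and s' :: store
    using that unfolding S_def by (elim conjE, intro conjI)
  have S_D': "s' 10 u \<le> density_bound t \<and> real (s' 10 u) = (real ?N) ^ (t + 1) * (step ^^ t) f u"
    if "S t s'" "u < n" for t u and s' :: store
    by (rule that(1)[unfolded S_def, THEN conjunct2, THEN conjunct1, rule_format, OF that(2)])
  have S_upd: "S t (s'(52 := x)) = S t s'" for t x and s' :: store unfolding S_def by simp
  let ?e = "Mul (Read 8 (Var 55)) (Div (Var 36) (Read 7 (Var 55)))"
  show ?thesis
    unfolding walk_def
  proof (rule wp_Seq, rule wp_MapTo[where B = n and g = "\<lambda>u. ld u * (?N div D u)"])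
    fix i assume i: "i < n"
    have "density_bound 0 \<le> 2 ^ B" using density_bound_small(2)[of 0] by simp
    then show "ld i * (?N div D i) < 2 ^ w" using init_le[OF i] by (intro pow_B_below) simp
  next
    fix k1 s1 assume g: "\<And>u. u < n \<Longrightarrow> s1 10 u = ld u * (?N div D u)"
      and f1: "\<And>a. a \<noteq> 10 \<Longrightarrow> a \<noteq> 55 \<Longrightarrow> s1 a = s a" and k1: "k1 \<le> (n + 1) * mapcost nV ?e"
    have s1: "env s1" by (rule env_cong[OF s]) (use f1 in \<open>auto simp: env_arrays_def\<close>)
    show "wp w (For 52 (Var 37) (If (Var 3) Skip walk_step)) (\<lambda>la s'. k1 + la \<le> (?\<tau> + 2) * ((B + 3) * ((m + 1) * 110000)) \<and>
      (found s' \<or> s' 3 0 = 0 \<and> variance ((step ^^ ?\<tau>) f) \<le> decay ^ ?\<tau> * variance f)) s1"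
    proof (rule wp_For_uniform[where B = ?\<tau> and Inv = "\<lambda>t s'. found s' \<or> S t s'" and b = "(B + 3) * ((m + 1) * 100000) + 100"])
      show "found (s1(52 := (s1 52)(0 := 0))) \<or> S 0 (s1(52 := (s1 52)(0 := 0)))"
        unfolding S_upd
      proof (intro disjI2 S_I)
        show "s1 3 0 = 0" using fl f1[of 3] by simp
        show "s1 10 u \<le> density_bound 0" if "u < n" for u using g init_le that by simp
        show "real (s1 10 u) = real ?N ^ (0 + 1) * (step ^^ 0) f u" if "u < n" for u
          unfolding g[OF that] init_real[OF that] by simp
      qed simp
    next
      fix i s' assume "\<And>a. a \<noteq> 52 \<Longrightarrow> a \<notin> writes (If (Var 3) Skip walk_step) \<Longrightarrow> s' a = s1 a"
      then have "s' 37 = s1 37" by simp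
      then show "aval (Var 37) s' = ?\<tau>" using s1 by (simp add: envD)
    next
      have "?\<tau> + 3 \<le> (l + 2) * (?\<tau> + 3)" using l_ge by simp
      then have "?\<tau> \<le> B" unfolding window_bits_def by linarith
      then show "?\<tau> < 2 ^ w" using B_below by simp
    next
      fix t s' assume t: "t < ?\<tau>" "s' 52 0 = t" and inv: "found s' \<or> S t s'"
        and fr: "\<And>a. a \<noteq> 52 \<Longrightarrow> a \<notin> writes (If (Var 3) Skip walk_step) \<Longrightarrow> s' a = s1 a"
      have s': "env s'" by (rule env_cong[OF s1]) (use fr in \<open>auto simp: env_arrays_def\<close>)
      have ft: "found (s''(52 := (s'' 52)(0 := x))) = found s''" for s'' x by (simp add: found_def)
      show "wp w (If (Var 3) Skip walk_step) (\<lambda>k s''. k \<le> (B + 3) * ((m + 1) * 100000) + 100 \<and> s'' 52 0 = t \<and>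
        (found (s''(52 := (s'' 52)(0 := Suc t))) \<or> S (Suc t) (s''(52 := (s'' 52)(0 := Suc t))))) s'"
      proof (rule wp_If)
        assume "aval (Var 3) s' \<noteq> 0"
        then have nz: "s' 3 0 \<noteq> 0" by simp
        have "found s' \<or> s' 3 0 = 0"
          using inv
        proof
          assume "S t s'"
          from conjunct1[OF S_D[OF this]] show ?thesis ..
        qed simp
        with nz have "found s'" by simp
        then show "wp w Skip (\<lambda>k s''. 1 + ecost (Var 3) + k \<le> (B + 3) * ((m + 1) * 100000) + 100 \<and> s'' 52 0 = t \<and>
          (found (s''(52 := (s'' 52)(0 := Suc t))) \<or> S (Suc t) (s''(52 := (s'' 52)(0 := Suc t))))) s'"
        proof (intro wp_Skip conjI disjI1)
          show "1 + ecost (Var 3) + 1 \<le> (B + 3) * ((m + 1) * 100000) + 100" by (simp add: ecost_def)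
          show "s' 52 0 = t" by (rule t(2))
          show "found s' \<Longrightarrow> found (s'(52 := (s' 52)(0 := Suc t)))" by (simp only: ft)
        qed
      next
        assume "aval (Var 3) s' = 0"
        then have z: "s' 3 0 = 0" by simp
        then have "\<not> found s'" by (simp add: found_def)
        with inv have S: "S t s'" by blast
        note db = density_bound_small[of t]
        have "wp w walk_step (\<lambda>k s''. k \<le> (B + 3) * ((m + 1) * 100000) \<and>
          (found s'' \<or> s'' 3 0 = 0 \<and> (\<forall>u<n. s'' 10 u = next_F (s' 10) u) \<and>
           variance (step ((step ^^ t) f)) \<le> decay * variance ((step ^^ t) f))) s'"
        proof (rule wp_walk_step[OF s' _ _ _ z, where Mx = "density_bound t" and K = "real ?N ^ (t + 1)"])
          show "(density_bound t)\<^sup>2 \<le> 2 ^ B" "density_bound t < 2 ^ B" using db t by simp_all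
          show "s' 10 u \<le> density_bound t" if "u < n" for u using S_D'[OF S that] by (rule conjunct1)
          show "real (s' 10 u) = real ?N ^ (t + 1) * (step ^^ t) f u" if "u < n" for u
            using S_D'[OF S that] by (rule conjunct2)
          show "0 < real ?N ^ (t + 1)" by (intro zero_less_power) simp
        qed
        then show "wp w walk_step (\<lambda>k s''. 1 + ecost (Var 3) + k \<le> (B + 3) * ((m + 1) * 100000) + 100 \<and> s'' 52 0 = t \<and>
          (found (s''(52 := (s'' 52)(0 := Suc t))) \<or> S (Suc t) (s''(52 := (s'' 52)(0 := Suc t))))) s'"
        proof (rule wp_conseq)
          fix k and s'' :: store
          assume *: "k \<le> (B + 3) * ((m + 1) * 100000) \<and>
            (found s'' \<or> s'' 3 0 = 0 \<and> (\<forall>u<n. s'' 10 u = next_F (s' 10) u) \<and>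
             variance (step ((step ^^ t) f)) \<le> decay * variance ((step ^^ t) f))"
            and fr2: "\<And>a. a \<notin> writes walk_step \<Longrightarrow> s'' a = s' a"
          have c1: "s'' 52 0 = t" using fr2 t by simp
          have c2: "1 + ecost (Var 3) + k \<le> (B + 3) * ((m + 1) * 100000) + 100"
            using conjunct1[OF *] by (simp add: ecost_def)
          have SS: "S (Suc t) s''" if A: "s'' 3 0 = 0" "\<forall>u<n. s'' 10 u = next_F (s' 10) u"
            "variance (step ((step ^^ t) f)) \<le> decay * variance ((step ^^ t) f)"
          proof (rule S_I)
            show "s'' 3 0 = 0" by fact
            fix u assume u: "u < n"
            have "next_F (s' 10) u \<le> ?N * density_bound t" by (rule next_F_le[OF u]) (rule conjunct1[OF S_D'[OF S]])
            then show "s'' 10 u \<le> density_bound (Suc t)" using A(2) u density_bound_step by simp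
            have r1: "real (next_F (s' 10) u) = real ?N ^ (t + 1) * 2 ^ (l + 2) * step ((step ^^ t) f) u"
              by (rule next_F_real[OF u]) (rule conjunct2[OF S_D'[OF S]])
            have r2: "real ?N ^ (Suc t + 1) = real ?N ^ (t + 1) * 2 ^ (l + 2)" by simp
            have r3: "s'' 10 u = next_F (s' 10) u" using A(2) u by blast
            show "real (s'' 10 u) = real ?N ^ (Suc t + 1) * (step ^^ Suc t) f u"
              unfolding r2 r3 r1 by simp
          next
            from mult_left_mono[OF conjunct2[OF S_D[OF S]] dec]
            have "decay * variance ((step ^^ t) f) \<le> decay ^ Suc t * variance f" by (simp only: power_Suc mult.assoc)
            from order_trans[OF A(3) this]
            show "variance ((step ^^ Suc t) f) \<le> decay ^ Suc t * variance f" by (simp only: funpow.simps o_apply)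
          qed
          have c3: "found s'' \<or> S (Suc t) s''"
            using conjunct2[OF *]
          proof
            assume "found s''" then show ?thesis ..
          next
            assume A: "s'' 3 0 = 0 \<and> (\<forall>u<n. s'' 10 u = next_F (s' 10) u) \<and>
             variance (step ((step ^^ t) f)) \<le> decay * variance ((step ^^ t) f)"
            from SS[OF conjunct1[OF A] conjunct1[OF conjunct2[OF A]] conjunct2[OF conjunct2[OF A]]]
            show ?thesis ..
          qed
          show "1 + ecost (Var 3) + k \<le> (B + 3) * ((m + 1) * 100000) + 100 \<and> s'' 52 0 = t \<and>
            (found (s''(52 := (s'' 52)(0 := Suc t))) \<or> S (Suc t) (s''(52 := (s'' 52)(0 := Suc t))))"
            unfolding ft S_upd by (intro conjI c1 c2 c3)
        qed
      qed simp
    next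
      fix k2 s2 assume inv: "found s2 \<or> S ?\<tau> s2"
        and k2: "k2 \<le> (?\<tau> + 1) * ((B + 3) * ((m + 1) * 100000) + 100 + fcost (Var 37))"
      have "k1 + k2 \<le> (?\<tau> + 2) * ((B + 3) * ((m + 1) * 110000))"
      proof -
        let ?y = "(B + 3) * (m + 1)"
        have y: "3 * (m + 1) \<le> ?y" by (rule mult_le_mono1) simp
        have "k1 \<le> (m + 1) * 1000"
          using k1 nm by (simp add: mapcost_def fcost_def ecost_def)
        then have a: "k1 \<le> 110000 * ?y" using y by linarith
        have "(B + 3) * ((m + 1) * 100000) + 100 + fcost (Var 37) \<le> 110000 * ?y"
        proof -
          have eq: "(B + 3) * ((m + 1) * 100000) = 100000 * ?y" by simp
          have fc: "100 + fcost (Var 37) \<le> 1000" by (simp add: fcost_def ecost_def)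
          have "100000 * y + c \<le> 110000 * y" if "c \<le> 1000" "3 * z \<le> y" "1 \<le> z" for c y z :: nat
            using that by linarith
          from this[OF fc y le_add2] have "100000 * ?y + (100 + fcost (Var 37)) \<le> 110000 * ?y" .
          then show ?thesis unfolding eq by (simp only: add.assoc)
        qed
        then have "(?\<tau> + 1) * ((B + 3) * ((m + 1) * 100000) + 100 + fcost (Var 37)) \<le> (?\<tau> + 1) * (110000 * ?y)"
          by (rule mult_le_mono2)
        then have "k1 + k2 \<le> (?\<tau> + 1) * (110000 * ?y) + 110000 * ?y" using a k2 by linarith
        also have "\<dots> = (?\<tau> + 2) * ((B + 3) * ((m + 1) * 110000))" by (simp add: algebra_simps)
        finally show ?thesis .
      qed
      moreover have "found s2 \<or> s2 3 0 = 0 \<and> variance ((step ^^ ?\<tau>) f) \<le> decay ^ ?\<tau> * variance f"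
        using inv
      proof
        assume "found s2"
        then show ?thesis ..
      next
        assume "S ?\<tau> s2"
        from S_D[OF this] show ?thesis ..
      qed
      ultimately show "k1 + k2 \<le> (?\<tau> + 2) * ((B + 3) * ((m + 1) * 110000)) \<and>
        (found s2 \<or> s2 3 0 = 0 \<and> variance ((step ^^ ?\<tau>) f) \<le> decay ^ ?\<tau> * variance f)"
        by (rule conjI)
    qed simp
  qed (use s ld n_below in \<open>auto simp: envD\<close>)
qed

end

section \<open>Greedy choice of seeds\<close>

definition nonfullE :: aexp where
  "nonfullE = Sub (Const 1) (Sub (Const 1) (Sub
     (Mul (Mul (Const 2) (Add (Var 27) (Mul (Var 24) (Var 24)))) (Read 7 tgt))
     (Mul (Read 8 tgt) (Mul (Var 24) (Var 24)))))"

text \<open>The product serves as a conjunction: the neighbour is not full, and cell 40 says that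
  receivers are still missing.\<close>

definition place_body :: com where
  "place_body = If (Mul nonfullE (Var 40))
     (Seq (Assign 8 tgt (Add (Read 8 tgt) (Var 41))) (Set 40 (Sub (Var 40) (Const 1)))) Skip"

definition place :: com where
  "place = Seq (Assign 9 (Var 55) (Const 1)) (Seq (Set 28 (Add (Var 28) (Mul (Var 41) (Var 40))))
     (For 56 (Read 5 (Var 55)) place_body))"

definition incE :: aexp where
  "incE = Mul (Const 4) (Add (Div (Var 27) (Read 7 (Var 55))) (Sub (Const 1) (Div (Var 27) (Read 7 (Var 55)))))"

definition try_seed :: com where
  "try_seed = If (Mul (Sub (Var 22) (Var 28)) (Sub (Const 1) (Read 9 (Var 55))))
     (Seq (SumTo 29 56 (Read 5 (Var 55)) nonfullE)
     (Seq (Set 40 (Div (Read 7 (Var 55)) (Const 4)))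
     (Seq (Set 41 incE) (If (Sub (Add (Var 29) (Const 1)) (Var 40)) place Skip)))) Skip"

definition seed :: com where
  "seed = Seq (MapTo 8 55 nV (Const 0)) (Seq (Set 28 (Const 0)) (For 55 nV try_seed))"

lemma writes_place_body [simp]: "writes place_body = {8, 40}"
  by (auto simp: place_body_def)

lemma writes_place [simp]: "writes place = {8, 9, 28, 40, 56}"
  by (auto simp: place_def)

lemma writes_try_seed [simp]: "writes try_seed = {8, 9, 28, 29, 40, 41, 56}"
  by (auto simp: try_seed_def)

lemma writes_seed [simp]: "writes seed = {8, 9, 28, 29, 40, 41, 55, 56}"
  by (auto simp: seed_def)

context big_graph
begin

text \<open>Four times the larger of 1 and \<open>M div D v\<close>; the subtraction is 1 exactly if
  the quotient vanishes. With \<open>share v\<close> receivers a seed spreads the larger of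
  \<open>M\<close> and \<open>D v\<close>, a multiple of \<open>M\<close> in either case when both
  are powers of two.\<close>

definition inc :: "nat \<Rightarrow> nat \<Rightarrow> nat" where
  "inc M v = 4 * (M div D v + (1 - M div D v))"

text \<open>A quarter of \<open>D v\<close> is at most half of the degree. A vertex with fewer
  nonfull neighbours than that therefore has at least half of its neighbours full, which is what
  \<open>volume_exhausted\<close> asks for.\<close>

definition share :: "nat \<Rightarrow> nat" where
  "share v = D v div 4"

text \<open>
  A vertex is full when its density reaches \<open>2 * (M / \<Delta>\<^sup>2 + 1)\<close>. The last increment adds at most
  twice that, which leads to the cap with constant \<open>6\<close> in \<open>seeded\<close>.
\<close>

definition nonfull :: "nat \<Rightarrow> (nat \<Rightarrow> nat) \<Rightarrow> nat \<Rightarrow> bool" where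
  "nonfull M ld u \<longleftrightarrow> ld u * \<Delta>\<^sup>2 < 2 * (M + \<Delta>\<^sup>2) * D u"

definition seeded :: "nat \<Rightarrow> nat set \<Rightarrow> (nat \<Rightarrow> nat set) \<Rightarrow> (nat \<Rightarrow> nat) \<Rightarrow> bool" where
  "seeded M A R ld \<longleftrightarrow> A \<subseteq> {..<n} \<and>
     (\<forall>v\<in>A. R v \<subseteq> nbrs G v \<and> card (R v) = share v) \<and>
     (\<forall>u<n. ld u = (\<Sum>v\<in>A. if u \<in> R v then inc M v else 0)) \<and>
     (\<forall>u<n. ld u * \<Delta>\<^sup>2 \<le> 6 * (M + \<Delta>\<^sup>2) * D u)"

definition seed_mass :: "nat \<Rightarrow> nat set \<Rightarrow> nat" where
  "seed_mass M A = (\<Sum>v\<in>A. inc M v * share v)"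

section \<open>Arithmetic of seeds and capacities\<close>

lemma \<Delta>_pos: "0 < \<Delta>"
  using \<Delta>_ge \<delta>_big by linarith

lemma inc_le: "inc M v \<le> 4 * (M div D v) + 4"
  by (simp add: inc_def)

text \<open>The large degrees make the power of two \<open>D v\<close> a multiple of 4, so the
  quarter in \<open>share\<close> is exact. If \<open>D v\<close> is at most the unit, it cancels
  against the quotient; otherwise the quotient is 0 and is replaced by 1.\<close>

lemma inc_share:
  assumes v: "v < n"
  shows "inc (2 ^ j) v * share v = max (2 ^ j) (D v)"
proof -
  obtain k where k: "D v = 2 ^ k" using D_pow[OF v] by blast
  have "(4::nat) \<le> 2 ^ k" using D_ge[OF v] \<delta>_le[OF v] \<delta>_big k by linarith
  then have "(2::nat) ^ 2 \<le> 2 ^ k" by simp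
  then have k2: "2 \<le> k" by (rule power_le_imp_le_exp[rotated]) simp
  then have sh: "share v * 4 = D v"
  proof -
    have "(2::nat) ^ 2 dvd 2 ^ k" by (rule le_imp_power_dvd[OF k2])
    then show ?thesis unfolding share_def k by (simp add: dvd_div_mult_self)
  qed
  show ?thesis
  proof (cases "k \<le> j")
    case True
    then have "2 ^ j div D v = 2 ^ (j - k)" by (simp add: k power_diff)
    then have "inc (2 ^ j) v * share v = 2 ^ (j - k) * (share v * 4)" by (simp add: inc_def Suc_le_eq)
    also have "\<dots> = 2 ^ j" using True by (simp add: sh k power_add[symmetric])
    also have "\<dots> = max (2 ^ j) (D v)" using True by (simp add: k max_def power_increasing)
    finally show ?thesis .
  next
    case False
    then have "(2::nat) ^ j < 2 ^ k" by (intro power_strict_increasing) auto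
    then show ?thesis using sh by (simp add: inc_def k[symmetric] max_def mult.commute)
  qed
qed

lemma dvd_inc_share:
  assumes v: "v < n"
  shows "2 ^ j dvd inc (2 ^ j) v * share v"
proof -
  obtain k where k: "D v = 2 ^ k" using D_pow[OF v] by blast
  show ?thesis unfolding inc_share[OF v] k
    by (cases "k \<le> j") (auto simp: max_def le_imp_power_dvd power_increasing_iff)
qed

lemma seeded_empty: "seeded M {} R (\<lambda>u. 0)"
  by (simp add: seeded_def)

lemma seeded_subset: "seeded M A R ld \<Longrightarrow> A \<subseteq> {..<n}"
  unfolding seeded_def by (rule conjunct1)

lemma seeded_targets: "seeded M A R ld \<Longrightarrow> v \<in> A \<Longrightarrow> R v \<subseteq> nbrs G v \<and> card (R v) = share v"
  unfolding seeded_def by (drule conjunct2, drule conjunct1, erule (1) bspec)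

lemma seeded_load: "seeded M A R ld \<Longrightarrow> u < n \<Longrightarrow> ld u = (\<Sum>v\<in>A. if u \<in> R v then inc M v else 0)"
  unfolding seeded_def by (drule conjunct2, drule conjunct2, drule conjunct1, drule spec, erule (1) mp)

lemma seeded_cap: "seeded M A R ld \<Longrightarrow> u < n \<Longrightarrow> ld u * \<Delta>\<^sup>2 \<le> 6 * (M + \<Delta>\<^sup>2) * D u"
  unfolding seeded_def by (drule conjunct2, drule conjunct2, drule conjunct2, drule spec, erule (1) mp)

lemma seeded_cong:
  assumes s: "seeded M A R ld" and eq: "\<And>u. u < n \<Longrightarrow> ld' u = ld u"
  shows "seeded M A R ld'"
  unfolding seeded_def
proof (intro conjI allI impI ballI)
  show "A \<subseteq> {..<n}" by (rule seeded_subset[OF s])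
  show "R v \<subseteq> nbrs G v" "card (R v) = share v" if "v \<in> A" for v
    using seeded_targets[OF s that] by simp_all
  fix u assume u: "u < n"
  show "ld' u = (\<Sum>v\<in>A. if u \<in> R v then inc M v else 0)" unfolding eq[OF u] by (rule seeded_load[OF s u])
  show "ld' u * \<Delta>\<^sup>2 \<le> 6 * (M + \<Delta>\<^sup>2) * D u" unfolding eq[OF u] by (rule seeded_cap[OF s u])
qed

lemma seeded_insert:
  assumes s: "seeded M A R ld" and v: "v < n" "v \<notin> A"
    and R': "R' \<subseteq> nbrs G v" "\<And>u. u \<in> R' \<Longrightarrow> nonfull M ld u" "card R' = share v"
  shows "seeded M (insert v A) (R(v := R')) (\<lambda>u. ld u + (if u \<in> R' then inc M v else 0))"
  unfolding seeded_def
proof (intro conjI allI impI ballI)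
  have A: "A \<subseteq> {..<n}" using seeded_subset[OF s] .
  then have fA: "finite A" using finite_subset by blast
  show "insert v A \<subseteq> {..<n}" using A v by simp
  show "(R(v := R')) x \<subseteq> nbrs G x" "card ((R(v := R')) x) = share x" if "x \<in> insert v A" for x
    using that seeded_targets[OF s, of x] R'(1,3) v by auto
  fix u assume u: "u < n"
  have "(\<Sum>x\<in>A. if u \<in> (R(v := R')) x then inc M x else 0) = (\<Sum>x\<in>A. if u \<in> R x then inc M x else 0)"
    by (rule sum.cong) (use v in auto)
  then show "ld u + (if u \<in> R' then inc M v else 0) = (\<Sum>x\<in>insert v A. if u \<in> (R(v := R')) x then inc M x else 0)"
    using seeded_load[OF s u] v fA by simp
  show "(ld u + (if u \<in> R' then inc M v else 0)) * \<Delta>\<^sup>2 \<le> 6 * (M + \<Delta>\<^sup>2) * D u"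
  proof (cases "u \<in> R'")
    case False
    then show ?thesis using seeded_cap[OF s u] by simp
  next
    case True
    then have 1: "ld u * \<Delta>\<^sup>2 \<le> 2 * (M + \<Delta>\<^sup>2) * D u" using R'(2)[of u] unfolding nonfull_def by (simp only: less_imp_le)
    have Du: "\<Delta> \<le> D u" "1 \<le> D u" using \<Delta>_le[OF u] \<Delta>_pos by auto
    \<comment> \<open>One factor \<open>\<Delta>\<close> is spent on the seed, by
      \<open>\<Delta> \<le> D v\<close>, and the other on the receiver, by
      \<open>\<Delta> \<le> D u\<close>.\<close>
    have "M div D v * \<Delta> \<le> M div D v * D v" using \<Delta>_le[OF v(1)] by simp
    also have "\<dots> \<le> M" by simp
    finally have f1: "M div D v * \<Delta> * \<Delta> \<le> M * D u" using Du by (intro mult_le_mono)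
    have f2: "\<Delta> * \<Delta> * 1 \<le> \<Delta> * \<Delta> * D u" using Du(2) by (rule mult_le_mono2)
    have "inc M v * \<Delta>\<^sup>2 \<le> (4 * (M div D v) + 4) * \<Delta>\<^sup>2" by (intro mult_le_mono1 inc_le)
    also have "\<dots> = 4 * (M div D v * \<Delta> * \<Delta>) + 4 * (\<Delta> * \<Delta> * 1)"
      by (simp add: algebra_simps power2_eq_square)
    also have "\<dots> \<le> 4 * (M * D u) + 4 * (\<Delta> * \<Delta> * D u)"
      by (intro add_mono mult_le_mono2 f1 f2)
    finally have "inc M v * \<Delta>\<^sup>2 \<le> 4 * (M * D u) + 4 * (\<Delta> * \<Delta> * D u)" .
    then have 2: "inc M v * \<Delta>\<^sup>2 \<le> 4 * (M + \<Delta>\<^sup>2) * D u"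
      by (simp add: algebra_simps power2_eq_square)
    have "(ld u + inc M v) * \<Delta>\<^sup>2 = ld u * \<Delta>\<^sup>2 + inc M v * \<Delta>\<^sup>2" by (rule distrib_right)
    also have "\<dots> \<le> 2 * (M + \<Delta>\<^sup>2) * D u + 4 * (M + \<Delta>\<^sup>2) * D u" by (rule add_mono[OF 1 2])
    also have "\<dots> = 6 * (M + \<Delta>\<^sup>2) * D u" by (simp add: algebra_simps)
    finally show ?thesis using True by simp
  qed
qed

lemma seeded_mass:
  assumes s: "seeded M A R ld"
  shows "(\<Sum>u<n. ld u) = seed_mass M A"
proof -
  have "(\<Sum>u<n. ld u) = (\<Sum>u<n. \<Sum>v\<in>A. if u \<in> R v then inc M v else 0)"
    using seeded_load[OF s] by (intro sum.cong) auto
  also have "\<dots> = (\<Sum>v\<in>A. \<Sum>u<n. if u \<in> R v then inc M v else 0)" by (rule sum.swap)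
  also have "\<dots> = seed_mass M A"
    unfolding seed_mass_def
  proof (rule sum.cong)
    fix v assume v: "v \<in> A"
    have "R v \<subseteq> {..<n}" "card (R v) = share v"
      using seeded_targets[OF s v] seeded_subset[OF s] v nb_less[of v] by auto
    moreover have "(\<Sum>u<n. if u \<in> R v then inc M v else 0) = (\<Sum>u\<in>{..<n} \<inter> R v. inc M v)"
      by (rule sum.inter_restrict[symmetric]) simp
    ultimately show "(\<Sum>u<n. if u \<in> R v then inc M v else 0) = inc M v * share v"
      by (simp add: Int_absorb1 mult.commute)
  qed simp
  finally show ?thesis .
qed

lemma vol_le_seed_mass:
  assumes "A \<subseteq> {..<n}"
  shows "vol A \<le> seed_mass (2 ^ j) A"
  unfolding vol_def seed_mass_def
proof (rule sum_mono)
  fix v assume "v \<in> A"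
  then have "v < n" using assms by blast
  then show "D v \<le> inc (2 ^ j) v * share v" by (simp add: inc_share)
qed

text \<open>A full vertex has load at least \<open>2 * D u\<close>, so
  \<open>volume_exhausted\<close> bounds \<open>2 * m\<close> by \<open>vol A + vol U\<close> plus
  the mass. As \<open>vol A\<close> is at most the mass and \<open>2 * m\<close> at least
  \<open>1024 * X\<close>, a used volume of \<open>200 * X\<close> leaves a mass well above
  \<open>X\<close>.\<close>

lemma seeded_progress:
  assumes s: "seeded (2 ^ j) A R ld" and U: "U \<subseteq> {..<n}" "vol U \<le> 200 * X"
    and full: "\<And>v. v < n \<Longrightarrow> v \<notin> A \<union> U \<Longrightarrow> card (nbrs G v) \<le> 2 * card {u \<in> nbrs G v. \<not> nonfull (2 ^ j) ld u}"
  shows "X \<le> seed_mass (2 ^ j) A"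
proof -
  have A: "A \<subseteq> {..<n}" using seeded_subset[OF s] .
  have "(\<Sum>v<n. card (nbrs G v)) \<le> vol (A \<union> U) + (\<Sum>u<n. ld u)"
  proof (rule volume_exhausted[where F = "{u. \<not> nonfull (2 ^ j) ld u}"])
    fix v assume "v < n" "v \<notin> A \<union> U"
    then show "card (nbrs G v) \<le> 2 * card {u \<in> nbrs G v. u \<in> {u. \<not> nonfull (2 ^ j) ld u}}"
      using full by simp
  next
    fix u assume "u < n" "u \<in> {u. \<not> nonfull (2 ^ j) ld u}"
    then have "2 * (2 ^ j + \<Delta>\<^sup>2) * D u \<le> ld u * \<Delta>\<^sup>2" by (simp add: nonfull_def)
    moreover have "2 * D u * \<Delta>\<^sup>2 \<le> 2 * (2 ^ j + \<Delta>\<^sup>2) * D u" by (simp add: algebra_simps)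
    ultimately have "2 * D u * \<Delta>\<^sup>2 \<le> ld u * \<Delta>\<^sup>2" by (rule le_trans[rotated])
    then show "2 * D u \<le> ld u" using \<Delta>_pos by simp
  qed (use A U in auto)
  then have "2 * m \<le> vol (A \<union> U) + seed_mass (2 ^ j) A"
    by (simp only: sum_degrees seeded_mass[OF s])
  also have "vol (A \<union> U) \<le> vol A + vol U"
    unfolding vol_def using sum_Un_nat[of A U D] A U finite_subset[of _ "{..<n}"] by simp
  also have "vol A \<le> seed_mass (2 ^ j) A" by (rule vol_le_seed_mass[OF A])
  finally show ?thesis using U(2) X_le by simp
qed

text \<open>If \<open>D v\<close> exceeds the unit, the overshoot is below \<open>2 * n\<close>.
  Otherwise the new seed adds one unit; when the mass so far is itself a multiple of the unit, as is
  \<open>X\<close>, this cannot step over \<open>X\<close>.\<close>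

lemma seed_mass_step:
  assumes A: "A \<subseteq> {..<n}" "seed_mass (2 ^ j) A < X" and v: "v < n" "v \<notin> A" and j: "j \<le> kX"
  shows "seed_mass (2 ^ j) (insert v A) \<le> X + 2 * n"
proof -
  have fA: "finite A" using A finite_subset by blast
  have eq: "seed_mass (2 ^ j) (insert v A) = max (2 ^ j) (D v) + seed_mass (2 ^ j) A"
    using fA v by (simp add: seed_mass_def inc_share)
  show ?thesis
  proof (cases "2 ^ j < D v")
    case True
    then show ?thesis using eq A(2) D_less[OF v(1)] by simp
  next
    case False
    have "2 ^ j dvd seed_mass (2 ^ j) A"
      unfolding seed_mass_def by (rule dvd_sum) (use A dvd_inc_share in auto)
    then obtain a where a: "seed_mass (2 ^ j) A = 2 ^ j * a" by (rule dvdE)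
    have "X = 2 ^ j * 2 ^ (kX - j)" using j by (simp add: X_pow power_add[symmetric])
    then have "a < 2 ^ (kX - j)" using A(2) a by simp
    then have "a + 1 \<le> 2 ^ (kX - j)" by simp
    then have "2 ^ j * (a + 1) \<le> 2 ^ j * 2 ^ (kX - j)" by (rule mult_le_mono2)
    then have "2 ^ j + seed_mass (2 ^ j) A \<le> X" using \<open>X = _\<close> a by (simp add: algebra_simps)
    then show ?thesis using eq False by simp
  qed
qed

lemma nonfull_mono: "ld u \<le> ld' u \<Longrightarrow> nonfull M ld' u \<Longrightarrow> nonfull M ld u"
  unfolding nonfull_def by (meson le_less_trans mult_le_mono1)

lemma full_or_share:
  assumes v: "v < n" and c: "card {u \<in> nbrs G v. nonfull M ld u} < share v"
  shows "card (nbrs G v) \<le> 2 * card {u \<in> nbrs G v. \<not> nonfull M ld u}"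
proof -
  have "card (nbrs G v) = card {u \<in> nbrs G v. nonfull M ld u} + card {u \<in> nbrs G v. \<not> nonfull M ld u}"
  proof -
    have "nbrs G v = {u \<in> nbrs G v. nonfull M ld u} \<union> {u \<in> nbrs G v. \<not> nonfull M ld u}" by auto
    then show ?thesis
      using card_Un_disjoint[of "{u \<in> nbrs G v. nonfull M ld u}" "{u \<in> nbrs G v. \<not> nonfull M ld u}"] finite_nb[OF v]
      by auto
  qed
  moreover have "2 * share v \<le> card (nbrs G v)" using D_le[OF v] by (simp add: share_def)
  ultimately show ?thesis using c by linarith
qed

lemma nonfullE_val:
  assumes "s 24 0 = \<Delta>" "s 27 0 = M" "aval tgt s = u" "s 7 u = D u"
  shows "aval nonfullE s = (if nonfull M (s 8) u then 1 else 0)"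
proof -
  have "aval nonfullE s = 1 - (1 - (2 * (M + \<Delta> * \<Delta>) * D u - s 8 u * (\<Delta> * \<Delta>)))"
    using assms by (simp add: nonfullE_def)
  then show ?thesis by (simp add: nonfull_def power2_eq_square)
qed

section \<open>Choice of the receivers of one seed\<close>

lemma wp_place_loop:
  assumes s: "env s" and v: "s 55 0 = v" "v < n" and M: "s 27 0 = M" and r: "s 40 0 = r" and ic: "s 41 0 = ic"
    and rc: "r \<le> card {u \<in> nbrs G v. nonfull M (s 8) u}"
    and b: "\<And>u. u < n \<Longrightarrow> s 8 u + ic < 2 ^ w"
  shows "wp w (For 56 (Read 5 (Var 55)) place_body) (\<lambda>k s'. k \<le> (card (nbrs G v) + 1) * 8000 \<and>
     (\<exists>R \<subseteq> {u \<in> nbrs G v. nonfull M (s 8) u}. card R = r \<and> s' 8 = (\<lambda>u. s 8 u + (if u \<in> R then ic else 0)))) s"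
proof -
  let ?t = "\<lambda>j. s 6 (v + n * j)" and ?d = "card (nbrs G v)" and ?nf = "nonfull M (s 8)"
  have bij: "bij_betw ?t {..<?d} (nbrs G v)" by (rule envD(14)[OF s v(2)])
  \<comment> \<open>Either all \<open>r\<close> receivers are chosen, or every nonfull neighbour
    seen so far is one of them; as at least \<open>r\<close> neighbours are nonfull,
    \<open>r\<close> receivers are chosen in the end.\<close>
  define I where "I j s' \<longleftrightarrow> (\<exists>R. R \<subseteq> {u \<in> ?t ` {..<j}. ?nf u} \<and> card R \<le> r \<and> s' 40 0 = r - card R \<and>
      (card R = r \<or> R = {u \<in> ?t ` {..<j}. ?nf u}) \<and> s' 8 = (\<lambda>u. s 8 u + (if u \<in> R then ic else 0)))"
    for j and s' :: store
  have I_upd: "I j (s'(56 := x)) = I j s'" for j x s' by (simp add: I_def)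
  have rw: "r < 2 ^ w" if "cells_below w s" using cells_belowD[OF that, of 40 0] r by simp
  show ?thesis
  proof (rule wp_below, rule wp_For_uniform[where Inv = I and B = ?d and b = 5000])
    show "I 0 (s(56 := (s 56)(0 := 0)))" unfolding I_upd unfolding I_def by (rule exI[of _ "{}"]) (simp add: r)
  next
    fix i s' assume "\<And>a. a \<noteq> 56 \<Longrightarrow> a \<notin> writes place_body \<Longrightarrow> s' a = s a"
    then have "s' 5 = s 5" "s' 55 = s 55" by simp_all
    then show "aval (Read 5 (Var 55)) s' = ?d" using s v by (simp add: envD)
  next
    fix j s' assume cb: "cells_below w s" and j: "j < ?d" "s' 56 0 = j" and inv: "I j s'"
      and fr: "\<And>a. a \<noteq> 56 \<Longrightarrow> a \<notin> writes place_body \<Longrightarrow> s' a = s a"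
    from inv obtain R where R: "R \<subseteq> {u \<in> ?t ` {..<j}. ?nf u}" "card R \<le> r" "s' 40 0 = r - card R"
      "card R = r \<or> R = {u \<in> ?t ` {..<j}. ?nf u}" "s' 8 = (\<lambda>u. s 8 u + (if u \<in> R then ic else 0))"
      unfolding I_def by blast
    let ?u = "?t j"
    \<comment> \<open>Neighbours are listed without repetition, so the current one has received
      nothing in this loop and its test still refers to the load before the loop.\<close>
    have inj: "?u \<notin> ?t ` {..<j}"
    proof
      assume "?u \<in> ?t ` {..<j}"
      then obtain i where i: "i < j" "?t i = ?t j" by auto
      moreover have "inj_on ?t {..<?d}" using bij by (simp add: bij_betw_def)
      ultimately have "i = j" using j(1) by (auto dest: inj_onD)
      then show False using i(1) by simp
    qed
    have uR: "?u \<notin> R" using inj R(1) by blast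
    have un: "?u < n" by (rule env_target(2)[OF s v(2) j(1)])
    have fR: "finite R" using R(1) by (rule finite_subset) simp
    have fr': "s' 24 = s 24" "s' 27 = s 27" "s' 55 = s 55" "s' 6 = s 6" "s' 7 = s 7" "s' 0 = s 0" "s' 41 = s 41"
      using fr by simp_all
    have t: "aval tgt s' = ?u" using j v fr' s by (simp add: envD)
    have nfv: "aval nonfullE s' = (if ?nf ?u then 1 else 0)"
    proof -
      have "aval nonfullE s' = (if nonfull M (s' 8) ?u then 1 else 0)"
        by (rule nonfullE_val[OF _ _ t]) (use fr' s M un in \<open>simp_all add: envD\<close>)
      then show ?thesis using uR by (simp add: nonfull_def R(5))
    qed
    have im: "{u \<in> ?t ` {..<Suc j}. ?nf u} = (if ?nf ?u then insert ?u {u \<in> ?t ` {..<j}. ?nf u} else {u \<in> ?t ` {..<j}. ?nf u})"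
      by (auto simp: less_Suc_eq)
    show "wp w place_body (\<lambda>k s''. k \<le> 5000 \<and> s'' 56 0 = j \<and> I (Suc j) (s''(56 := (s'' 56)(0 := Suc j)))) s'"
      unfolding place_body_def I_upd
    proof (rule wp_If)
      assume "aval (Mul nonfullE (Var 40)) s' \<noteq> 0"
      then have nf: "?nf ?u" and pos: "card R < r" using nfv R(3) by (auto split: if_splits)
      let ?s2 = "s'(8 := (s' 8)(?u := s 8 ?u + ic), 40 := (s' 40)(0 := r - card (insert ?u R)))"
      have I2: "I (Suc j) ?s2"
        unfolding I_def im
      proof (intro exI[of _ "insert ?u R"] conjI)
        show "insert ?u R \<subseteq> (if ?nf ?u then insert ?u {u \<in> ?t ` {..<j}. ?nf u} else {u \<in> ?t ` {..<j}. ?nf u})"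
          using R(1) nf by auto
        show "card (insert ?u R) \<le> r" using pos uR fR by simp
        show "card (insert ?u R) = r \<or> insert ?u R = (if ?nf ?u then insert ?u {u \<in> ?t ` {..<j}. ?nf u} else {u \<in> ?t ` {..<j}. ?nf u})"
          using R(4) pos nf by auto
        show "?s2 8 = (\<lambda>u. s 8 u + (if u \<in> insert ?u R then ic else 0))"
          using R(5) by auto
      qed simp
      have "wp w (Seq (Assign 8 tgt (Add (Read 8 tgt) (Var 41))) (Set 40 (Sub (Var 40) (Const 1))))
         (\<lambda>k s''. k \<le> 900 \<and> s'' = ?s2) s'"
      proof (intro wp_Seq wp_Assign)
        have a8: "aval (Add (Read 8 tgt) (Var 41)) s' = s 8 ?u + ic"
          using t uR fr' ic R(5) by simp
        show "aval (Add (Read 8 tgt) (Var 41)) s' < 2 ^ w" unfolding a8 by (rule b[OF un])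
        let ?s1 = "s'(8 := (s' 8)(aval tgt s' := aval (Add (Read 8 tgt) (Var 41)) s'))"
        have "r - card R < 2 ^ w" using rw[OF cb] by simp
        then show "aval (Sub (Var 40) (Const 1)) ?s1 < 2 ^ w" using R(3) by simp
        have c: "card (insert ?u R) = card R + 1" using uR fR by simp
        have "?s1(40 := (?s1 40)(aval (Const 0) ?s1 := aval (Sub (Var 40) (Const 1)) ?s1)) = ?s2"
          unfolding a8 t c using R(3) by simp
        then show "1 + ecost tgt + ecost (Add (Read 8 tgt) (Var 41)) + (1 + ecost (Const 0) + ecost (Sub (Var 40) (Const 1))) \<le> 900 \<and>
           ?s1(40 := (?s1 40)(aval (Const 0) ?s1 := aval (Sub (Var 40) (Const 1)) ?s1)) = ?s2"
          by (simp add: ecost_def)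
      qed simp_all
      then show "wp w (Seq (Assign 8 tgt (Add (Read 8 tgt) (Var 41))) (Set 40 (Sub (Var 40) (Const 1))))
         (\<lambda>k s''. 1 + ecost (Mul nonfullE (Var 40)) + k \<le> 5000 \<and> s'' 56 0 = j \<and> I (Suc j) s'') s'"
        by (rule wp_conseq) (use I2 j in \<open>simp add: ecost_def nonfullE_def\<close>)
    next
      assume "aval (Mul nonfullE (Var 40)) s' = 0"
      then have "\<not> ?nf ?u \<or> card R = r" using nfv R(2,3) by (auto split: if_splits)
      then have "I (Suc j) s'" unfolding I_def im using R by (intro exI[of _ R]) auto
      then show "wp w Skip (\<lambda>k s''. 1 + ecost (Mul nonfullE (Var 40)) + k \<le> 5000 \<and> s'' 56 0 = j \<and> I (Suc j) s'') s'"
        by (intro wp_Skip) (use j in \<open>simp add: ecost_def nonfullE_def\<close>)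
    qed (simp add: nonfullE_def)
  next
    fix k s' assume inv: "I ?d s'" and k: "k \<le> (?d + 1) * (5000 + fcost (Read 5 (Var 55)))"
    have img: "?t ` {..<?d} = nbrs G v" using bij by (simp add: bij_betw_def)
    from inv obtain R where R: "R \<subseteq> {u \<in> nbrs G v. ?nf u}" "card R \<le> r"
      "card R = r \<or> R = {u \<in> nbrs G v. ?nf u}" "s' 8 = (\<lambda>u. s 8 u + (if u \<in> R then ic else 0))"
      unfolding I_def img by blast
    have "card R = r" using R(2,3) rc by auto
    moreover have "k \<le> (?d + 1) * 8000"
    proof -
      have "(?d + 1) * (5000 + fcost (Read 5 (Var 55))) \<le> (?d + 1) * 8000"
        by (intro mult_le_mono2) (simp add: fcost_def ecost_def)
      then show ?thesis using k by linarith
    qed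
    ultimately show "k \<le> (?d + 1) * 8000 \<and>
     (\<exists>R \<subseteq> {u \<in> nbrs G v. ?nf u}. card R = r \<and> s' 8 = (\<lambda>u. s 8 u + (if u \<in> R then ic else 0)))"
      using R by blast
  qed (use card_below[OF v(2)] in simp_all)
qed

lemma wp_place:
  assumes s: "env s" and v: "s 55 0 = v" "v < n" and M: "s 27 0 = M" and r: "s 40 0 = r" and ic: "s 41 0 = ic"
    and rc: "r \<le> card {u \<in> nbrs G v. nonfull M (s 8) u}"
    and b: "\<And>u. u < n \<Longrightarrow> s 8 u + ic < 2 ^ w" and mb: "s 28 0 + ic * r < 2 ^ w"
  shows "wp w place (\<lambda>k s'. k \<le> (card (nbrs G v) + 1) * 9000 \<and> s' 9 = (s 9)(v := 1) \<and> s' 28 0 = s 28 0 + ic * r \<and>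
     (\<exists>R \<subseteq> {u \<in> nbrs G v. nonfull M (s 8) u}. card R = r \<and> s' 8 = (\<lambda>u. s 8 u + (if u \<in> R then ic else 0)))) s"
proof -
  let ?s1 = "s(9 := (s 9)(v := 1), 28 := (s 28)(0 := s 28 0 + ic * r))"
  have s1: "env ?s1" by (rule env_cong[OF s]) (auto simp: env_arrays_def)
  have loop: "wp w (For 56 (Read 5 (Var 55)) place_body) (\<lambda>k s'. k + 500 \<le> (card (nbrs G v) + 1) * 9000 \<and>
      s' 9 = (s 9)(v := 1) \<and> s' 28 0 = s 28 0 + ic * r \<and>
     (\<exists>R \<subseteq> {u \<in> nbrs G v. nonfull M (s 8) u}. card R = r \<and> s' 8 = (\<lambda>u. s 8 u + (if u \<in> R then ic else 0)))) ?s1"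
  proof (rule wp_conseq[OF wp_place_loop[OF s1, of v M r ic]])
    fix k and s' :: store
    assume *: "k \<le> (card (nbrs G v) + 1) * 8000 \<and>
     (\<exists>R \<subseteq> {u \<in> nbrs G v. nonfull M (?s1 8) u}. card R = r \<and> s' 8 = (\<lambda>u. ?s1 8 u + (if u \<in> R then ic else 0)))"
      and fr: "\<And>a. a \<notin> writes (For 56 (Read 5 (Var 55)) place_body) \<Longrightarrow> s' a = ?s1 a"
    have "s' 9 = (s 9)(v := 1)" "s' 28 0 = s 28 0 + ic * r" using fr by simp_all
    then show "k + 500 \<le> (card (nbrs G v) + 1) * 9000 \<and> s' 9 = (s 9)(v := 1) \<and> s' 28 0 = s 28 0 + ic * r \<and>
     (\<exists>R \<subseteq> {u \<in> nbrs G v. nonfull M (s 8) u}. card R = r \<and> s' 8 = (\<lambda>u. s 8 u + (if u \<in> R then ic else 0)))"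
      using * by simp
  qed (use v M r ic rc b in simp_all)
  show ?thesis
    unfolding place_def
  proof (rule wp_below, rule wp_Seq, rule wp_Assign, simp)
    assume cb: "cells_below w s"
    show "aval (Const 1) s < 2 ^ w" using small_below[OF cb, of 1] by simp
    let ?s0 = "s(9 := (s 9)(aval (Var 55) s := aval (Const 1) s))"
    show "wp w (Seq (Set 28 (Add (Var 28) (Mul (Var 41) (Var 40)))) (For 56 (Read 5 (Var 55)) place_body))
      (\<lambda>k s'. 1 + ecost (Var 55) + ecost (Const 1) + k \<le> (card (nbrs G v) + 1) * 9000 \<and> s' 9 = (s 9)(v := 1) \<and> s' 28 0 = s 28 0 + ic * r \<and>
     (\<exists>R \<subseteq> {u \<in> nbrs G v. nonfull M (s 8) u}. card R = r \<and> s' 8 = (\<lambda>u. s 8 u + (if u \<in> R then ic else 0)))) ?s0"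
    proof (rule wp_Seq, rule wp_Assign, simp)
      show "aval (Add (Var 28) (Mul (Var 41) (Var 40))) ?s0 < 2 ^ w" using mb r ic by simp
      have eq: "?s0(28 := (?s0 28)(aval (Const 0) ?s0 := aval (Add (Var 28) (Mul (Var 41) (Var 40))) ?s0)) = ?s1"
        using v r ic by simp
      show "wp w (For 56 (Read 5 (Var 55)) place_body)
        (\<lambda>k s'. 1 + ecost (Var 55) + ecost (Const 1) + (1 + ecost (Const 0) + ecost (Add (Var 28) (Mul (Var 41) (Var 40))) + k)
           \<le> (card (nbrs G v) + 1) * 9000 \<and> s' 9 = (s 9)(v := 1) \<and> s' 28 0 = s 28 0 + ic * r \<and>
         (\<exists>R \<subseteq> {u \<in> nbrs G v. nonfull M (s 8) u}. card R = r \<and> s' 8 = (\<lambda>u. s 8 u + (if u \<in> R then ic else 0))))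
        (?s0(28 := (?s0 28)(aval (Const 0) ?s0 := aval (Add (Var 28) (Mul (Var 41) (Var 40))) ?s0)))"
        unfolding eq by (rule wp_conseq[OF loop]) (simp add: ecost_def)
    qed
  qed
qed

text \<open>\<open>U\<close> stands for the seeds of earlier phases of the scale and
  \<open>i\<close> for the number of vertices examined. The last clause is what
  \<open>seeded_progress\<close> consumes at the end of the pass.\<close>

definition greedy :: "nat \<Rightarrow> nat set \<Rightarrow> nat \<Rightarrow> nat set \<Rightarrow> (nat \<Rightarrow> nat set) \<Rightarrow> store \<Rightarrow> bool" where
  "greedy M U i A R s \<longleftrightarrow> seeded M A R (s 8) \<and> A \<subseteq> {..<i} \<and> A \<inter> U = {} \<and>
     (\<forall>v<n. s 9 v = (if v \<in> A \<union> U then 1 else 0)) \<and> s 28 0 = seed_mass M A \<and> seed_mass M A \<le> X + 2 * n \<and>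
     (X \<le> seed_mass M A \<or>
      (\<forall>v<i. v \<notin> A \<union> U \<longrightarrow> card (nbrs G v) \<le> 2 * card {u \<in> nbrs G v. \<not> nonfull M (s 8) u}))"

lemma greedy_cong:
  assumes "greedy M U i A R s" "s' 8 = s 8" "s' 9 = s 9" "s' 28 = s 28"
  shows "greedy M U i A R s'"
  using assms(1) unfolding greedy_def assms(2-4) .

lemma greedyD:
  assumes g: "greedy M U i A R s"
  shows "seeded M A R (s 8)" "A \<subseteq> {..<i}" "A \<inter> U = {}" "v < n \<Longrightarrow> s 9 v = (if v \<in> A \<union> U then 1 else 0)"
    "s 28 0 = seed_mass M A" "seed_mass M A \<le> X + 2 * n"
    "seed_mass M A < X \<Longrightarrow> v < i \<Longrightarrow> v \<notin> A \<union> U \<Longrightarrow>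
       card (nbrs G v) \<le> 2 * card {u \<in> nbrs G v. \<not> nonfull M (s 8) u}"
proof -
  note h = g[unfolded greedy_def]
  show "seeded M A R (s 8)" by (rule h[THEN conjunct1])
  note h = h[THEN conjunct2]
  show "A \<subseteq> {..<i}" by (rule h[THEN conjunct1])
  note h = h[THEN conjunct2]
  show "A \<inter> U = {}" by (rule h[THEN conjunct1])
  note h = h[THEN conjunct2]
  show "v < n \<Longrightarrow> s 9 v = (if v \<in> A \<union> U then 1 else 0)" by (rule h[THEN conjunct1, rule_format])
  note h = h[THEN conjunct2]
  show "s 28 0 = seed_mass M A" by (rule h[THEN conjunct1])
  note h = h[THEN conjunct2]
  show "seed_mass M A \<le> X + 2 * n" by (rule h[THEN conjunct1])
  note h = h[THEN conjunct2]
  show "card (nbrs G v) \<le> 2 * card {u \<in> nbrs G v. \<not> nonfull M (s 8) u}"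
    if "seed_mass M A < X" "v < i" "v \<notin> A \<union> U"
    using h
  proof
    assume "X \<le> seed_mass M A" then show ?thesis using that(1) by simp
  next
    assume "\<forall>v<i. v \<notin> A \<union> U \<longrightarrow> card (nbrs G v) \<le> 2 * card {u \<in> nbrs G v. \<not> nonfull M (s 8) u}"
    then show ?thesis using that(2,3) by simp
  qed
qed

lemma greedyI:
  assumes "seeded M A R (s 8)" "A \<subseteq> {..<i}" "A \<inter> U = {}"
    "\<And>v. v < n \<Longrightarrow> s 9 v = (if v \<in> A \<union> U then 1 else 0)"
    "s 28 0 = seed_mass M A" "seed_mass M A \<le> X + 2 * n"
    "\<And>v. seed_mass M A < X \<Longrightarrow> v < i \<Longrightarrow> v \<notin> A \<union> U \<Longrightarrow>
       card (nbrs G v) \<le> 2 * card {u \<in> nbrs G v. \<not> nonfull M (s 8) u}"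
  shows "greedy M U i A R s"
  unfolding greedy_def
proof (intro conjI allI impI)
  show "X \<le> seed_mass M A \<or>
      (\<forall>v<i. v \<notin> A \<union> U \<longrightarrow> card (nbrs G v) \<le> 2 * card {u \<in> nbrs G v. \<not> nonfull M (s 8) u})"
  proof (cases "seed_mass M A < X")
    case True
    show ?thesis by (intro disjI2 allI impI) (rule assms(7)[OF True])
  next
    case False
    then have "X \<le> seed_mass M A" by simp
    then show ?thesis ..
  qed
qed (rule assms; assumption?)+

lemma poly_below: "a \<le> 5 * X + 2 * n + 4 \<Longrightarrow> a < 2 ^ w"
proof -
  assume a: "a \<le> 5 * X + 2 * n + 4"
  have "5 * X + 2 * n + 4 \<le> 2 * (n * n)"
  proof -
    have "2 * n + 4 \<le> 3 * n" "3 * n \<le> n * n" using n_ge by (auto intro: mult_le_mono1)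
    then show ?thesis using X_le m_less by linarith
  qed
  then show ?thesis using a n_le_pow(4) by (intro below_w_poly) linarith
qed

text \<open>Loads only grow, so a vertex that was passed over as blocked stays blocked; hence a
  single pass over the vertices suffices.\<close>

lemma full_card_mono:
  assumes "v < n" "\<And>u. ld u \<le> ld' u"
    "card (nbrs G v) \<le> 2 * card {u \<in> nbrs G v. \<not> nonfull M ld u}"
  shows "card (nbrs G v) \<le> 2 * card {u \<in> nbrs G v. \<not> nonfull M ld' u}"
proof -
  have "{u \<in> nbrs G v. \<not> nonfull M ld u} \<subseteq> {u \<in> nbrs G v. \<not> nonfull M ld' u}"
    using nonfull_mono[where ld = ld and ld' = ld', OF assms(2)] by auto
  then have "card {u \<in> nbrs G v. \<not> nonfull M ld u} \<le> card {u \<in> nbrs G v. \<not> nonfull M ld' u}"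
    by (rule card_mono[rotated]) (use finite_nb[OF assms(1)] in simp)
  then show ?thesis using assms(3) by linarith
qed

lemma wp_try_seed:
  assumes s: "env s" and i: "s 55 0 = i" "i < n" and M: "s 27 0 = 2 ^ j" "j \<le> kX"
    and g: "greedy (2 ^ j) U i A R s"
  shows "wp w try_seed (\<lambda>k s'. k \<le> (card (nbrs G i) + 1) * 20000 \<and> (\<exists>A R. greedy (2 ^ j) U (Suc i) A R s')) s"
  unfolding try_seed_def
proof (rule wp_If)
  assume "aval (Mul (Sub (Var 22) (Var 28)) (Sub (Const 1) (Read 9 (Var 55)))) s = 0"
  then have "X \<le> seed_mass (2 ^ j) A \<or> i \<in> A \<union> U"
    using s i greedyD(4)[OF g i(2)] greedyD(5)[OF g] by (auto simp: envD split: if_splits)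
  then have "greedy (2 ^ j) U (Suc i) A R s"
    using greedyD(2)[OF g] by (intro greedyI greedyD[OF g]) (auto simp: less_Suc_eq)
  then show "wp w Skip (\<lambda>k s'. 1 + ecost (Mul (Sub (Var 22) (Var 28)) (Sub (Const 1) (Read 9 (Var 55)))) + k
      \<le> (card (nbrs G i) + 1) * 20000 \<and> (\<exists>A R. greedy (2 ^ j) U (Suc i) A R s')) s"
    by (intro wp_Skip) (auto simp: ecost_def)
next
  let ?M = "2 ^ j :: nat" and ?d = "card (nbrs G i)"
  assume "aval (Mul (Sub (Var 22) (Var 28)) (Sub (Const 1) (Read 9 (Var 55)))) s \<noteq> 0"
  then have lt: "seed_mass ?M A < X" and iAU: "i \<notin> A \<union> U"
    using s i greedyD(4)[OF g i(2)] greedyD(5)[OF g] by (auto simp: envD split: if_splits)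
  have A: "A \<subseteq> {..<n}" by (rule seeded_subset[OF greedyD(1)[OF g]])
  let ?N = "{u \<in> nbrs G i. nonfull ?M (s 8) u}"
  have MX: "?M \<le> X" unfolding X_pow using M(2) by (intro power_increasing) auto
  have incX: "inc ?M i \<le> 4 * X + 4"
  proof -
    have "?M div D i \<le> X" using MX div_le_dividend le_trans by blast
    then show ?thesis using inc_le[of ?M i] by linarith
  qed
  have lds: "s 8 u \<le> X + 2 * n" if "u < n" for u
  proof -
    have "s 8 u \<le> (\<Sum>u<n. s 8 u)" by (rule member_le_sum) (use that in auto)
    then show ?thesis using seeded_mass[OF greedyD(1)[OF g]] greedyD(6)[OF g] by simp
  qed
  show "wp w (Seq (SumTo 29 56 (Read 5 (Var 55)) nonfullE)
     (Seq (Set 40 (Div (Read 7 (Var 55)) (Const 4)))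
     (Seq (Set 41 incE) (If (Sub (Add (Var 29) (Const 1)) (Var 40)) place Skip))))
     (\<lambda>k s'. 1 + ecost (Mul (Sub (Var 22) (Var 28)) (Sub (Const 1) (Read 9 (Var 55)))) + k
      \<le> (card (nbrs G i) + 1) * 20000 \<and> (\<exists>A R. greedy (2 ^ j) U (Suc i) A R s')) s"
  proof (rule wp_Seq, rule wp_SumTo[where B = ?d and g = "\<lambda>x. if nonfull ?M (s 8) (s 6 (i + n * x)) then 1 else 0"])
    fix s' assume "\<And>a. a \<noteq> 29 \<Longrightarrow> a \<noteq> 56 \<Longrightarrow> s' a = s a"
    then show "aval (Read 5 (Var 55)) s' = ?d" using s i by (simp add: envD)
  next
    fix x s' assume x: "x < ?d" "s' 56 0 = x" and f: "\<And>a. a \<noteq> 29 \<Longrightarrow> a \<noteq> 56 \<Longrightarrow> s' a = s a"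
    have un: "s 6 (i + n * x) < n" by (rule env_target(2)[OF s i(2) x(1)])
    have "aval nonfullE s' = (if nonfull ?M (s' 8) (s 6 (i + n * x)) then 1 else 0)"
      by (rule nonfullE_val) (use f x i s M un in \<open>simp_all add: envD\<close>)
    then show "aval nonfullE s' = (if nonfull ?M (s 8) (s 6 (i + n * x)) then 1 else 0)" using f[of 8] by simp
  next
    show "?d < 2 ^ w" by (rule card_below[OF i(2)])
    have "(\<Sum>x<?d. if nonfull ?M (s 8) (s 6 (i + n * x)) then 1 else 0) \<le> (\<Sum>x<?d. 1 :: nat)"
      by (rule sum_mono) auto
    then show "(\<Sum>x<?d. if nonfull ?M (s 8) (s 6 (i + n * x)) then 1 else 0) < (2 :: nat) ^ w"
      using card_below[OF i(2)] by simp
  next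
    fix k1 s1 assume v: "s1 29 0 = (\<Sum>x<?d. if nonfull ?M (s 8) (s 6 (i + n * x)) then 1 else 0)"
      and f1: "\<And>a. a \<noteq> 29 \<Longrightarrow> a \<noteq> 56 \<Longrightarrow> s1 a = s a"
      and k1: "k1 \<le> (?d + 1) * sumcost (Read 5 (Var 55)) nonfullE"
    have cnt: "s1 29 0 = card ?N"
    proof -
      have "s1 29 0 = (\<Sum>u\<in>nbrs G i. if nonfull ?M (s 8) u then 1 else 0)"
        unfolding v by (rule env_sum_targets[OF s i(2), of "\<lambda>u. if nonfull ?M (s 8) u then 1 else 0"])
      also have "\<dots> = (\<Sum>u\<in>?N. 1)" by (rule sum.inter_filter[OF finite_nb[OF i(2)], symmetric])
      finally show ?thesis by simp
    qed
    let ?s3 = "s1(40 := (s1 40)(0 := share i), 41 := (s1 41)(0 := inc ?M i))"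
    have s3: "env ?s3" by (rule env_cong[OF s]) (use f1 in \<open>auto simp: env_arrays_def\<close>)
    have f3: "?s3 8 = s 8" "?s3 9 = s 9" "?s3 28 = s 28" "?s3 55 = s 55" "?s3 27 = s 27" "?s3 29 = s1 29"
      using f1 by simp_all
    have last: "wp w (If (Sub (Add (Var 29) (Const 1)) (Var 40)) place Skip)
      (\<lambda>k s'. k1 + k + 2000 \<le> (?d + 1) * 20000 \<and> (\<exists>A R. greedy ?M U (Suc i) A R s')) ?s3"
    proof (rule wp_If)
      assume "aval (Sub (Add (Var 29) (Const 1)) (Var 40)) ?s3 \<noteq> 0"
      then have rc: "share i \<le> card ?N" using cnt by simp
      have mass': "seed_mass ?M (insert i A) = seed_mass ?M A + inc ?M i * share i"
        using iAU A finite_subset[OF A] by (simp add: seed_mass_def)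
      have mass_le: "seed_mass ?M (insert i A) \<le> X + 2 * n"
        by (rule seed_mass_step[OF A lt i(2) _ M(2)]) (use iAU in simp)
      have "wp w place (\<lambda>k s'. k \<le> (?d + 1) * 9000 \<and> s' 9 = (?s3 9)(i := 1) \<and> s' 28 0 = ?s3 28 0 + inc ?M i * share i \<and>
        (\<exists>R \<subseteq> {u \<in> nbrs G i. nonfull ?M (?s3 8) u}. card R = share i \<and> s' 8 = (\<lambda>u. ?s3 8 u + (if u \<in> R then inc ?M i else 0)))) ?s3"
      proof (rule wp_place[OF s3])
        show "?s3 55 0 = i" "i < n" "?s3 27 0 = ?M" using f3 i M by simp_all
        show "share i \<le> card {u \<in> nbrs G i. nonfull ?M (?s3 8) u}" unfolding f3 by (rule rc)
        show "?s3 8 u + inc ?M i < 2 ^ w" if "u < n" for u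
          unfolding f3 using lds[OF that] incX by (intro poly_below) linarith
        show "?s3 28 0 + inc ?M i * share i < 2 ^ w"
          unfolding f3 greedyD(5)[OF g] mass'[symmetric] using mass_le by (intro poly_below) linarith
      qed simp_all
      then show "wp w place (\<lambda>k s'. k1 + (1 + ecost (Sub (Add (Var 29) (Const 1)) (Var 40)) + k) + 2000 \<le> (?d + 1) * 20000 \<and>
        (\<exists>A R. greedy ?M U (Suc i) A R s')) ?s3"
        unfolding f3
      proof (rule wp_conseq)
        fix k and s' :: store
        assume *: "k \<le> (?d + 1) * 9000 \<and> s' 9 = (s 9)(i := 1) \<and> s' 28 0 = s 28 0 + inc ?M i * share i \<and>
          (\<exists>R \<subseteq> ?N. card R = share i \<and> s' 8 = (\<lambda>u. s 8 u + (if u \<in> R then inc ?M i else 0)))"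
        then obtain R' where R': "R' \<subseteq> ?N" "card R' = share i" "s' 8 = (\<lambda>u. s 8 u + (if u \<in> R' then inc ?M i else 0))"
          by (elim conjE exE)
        note k = conjunct1[OF *] and s9 = conjunct1[OF conjunct2[OF *]]
          and s28 = conjunct1[OF conjunct2[OF conjunct2[OF *]]]
        have "greedy ?M U (Suc i) (insert i A) (R(i := R')) s'"
        proof (rule greedyI)
          show "seeded ?M (insert i A) (R(i := R')) (s' 8)"
            unfolding R'(3) by (rule seeded_insert[OF greedyD(1)[OF g] i(2)]) (use iAU R' in auto)
          show "insert i A \<subseteq> {..<Suc i}" using greedyD(2)[OF g] by auto
          show "insert i A \<inter> U = {}" using greedyD(3)[OF g] iAU by simp
          show "s' 9 v = (if v \<in> insert i A \<union> U then 1 else 0)" if "v < n" for v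
            unfolding s9 using greedyD(4)[OF g that] by simp
          show "s' 28 0 = seed_mass ?M (insert i A)" unfolding s28 mass' greedyD(5)[OF g] ..
          show "seed_mass ?M (insert i A) \<le> X + 2 * n" by (rule mass_le)
          fix v assume v: "v < Suc i" "v \<notin> insert i A \<union> U"
          then have v': "v < i" "v \<notin> A \<union> U" by auto
          have "v < n" using v' i by simp
          then show "card (nbrs G v) \<le> 2 * card {u \<in> nbrs G v. \<not> nonfull ?M (s' 8) u}"
            by (rule full_card_mono[OF _ _ greedyD(7)[OF g lt v']]) (simp add: R'(3))
        qed
        moreover have "k1 + (1 + ecost (Sub (Add (Var 29) (Const 1)) (Var 40)) + k) + 2000 \<le> (?d + 1) * 20000"
        proof -
          have "k1 \<le> (?d + 1) * 5000"
            using k1 by (simp add: sumcost_def fcost_def ecost_def nonfullE_def)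
          then show ?thesis using k by (simp add: ecost_def)
        qed
        ultimately show "k1 + (1 + ecost (Sub (Add (Var 29) (Const 1)) (Var 40)) + k) + 2000 \<le> (?d + 1) * 20000 \<and>
          (\<exists>A R. greedy ?M U (Suc i) A R s')" by (intro conjI exI)
      qed
    next
      assume "aval (Sub (Add (Var 29) (Const 1)) (Var 40)) ?s3 = 0"
      then have lt2: "card ?N < share i" using cnt by simp
      have "greedy ?M U (Suc i) A R ?s3"
      proof (rule greedyI, unfold f3)
        show "A \<subseteq> {..<Suc i}" using greedyD(2)[OF g] by auto
        fix v assume v: "v < Suc i" "v \<notin> A \<union> U"
        show "card (nbrs G v) \<le> 2 * card {u \<in> nbrs G v. \<not> nonfull ?M (s 8) u}"
        proof (cases "v = i")
          case True
          then show ?thesis using full_or_share[OF i(2) lt2] by simp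
        next
          case False
          then show ?thesis using v by (intro greedyD(7)[OF g lt]) auto
        qed
      qed (rule greedyD[OF g]; assumption?)+
      moreover have "k1 + (1 + ecost (Sub (Add (Var 29) (Const 1)) (Var 40)) + 1) + 2000 \<le> (?d + 1) * 20000"
        using k1 by (simp add: sumcost_def fcost_def ecost_def nonfullE_def)
      ultimately show "wp w Skip (\<lambda>k s'. k1 + (1 + ecost (Sub (Add (Var 29) (Const 1)) (Var 40)) + k) + 2000 \<le> (?d + 1) * 20000 \<and>
        (\<exists>A R. greedy ?M U (Suc i) A R s')) ?s3"
        by (intro wp_Skip conjI exI)
    qed simp
    show "wp w (Seq (Set 40 (Div (Read 7 (Var 55)) (Const 4)))
     (Seq (Set 41 incE) (If (Sub (Add (Var 29) (Const 1)) (Var 40)) place Skip)))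
      (\<lambda>l s'. 1 + ecost (Mul (Sub (Var 22) (Var 28)) (Sub (Const 1) (Read 9 (Var 55)))) + (k1 + l)
      \<le> (?d + 1) * 20000 \<and> (\<exists>A R. greedy ?M U (Suc i) A R s')) s1"
    proof (rule wp_Seq, rule wp_Assign, simp)
      have a: "aval (Div (Read 7 (Var 55)) (Const 4)) s1 = share i"
        using f1[of 7] f1[of 55] s i by (simp add: envD share_def)
      have "share i \<le> 2 * n" using D_less[OF i(2)] by (simp add: share_def)
      then show "aval (Div (Read 7 (Var 55)) (Const 4)) s1 < 2 ^ w" unfolding a by (intro poly_below) linarith
      let ?s2 = "s1(40 := (s1 40)(aval (Const 0) s1 := aval (Div (Read 7 (Var 55)) (Const 4)) s1))"
      have b: "aval incE ?s2 = inc ?M i"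
        using f1[of 7] f1[of 55] f1[of 27] s i M by (simp add: incE_def inc_def envD)
      show "wp w (Seq (Set 41 incE) (If (Sub (Add (Var 29) (Const 1)) (Var 40)) place Skip))
        (\<lambda>l s'. 1 + ecost (Mul (Sub (Var 22) (Var 28)) (Sub (Const 1) (Read 9 (Var 55)))) + (k1 + (1 + ecost (Const 0) + ecost (Div (Read 7 (Var 55)) (Const 4)) + l))
        \<le> (?d + 1) * 20000 \<and> (\<exists>A R. greedy ?M U (Suc i) A R s')) ?s2"
      proof (rule wp_Seq, rule wp_Assign, simp add: incE_def)
        show "aval incE ?s2 < 2 ^ w" unfolding b using incX by (intro poly_below) linarith
        have eq: "?s2(41 := (?s2 41)(aval (Const 0) ?s2 := aval incE ?s2)) = ?s3"
          unfolding b unfolding a by simp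
        show "wp w (If (Sub (Add (Var 29) (Const 1)) (Var 40)) place Skip)
          (\<lambda>l s'. 1 + ecost (Mul (Sub (Var 22) (Var 28)) (Sub (Const 1) (Read 9 (Var 55)))) + (k1 + (1 + ecost (Const 0) + ecost (Div (Read 7 (Var 55)) (Const 4)) + (1 + ecost (Const 0) + ecost incE + l)))
          \<le> (?d + 1) * 20000 \<and> (\<exists>A R. greedy ?M U (Suc i) A R s')) (?s2(41 := (?s2 41)(aval (Const 0) ?s2 := aval incE ?s2)))"
          unfolding eq by (rule wp_conseq[OF last]) (simp add: ecost_def incE_def)
      qed
    qed
  qed (simp_all add: nonfullE_def)
qed simp

lemma wp_seed:
  assumes s: "env s" and M: "s 27 0 = 2 ^ j" "j \<le> kX"
    and U: "U \<subseteq> {..<n}" "vol U \<le> 200 * X" and used: "\<And>v. v < n \<Longrightarrow> s 9 v = (if v \<in> U then 1 else 0)"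
  shows "wp w seed (\<lambda>k s'. k \<le> (m + 1) * 100000 \<and> (\<exists>A R. greedy (2 ^ j) U n A R s' \<and> X \<le> seed_mass (2 ^ j) A)) s"
  unfolding seed_def
proof (rule wp_Seq, rule wp_MapTo[where B = n and g = "\<lambda>u. 0"])
  have nm: "n \<le> m" using m_ge by linarith
  let ?M = "2 ^ j :: nat"
  fix k1 s1 assume z: "\<And>u. u < n \<Longrightarrow> s1 8 u = 0" and f1: "\<And>a. a \<noteq> 8 \<Longrightarrow> a \<noteq> 55 \<Longrightarrow> s1 a = s a"
    and k1: "k1 \<le> (n + 1) * mapcost nV (Const 0)"
  let ?s2 = "s1(28 := (s1 28)(0 := 0))"
  have s2: "env ?s2" by (rule env_cong[OF s]) (use f1 in \<open>auto simp: env_arrays_def\<close>)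
  have g0: "greedy ?M U 0 {} (\<lambda>_. {}) ?s2"
  proof (rule greedyI)
    show "seeded ?M {} (\<lambda>_. {}) (?s2 8)" by (rule seeded_cong[OF seeded_empty]) (use z in simp)
    show "?s2 9 v = (if v \<in> {} \<union> U then 1 else 0)" if "v < n" for v using used[OF that] f1[of 9] by simp
  qed (simp_all add: seed_mass_def)
  have loop: "wp w (For 55 nV try_seed) (\<lambda>k s'. k1 + k + 100 \<le> (m + 1) * 100000 \<and>
     (\<exists>A R. greedy ?M U n A R s' \<and> X \<le> seed_mass ?M A)) ?s2"
  proof (rule wp_For[where B = n and Inv = "\<lambda>i s'. \<exists>A R. greedy ?M U i A R s'" and b = "\<lambda>i. (card (nbrs G i) + 1) * 20000"])
    show "\<exists>A R. greedy ?M U 0 A R (?s2(55 := (?s2 55)(0 := 0)))"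
      by (intro exI) (rule greedy_cong[OF g0]; simp)
  next
    fix i s' assume "\<And>a. a \<noteq> 55 \<Longrightarrow> a \<notin> writes try_seed \<Longrightarrow> s' a = ?s2 a"
    then have "s' 0 = s1 0" by simp
    then show "aval nV s' = n" using envD(1)[OF s2] by simp
  next
    show "n < 2 ^ w" by (rule n_below)
  next
    fix i s' assume i: "i < n" "s' 55 0 = i" and inv: "\<exists>A R. greedy ?M U i A R s'"
      and fr: "\<And>a. a \<noteq> 55 \<Longrightarrow> a \<notin> writes try_seed \<Longrightarrow> s' a = ?s2 a"
    have s': "env s'" by (rule env_cong[OF s2]) (use fr in \<open>auto simp: env_arrays_def\<close>)
    have M': "s' 27 0 = ?M" using fr f1 M by simp
    from inv obtain A R where g: "greedy ?M U i A R s'" by (elim exE)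
    show "wp w try_seed (\<lambda>k s''. k \<le> (card (nbrs G i) + 1) * 20000 \<and> s'' 55 0 = i \<and>
      (\<exists>A R. greedy ?M U (Suc i) A R (s''(55 := (s'' 55)(0 := Suc i))))) s'"
    proof (rule wp_conseq[OF wp_try_seed[OF s' i(2,1) M' M(2) g]])
      fix k and s'' :: store
      assume *: "k \<le> (card (nbrs G i) + 1) * 20000 \<and> (\<exists>A R. greedy ?M U (Suc i) A R s'')"
        and fr2: "\<And>a. a \<notin> writes try_seed \<Longrightarrow> s'' a = s' a"
      from conjunct2[OF *] obtain A' R' where g': "greedy ?M U (Suc i) A' R' s''" by (elim exE)
      have "greedy ?M U (Suc i) A' R' (s''(55 := (s'' 55)(0 := Suc i)))" by (rule greedy_cong[OF g']) simp_all
      moreover have "s'' 55 0 = i" using fr2 i by simp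
      ultimately show "k \<le> (card (nbrs G i) + 1) * 20000 \<and> s'' 55 0 = i \<and>
        (\<exists>A R. greedy ?M U (Suc i) A R (s''(55 := (s'' 55)(0 := Suc i))))"
        using conjunct1[OF *] by (intro conjI exI)
    qed
  next
    fix k2 s3 assume inv: "\<exists>A R. greedy ?M U n A R s3"
      and k2: "k2 \<le> (\<Sum>i<n. (card (nbrs G i) + 1) * 20000) + (n + 1) * fcost nV"
    from inv obtain A R where g: "greedy ?M U n A R s3" by (elim exE)
    have "X \<le> seed_mass ?M A"
    proof (rule ccontr)
      assume "\<not> X \<le> seed_mass ?M A"
      then have lt: "seed_mass ?M A < X" by simp
      have "X \<le> seed_mass ?M A"
        by (rule seeded_progress[OF greedyD(1)[OF g] U]) (rule greedyD(7)[OF g lt])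
      then show False using lt by simp
    qed
    moreover have "k1 + k2 + 100 \<le> (m + 1) * 100000"
    proof -
      have "(\<Sum>i<n. (card (nbrs G i) + 1) * 20000) = (2 * m + n) * 20000"
        unfolding sum_distrib_right[symmetric] sum.distrib by (simp add: sum_degrees)
      then have "k2 \<le> (2 * m + n) * 20000 + (n + 1) * 200" using k2 by (simp add: fcost_def ecost_def)
      moreover have "k1 \<le> (n + 1) * 300" using k1 by (simp add: mapcost_def fcost_def ecost_def)
      ultimately show ?thesis using nm by simp
    qed
    ultimately show "k1 + k2 + 100 \<le> (m + 1) * 100000 \<and> (\<exists>A R. greedy ?M U n A R s3 \<and> X \<le> seed_mass ?M A)"
      using g by (intro conjI exI)
  qed simp
  show "wp w (Seq (Set 28 (Const 0)) (For 55 nV try_seed))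
    (\<lambda>l s'. k1 + l \<le> (m + 1) * 100000 \<and> (\<exists>A R. greedy ?M U n A R s' \<and> X \<le> seed_mass ?M A)) s1"
  proof (rule wp_Seq, rule wp_Assign, simp, simp)
    have eq: "s1(28 := (s1 28)(aval (Const 0) s1 := aval (Const 0) s1)) = ?s2" by simp
    show "wp w (For 55 nV try_seed)
      (\<lambda>l s'. k1 + (1 + ecost (Const 0) + ecost (Const 0) + l) \<le> (m + 1) * 100000 \<and>
         (\<exists>A R. greedy ?M U n A R s' \<and> X \<le> seed_mass ?M A)) (s1(28 := (s1 28)(aval (Const 0) s1 := aval (Const 0) s1)))"
      unfolding eq by (rule wp_conseq[OF loop]) (simp add: ecost_def)
  qed
qed (use s n_below in \<open>simp_all add: envD\<close>)

end

section \<open>Phases and scales\<close>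

definition phase :: com where
  "phase = If (Var 3) Skip (Seq seed walk)"

text \<open>Marks of used seeds are cleared once per scale and kept between its phases, which makes
  the seed sets within a scale disjoint.\<close>

definition scale :: com where
  "scale = Seq (MapTo 9 55 nV (Const 0)) (For 51 (Const 128) phase)"

definition scales :: com where
  "scales = Seq (Set 27 (Const 1))
     (For 50 (Add (Var 23) (Const 1)) (Seq scale (Set 27 (Mul (Const 2) (Var 27)))))"

lemma writes_phase [simp]:
  "writes phase = {8, 9, 28, 29, 40, 41, 55, 56, 52, 10, 30, 53, 12, 3, 4, 54, 31, 32, 13, 35, 11, 33, 34}"
  by (auto simp: phase_def)

lemma writes_scale [simp]:
  "writes scale = {51, 8, 9, 28, 29, 40, 41, 55, 56, 52, 10, 30, 53, 12, 3, 4, 54, 31, 32, 13, 35, 11, 33, 34}"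
  by (auto simp: scale_def)

context big_graph
begin

definition phase_cost :: nat where
  "phase_cost = (num_steps l + 3) * ((B + 3) * ((m + 1) * 110000))"

definition density :: "(nat \<Rightarrow> nat) \<Rightarrow> nat \<Rightarrow> real" where
  "density ld u = real (ld u) / real (D u)"

text \<open>Receivers and loads are existentially quantified because the next phase overwrites them
  in memory; only the seed set has to be named, for disjointness.\<close>

definition phase_ok :: "nat \<Rightarrow> nat set \<Rightarrow> bool" where
  "phase_ok M A \<longleftrightarrow> (\<exists>R ld. seeded M A R ld \<and> X \<le> (\<Sum>u<n. ld u) \<and> 2 * (\<Sum>u<n. ld u) \<le> 3 * X \<and>
     variance ((step ^^ num_steps l) (density ld)) \<le> 1 / 10 ^ 6)"

definition phases_ok :: "nat \<Rightarrow> nat \<Rightarrow> (nat \<Rightarrow> nat set) \<Rightarrow> store \<Rightarrow> bool" where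
  "phases_ok M i A s \<longleftrightarrow> s 3 0 = 0 \<and> disjoint_family_on A {..<i} \<and>
     (\<forall>k<i. phase_ok M (A k) \<and> A k \<subseteq> {..<n} \<and> vol (A k) \<le> X + 2 * n) \<and>
     (\<forall>v<n. s 9 v = (if v \<in> (\<Union>k<i. A k) then 1 else 0))"

definition scale_ok :: "nat \<Rightarrow> bool" where
  "scale_ok M \<longleftrightarrow> (\<exists>A. disjoint_family_on A {..<128::nat} \<and> (\<forall>i<128. phase_ok M (A i)))"

lemma found_upd: "x \<noteq> 3 \<Longrightarrow> x \<noteq> 4 \<Longrightarrow> found (s(x := y)) = found s"
  by (simp add: found_def)

lemma foundD: "found s \<Longrightarrow> s 3 0 = 1"
  unfolding found_def by (rule conjunct1)

lemma vol_Union_le: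
  assumes "\<And>k. k < i \<Longrightarrow> vol (A k) \<le> b" "\<And>k. k < i \<Longrightarrow> A k \<subseteq> {..<n}"
  shows "vol (\<Union>k<i. A k) \<le> i * b"
  using assms
proof (induction i)
  case (Suc i)
  have fin: "finite (A k)" if "k < Suc i" for k using Suc.prems(2)[OF that] finite_subset by blast
  have "(\<Union>k<Suc i. A k) = A i \<union> (\<Union>k<i. A k)" by (auto simp: less_Suc_eq)
  then have "vol (\<Union>k<Suc i. A k) \<le> vol (A i) + vol (\<Union>k<i. A k)"
    unfolding vol_def using sum_Un_nat[of "A i" "\<Union>k<i. A k" D] fin by simp
  also have "\<dots> \<le> b + i * b" using Suc by (intro add_mono) auto
  finally show ?case by simp
qed (simp add: vol_def)

lemma wp_phase:
  assumes s: "env s" and M: "s 27 0 = 2 ^ j" "j \<le> kX" and i: "i < 128"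
    and st: "found s \<or> phases_ok (2 ^ j) i A s"
  shows "wp w phase (\<lambda>k s'. k \<le> phase_cost \<and> (found s' \<or> (\<exists>A. phases_ok (2 ^ j) (Suc i) A s'))) s"
  unfolding phase_def
proof (rule wp_If)
  assume "aval (Var 3) s \<noteq> 0"
  then have nz: "s 3 0 \<noteq> 0" by simp
  have f: "found s"
    using st
  proof
    assume "phases_ok (2 ^ j) i A s"
    then have "s 3 0 = 0" unfolding phases_ok_def by (rule conjunct1)
    then show ?thesis using nz by (rule notE[rotated])
  qed
  have "1 + ecost (Var 3) + 1 \<le> 1 * (1 * (1 * 110000))" by (simp add: ecost_def)
  also have "\<dots> \<le> phase_cost" unfolding phase_cost_def by (intro mult_le_mono) auto
  finally show "wp w Skip (\<lambda>k s'. 1 + ecost (Var 3) + k \<le> phase_cost \<and> (found s' \<or> (\<exists>A. phases_ok (2 ^ j) (Suc i) A s'))) s"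
    using f by (intro wp_Skip conjI disjI1)
next
  let ?M = "2 ^ j :: nat"
  assume "aval (Var 3) s = 0"
  then have z: "s 3 0 = 0" by simp
  then have "\<not> found s" using foundD by fastforce
  with st have P: "phases_ok ?M i A s" by simp
  note P1 = P[unfolded phases_ok_def, THEN conjunct2]
  have Pk: "phase_ok ?M (A k)" "A k \<subseteq> {..<n}" "vol (A k) \<le> X + 2 * n" if "k < i" for k
    using P1[THEN conjunct2, THEN conjunct1, rule_format, OF that] by simp_all
  let ?U = "\<Union>k<i. A k"
  have U: "?U \<subseteq> {..<n}" using Pk(2) by blast
  \<comment> \<open>\<open>9 * n \<le> X\<close> makes \<open>128 * (X + 2 * n)\<close> less than
    \<open>200 * X\<close>, the budget of \<open>seeded_progress\<close>.\<close>
  have volU: "vol ?U \<le> 200 * X"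
  proof -
    have "vol ?U \<le> i * (X + 2 * n)" by (rule vol_Union_le) (use Pk in auto)
    also have "\<dots> \<le> 128 * (X + 2 * n)" using i by (intro mult_le_mono1) simp
    also have "\<dots> \<le> 200 * X" using X_ge by simp
    finally show ?thesis .
  qed
  show "wp w (Seq seed walk) (\<lambda>k s'. 1 + ecost (Var 3) + k \<le> phase_cost \<and> (found s' \<or> (\<exists>A. phases_ok ?M (Suc i) A s'))) s"
  proof (rule wp_Seq, rule wp_conseq[OF wp_seed[OF s M U volU]])
    show "s 9 v = (if v \<in> ?U then 1 else 0)" if "v < n" for v
      by (rule P1[THEN conjunct2, THEN conjunct2, rule_format, OF that])
  next
    fix k1 and s1 :: store
    assume *: "k1 \<le> (m + 1) * 100000 \<and> (\<exists>A R. greedy ?M ?U n A R s1 \<and> X \<le> seed_mass ?M A)"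
      and f1: "\<And>a. a \<notin> writes seed \<Longrightarrow> s1 a = s a"
    from conjunct2[OF *] obtain A' R' where g: "greedy ?M ?U n A' R' s1" and X: "X \<le> seed_mass ?M A'"
      by (elim exE conjE)
    have s1: "env s1" by (rule env_cong[OF s]) (use f1 in \<open>auto simp: env_arrays_def\<close>)
    have z1: "s1 3 0 = 0" using f1 z by simp
    note sd = greedyD(1)[OF g]
    have total: "(\<Sum>u<n. s1 8 u) = seed_mass ?M A'" by (rule seeded_mass[OF sd])
    have Z: "(\<Sum>u<n. s1 8 u) \<le> X + 2 * n" unfolding total by (rule greedyD(6)[OF g])
    have Z2: "2 * (\<Sum>u<n. s1 8 u) \<le> 3 * X" using Z X_ge by linarith
    have Zn: "(\<Sum>u<n. s1 8 u) \<le> n * n" using Z2 X_le m_less by linarith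
    have nn: "n * n \<le> 2 ^ (2 * l)"
    proof -
      have "n * n \<le> 2 ^ l * 2 ^ l" using n_bits by (intro mult_le_mono) auto
      then show ?thesis by (simp add: power_add[symmetric] mult_2)
    qed
    have small: "s1 8 u \<le> 2 ^ (2 * l)" if "u < n" for u
    proof -
      have "s1 8 u \<le> (\<Sum>u<n. s1 8 u)" by (rule member_le_sum) (use that in auto)
      then show ?thesis using Zn nn by linarith
    qed
    let ?f = "density (s1 8)"
    have "wp w walk (\<lambda>k s'. k \<le> (num_steps l + 2) * ((B + 3) * ((m + 1) * 110000)) \<and>
     (found s' \<or> s' 3 0 = 0 \<and> variance ((step ^^ num_steps l) ?f) \<le> decay ^ num_steps l * variance ?f)) s1"
      unfolding density_def[abs_def] by (rule wp_walk[OF s1 z1 refl small])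
    then show "wp w walk (\<lambda>l' s'. 1 + ecost (Var 3) + (k1 + l') \<le> phase_cost \<and>
       (found s' \<or> (\<exists>A. phases_ok ?M (Suc i) A s'))) s1"
    proof (rule wp_conseq)
      fix k and s' :: store
      assume w: "k \<le> (num_steps l + 2) * ((B + 3) * ((m + 1) * 110000)) \<and>
       (found s' \<or> s' 3 0 = 0 \<and> variance ((step ^^ num_steps l) ?f) \<le> decay ^ num_steps l * variance ?f)"
        and f2: "\<And>a. a \<notin> writes walk \<Longrightarrow> s' a = s1 a"
      have "1 + ecost (Var 3) + (k1 + k) \<le> phase_cost"
      proof -
        let ?z = "(B + 3) * ((m + 1) * 110000)"
        have "1 + ecost (Var 3) + k1 \<le> (m + 1) * 110000" using conjunct1[OF *] by (simp add: ecost_def)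
        also have "\<dots> \<le> ?z" by simp
        finally have "1 + ecost (Var 3) + (k1 + k) \<le> ?z + (num_steps l + 2) * ?z" using conjunct1[OF w] by linarith
        also have "\<dots> = phase_cost" unfolding phase_cost_def by (simp add: algebra_simps)
        finally show ?thesis .
      qed
      moreover have "found s' \<or> (\<exists>A. phases_ok ?M (Suc i) A s')"
        using conjunct2[OF w]
      proof
        assume "found s'" then show ?thesis ..
      next
        assume v: "s' 3 0 = 0 \<and> variance ((step ^^ num_steps l) ?f) \<le> decay ^ num_steps l * variance ?f"
        \<comment> \<open>The total load is at most \<open>n\<^sup>2\<close>, so the initial
          variance is at most \<open>n ^ 4\<close>, as \<open>iterated_decay_small\<close>
          requires.\<close>
        have "decay ^ num_steps l * variance ?f \<le> 1 / 10 ^ 6"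
          unfolding decay_def num_steps_def
        proof (rule iterated_decay_small[where N = "real n"])
          show "20 \<le> l" by (rule l_ge)
          have "real n \<le> real (2 ^ l)" unfolding of_nat_le_iff using n_bits by simp
          then show "real n \<le> 2 ^ l" by simp
          have "variance ?f \<le> (real (\<Sum>u<n. s1 8 u))\<^sup>2"
            unfolding density_def[abs_def] by (rule initial_variance[OF n_pos])
          also have "\<dots> \<le> (real (n * n))\<^sup>2" using Zn by (intro power_mono) (auto simp only: of_nat_le_iff of_nat_0_le_iff)
          finally show "variance ?f \<le> ((real n)\<^sup>2)\<^sup>2" by (simp add: power2_eq_square)
        qed simp
        with conjunct2[OF v] have var: "variance ((step ^^ num_steps l) ?f) \<le> 1 / 10 ^ 6" by (rule order_trans)
        have "X \<le> (\<Sum>u<n. s1 8 u)" unfolding total by (rule X)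
        then have ok: "phase_ok ?M A'"
          unfolding phase_ok_def using sd Z2 var by (intro exI conjI)
        have An: "A' \<subseteq> {..<n}" by (rule seeded_subset[OF sd])
        have vA: "vol A' \<le> X + 2 * n" using vol_le_seed_mass[OF An, of j] greedyD(6)[OF g] by linarith
        let ?A = "A(i := A')"
        have Un: "(\<Union>k<Suc i. ?A k) = A' \<union> ?U" by (auto simp: less_Suc_eq)
        have "phases_ok ?M (Suc i) ?A s'"
          unfolding phases_ok_def
        proof (intro conjI allI impI)
          show "s' 3 0 = 0" by (rule conjunct1[OF v])
          have d: "disjoint_family_on A {..<i}" by (rule P1[THEN conjunct1])
          show "disjoint_family_on ?A {..<Suc i}"
            unfolding disjoint_family_on_def
          proof (intro ballI impI)
            fix a b assume ab: "a \<in> {..<Suc i}" "b \<in> {..<Suc i}" "a \<noteq> b"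
            have e: "A' \<inter> A k = {}" if "k < i" for k using greedyD(3)[OF g] that by blast
            show "?A a \<inter> ?A b = {}"
            proof (cases "a = i")
              case True
              then have "b < i" using ab by simp
              then show ?thesis using e[of b] True ab by simp
            next
              case False
              then have a: "a < i" using ab by simp
              show ?thesis
              proof (cases "b = i")
                case True
                then show ?thesis using e[OF a] a by (simp add: Int_commute)
              next
                case False
                then show ?thesis using disjoint_family_onD[OF d, of a b] a ab by simp
              qed
            qed
          qed
          fix k assume k: "k < Suc i"
          show "phase_ok ?M (?A k)" "?A k \<subseteq> {..<n}" "vol (?A k) \<le> X + 2 * n"
            using Pk[of k] ok An vA k by (cases "k = i"; simp)+
        next
          fix v assume v: "v < n"
          have "s' 9 = s1 9" using f2 by simp
          then show "s' 9 v = (if v \<in> (\<Union>k<Suc i. ?A k) then 1 else 0)"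
            unfolding Un using greedyD(4)[OF g v] by simp
        qed
        then show ?thesis by (intro disjI2 exI)
      qed
      ultimately show "1 + ecost (Var 3) + (k1 + k) \<le> phase_cost \<and> (found s' \<or> (\<exists>A. phases_ok ?M (Suc i) A s'))"
        by (rule conjI)
    qed
  qed
qed simp

lemma wp_scale:
  assumes s: "env s" and M: "s 27 0 = 2 ^ j" "j \<le> kX" and st: "found s \<or> s 3 0 = 0"
  shows "wp w scale (\<lambda>k s'. k \<le> 200 * phase_cost \<and> (found s' \<or> s 3 0 = 0 \<and> s' 3 0 = 0 \<and> scale_ok (2 ^ j))) s"
  unfolding scale_def
proof (rule wp_Seq, rule wp_MapTo[where B = n and g = "\<lambda>u. 0"])
  let ?M = "2 ^ j :: nat"
  have pc: "(m + 1) * 110000 \<le> phase_cost" unfolding phase_cost_def by simp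
  have nm: "n \<le> m" using m_ge by linarith
  fix k1 s1 assume z: "\<And>u. u < n \<Longrightarrow> s1 9 u = 0" and f1: "\<And>a. a \<noteq> 9 \<Longrightarrow> a \<noteq> 55 \<Longrightarrow> s1 a = s a"
    and k1: "k1 \<le> (n + 1) * mapcost nV (Const 0)"
  have s1: "env s1" by (rule env_cong[OF s]) (use f1 in \<open>auto simp: env_arrays_def\<close>)
  have fd1: "found s1 = found s" using f1[of 3] f1[of 4] by (simp add: found_def)
  define I where "I i s' \<longleftrightarrow> found s' \<or> s 3 0 = 0 \<and> (\<exists>A. phases_ok ?M i A s')" for i and s' :: store
  have I_upd: "I i (s'(51 := x)) = I i s'" for i x and s' :: store
    unfolding I_def phases_ok_def by (simp add: found_upd)
  show "wp w (For 51 (Const 128) phase) (\<lambda>l' s'. k1 + l' \<le> 200 * phase_cost \<and>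
     (found s' \<or> s 3 0 = 0 \<and> s' 3 0 = 0 \<and> scale_ok ?M)) s1"
  proof (rule wp_below, rule wp_For_uniform[where B = 128 and Inv = I and b = phase_cost])
    show "I 0 (s1(51 := (s1 51)(0 := 0)))"
      unfolding I_upd unfolding I_def
      using st
    proof
      assume "found s" then show "found s1 \<or> s 3 0 = 0 \<and> (\<exists>A. phases_ok ?M 0 A s1)" using fd1 by simp
    next
      assume s0: "s 3 0 = 0"
      have "phases_ok ?M 0 (\<lambda>_. {}) s1"
        unfolding phases_ok_def using s0 f1[of 3] z by (simp add: disjoint_family_on_def)
      then show "found s1 \<or> s 3 0 = 0 \<and> (\<exists>A. phases_ok ?M 0 A s1)" using s0 by (intro disjI2 conjI exI)
    qed
  next
    assume "cells_below w s1"
    then show "(128::nat) < 2 ^ w" by (rule small_below) simp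
  next
    fix i s' assume i: "i < 128" "s' 51 0 = i" and inv: "I i s'"
      and fr: "\<And>a. a \<noteq> 51 \<Longrightarrow> a \<notin> writes phase \<Longrightarrow> s' a = s1 a"
    have s': "env s'" by (rule env_cong[OF s1]) (use fr in \<open>auto simp: env_arrays_def\<close>)
    have M': "s' 27 0 = ?M" using fr f1 M by simp
    have "\<exists>A. found s' \<or> phases_ok ?M i A s'"
      using inv unfolding I_def
      by (elim disjE conjE exE) (rule exI, erule disjI1, rule exI, erule disjI2)
    then obtain A where A: "found s' \<or> phases_ok ?M i A s'" ..
    have s0: "found s' \<or> s 3 0 = 0" using inv unfolding I_def by (elim disjE conjE exE) simp_all
    show "wp w phase (\<lambda>k s''. k \<le> phase_cost \<and> s'' 51 0 = i \<and> I (Suc i) (s''(51 := (s'' 51)(0 := Suc i)))) s'"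
      unfolding I_upd
    proof (cases "found s'")
      case False
      then have s0': "s 3 0 = 0" using s0 by simp
      show "wp w phase (\<lambda>k s''. k \<le> phase_cost \<and> s'' 51 0 = i \<and> I (Suc i) s'') s'"
      proof (rule wp_conseq[OF wp_phase[OF s' M' M(2) i(1) A]])
        fix k and s'' :: store
        assume *: "k \<le> phase_cost \<and> (found s'' \<or> (\<exists>A. phases_ok ?M (Suc i) A s''))"
          and fr2: "\<And>a. a \<notin> writes phase \<Longrightarrow> s'' a = s' a"
        have "s'' 51 0 = i" using fr2 i by simp
        moreover have "I (Suc i) s''" unfolding I_def using conjunct2[OF *] s0' by (elim disjE) simp_all
        ultimately show "k \<le> phase_cost \<and> s'' 51 0 = i \<and> I (Suc i) s''"
          using conjunct1[OF *] by (intro conjI)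
      qed
    next
      case True
      then have nz: "aval (Var 3) s' \<noteq> 0" using foundD by fastforce
      show "wp w phase (\<lambda>k s''. k \<le> phase_cost \<and> s'' 51 0 = i \<and> I (Suc i) s'') s'"
        unfolding phase_def
      proof (rule wp_If)
        have "1 + ecost (Var 3) + 1 \<le> phase_cost" using pc by (simp add: ecost_def)
        then show "wp w Skip (\<lambda>k s''. 1 + ecost (Var 3) + k \<le> phase_cost \<and> s'' 51 0 = i \<and> I (Suc i) s'') s'"
          using True i(2) unfolding I_def by (intro wp_Skip conjI disjI1)
      qed (use nz in simp_all)
    qed
  next
    fix k2 s2 assume inv: "I 128 s2" and k2: "k2 \<le> (128 + 1) * (phase_cost + fcost (Const 128))"
    have "k1 + k2 \<le> 200 * phase_cost"
    proof -
      have "k1 \<le> (m + 1) * 1000" using k1 nm by (simp add: mapcost_def fcost_def ecost_def)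
      moreover have "k2 \<le> 129 * phase_cost + 129 * 200" using k2 by (simp add: fcost_def ecost_def)
      moreover have "a + b \<le> 200 * p" if "a \<le> z * 1000" "b \<le> 129 * p + 129 * 200" "z * 110000 \<le> p" "1 \<le> z" for a b p z :: nat
        using that by linarith
      ultimately show ?thesis using pc le_add2[of 1 m] by metis
    qed
    moreover have "found s2 \<or> s 3 0 = 0 \<and> s2 3 0 = 0 \<and> scale_ok ?M"
      using inv unfolding I_def
    proof (elim disjE conjE exE)
      assume "found s2" then show ?thesis ..
    next
      fix A assume s0: "s 3 0 = 0" and P: "phases_ok ?M 128 A s2"
      note P1 = P[unfolded phases_ok_def]
      have "scale_ok ?M"
        unfolding scale_ok_def
      proof (intro exI conjI allI impI)
        show "disjoint_family_on A {..<128}" by (rule P1[THEN conjunct2, THEN conjunct1])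
        show "phase_ok ?M (A i)" if "i < 128" for i
          by (rule P1[THEN conjunct2, THEN conjunct2, THEN conjunct1, rule_format, OF that, THEN conjunct1])
      qed
      then show ?thesis using s0 P1[THEN conjunct1] by (intro disjI2 conjI)
    qed
    ultimately show "k1 + k2 \<le> 200 * phase_cost \<and> (found s2 \<or> s 3 0 = 0 \<and> s2 3 0 = 0 \<and> scale_ok ?M)"
      by (rule conjI)
  qed simp_all
qed (use s n_below in \<open>simp_all add: envD\<close>)

definition total_cost :: nat where
  "total_cost = (kX + 2) * (300 * phase_cost)"

lemma wp_scales:
  assumes s: "env s" and z: "s 3 0 = 0"
  shows "wp w scales (\<lambda>k s'. k \<le> total_cost \<and> (found s' \<or> s' 3 0 = 0 \<and> (\<forall>j\<le>kX. scale_ok (2 ^ j)))) s"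
  unfolding scales_def
proof (rule wp_below, rule wp_Seq, rule wp_Assign, simp)
  assume cb: "cells_below w s"
  show "aval (Const 1) s < 2 ^ w" using small_below[OF cb, of 1] by simp
  let ?s1 = "s(27 := (s 27)(aval (Const 0) s := aval (Const 1) s))"
  have s1: "env ?s1" by (rule env_cong[OF s]) (auto simp: env_arrays_def)
  have "1 * (1 * (1 * 110000)) \<le> phase_cost" unfolding phase_cost_def by (intro mult_le_mono) auto
  then have pc: "110000 \<le> phase_cost" by simp
  have X2: "(2::nat) * 2 ^ j < 2 ^ w" if "j < kX + 1" for j
  proof -
    have "2 ^ j \<le> X" unfolding X_pow using that by (intro power_increasing) auto
    then show ?thesis by (intro poly_below) linarith
  qed
  have kw: "kX + 1 < 2 ^ w"
  proof -
    have "kX < X" unfolding X_pow by (rule less_exp)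
    then show ?thesis by (intro poly_below) linarith
  qed
  define I where "I j s' \<longleftrightarrow> s' 27 0 = 2 ^ j \<and> (found s' \<or> s' 3 0 = 0 \<and> (\<forall>i<j. scale_ok (2 ^ i)))"
    for j and s' :: store
  have I_upd: "I j (s'(50 := x)) = I j s'" for j x and s' :: store
    unfolding I_def by (simp add: found_upd)
  let ?N = "Add (Var 23) (Const 1)" and ?body = "Seq scale (Set 27 (Mul (Const 2) (Var 27)))"
  show "wp w (For 50 ?N ?body) (\<lambda>l' s'. 1 + ecost (Const 0) + ecost (Const 1) + l' \<le> total_cost \<and>
     (found s' \<or> s' 3 0 = 0 \<and> (\<forall>j\<le>kX. scale_ok (2 ^ j)))) ?s1"
  proof (rule wp_For_uniform[where B = "kX + 1" and Inv = I and b = "200 * phase_cost + 100"])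
    show "I 0 (?s1(50 := (?s1 50)(0 := 0)))"
      unfolding I_upd unfolding I_def using z by simp
  next
    fix i s' assume "\<And>a. a \<noteq> 50 \<Longrightarrow> a \<notin> writes ?body \<Longrightarrow> s' a = ?s1 a"
    then have "s' 23 = s 23" by simp
    then show "aval ?N s' = kX + 1" using s by (simp add: envD)
  next
    show "kX + 1 < 2 ^ w" by (rule kw)
  next
    fix j s' assume j: "j < kX + 1" "s' 50 0 = j" and inv: "I j s'"
      and fr: "\<And>a. a \<noteq> 50 \<Longrightarrow> a \<notin> writes ?body \<Longrightarrow> s' a = ?s1 a"
    have s': "env s'" by (rule env_cong[OF s1]) (use fr in \<open>auto simp: env_arrays_def\<close>)
    have M: "s' 27 0 = 2 ^ j" using inv unfolding I_def by (rule conjunct1)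
    have st: "found s' \<or> s' 3 0 = 0 \<and> (\<forall>i<j. scale_ok (2 ^ i))" using inv unfolding I_def by (rule conjunct2)
    then have st': "found s' \<or> s' 3 0 = 0" by (elim disjE conjE) simp_all
    have jk: "j \<le> kX" using j by simp
    show "wp w ?body (\<lambda>k s''. k \<le> 200 * phase_cost + 100 \<and> s'' 50 0 = j \<and> I (Suc j) (s''(50 := (s'' 50)(0 := Suc j)))) s'"
      unfolding I_upd
    proof (rule wp_Seq, rule wp_conseq[OF wp_scale[OF s' M jk st']])
      fix k1 and s2 :: store
      assume *: "k1 \<le> 200 * phase_cost \<and> (found s2 \<or> s' 3 0 = 0 \<and> s2 3 0 = 0 \<and> scale_ok (2 ^ j))"
        and f2: "\<And>a. a \<notin> writes scale \<Longrightarrow> s2 a = s' a"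
      let ?s3 = "s2(27 := (s2 27)(0 := 2 * 2 ^ j))"
      have M2: "s2 27 0 = 2 ^ j" "s2 50 0 = j" using f2[of 27] f2[of 50] M j by simp_all
      have "I (Suc j) ?s3"
        unfolding I_def
      proof
        show "?s3 27 0 = 2 ^ Suc j" by simp
        show "found ?s3 \<or> ?s3 3 0 = 0 \<and> (\<forall>i<Suc j. scale_ok (2 ^ i))"
          using conjunct2[OF *]
        proof
          assume "found s2" then show ?thesis by (simp add: found_upd)
        next
          assume c: "s' 3 0 = 0 \<and> s2 3 0 = 0 \<and> scale_ok (2 ^ j)"
          have "\<not> found s'" using conjunct1[OF c] foundD by fastforce
          with st have "\<forall>i<j. scale_ok (2 ^ i)" by simp
          then show ?thesis using c by (auto simp: less_Suc_eq)
        qed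
      qed
      moreover have "s2(27 := (s2 27)(aval (Const 0) s2 := aval (Mul (Const 2) (Var 27)) s2)) = ?s3"
        using M2 by simp
      ultimately show "wp w (Set 27 (Mul (Const 2) (Var 27)))
         (\<lambda>l' s''. k1 + l' \<le> 200 * phase_cost + 100 \<and> s'' 50 0 = j \<and> I (Suc j) s'') s2"
        by (intro wp_Assign) (use M2 X2[OF j(1)] conjunct1[OF *] in \<open>simp_all add: ecost_def\<close>)
    qed
  next
    fix k s' assume inv: "I (kX + 1) s'" and k: "k \<le> (kX + 1 + 1) * (200 * phase_cost + 100 + fcost ?N)"
    have "1 + ecost (Const 0) + ecost (Const 1) + k \<le> total_cost"
    proof -
      have "200 * phase_cost + 100 + fcost ?N + 10 \<le> 300 * phase_cost"
        using pc by (simp add: fcost_def ecost_def)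
      then have "(kX + 2) * (200 * phase_cost + 100 + fcost ?N + 10) \<le> total_cost"
        unfolding total_cost_def by (rule mult_le_mono2)
      moreover have "(kX + 2) * (200 * phase_cost + 100 + fcost ?N + 10) =
         (kX + 1 + 1) * (200 * phase_cost + 100 + fcost ?N) + (kX + 2) * 10" by (simp add: algebra_simps)
      moreover have "1 + ecost (Const 0) + ecost (Const 1) \<le> (kX + 2) * 10" by (simp add: ecost_def)
      ultimately show ?thesis using k by linarith
    qed
    moreover have "found s' \<or> s' 3 0 = 0 \<and> (\<forall>j\<le>kX. scale_ok (2 ^ j))"
      using inv[unfolded I_def, THEN conjunct2]
    proof
      assume "found s'" then show ?thesis ..
    next
      assume c: "s' 3 0 = 0 \<and> (\<forall>i<kX + 1. scale_ok (2 ^ i))"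
      then have "\<forall>j\<le>kX. scale_ok (2 ^ j)" by simp
      then show ?thesis using conjunct1[OF c] by (intro disjI2 conjI)
    qed
    ultimately show "1 + ecost (Const 0) + ecost (Const 1) + k \<le> total_cost \<and>
     (found s' \<or> s' 3 0 = 0 \<and> (\<forall>j\<le>kX. scale_ok (2 ^ j)))" by (rule conjI)
  qed simp
qed

section \<open>Certification by completed scales\<close>

lemma seeded_seeding:
  assumes s: "seeded (2 ^ j) A R ld"
  shows "seeding (2 ^ j) A R (inc (2 ^ j)) ld"
  unfolding seeding_def
proof (intro conjI ballI allI impI)
  show A: "A \<subseteq> {..<n}" by (rule seeded_subset[OF s])
  fix v assume v: "v \<in> A"
  show "R v \<subseteq> nbrs G v" using seeded_targets[OF s v] by simp
  have "v < n" using v A by blast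
  then show "2 ^ j dvd inc (2 ^ j) v * card (R v)" using dvd_inc_share seeded_targets[OF s v] by simp
next
  show "ld u = (\<Sum>v\<in>A. if u \<in> R v then inc (2 ^ j) v else 0)" if "u < n" for u
    by (rule seeded_load[OF s that])
qed

text \<open>The scale suited to \<open>T\<close> is the least power of two that is at least
  \<open>2 * vol T * X / vol {..<n}\<close>. It is at most \<open>X\<close> because \<open>T\<close>
  has at most half of the volume, and \<open>vol T \<ge> 20000\<close> keeps the quotient above 1;
  so it is one of the scales that were tried.\<close>

lemma scales_certify:
  assumes ok: "\<And>j. j \<le> kX \<Longrightarrow> scale_ok (2 ^ j)"
    and T: "T \<subseteq> {..<n}" "crossing T \<le> \<delta>" "\<delta>\<^sup>2 \<le> vol T" "2 * vol T \<le> vol {..<n}"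
  shows False
proof -
  let ?V = "vol {..<n}"
  have V: "?V < 4096 * X" using vol_bounds(2) X_gt by linarith
  have dX: "20000 * X \<le> vol T * X"
  proof -
    have "20000 * 1 \<le> \<delta> * \<delta>" using \<delta>_big by (intro mult_le_mono) auto
    then have "20000 \<le> vol T" using T(3) by (simp add: power2_eq_square)
    then show ?thesis by (rule mult_le_mono1)
  qed
  have "2 * (vol T * X) \<le> 2 ^ kX * ?V"
  proof -
    have "2 * vol T * X \<le> ?V * X" using T(4) by (rule mult_le_mono1)
    then show ?thesis by (simp add: X_pow[symmetric] mult.commute mult.left_commute)
  qed
  moreover have "?V < 2 * (2 * (vol T * X))" using V dX by linarith
  ultimately obtain j where j: "j \<le> kX" "2 * (vol T * X) \<le> 2 ^ j * ?V" "2 ^ j * ?V < 4 * (vol T * X)"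
    using dyadic_scale by blast
  from ok[OF j(1)] obtain A where A: "disjoint_family_on A {..<128::nat}" "\<And>i. i < 128 \<Longrightarrow> phase_ok (2 ^ j) (A i)"
    unfolding scale_ok_def by blast
  define P where "P i R ld \<longleftrightarrow> seeded (2 ^ j) (A i) R ld \<and> X \<le> (\<Sum>u<n. ld u) \<and> 2 * (\<Sum>u<n. ld u) \<le> 3 * X \<and>
     variance ((step ^^ num_steps l) (density ld)) \<le> 1 / 10 ^ 6" for i R ld
  have "\<forall>i. \<exists>R ld. i < 128 \<longrightarrow> P i R ld"
    using A(2) unfolding phase_ok_def P_def[symmetric] by blast
  then obtain R ld where "\<And>i. i < 128 \<Longrightarrow> P i (R i) (ld i)" by metis
  then have P: "seeded (2 ^ j) (A i) (R i) (ld i)" "X \<le> (\<Sum>u<n. ld i u)" "2 * (\<Sum>u<n. ld i u) \<le> 3 * X"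
     "variance ((step ^^ num_steps l) (density (ld i))) \<le> 1 / 10 ^ 6" if "i < 128" for i
    using that unfolding P_def by simp_all
  show False
  proof (rule scale_refutes_cut[where A = A and ld = ld and R = R and M = "2 ^ j" and X = X and \<Delta> = \<Delta>
        and \<delta> = \<delta> and \<tau> = "num_steps l" and T = T and inc = "inc (2 ^ j)"])
    fix i :: nat assume i: "i < 128"
    show "seeding (2 ^ j) (A i) (R i) (inc (2 ^ j)) (ld i)" by (rule seeded_seeding[OF P(1)[OF i]])
    show "ld i u * \<Delta>\<^sup>2 \<le> 6 * (2 ^ j + \<Delta>\<^sup>2) * D u" if "u < n" for u by (rule seeded_cap[OF P(1)[OF i] that])
    show "X \<le> (\<Sum>u<n. ld i u) \<and> 2 * (\<Sum>u<n. ld i u) \<le> 3 * X" using P(2,3)[OF i] ..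
    show "variance ((step ^^ num_steps l) (\<lambda>u. real (ld i u) / real (D u))) \<le> 1 / 10 ^ 6"
      using P(4)[OF i] unfolding density_def[abs_def] .
  next
    show "\<delta> \<le> D u" if "u < n" for u using \<delta>_le[OF that] D_ge[OF that] by linarith
    show "2 * vol T * X \<le> 2 ^ j * ?V" "2 ^ j * ?V < 4 * vol T * X" using j(2,3) by (simp_all add: mult.assoc)
  qed (rule A T V \<delta>_ge \<delta>_big \<Delta>_ge inc_le)+
qed

text \<open>The volume estimates hold for both sides of a nontrivial min-cut, and one of the sides
  has at most half of the volume.\<close>

lemma no_nontrivial_min_cut:
  assumes ok: "\<And>j. j \<le> kX \<Longrightarrow> scale_ok (2 ^ j)"
  shows "\<not> (\<exists>U. min_cut (verts G) (edges G) U \<and> nontrivial_cut (verts G) U)"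
proof
  assume "\<exists>U. min_cut (verts G) (edges G) U \<and> nontrivial_cut (verts G) U"
  then obtain U where U: "min_cut (verts G) (edges G) U" "nontrivial_cut (verts G) U" by blast
  have UV: "U \<subseteq> {..<n}" using U(2) by (auto simp: nontrivial_cut_def is_cut_def verts_def n_def)
  have V: "verts G = {..<n}" by (simp add: verts_def n_def)
  have pos: "0 < \<delta>" using \<delta>_big by linarith
  have side: False if S: "S = U \<or> S = verts G - U" and half: "2 * vol S \<le> vol {..<n}" for S
  proof (rule scales_certify[OF ok])
    note nv = nontrivial_min_cut_volume[OF G U \<delta>_def pos S]
    show Sn: "S \<subseteq> {..<n}" using S UV V by auto
    show "crossing S \<le> \<delta>" unfolding crossing_def by (rule nv(1))
    have "(\<Sum>u\<in>S. card (nbrs G u)) \<le> vol S"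
      unfolding vol_def by (rule sum_mono) (use D_ge Sn in auto)
    then show "\<delta>\<^sup>2 \<le> vol S" using nv(2) by linarith
  qed (use half in simp_all)
  have "vol {..<n} = vol ({..<n} - U) + vol U"
    unfolding vol_def by (rule sum.subset_diff) (use UV in auto)
  then have "2 * vol U \<le> vol {..<n} \<or> 2 * vol (verts G - U) \<le> vol {..<n}" unfolding V by linarith
  then show False using side by blast
qed

text \<open>Passing from \<open>D\<close> to degrees costs a factor of at most 2 in the volume,
  which the 2 in \<open>sparse_set\<close> compensates. The complement is nonempty as its volume is
  at least that of \<open>S\<close>, which is positive.\<close>

lemma good_cut_conductance:
  assumes S: "good_cut S"
  shows "is_cut (verts G) S" "conductance (verts G) (edges G) S \<le> 1 / real (l\<^sup>2)"
proof -
  have V: "verts G = {..<n}" by (simp add: verts_def n_def)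
  have Sn: "S \<subseteq> {..<n}" and cr: "l\<^sup>2 * (2 * crossing S) < vol S" and half: "2 * vol S \<le> vol {..<n}"
    using S by (auto simp: good_cut_def sparse_set_def)
  have split: "vol {..<n} = vol ({..<n} - S) + vol S"
    unfolding vol_def by (rule sum.subset_diff) (use Sn in auto)
  have vS: "0 < vol S" using cr by linarith
  have vC: "vol S \<le> vol ({..<n} - S)" using split half by linarith
  show "is_cut (verts G) S"
    unfolding is_cut_def V using Sn vS vC by (auto simp: vol_def)
  have dv: "vol W \<le> 2 * volume (edges G) W" if "W \<subseteq> {..<n}" for W
    unfolding vol_def volume_def sum_distrib_left degree_nbrs[OF G] by (rule sum_mono) (use D_le that in auto)
  let ?m = "min (volume (edges G) S) (volume (edges G) (verts G - S))"
  have mn: "vol S \<le> 2 * ?m"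
    using dv[OF Sn] dv[of "{..<n} - S"] vC unfolding V by (auto simp: min_def)
  have "card (edge_boundary (verts G) (edges G) S) = crossing S"
    unfolding crossing_def by (rule boundary_arcs[OF G]) (use Sn V in simp)
  moreover have "real (crossing S) / real ?m \<le> 1 / real (l\<^sup>2)"
  proof -
    have "l\<^sup>2 * (2 * crossing S) \<le> 2 * ?m" using cr mn by linarith
    then have "l\<^sup>2 * crossing S \<le> ?m" by linarith
    then have "real (l\<^sup>2 * crossing S) \<le> real ?m" by (simp only: of_nat_le_iff)
    moreover have "0 < ?m" using mn vS by linarith
    then have "0 < real ?m" by (simp only: of_nat_0_less_iff)
    moreover have "0 < real (l\<^sup>2)" using l_ge by simp
    ultimately show ?thesis by (simp add: field_simps)
  qed
  ultimately show "conductance (verts G) (edges G) S \<le> 1 / real (l\<^sup>2)" by (simp add: conductance_def)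
qed

end

section \<open>Preparation of the parameters\<close>

text \<open>\<open>DoubleTo\<close> stops at a strict inequality, so the degree minus one is passed
  in order to obtain the least power of two that is at least the degree.\<close>

definition degree_powers :: com where
  "degree_powers = For 55 nV (Seq
     (DoubleTo 40 41 56 (Var 20) (Const 1) (Sub (Read 5 (Var 55)) (Const 1)))
     (Assign 7 (Var 55) (Var 40)))"

text \<open>Once more \<open>x - (x - y)\<close> computes the smaller of \<open>x\<close> and
  \<open>y\<close>.\<close>

definition minimum :: com where
  "minimum = Seq (Set 24 (Read 7 (Const 0)))
     (For 55 nV (Set 24 (Sub (Var 24) (Sub (Var 24) (Read 7 (Var 55))))))"

definition parameters :: com where
  "parameters = Seq (Set 36 (Mul (Const 4) (Var 21)))
     (Seq (Set 37 (Mul (Const 80) (Mul (Var 20) (Mul (Var 20) (Mul (Var 20) (Mul (Var 20) (Var 20)))))))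
     (Seq (Set 38 (Mul (Const 2) (Mul (Add (Var 20) (Const 2)) (Add (Var 37) (Const 3)))))
       (DoubleTo 25 40 55 (Var 38) (Const 0) (Const 0))))"

definition prepare :: com where
  "prepare = Seq setup_adj (Seq (DoubleTo 21 20 55 nV (Const 1) nV) (Seq degree_powers (Seq minimum
     (Seq (SumTo 26 55 nV (Read 7 (Var 55))) (Seq (DoubleTo 22 23 55 mV (Const 1024) mV) parameters)))))"

lemma writes_setup_parts [simp]:
  "writes degree_powers = {55, 56, 40, 41, 7}" "writes minimum = {24, 55}"
  "writes parameters = {36, 37, 38, 25, 40, 55}"
  by (auto simp: degree_powers_def minimum_def parameters_def)

lemma wp_Seq_Set:
  assumes "small_consts e" and "aval e s = v" and "v < 2 ^ w"
    and "wp w d (\<lambda>l. Q (1 + ecost (Const 0) + ecost e + l)) (s(x := (s x)(0 := v)))"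
  shows "wp w (Seq (Set x e) d) Q s"
  by (rule wp_Seq, rule wp_Assign) (use assms in simp_all)

context base_graph
begin

lemma wp_degree_powers:
  assumes s: "s 0 0 = n" "s 20 0 = l" "adj_ready G s"
  shows "wp w degree_powers (\<lambda>k s'. k \<le> (n + 1) * ((l + 1) * 10000) \<and>
     (\<forall>u<n. (\<exists>j. s' 7 u = 2 ^ j) \<and> card (nbrs G u) \<le> s' 7 u \<and> s' 7 u \<le> 2 * card (nbrs G u))) s"
  unfolding degree_powers_def
proof (rule wp_For_uniform[where B = n and b = "(l + 1) * 9000" and
      Inv = "\<lambda>i s'. \<forall>u<i. (\<exists>j. s' 7 u = 2 ^ j) \<and> card (nbrs G u) \<le> s' 7 u \<and> s' 7 u \<le> 2 * card (nbrs G u)"])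
  let ?d = "DoubleTo 40 41 56 (Var 20) (Const 1) (Sub (Read 5 (Var 55)) (Const 1))"
  let ?ok = "\<lambda>u x. (\<exists>j. x = 2 ^ j) \<and> card (nbrs G u) \<le> x \<and> x \<le> 2 * card (nbrs G u)"
  fix i s' assume fr: "\<And>a. a \<noteq> 55 \<Longrightarrow> a \<notin> writes (Seq ?d (Assign 7 (Var 55) (Var 40))) \<Longrightarrow> s' a = s a"
  then have f0: "s' 0 = s 0" "s' 20 = s 20" "s' 5 = s 5" by simp_all
  then show "aval nV s' = n" using s by simp
  assume i: "i < n" "s' 55 0 = i" and inv: "\<forall>u<i. ?ok u (s' 7 u)"
  have deg: "s' 5 i = card (nbrs G i)" using s(3) i(1) f0 by (simp add: adj_ready_def n_def)
  show "wp w (Seq ?d (Assign 7 (Var 55) (Var 40))) (\<lambda>k s''. k \<le> (l + 1) * 9000 \<and> s'' 55 0 = i \<and>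
    (\<forall>u<Suc i. ?ok u ((s''(55 := (s'' 55)(0 := Suc i))) 7 u))) s'"
  proof (rule wp_Seq, rule wp_DoubleTo[where B = l and C = 1 and E = "card (nbrs G i) - 1"])
    fix s'' assume f: "\<And>a. a \<noteq> 40 \<Longrightarrow> a \<noteq> 41 \<Longrightarrow> a \<noteq> 56 \<Longrightarrow> s'' a = s' a"
    show "aval (Var 20) s'' = l \<and> aval (Const 1) s'' = 1 \<and>
      aval (Sub (Read 5 (Var 55)) (Const 1)) s'' = card (nbrs G i) - 1"
      using f[of 20] f[of 5] f[of 55] f0 s i deg by simp
  next
    show "l < 2 ^ w" using less_exp[of l] n_bits(2) n_le_pow(2) by (intro below_w_poly) linarith
    show "2 * (card (nbrs G i) - 1) < 2 ^ w"
      using card_nbrs_less[OF i(1)] n_le_pow(2) by (intro below_w_poly) linarith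
  next
    fix t s'' j
    assume v: "s'' 40 0 = 2 ^ j" and j: "j = 0 \<or> 1 * 2 ^ j \<le> 2 * (card (nbrs G i) - 1)"
      "j = l \<or> card (nbrs G i) - 1 < 1 * 2 ^ j"
      and f: "\<And>a. a \<noteq> 40 \<Longrightarrow> a \<noteq> 41 \<Longrightarrow> a \<noteq> 56 \<Longrightarrow> s'' a = s' a"
      and t: "t \<le> (l + 1) * doublecost (Var 20) (Const 1) (Sub (Read 5 (Var 55)) (Const 1))"
    have d: "1 \<le> card (nbrs G i)" using \<delta>_le[OF i(1)] \<delta>_big by linarith
    have ok: "?ok i (2 ^ j)"
    proof (intro conjI exI)
      show "card (nbrs G i) \<le> 2 ^ j"
        using j(2)
      proof
        assume "j = l" then show ?thesis using card_nbrs_less[OF i(1)] n_bits(1) by simp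
      qed simp
      show "2 ^ j \<le> 2 * card (nbrs G i)" using j(1) d by (elim disjE) simp_all
    qed simp
    have "(2::nat) ^ j \<le> n ^ 8"
      using ok card_nbrs_less[OF i(1)] n_le_pow(2) by linarith
    then have jw: "(2::nat) ^ j < 2 ^ w" by (rule below_w_poly)
    have "doublecost (Var 20) (Const 1) (Sub (Read 5 (Var 55)) (Const 1)) \<le> 8000"
      by (simp add: doublecost_def fcost_def ecost_def)
    then have "t \<le> (l + 1) * 8000" using t mult_le_mono2 le_trans by blast
    then have k: "t + (1 + ecost (Var 55) + ecost (Var 40)) \<le> (l + 1) * 9000"
      by (simp add: ecost_def)
    show "wp w (Assign 7 (Var 55) (Var 40)) (\<lambda>la s''. t + la \<le> (l + 1) * 9000 \<and> s'' 55 0 = i \<and>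
      (\<forall>u<Suc i. ?ok u ((s''(55 := (s'' 55)(0 := Suc i))) 7 u))) s''"
    proof (rule wp_Assign)
      show "aval (Var 40) s'' < 2 ^ w" using v jw by simp
      have "s'' 7 = s' 7" "s'' 55 0 = i" using f i by simp_all
      then show "t + (1 + ecost (Var 55) + ecost (Var 40)) \<le> (l + 1) * 9000 \<and>
        (s''(7 := (s'' 7)(aval (Var 55) s'' := aval (Var 40) s''))) 55 0 = i \<and>
        (\<forall>u<Suc i. ?ok u (((s''(7 := (s'' 7)(aval (Var 55) s'' := aval (Var 40) s'')))
           (55 := ((s''(7 := (s'' 7)(aval (Var 55) s'' := aval (Var 40) s''))) 55)(0 := Suc i))) 7 u))"
        using k v inv ok less_antisym by auto
    qed simp
  qed simp_all
next
  fix k s' assume k: "k \<le> (n + 1) * ((l + 1) * 9000 + fcost nV)"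
    and inv: "\<forall>u<n. (\<exists>j. s' 7 u = 2 ^ j) \<and> card (nbrs G u) \<le> s' 7 u \<and> s' 7 u \<le> 2 * card (nbrs G u)"
  have "(l + 1) * 9000 + fcost nV \<le> (l + 1) * 10000" by (simp add: fcost_def ecost_def)
  then have "k \<le> (n + 1) * ((l + 1) * 10000)" using k mult_le_mono2 le_trans by blast
  then show "k \<le> (n + 1) * ((l + 1) * 10000) \<and>
     (\<forall>u<n. (\<exists>j. s' 7 u = 2 ^ j) \<and> card (nbrs G u) \<le> s' 7 u \<and> s' 7 u \<le> 2 * card (nbrs G u))"
    using inv by (rule conjI)
qed (use n_below in simp_all)

lemma wp_minimum:
  assumes s: "s 0 0 = n"
  shows "wp w minimum (\<lambda>k s'. k \<le> (n + 1) * 10000 \<and> (\<forall>u<n. s' 24 0 \<le> s 7 u) \<and> (\<exists>u<n. s' 24 0 = s 7 u)) s"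
proof (rule wp_below)
  assume cb: "cells_below w s"
  let ?b = "Set 24 (Sub (Var 24) (Sub (Var 24) (Read 7 (Var 55))))"
  let ?s = "s(24 := (s 24)(0 := s 7 0))"
  have "wp w (For 55 nV ?b) (\<lambda>k s'. 1000 + k \<le> (n + 1) * 10000 \<and>
     (\<forall>u<n. s' 24 0 \<le> s 7 u) \<and> (\<exists>u<n. s' 24 0 = s 7 u)) ?s"
  proof (rule wp_For_uniform[where B = n and b = 4000 and
        Inv = "\<lambda>i s'. (\<forall>u<i. s' 24 0 \<le> s 7 u) \<and> (\<exists>u<n. s' 24 0 = s 7 u)"])
    show "(\<forall>u<0. (?s(55 := (?s 55)(0 := 0))) 24 0 \<le> s 7 u) \<and>
      (\<exists>u<n. (?s(55 := (?s 55)(0 := 0))) 24 0 = s 7 u)"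
      using n_pos by auto
  next
    fix i s' assume "\<And>a. a \<noteq> 55 \<Longrightarrow> a \<notin> writes ?b \<Longrightarrow> s' a = ?s a"
    then have f: "s' 0 = s 0" "s' 7 = s 7" by simp_all
    then show "aval nV s' = n" using s by simp
    assume i: "i < n" "s' 55 0 = i" and inv: "(\<forall>u<i. s' 24 0 \<le> s 7 u) \<and> (\<exists>u<n. s' 24 0 = s 7 u)"
    have v: "aval (Sub (Var 24) (Sub (Var 24) (Read 7 (Var 55)))) s' = min (s' 24 0) (s 7 i)"
      using f i by (simp add: min_def)
    show "wp w ?b (\<lambda>k s''. k \<le> 4000 \<and> s'' 55 0 = i \<and>
       (\<forall>u<Suc i. (s''(55 := (s'' 55)(0 := Suc i))) 24 0 \<le> s 7 u) \<and>
       (\<exists>u<n. (s''(55 := (s'' 55)(0 := Suc i))) 24 0 = s 7 u)) s'"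
    proof (rule wp_Assign)
      assume cb': "cells_below w s'"
      show "aval (Sub (Var 24) (Sub (Var 24) (Read 7 (Var 55)))) s' < 2 ^ w"
        unfolding v using cells_belowD[OF cb', of 24 0] by simp
    next
      have "\<exists>u<n. min (s' 24 0) (s 7 i) = s 7 u" using inv i(1) by (auto simp: min_def)
      moreover have "\<forall>u<Suc i. min (s' 24 0) (s 7 i) \<le> s 7 u"
        using inv by (auto simp: less_Suc_eq min.coboundedI1)
      ultimately show "1 + ecost (Const 0) + ecost (Sub (Var 24) (Sub (Var 24) (Read 7 (Var 55)))) \<le> 4000 \<and>
        (s'(24 := (s' 24)(aval (Const 0) s' := aval (Sub (Var 24) (Sub (Var 24) (Read 7 (Var 55)))) s'))) 55 0 = i \<and>
        (\<forall>u<Suc i. ((s'(24 := (s' 24)(aval (Const 0) s' := aval (Sub (Var 24) (Sub (Var 24) (Read 7 (Var 55)))) s')))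
          (55 := ((s'(24 := (s' 24)(aval (Const 0) s' := aval (Sub (Var 24) (Sub (Var 24) (Read 7 (Var 55)))) s'))) 55)(0 := Suc i))) 24 0 \<le> s 7 u) \<and>
        (\<exists>u<n. ((s'(24 := (s' 24)(aval (Const 0) s' := aval (Sub (Var 24) (Sub (Var 24) (Read 7 (Var 55)))) s')))
          (55 := ((s'(24 := (s' 24)(aval (Const 0) s' := aval (Sub (Var 24) (Sub (Var 24) (Read 7 (Var 55)))) s'))) 55)(0 := Suc i))) 24 0 = s 7 u)"
        unfolding v using i(2) by (simp add: ecost_def)
    qed simp
  next
    fix k s' assume "k \<le> (n + 1) * (4000 + fcost nV)"
      "(\<forall>u<n. s' 24 0 \<le> s 7 u) \<and> (\<exists>u<n. s' 24 0 = s 7 u)"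
    then show "1000 + k \<le> (n + 1) * 10000 \<and> (\<forall>u<n. s' 24 0 \<le> s 7 u) \<and> (\<exists>u<n. s' 24 0 = s 7 u)"
      by (simp add: fcost_def ecost_def)
  qed (use n_below in simp_all)
  note For = this
  show ?thesis
    unfolding minimum_def
  proof (rule wp_Seq, rule wp_Assign)
    show "aval (Read 7 (Const 0)) s < 2 ^ w" using cells_belowD[OF cb, of 7 0] by simp
    have eq: "s(24 := (s 24)(aval (Const 0) s := aval (Read 7 (Const 0)) s)) = ?s" by simp
    show "wp w (For 55 nV ?b) (\<lambda>la s'. 1 + ecost (Const 0) + ecost (Read 7 (Const 0)) + la \<le> (n + 1) * 10000 \<and>
       (\<forall>u<n. s' 24 0 \<le> s 7 u) \<and> (\<exists>u<n. s' 24 0 = s 7 u))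
       (s(24 := (s 24)(aval (Const 0) s := aval (Read 7 (Const 0)) s)))"
      unfolding eq by (rule wp_conseq[OF For]) (simp add: ecost_def)
  qed simp
qed

lemma wp_parameters:
  assumes s: "s 20 0 = l" "s 21 0 = 2 ^ l"
  shows "wp w parameters (\<lambda>k s'. k \<le> (B + 1) * 10000 \<and> s' 36 0 = 2 ^ (l + 2) \<and> s' 37 0 = num_steps l \<and>
     s' 38 0 = B \<and> s' 25 0 = 2 ^ B) s"
proof -
  let ?t = "Mul (Const 80) (Mul (Var 20) (Mul (Var 20) (Mul (Var 20) (Mul (Var 20) (Var 20)))))"
  let ?B = "Mul (Const 2) (Mul (Add (Var 20) (Const 2)) (Add (Var 37) (Const 3)))"
  let ?s = "s(36 := (s 36)(0 := 2 ^ (l + 2)), 37 := (s 37)(0 := num_steps l), 38 := (s 38)(0 := B))"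
  have D: "wp w (DoubleTo 25 40 55 (Var 38) (Const 0) (Const 0)) (\<lambda>k s'. 3000 + k \<le> (B + 1) * 10000 \<and>
     s' 36 0 = 2 ^ (l + 2) \<and> s' 37 0 = num_steps l \<and> s' 38 0 = B \<and> s' 25 0 = 2 ^ B) ?s"
  proof (rule wp_DoubleTo[where B = B and C = 0 and E = 0])
    fix s' assume "\<And>a. a \<noteq> 25 \<Longrightarrow> a \<noteq> 40 \<Longrightarrow> a \<noteq> 55 \<Longrightarrow> s' a = ?s a"
    then have "s' 38 = ?s 38" by simp
    then show "aval (Var 38) s' = B \<and> aval (Const 0) s' = 0 \<and> aval (Const 0) s' = 0" by simp
  next
    show "B < w" by (simp add: w_def width_def)
    then show "B < 2 ^ w" using less_exp[of w] by (rule less_trans)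
  next
    fix t s' j assume v: "s' 25 0 = 2 ^ j" and j: "j = B \<or> 0 < 0 * (2::nat) ^ j"
      and f: "\<And>a. a \<noteq> 25 \<Longrightarrow> a \<noteq> 40 \<Longrightarrow> a \<noteq> 55 \<Longrightarrow> s' a = ?s a"
      and t: "t \<le> (B + 1) * doublecost (Var 38) (Const 0) (Const 0)"
    have "doublecost (Var 38) (Const 0) (Const 0) \<le> 7000"
      by (simp add: doublecost_def fcost_def ecost_def)
    then have "t \<le> (B + 1) * 7000" using t mult_le_mono2 le_trans by blast
    then have "3000 + t \<le> (B + 1) * 10000" by simp
    moreover have "s' 36 = ?s 36" "s' 37 = ?s 37" "s' 38 = ?s 38" using f by simp_all
    ultimately show "3000 + t \<le> (B + 1) * 10000 \<and> s' 36 0 = 2 ^ (l + 2) \<and> s' 37 0 = num_steps l \<and>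
       s' 38 0 = B \<and> s' 25 0 = 2 ^ B"
      using v j by simp
  qed simp_all
  have b36: "(2::nat) ^ (l + 2) < 2 ^ w"
    by (rule power_strict_increasing) (simp_all add: w_def width_def)
  have l5: "l ^ 5 = l * (l * (l * (l * l)))" by (simp add: numeral_eq_Suc)
  have "B < w" by (simp add: w_def width_def)
  then have b38: "B < 2 ^ w" using less_exp[of w] by (rule less_trans)
  have "num_steps l \<le> B" by (simp add: window_bits_def)
  then have b37: "num_steps l < 2 ^ w" using b38 by (rule le_less_trans)
  have eq: "s(36 := (s 36)(0 := 2 ^ (l + 2)),
          37 := ((s(36 := (s 36)(0 := 2 ^ (l + 2)))) 37)(0 := num_steps l),
          38 := ((s(36 := (s 36)(0 := 2 ^ (l + 2)), 37 := ((s(36 := (s 36)(0 := 2 ^ (l + 2)))) 37)(0 := num_steps l))) 38)(0 := B)) = ?s"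
    by simp
  show ?thesis
    unfolding parameters_def
  proof (rule wp_Seq_Set[where v = "2 ^ (l + 2)"], rule_tac [4] wp_Seq_Set[where v = "num_steps l"],
      rule_tac [7] wp_Seq_Set[where v = B])
    show "aval ?t (s(36 := (s 36)(0 := 2 ^ (l + 2)))) = num_steps l"
      using s l5 by (simp add: num_steps_def)
    show "aval ?B (s(36 := (s 36)(0 := 2 ^ (l + 2)),
        37 := ((s(36 := (s 36)(0 := 2 ^ (l + 2)))) 37)(0 := num_steps l))) = B"
      using s by (simp add: window_bits_def)
    show "wp w (DoubleTo 25 40 55 (Var 38) (Const 0) (Const 0))
       (\<lambda>k s'. 1 + ecost (Const 0) + ecost (Mul (Const 4) (Var 21)) +
          (1 + ecost (Const 0) + ecost ?t + (1 + ecost (Const 0) + ecost ?B + k)) \<le> (B + 1) * 10000 \<and>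
         s' 36 0 = 2 ^ (l + 2) \<and> s' 37 0 = num_steps l \<and> s' 38 0 = B \<and> s' 25 0 = 2 ^ B)
       (s(36 := (s 36)(0 := 2 ^ (l + 2)),
          37 := ((s(36 := (s 36)(0 := 2 ^ (l + 2)))) 37)(0 := num_steps l),
          38 := ((s(36 := (s 36)(0 := 2 ^ (l + 2)), 37 := ((s(36 := (s 36)(0 := 2 ^ (l + 2)))) 37)(0 := num_steps l))) 38)(0 := B)))"
      unfolding eq by (rule wp_conseq[OF D]) (simp add: ecost_def)
  qed (use s b36 b37 b38 in simp_all)
qed

text \<open>Identifies the exponent found by repeated doubling with the bit length given by
  \<open>floorlog\<close>.\<close>

lemma bits_unique:
  assumes "n < 2 ^ j" "2 ^ j \<le> 2 * n"
  shows "j = l"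
proof -
  have "\<not> j < l"
  proof
    assume "j < l"
    then have "(2::nat) ^ Suc j \<le> 2 ^ l" by (intro power_increasing) auto
    then have "2 * 2 ^ j \<le> (2::nat) ^ l" by simp
    then show False using assms(1) n_bits(2) by linarith
  qed
  moreover have "\<not> l < j"
  proof
    assume "l < j"
    then have "(2::nat) ^ Suc l \<le> 2 ^ j" by (intro power_increasing) auto
    then have "2 * 2 ^ l \<le> (2::nat) ^ j" by simp
    then show False using assms(2) n_bits(1) by linarith
  qed
  ultimately show ?thesis by linarith
qed

text \<open>\<open>D\<close>, \<open>X\<close>, \<open>kX\<close> and \<open>\<Delta>\<close> are
  read off the memory that the preparation produces; hence they are existentially quantified, and
  \<open>big_graph\<close> is interpreted only inside the proof.\<close>

lemma wp_prepare:
  assumes s: "s = initial_store G"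
  shows "wp w prepare (\<lambda>k s'. k \<le> (m + 1) * ((B + 2) * 70000) \<and> s' 3 0 = 0 \<and>
     (\<exists>D X kX \<Delta>. big_graph G \<delta> n m l w D X kX \<Delta> \<and> big_graph.env G n m l D X kX \<Delta> s')) s"
  unfolding prepare_def
proof (rule wp_Seq, rule wp_conseq[OF wp_setup_adj[OF G s]])
  \<comment> \<open>Each of the seven parts of the preparation costs at most \<open>?K\<close>,
    which makes up the constant 70000.\<close>
  let ?K = "(m + 1) * ((B + 2) * 10000)"
  have K: "t \<le> ?K" if "t \<le> a * b" "a \<le> m + 1" "b \<le> (B + 2) * 10000" for t a b :: nat
    using mult_le_mono[OF that(2,3)] that(1) by (rule order_trans[rotated])
  have nm: "n + 1 \<le> m + 1" using m_ge by linarith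
  show "length (snd G) < 2 ^ w" "fst G < 2 ^ w" using m_below n_below by (simp_all add: m_def n_def)
  fix k1 s1 assume "k1 \<le> (length (snd G) + 1) * 2000 \<and> adj_ready G s1"
    and f: "\<And>a. a \<notin> writes setup_adj \<Longrightarrow> s1 a = s a"
  then have k1: "k1 \<le> ?K" and adj: "adj_ready G s1"
    using K[of k1 "m + 1" 2000] by (auto simp: m_def)
  have s1: "s1 0 0 = n" "s1 0 1 = m" "s1 3 0 = 0"
    using f by (simp_all add: s initial_store_def array_of_def n_def m_def)
  show "wp w (Seq (DoubleTo 21 20 55 nV (Const 1) nV) (Seq degree_powers (Seq minimum
     (Seq (SumTo 26 55 nV (Read 7 (Var 55))) (Seq (DoubleTo 22 23 55 mV (Const 1024) mV) parameters)))))
     (\<lambda>l' s'. k1 + l' \<le> (m + 1) * ((B + 2) * 70000) \<and> s' 3 0 = 0 \<and>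
     (\<exists>D X kX \<Delta>. big_graph G \<delta> n m l w D X kX \<Delta> \<and> big_graph.env G n m l D X kX \<Delta> s')) s1"
  proof (rule wp_Seq, rule wp_DoubleTo[where B = n and C = 1 and E = n])
    show "2 * n < 2 ^ w" by (rule below_w_poly[OF n_le_pow(2)])
    fix k2 s2 j assume v: "s2 21 0 = 2 ^ j" "s2 20 0 = j" and j: "j = 0 \<or> 1 * 2 ^ j \<le> 2 * n" "j = n \<or> n < 1 * 2 ^ j"
      and f: "\<And>a. a \<noteq> 21 \<Longrightarrow> a \<noteq> 20 \<Longrightarrow> a \<noteq> 55 \<Longrightarrow> s2 a = s1 a"
      and k: "k2 \<le> (n + 1) * doublecost nV (Const 1) nV"
    have k2: "k2 \<le> ?K" by (rule K[OF k nm]) (simp add: doublecost_def fcost_def ecost_def)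
    have "j = l"
    proof (rule bits_unique)
      show "n < 2 ^ j" using j(2) less_exp[of n] by auto
      show "2 ^ j \<le> 2 * n" using j(1) n_pos by (elim disjE) simp_all
    qed
    then have s2: "s2 21 0 = 2 ^ l" "s2 20 0 = l" "s2 0 0 = n" "s2 0 1 = m" "s2 3 0 = 0" "adj_ready G s2"
      using v s1 adj f by (simp_all add: adj_ready_def)
    show "wp w (Seq degree_powers (Seq minimum
     (Seq (SumTo 26 55 nV (Read 7 (Var 55))) (Seq (DoubleTo 22 23 55 mV (Const 1024) mV) parameters))))
     (\<lambda>l' s'. k1 + (k2 + l') \<le> (m + 1) * ((B + 2) * 70000) \<and> s' 3 0 = 0 \<and>
     (\<exists>D X kX \<Delta>. big_graph G \<delta> n m l w D X kX \<Delta> \<and> big_graph.env G n m l D X kX \<Delta> s')) s2"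
    proof (rule wp_Seq, rule wp_conseq[OF wp_degree_powers[of s2, OF s2(3,2,6)]])
      fix k3 s3
      assume d: "k3 \<le> (n + 1) * ((l + 1) * 10000) \<and> (\<forall>u<n. (\<exists>j. s3 7 u = 2 ^ j) \<and>
         card (nbrs G u) \<le> s3 7 u \<and> s3 7 u \<le> 2 * card (nbrs G u))"
        and f: "\<And>a. a \<notin> writes degree_powers \<Longrightarrow> s3 a = s2 a"
      have "(l + 1) * 10000 \<le> (2 * y + 2) * 10000" if "l + 2 \<le> y" for y :: nat using that by simp
      moreover have "l + 2 \<le> (l + 2) * (num_steps l + 3)"
        by (rule mult_le_mono2[of 1 _ "l + 2", unfolded mult_1_right]) simp
      ultimately have "(l + 1) * 10000 \<le> (B + 2) * 10000" unfolding window_bits_def by blast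
      then have k3: "k3 \<le> ?K" using K[OF conjunct1[OF d] nm] by blast
      define D where "D = s3 7"
      have D: "\<exists>j. D u = 2 ^ j" "card (nbrs G u) \<le> D u" "D u \<le> 2 * card (nbrs G u)" if "u < n" for u
        using d that by (simp_all add: D_def)
      have sum: "(\<Sum>u<n. D u) < 2 ^ w"
      proof (rule below_w_poly)
        have "(\<Sum>u<n. D u) \<le> (\<Sum>u<n. 2 * card (nbrs G u))" by (rule sum_mono) (use D in auto)
        then show "(\<Sum>u<n. D u) \<le> n ^ 8"
          using m_less n_le_pow(4) by (simp add: sum_distrib_left[symmetric] sum_degrees)
      qed
      have s3: "s3 21 0 = 2 ^ l" "s3 20 0 = l" "s3 0 0 = n" "s3 0 1 = m" "s3 3 0 = 0" "adj_ready G s3"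
        using s2 f by (simp_all add: adj_ready_def)
      show "wp w (Seq minimum (Seq (SumTo 26 55 nV (Read 7 (Var 55)))
         (Seq (DoubleTo 22 23 55 mV (Const 1024) mV) parameters)))
       (\<lambda>l' s'. k1 + (k2 + (k3 + l')) \<le> (m + 1) * ((B + 2) * 70000) \<and> s' 3 0 = 0 \<and>
       (\<exists>D X kX \<Delta>. big_graph G \<delta> n m l w D X kX \<Delta> \<and> big_graph.env G n m l D X kX \<Delta> s')) s3"
      proof (rule wp_Seq, rule wp_conseq[OF wp_minimum[of s3, OF s3(3)]])
        fix k4 s4
        assume mn: "k4 \<le> (n + 1) * 10000 \<and> (\<forall>u<n. s4 24 0 \<le> s3 7 u) \<and> (\<exists>u<n. s4 24 0 = s3 7 u)"
          and f: "\<And>a. a \<notin> writes minimum \<Longrightarrow> s4 a = s3 a"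
        have k4: "k4 \<le> ?K" by (rule K[OF conjunct1[OF mn] nm]) simp
        define \<Delta> where "\<Delta> = s4 24 0"
        have \<Delta>: "\<Delta> \<le> D u" if "u < n" for u using mn that by (simp add: D_def \<Delta>_def)
        obtain u where "u < n" "\<Delta> = D u" using mn by (auto simp: D_def \<Delta>_def)
        then have \<delta>\<Delta>: "\<delta> \<le> \<Delta>" using D(2)[of u] \<delta>_le[of u] by linarith
        have s4: "s4 21 0 = 2 ^ l" "s4 20 0 = l" "s4 0 0 = n" "s4 0 1 = m" "s4 3 0 = 0" "adj_ready G s4"
          "s4 7 = D" "s4 24 0 = \<Delta>"
          using s3 f by (simp_all add: adj_ready_def D_def \<Delta>_def)
        show "wp w (Seq (SumTo 26 55 nV (Read 7 (Var 55))) (Seq (DoubleTo 22 23 55 mV (Const 1024) mV) parameters))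
         (\<lambda>l' s'. k1 + (k2 + (k3 + (k4 + l'))) \<le> (m + 1) * ((B + 2) * 70000) \<and> s' 3 0 = 0 \<and>
         (\<exists>D X kX \<Delta>. big_graph G \<delta> n m l w D X kX \<Delta> \<and> big_graph.env G n m l D X kX \<Delta> s')) s4"
        proof (rule wp_Seq, rule wp_SumTo[where B = n and g = D])
          show "(\<Sum>u<n. D u) < 2 ^ w" by (rule sum)
          fix k5 s5 assume vol: "s5 26 0 = (\<Sum>u<n. D u)" and f: "\<And>a. a \<noteq> 26 \<Longrightarrow> a \<noteq> 55 \<Longrightarrow> s5 a = s4 a"
            and k: "k5 \<le> (n + 1) * sumcost nV (Read 7 (Var 55))"
          have k5: "k5 \<le> ?K" by (rule K[OF k nm]) (simp add: sumcost_def fcost_def ecost_def)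
          have s5: "s5 21 0 = 2 ^ l" "s5 20 0 = l" "s5 0 0 = n" "s5 0 1 = m" "s5 3 0 = 0" "adj_ready G s5"
            "s5 7 = D" "s5 24 0 = \<Delta>"
            using s4 f by (simp_all add: adj_ready_def)
          show "wp w (Seq (DoubleTo 22 23 55 mV (Const 1024) mV) parameters)
           (\<lambda>l' s'. k1 + (k2 + (k3 + (k4 + (k5 + l')))) \<le> (m + 1) * ((B + 2) * 70000) \<and> s' 3 0 = 0 \<and>
           (\<exists>D X kX \<Delta>. big_graph G \<delta> n m l w D X kX \<Delta> \<and> big_graph.env G n m l D X kX \<Delta> s')) s5"
          proof (rule wp_Seq, rule wp_DoubleTo[where B = m and C = 1024 and E = m])
            show "2 * m < 2 ^ w" using m_less n_le_pow(3) by (intro below_w_poly) linarith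
            fix k6 s6 kX assume v: "s6 22 0 = 2 ^ kX" "s6 23 0 = kX"
              and j: "kX = 0 \<or> 1024 * 2 ^ kX \<le> 2 * m" "kX = m \<or> m < 1024 * 2 ^ kX"
              and f: "\<And>a. a \<noteq> 22 \<Longrightarrow> a \<noteq> 23 \<Longrightarrow> a \<noteq> 55 \<Longrightarrow> s6 a = s5 a"
              and k: "k6 \<le> (m + 1) * doublecost mV (Const 1024) mV"
            have k6: "k6 \<le> ?K" by (rule K[OF k order_refl]) (simp add: doublecost_def fcost_def ecost_def)
            have s6: "s6 20 0 = l" "s6 21 0 = 2 ^ l" "s6 0 0 = n" "s6 0 1 = m" "s6 3 0 = 0" "adj_ready G s6"
              "s6 7 = D" "s6 24 0 = \<Delta>" "s6 26 0 = sum D {..<n}"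
              using s5 vol f by (simp_all add: adj_ready_def)
            have "big_graph G \<delta> n m l w D (2 ^ kX) kX \<Delta>"
            proof unfold_locales
              show "1024 * 2 ^ kX \<le> 2 * m" using j(1) m_ge n_pos by (elim disjE) simp_all
              show "m < 1024 * 2 ^ kX" using j(2)
              proof
                assume "kX = m" show ?thesis unfolding \<open>kX = m\<close> using less_exp[of m] by linarith
              qed simp
            qed (use D \<Delta> \<delta>\<Delta> in auto)
            then interpret big_graph G \<delta> n m l w D "2 ^ kX" kX \<Delta> .
            show "wp w parameters (\<lambda>l' s'. k1 + (k2 + (k3 + (k4 + (k5 + (k6 + l'))))) \<le> (m + 1) * ((B + 2) * 70000) \<and> s' 3 0 = 0 \<and>
              (\<exists>D X kX \<Delta>. big_graph G \<delta> n m l w D X kX \<Delta> \<and> big_graph.env G n m l D X kX \<Delta> s')) s6"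
            proof (rule wp_conseq[OF wp_parameters[of s6, OF s6(1,2)]])
              fix k7 s7 assume p: "k7 \<le> (B + 1) * 10000 \<and> s7 36 0 = 2 ^ (l + 2) \<and> s7 37 0 = num_steps l \<and>
                 s7 38 0 = B \<and> s7 25 0 = 2 ^ B" and f: "\<And>a. a \<notin> writes parameters \<Longrightarrow> s7 a = s6 a"
              have "1 \<le> m + 1" "(B + 1) * 10000 \<le> (B + 2) * 10000" by simp_all
              then have k7: "k7 \<le> ?K" using K[of k7 1 "(B + 1) * 10000"] conjunct1[OF p] by simp
              have "env s7"
                unfolding env_def vol_def using p s6 v f by (simp add: adj_ready_def)
              then have "\<exists>D X kX \<Delta>. big_graph G \<delta> n m l w D X kX \<Delta> \<and> big_graph.env G n m l D X kX \<Delta> s7"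
                using big_graph_axioms by blast
              moreover have "s7 3 0 = 0" using s6 f by simp
              moreover have "k1 + (k2 + (k3 + (k4 + (k5 + (k6 + k7))))) \<le> (m + 1) * ((B + 2) * 70000)"
                using k1 k2 k3 k4 k5 k6 k7 by (simp only: mult.assoc[symmetric])
              ultimately show "k1 + (k2 + (k3 + (k4 + (k5 + (k6 + k7))))) \<le> (m + 1) * ((B + 2) * 70000) \<and> s7 3 0 = 0 \<and>
                (\<exists>D X kX \<Delta>. big_graph G \<delta> n m l w D X kX \<Delta> \<and> big_graph.env G n m l D X kX \<Delta> s7)"
                by simp
            qed
          qed (use s5 m_below in simp_all)
        qed (use s4 n_below in simp_all)
      qed
    qed
  qed (use s1 n_below in simp_all)
qed

end

section \<open>The complete algorithm\<close>

text \<open>The asymptotic claims do not constrain graphs below the threshold, but the outcome must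
  still be correct. An arbitrary cut is reported, unless there is at most one vertex and hence no
  cut at all.\<close>

definition tiny :: com where
  "tiny = If (Sub nV (Const 1)) (Seq (Assign 4 (Const 0) (Const 1)) (Set 3 (Const 1))) Skip"

definition prog :: "nat \<Rightarrow> com" where
  "prog n0 = If (Sub (Const n0) nV) tiny (Seq prepare scales)"

lemma computes_tiny:
  assumes n0: "fst G < n0"
  shows "\<exists>t. computes (prog n0) G t (if fst G \<le> 1 then No_nontrivial_min_cut else Cut_found {0})"
proof -
  define s where "s = initial_store G"
  have s: "s 0 0 = fst G" "s 3 0 = 0" "s 4 = (\<lambda>_. 0)"
    by (simp_all add: s_def initial_store_def array_of_def)
  have b: "aval (Sub (Const n0) nV) s \<noteq> 0" using n0 s by simp
  show ?thesis
  proof (cases "fst G \<le> 1")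
    case True
    then have "aval (Sub nV (Const 1)) s = 0" using s by simp
    then obtain t where "exec (prog n0) s t s"
      unfolding prog_def tiny_def using exec.IfTrue[OF b exec.IfFalse[OF _ exec.Skip]] that by metis
    then have "computes (prog n0) G t (outcome_of G s)" unfolding computes_def s_def by blast
    moreover have "outcome_of G s = No_nontrivial_min_cut" using s by (simp add: outcome_of_def)
    ultimately show ?thesis using True by auto
  next
    case False
    define s1 where "s1 = s(4 := (s 4)(0 := 1))"
    define s2 where "s2 = s1(3 := (s1 3)(0 := 1))"
    have "\<exists>t. exec (Assign 4 (Const 0) (Const 1)) s t s1"
      using exec.Assign[of 4 "Const 0" "Const 1" s] unfolding s1_def aval.simps by (rule exI)
    moreover have "\<exists>t. exec (Set 3 (Const 1)) s1 t s2"
      using exec.Assign[of 3 "Const 0" "Const 1" s1] unfolding s2_def aval.simps by (rule exI)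
    ultimately obtain t1 t2 where e: "exec (Assign 4 (Const 0) (Const 1)) s t1 s1" "exec (Set 3 (Const 1)) s1 t2 s2"
      by blast
    have "aval (Sub nV (Const 1)) s \<noteq> 0" using False s by simp
    from exec.IfTrue[OF b exec.IfTrue[OF this exec.Seq[OF e]]]
    obtain t where "exec (prog n0) s t s2" unfolding prog_def tiny_def by fast
    then have "computes (prog n0) G t (outcome_of G s2)" unfolding computes_def s_def by blast
    moreover have "outcome_of G s2 = Cut_found {0}"
      using False by (auto simp: outcome_of_def s2_def s1_def s(3) verts_def)
    ultimately show ?thesis using False by auto
  qed
qed

lemma cells_below_initial:
  assumes G: "encodes_simple_graph G" and w: "fst G < 2 ^ w" "length (snd G) < 2 ^ w" "20 \<le> w"
  shows "cells_below w (initial_store G)"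
  unfolding cells_below_def
proof (intro conjI allI)
  fix a i
  have edge: "fst (snd G ! i) < 2 ^ w \<and> snd (snd G ! i) < 2 ^ w" if "i < length (snd G)"
  proof -
    obtain a b where e: "snd G ! i = (a, b)" by fastforce
    show ?thesis using nth_edge(1,2)[OF G that e] w(1) e by simp
  qed
  have "array_of [fst G, length (snd G)] i < 2 ^ w"
    using w by (auto simp: array_of_def less_Suc_eq nth_Cons')
  then show "initial_store G a i < 2 ^ w"
    using edge by (auto simp: initial_store_def array_of_def)
qed (rule w(3))

context base_graph
begin

definition correct :: "outcome \<Rightarrow> bool" where
  "correct r \<longleftrightarrow> (case r of
      No_nontrivial_min_cut \<Rightarrow> \<not> (\<exists>U. min_cut (verts G) (edges G) U \<and> nontrivial_cut (verts G) U)
    | Cut_found S \<Rightarrow> is_cut (verts G) S \<and> conductance (verts G) (edges G) S \<le> 1 / real (l\<^sup>2))"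

lemma wp_main:
  "wp w (Seq prepare scales) (\<lambda>k s'. k \<le> (m + 1) * ((B + 2) * 70000) +
      (2 * l + 2) * (300 * ((num_steps l + 3) * ((B + 3) * ((m + 1) * 110000)))) \<and>
      correct (outcome_of G s')) (initial_store G)"
proof (rule wp_Seq, rule wp_conseq[OF wp_prepare[OF refl]])
  fix k1 s1
  assume *: "k1 \<le> (m + 1) * ((B + 2) * 70000) \<and> s1 3 0 = 0 \<and>
     (\<exists>D X kX \<Delta>. big_graph G \<delta> n m l w D X kX \<Delta> \<and> big_graph.env G n m l D X kX \<Delta> s1)"
  then obtain D X kX \<Delta> where b: "big_graph G \<delta> n m l w D X kX \<Delta>" and e: "big_graph.env G n m l D X kX \<Delta> s1"
    by blast
  interpret big_graph G \<delta> n m l w D X kX \<Delta> by (rule b)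
  \<comment> \<open>\<open>X\<close> is at most \<open>m / 512\<close> and \<open>m\<close> is below
    \<open>n\<^sup>2\<close>, so the number of scales is logarithmic.\<close>
  have "kX \<le> 2 * l"
  proof (rule ccontr)
    assume "\<not> kX \<le> 2 * l"
    then have "(2::nat) ^ (2 * l) \<le> 2 ^ kX" by (intro power_increasing) auto
    moreover have "n * n \<le> 2 ^ l * 2 ^ l" using n_bits(1) by (intro mult_le_mono) auto
    then have "n * n \<le> 2 ^ (2 * l)" by (simp add: mult_2 power_add)
    ultimately have "2 * m \<le> X" using m_less unfolding X_pow by linarith
    then show False using X_le m_ge n_pos by linarith
  qed
  then have tc: "total_cost \<le> (2 * l + 2) * (300 * ((num_steps l + 3) * ((B + 3) * ((m + 1) * 110000))))"
    unfolding total_cost_def phase_cost_def by (intro mult_le_mono1) simp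
  show "wp w scales (\<lambda>l' s'. k1 + l' \<le> (m + 1) * ((B + 2) * 70000) +
      (2 * l + 2) * (300 * ((num_steps l + 3) * ((B + 3) * ((m + 1) * 110000)))) \<and>
      correct (outcome_of G s')) s1"
  proof (rule wp_conseq[OF wp_scales[OF e]])
    show "s1 3 0 = 0" using * by simp
    fix k s' assume k: "k \<le> total_cost \<and> (found s' \<or> s' 3 0 = 0 \<and> (\<forall>j\<le>kX. scale_ok (2 ^ j)))"
    have "k1 + k \<le> (m + 1) * ((B + 2) * 70000) +
      (2 * l + 2) * (300 * ((num_steps l + 3) * ((B + 3) * ((m + 1) * 110000))))"
      by (rule add_mono[OF conjunct1[OF *] order_trans[OF conjunct1[OF k] tc]])
    moreover have "correct (outcome_of G s')"
      using conjunct2[OF k]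
    proof
      assume f: "found s'"
      have "{v \<in> verts G. s' 4 v \<noteq> 0} = {v. v < n \<and> s' 4 v \<noteq> 0}" by (auto simp: verts_def n_def)
      then have "outcome_of G s' = Cut_found {v. v < n \<and> s' 4 v \<noteq> 0}"
        using f by (simp add: outcome_of_def found_def)
      moreover have "good_cut {v. v < n \<and> s' 4 v \<noteq> 0}" using f by (simp add: found_def)
      ultimately show ?thesis using good_cut_conductance by (simp add: correct_def)
    next
      assume a: "s' 3 0 = 0 \<and> (\<forall>j\<le>kX. scale_ok (2 ^ j))"
      have "\<not> (\<exists>U. min_cut (verts G) (edges G) U \<and> nontrivial_cut (verts G) U)"
        by (rule no_nontrivial_min_cut) (use a in blast)
      then show ?thesis using a by (simp add: correct_def outcome_of_def)
    qed
    ultimately show "k1 + k \<le> (m + 1) * ((B + 2) * 70000) +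
      (2 * l + 2) * (300 * ((num_steps l + 3) * ((B + 3) * ((m + 1) * 110000)))) \<and>
      correct (outcome_of G s')" by (rule conjI)
  qed
qed

section \<open>Polylogarithmic factors in the running time\<close>

lemma cost_bounds:
  "num_steps l + 3 \<le> 81 * l ^ 5" "B + 3 \<le> 325 * l ^ 6" "w \<le> 335 * l ^ 6"
proof -
  have p: "20 \<le> l ^ 5" "l \<le> l ^ 6" "20 \<le> l ^ 6"
    using self_le_power[of l 5] self_le_power[of l 6] l_ge by linarith+
  show 1: "num_steps l + 3 \<le> 81 * l ^ 5" using p by (simp add: num_steps_def)
  have "(l + 2) * (num_steps l + 3) \<le> (2 * l) * (81 * l ^ 5)"
    using 1 l_ge by (intro mult_le_mono) auto
  also have "\<dots> = 162 * (l * l ^ 5)" by simp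
  also have "l * l ^ 5 = l ^ 6" by (simp add: power_Suc[symmetric] del: power_Suc)
  finally have "(l + 2) * (num_steps l + 3) \<le> 162 * l ^ 6" .
  then show 2: "B + 3 \<le> 325 * l ^ 6" unfolding window_bits_def using p by linarith
  have "8 * l + 40 \<le> 10 * l ^ 6"
  proof -
    have "20 ^ 5 * l \<le> l ^ 5 * l" using l_ge by (intro mult_le_mono1 power_mono) auto
    then have "20 ^ 5 * l \<le> l ^ 6" by (simp add: power_Suc2[symmetric])
    then show ?thesis using p by simp
  qed
  then show "w \<le> 335 * l ^ 6" unfolding w_def width_def using 2 by linarith
qed

text \<open>\<open>l ^ 18\<close> consists of \<open>l\<close> for the scales, \<open>l ^ 5\<close>
  for the steps of a walk, \<open>l ^ 6\<close> for the bisections in a step and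
  \<open>l ^ 6\<close> for the length of the numbers. The summand 3 pays for the initial comparison
  with the threshold.\<close>

lemma main_cost:
  "((m + 1) * ((B + 2) * 70000) +
      (2 * l + 2) * (300 * ((num_steps l + 3) * ((B + 3) * ((m + 1) * 110000)))) + 3) * w
   \<le> 10 ^ 16 * l ^ 18 * m"
proof -
  note b = cost_bounds
  have m1: "m + 1 \<le> 2 * m" using m_ge n_pos by linarith
  have "(m + 1) * ((B + 2) * 70000) \<le> (2 * m) * ((325 * l ^ 6) * 70000)"
    using b m1 by (intro mult_le_mono) auto
  also have "\<dots> = 45500000 * (l ^ 6 * m)" by simp
  also have "l ^ 6 * m \<le> l ^ 12 * m" using l_ge by (intro mult_le_mono1 power_increasing) auto
  finally have 1: "(m + 1) * ((B + 2) * 70000) \<le> 45500000 * (l ^ 12 * m)" by simp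
  have "(2 * l + 2) * (300 * ((num_steps l + 3) * ((B + 3) * ((m + 1) * 110000))))
     \<le> (3 * l) * (300 * ((81 * l ^ 5) * ((325 * l ^ 6) * ((2 * m) * 110000))))"
    using b m1 l_ge by (intro mult_le_mono) auto
  also have "\<dots> = 5212350000000 * ((l * l ^ 5 * l ^ 6) * m)" by simp
  also have "l * l ^ 5 * l ^ 6 = l ^ 12" by (simp add: power_add[symmetric] power_Suc[symmetric] del: power_Suc)
  finally have 2: "(2 * l + 2) * (300 * ((num_steps l + 3) * ((B + 3) * ((m + 1) * 110000))))
     \<le> 5212350000000 * (l ^ 12 * m)" .
  have "1 * 1 \<le> l ^ 12 * m" using l_ge m_ge n_pos by (intro mult_le_mono) auto
  then have "(m + 1) * ((B + 2) * 70000) +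
      (2 * l + 2) * (300 * ((num_steps l + 3) * ((B + 3) * ((m + 1) * 110000)))) + 3 \<le> 6000000000000 * (l ^ 12 * m)"
    using 1 2 by linarith
  then have "((m + 1) * ((B + 2) * 70000) +
      (2 * l + 2) * (300 * ((num_steps l + 3) * ((B + 3) * ((m + 1) * 110000)))) + 3) * w
     \<le> (6000000000000 * (l ^ 12 * m)) * (335 * l ^ 6)"
    using b(3) by (rule mult_le_mono)
  also have "\<dots> = 2010000000000000 * (l ^ 12 * l ^ 6 * m)" by simp
  also have "l ^ 12 * l ^ 6 = l ^ 18" by (simp add: power_add[symmetric])
  also have "2010000000000000 * (l ^ 18 * m) \<le> 10 ^ 16 * l ^ 18 * m" by simp
  finally show ?thesis .
qed

lemma computes_prog:
  assumes "n0 \<le> n"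
  shows "\<exists>t r. computes (prog n0) G t r \<and> t \<le> 10 ^ 16 * l ^ 18 * m \<and> correct r"
proof -
  have w20: "20 \<le> w" by (simp add: w_def width_def)
  let ?s = "initial_store G"
  have "cells_below w ?s"
    by (rule cells_below_initial[OF G]) (use n_below m_below w20 in \<open>simp_all add: n_def m_def\<close>)
  then obtain t k s' where ex: "exec (Seq prepare scales) ?s t s'" and t: "t \<le> k * w"
    and k: "k \<le> (m + 1) * ((B + 2) * 70000) +
      (2 * l + 2) * (300 * ((num_steps l + 3) * ((B + 3) * ((m + 1) * 110000))))"
    and r: "correct (outcome_of G s')"
    using wp_main unfolding wp_def by blast
  have s: "?s 0 0 = n" by (simp add: initial_store_def array_of_def n_def)
  have z: "aval (Sub (Const n0) nV) ?s = 0" using assms s by simp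
  \<comment> \<open>\<open>n0\<close> need not be a small constant, but as \<open>n0 \<le> n\<close>
    its length is within \<open>w\<close>.\<close>
  have "floorlog 2 n0 \<le> w" "floorlog 2 n \<le> w"
    using assms n_below by (intro floorlog_le_of_less; simp)+
  then have ac: "1 + acost (Sub (Const n0) nV) ?s \<le> 3 * w"
    using z s w20 by (simp add: floorlog_def)
  have "1 + acost (Sub (Const n0) nV) ?s + t \<le> (k + 3) * w"
    using ac t by (simp add: distrib_right)
  also have "\<dots> \<le> ((m + 1) * ((B + 2) * 70000) +
      (2 * l + 2) * (300 * ((num_steps l + 3) * ((B + 3) * ((m + 1) * 110000)))) + 3) * w"
    using k by (intro mult_le_mono1 add_mono) auto
  also have "\<dots> \<le> 10 ^ 16 * l ^ 18 * m" by (rule main_cost)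
  finally have "1 + acost (Sub (Const n0) nV) ?s + t \<le> 10 ^ 16 * l ^ 18 * m" .
  moreover have "computes (prog n0) G (1 + acost (Sub (Const n0) nV) ?s + t) (outcome_of G s')"
    unfolding computes_def prog_def using exec.IfFalse[OF z ex] by blast
  ultimately show ?thesis using r by blast
qed

end

lemma eventually_log_ge: "\<exists>N::nat. \<forall>n\<ge>N. c \<le> log 2 (real n)"
proof -
  obtain N :: nat where N: "2 powr c \<le> real N" using real_arch_simple by blast
  have "c \<le> log 2 (real n)" if "N \<le> n" for n
  proof -
    have "2 powr c \<le> real n" using N that by (meson of_nat_mono order_trans)
    moreover have "0 < 2 powr c" by simp
    ultimately have "0 < real n" by linarith
    with \<open>2 powr c \<le> real n\<close> show ?thesis by (simp add: le_log_iff)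
  qed
  then show ?thesis by blast
qed

text \<open>From \<open>l \<le> 2 * x\<close> the required \<open>200000 * 80 * l ^ 5\<close> is at
  most \<open>512000000 * x ^ 5\<close>, so \<open>x ^ 6\<close> suffices as soon as
  \<open>x\<close> exceeds that constant.\<close>

lemma base_graphI:
  assumes G: "encodes_simple_graph G" and x: "x = log 2 (real (fst G))" "10 ^ 22 \<le> x"
    and d: "x ^ 6 \<le> real (min_degree (verts G) (edges G))"
  shows "base_graph G (min_degree (verts G) (edges G)) (fst G) (length (snd G)) (bits G) (width (bits G))"
    and "x \<le> real (bits G)" "real (bits G) \<le> 2 * x" "real (length (snd G)) \<le> real (fst G) ^ 2"
proof -
  have n: "0 < fst G" using x by (cases "fst G = 0") (auto simp: log_def)
  have "2 ^ (floorlog 2 (fst G) - 1) \<le> fst G \<and> fst G < 2 ^ floorlog 2 (fst G)"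
    by (rule floorlog_bounds) (use n in auto)
  then have b: "2 ^ (bits G - 1) \<le> fst G" "fst G < 2 ^ bits G" by (auto simp: bits_def)
  have "real (fst G) \<le> 2 ^ bits G"
    using b(2) by (metis less_imp_le of_nat_le_iff of_nat_numeral of_nat_power)
  then have "log 2 (real (fst G)) \<le> log 2 (2 ^ bits G)" using n by (subst log_le_cancel_iff) auto
  then show xl: "x \<le> real (bits G)" by (simp add: x log_nat_power)
  have "2 ^ (bits G - 1) \<le> real (fst G)"
    using b(1) by (metis of_nat_le_iff of_nat_numeral of_nat_power)
  then have "log 2 (2 ^ (bits G - 1)) \<le> log 2 (real (fst G))" using n by (subst log_le_cancel_iff) auto
  then have "real (bits G - 1) \<le> x" by (simp add: x log_nat_power)
  moreover have "real (bits G) \<le> real (bits G - 1) + 1" by (cases "bits G") auto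
  moreover have x1: "512000000 \<le> x" by (rule order_trans[OF _ x(2)]) simp
  ultimately show lx: "real (bits G) \<le> 2 * x" by linarith
  have "real 20 \<le> real (bits G)" using xl x1 by simp
  then have l20: "20 \<le> bits G" by (simp only: of_nat_le_iff)
  have "real (200000 * num_steps (bits G)) = 16000000 * real (bits G) ^ 5" by (simp add: num_steps_def)
  also have "\<dots> \<le> 16000000 * (2 * x) ^ 5" using lx by (intro mult_left_mono power_mono) auto
  also have "\<dots> = 512000000 * x ^ 5" by (simp add: power_mult_distrib)
  also have "\<dots> \<le> x * x ^ 5" using x1 by (intro mult_right_mono) auto
  also have "\<dots> = x ^ 6" by (simp add: numeral_eq_Suc)
  finally have "real (200000 * num_steps (bits G)) \<le> real (min_degree (verts G) (edges G))" using d by linarith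
  then have "200000 * num_steps (bits G) \<le> min_degree (verts G) (edges G)" by (simp only: of_nat_le_iff)
  then show bg: "base_graph G (min_degree (verts G) (edges G)) (fst G) (length (snd G)) (bits G) (width (bits G))"
    unfolding base_graph_def using G n l20 by (intro conjI refl) assumption+
  interpret base_graph G "min_degree (verts G) (edges G)" "fst G" "length (snd G)" "bits G" "width (bits G)"
    by (rule bg)
  have "length (snd G) \<le> fst G * fst G" using m_less by linarith
  then have "real (length (snd G)) \<le> real (fst G * fst G)" by (simp only: of_nat_le_iff)
  then show "real (length (snd G)) \<le> real (fst G) ^ 2" by (simp add: power2_eq_square)
qed

text \<open>Correctness of the outcome holds for inputs of every size, the quantitative claims only
  from \<open>n0\<close> on. Both are stated for the same \<open>t\<close> and \<open>r\<close>, so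
  that time and outcome can be chosen together.\<close>

lemma certified:
  assumes "encodes_simple_graph G"
    and "log 2 (real (fst G)) ^ 6 \<le> real (min_degree (verts G) (edges G))"
    and n0: "\<And>n. n0 \<le> n \<Longrightarrow> 10 ^ 22 \<le> log 2 (real n)"
  shows "\<exists>t r. computes (prog n0) G t r \<and>
     (r = No_nontrivial_min_cut \<longrightarrow> \<not> (\<exists>U. min_cut (verts G) (edges G) U \<and> nontrivial_cut (verts G) U)) \<and>
     (r \<noteq> No_nontrivial_min_cut \<longrightarrow> is_cut (verts G) (found_cut r)) \<and>
     (n0 \<le> fst G \<longrightarrow> real t \<le> real (length (snd G)) * log 2 (real (fst G)) ^ 19 \<and>
       (r \<noteq> No_nontrivial_min_cut \<longrightarrow>
         conductance (verts G) (edges G) (found_cut r) \<le> 1 / (log 2 (real (fst G)))\<^sup>2))"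
proof (cases "n0 \<le> fst G")
  case False
  then obtain t where t: "computes (prog n0) G t (if fst G \<le> 1 then No_nontrivial_min_cut else Cut_found {0})"
    using computes_tiny[of G n0] by auto
  have "\<not> nontrivial_cut (verts G) U" if "fst G \<le> 1" for U
  proof
    assume U: "nontrivial_cut (verts G) U"
    then have "card U \<le> card (verts G)" by (intro card_mono) (auto simp: verts_def nontrivial_cut_def is_cut_def)
    then show False using U that by (simp add: nontrivial_cut_def verts_def)
  qed
  moreover have "is_cut (verts G) {0}" if "\<not> fst G \<le> 1"
  proof -
    have "1 \<in> verts G - {0}" "0 \<in> verts G" using that by (simp_all add: verts_def)
    then show ?thesis unfolding is_cut_def by blast
  qed
  ultimately show ?thesis using t False by (cases "fst G \<le> 1") fastforce+
next
  case True
  define x where "x = log 2 (real (fst G))"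
  have x: "10 ^ 22 \<le> x" unfolding x_def by (rule n0[OF True])
  note b = base_graphI[OF assms(1) x_def x assms(2)[folded x_def]]
  interpret base_graph G "min_degree (verts G) (edges G)" "fst G" "length (snd G)" "bits G" "width (bits G)"
    by (rule b(1))
  obtain t r where tr: "computes (prog n0) G t r" "t \<le> 10 ^ 16 * bits G ^ 18 * length (snd G)" "correct r"
    using computes_prog[OF True] by blast
  have x0: "0 < x" by (rule less_le_trans[OF _ x]) simp
  have "real t \<le> real (10 ^ 16 * bits G ^ 18 * length (snd G))" using tr(2) by (simp only: of_nat_le_iff)
  also have "\<dots> = 10 ^ 16 * real (bits G) ^ 18 * real (length (snd G))" by simp
  also have "\<dots> \<le> 10 ^ 16 * (2 * x) ^ 18 * real (length (snd G))"
    using b(3) by (intro mult_right_mono mult_left_mono power_mono) auto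
  \<comment> \<open>The constant is about \<open>2.6 * 10 ^ 21\<close>; a nineteenth factor of the
    logarithm absorbs it, which is why the threshold demands \<open>10 ^ 22 \<le> x\<close>.\<close>
  also have "\<dots> = (10 ^ 16 * 2 ^ 18) * (x ^ 18 * real (length (snd G)))" by (simp add: power_mult_distrib)
  also have "\<dots> \<le> x * (x ^ 18 * real (length (snd G)))"
    by (rule mult_right_mono, rule order_trans[OF _ x]) (use x0 in simp_all)
  also have "\<dots> = real (length (snd G)) * x ^ 19"
    using power_Suc[of x 18] by simp
  finally have time: "real t \<le> real (length (snd G)) * x ^ 19" .
  have "conductance (verts G) (edges G) S \<le> 1 / x\<^sup>2" if "r = Cut_found S" for S
  proof -
    have "conductance (verts G) (edges G) S \<le> 1 / real ((bits G)\<^sup>2)" using tr(3) that by (simp add: correct_def)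
    also have "\<dots> \<le> 1 / x\<^sup>2"
      unfolding of_nat_power using b(2) x0 by (intro divide_left_mono power_mono) auto
    finally show ?thesis .
  qed
  then show ?thesis
    unfolding x_def[symmetric] using tr(1,3) time
    by (intro exI[of _ t] exI[of _ r]) (cases r; simp add: correct_def)
qed

theorem proposition10:
  fixes I :: "graph_input set"
  defines "I \<equiv> {G. encodes_simple_graph G \<and> connected_graph (verts G) (edges G) \<and>
                   real (min_degree (verts G) (edges G)) \<ge> log 2 (real (num_verts G)) ^ 6}"
  shows "\<exists>(P :: com) (run_time :: graph_input \<Rightarrow> nat) (result :: graph_input \<Rightarrow> outcome).
    (\<forall>G\<in>I. computes P G (run_time G) (result G)) \<and>
    soft_bigo I (\<lambda>G. real (run_time G)) (\<lambda>G. real (num_edges G)) \<and>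
    (\<forall>G\<in>I. result G = No_nontrivial_min_cut \<longrightarrow>
       \<not> (\<exists>U. min_cut (verts G) (edges G) U \<and> nontrivial_cut (verts G) U)) \<and>
    (\<forall>G\<in>I. result G \<noteq> No_nontrivial_min_cut \<longrightarrow> is_cut (verts G) (found_cut (result G))) \<and>
    (\<lambda>G. conductance (verts G) (edges G) (found_cut (result G)))
      \<in> o[order_to_infinity {G \<in> I. result G \<noteq> No_nontrivial_min_cut}](\<lambda>G. 1 / log 2 (real (num_edges G)))"
proof -
  have nv: "num_verts G = fst G" for G by (simp add: num_verts_def verts_def)
  obtain n0 :: nat where n0: "10 ^ 22 \<le> log 2 (real n)" if "n0 \<le> n" for n
    using eventually_log_ge[of "10 ^ 22"] by blast
  define good where "good G t r \<longleftrightarrow> computes (prog n0) G t r \<and>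
     (r = No_nontrivial_min_cut \<longrightarrow> \<not> (\<exists>U. min_cut (verts G) (edges G) U \<and> nontrivial_cut (verts G) U)) \<and>
     (r \<noteq> No_nontrivial_min_cut \<longrightarrow> is_cut (verts G) (found_cut r)) \<and>
     (n0 \<le> fst G \<longrightarrow> real t \<le> real (length (snd G)) * log 2 (real (fst G)) ^ 19 \<and>
       (r \<noteq> No_nontrivial_min_cut \<longrightarrow>
         conductance (verts G) (edges G) (found_cut r) \<le> 1 / (log 2 (real (fst G)))\<^sup>2))" for G t r
  have "\<exists>t r. good G t r" if "G \<in> I" for G
    unfolding good_def by (rule certified[OF _ _ n0]) (use that in \<open>simp_all add: I_def nv\<close>)
  then obtain run_time result where good: "good G (run_time G) (result G)" if "G \<in> I" for G
    by metis
  have edges: "num_edges G = length (snd G)" if "G \<in> I" for G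
    using that by (intro num_edges_length) (simp add: I_def)
  have "soft_bigo I (\<lambda>G. real (run_time G)) (\<lambda>G. real (num_edges G))"
    unfolding soft_bigo_def nv
  proof (intro exI ballI impI)
    fix G assume "G \<in> I" "n0 \<le> fst G"
    then show "real (run_time G) \<le> real (num_edges G) * log 2 (real (fst G)) ^ 19"
      using good[of G] edges[of G] by (simp add: good_def)
  qed
  moreover have "(\<lambda>G. conductance (verts G) (edges G) (found_cut (result G)))
      \<in> o[order_to_infinity {G \<in> I. result G \<noteq> No_nontrivial_min_cut}](\<lambda>G. 1 / log 2 (real (num_edges G)))"
  proof (rule landau_o.smallI)
    fix c :: real assume c: "0 < c"
    \<comment> \<open>With \<open>y \<le> 2 * x\<close> for the logarithm \<open>y\<close> of the
      number of edges, \<open>1 / x\<^sup>2 \<le> c / y\<close> holds as soon as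
      \<open>2 \<le> c * x\<close>.\<close>
    obtain N :: nat where N: "2 / c \<le> log 2 (real n)" if "N \<le> n" for n
      using eventually_log_ge[of "2 / c"] by blast
    show "\<forall>\<^sub>F G in order_to_infinity {G \<in> I. result G \<noteq> No_nontrivial_min_cut}.
       norm (conductance (verts G) (edges G) (found_cut (result G))) \<le> c * norm (1 / log 2 (real (num_edges G)))"
      unfolding eventually_order_to_infinity nv
    proof (intro exI ballI impI)
      fix G assume "G \<in> {G \<in> I. result G \<noteq> No_nontrivial_min_cut}" and n: "max n0 N \<le> fst G"
      then have GI: "G \<in> I" "result G \<noteq> No_nontrivial_min_cut" by simp_all
      define x where "x = log 2 (real (fst G))"
      define y where "y = log 2 (real (length (snd G)))"
      have n': "n0 \<le> fst G" "N \<le> fst G" using n by simp_all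
      have x: "10 ^ 22 \<le> x" "2 / c \<le> x" unfolding x_def using n0[OF n'(1)] N[OF n'(2)] .
      have x0: "0 < x" by (rule less_le_trans[OF _ x(1)]) simp
      have enc: "encodes_simple_graph G" "x ^ 6 \<le> real (min_degree (verts G) (edges G))"
        using GI(1) by (simp_all add: I_def nv x_def)
      note b = base_graphI[OF enc(1) x_def x(1) enc(2)]
      interpret base_graph G "min_degree (verts G) (edges G)" "fst G" "length (snd G)" "bits G" "width (bits G)"
        by (rule b(1))
      \<comment> \<open>At least two edges make \<open>y\<close> positive, so that the norm of
        \<open>1 / y\<close> is \<open>1 / y\<close> itself.\<close>
      have m2: "2 \<le> length (snd G)" using m_ge n_pos by linarith
      then have "log 2 2 \<le> y" unfolding y_def by (subst log_le_cancel_iff) auto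
      then have y1: "1 \<le> y" by simp
      have "y \<le> log 2 (real (fst G) ^ 2)"
        unfolding y_def using b(4) m2 n_pos by (subst log_le_cancel_iff) auto
      also have "\<dots> = 2 * x" using n_pos by (simp add: log_nat_power x_def)
      finally have y2: "y \<le> 2 * x" .
      have "conductance (verts G) (edges G) (found_cut (result G)) \<le> 1 / x\<^sup>2"
        using good[OF GI(1)] GI(2) n'(1) by (simp add: good_def x_def)
      also have "1 / x\<^sup>2 \<le> c / y"
      proof -
        have "y \<le> c * x * x"
        proof -
          have "2 \<le> c * x" using x(2) c by (simp add: field_simps)
          then have "2 * x \<le> c * x * x" using x0 by (intro mult_right_mono) auto
          then show ?thesis using y2 by linarith
        qed
        then show ?thesis using x0 y1 by (simp add: field_simps power2_eq_square)
      qed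
      finally have "conductance (verts G) (edges G) (found_cut (result G)) \<le> c / y" .
      moreover have "0 \<le> conductance (verts G) (edges G) (found_cut (result G))"
        by (simp add: conductance_def)
      ultimately show "norm (conductance (verts G) (edges G) (found_cut (result G))) \<le> c * norm (1 / log 2 (real (num_edges G)))"
        unfolding edges[OF GI(1)] y_def[symmetric] using y1 by simp
    qed
  qed
  ultimately show ?thesis
    using good unfolding good_def by blast
qed

end
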